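(* Let $x$ be an object of $\mathcal A$. Then $$[x]=\bigoplus_{z_y\in\mathrm{sq}(x)}[z]^0_y .$$ This decomposition is compatible with the subobject filtration, i.e., for every subobject $y\subseteq x$, $$p_y[x]=\bigoplus_{z_u\in\mathrm{sq}(x),\ u\subseteq y}[z]^0_u .$$ Moreover, the projection $p_x^*:[x]\to[x]^*$ induces an isomorphism $$\bigoplus_{z\in\mathrm q(x)}[z]^0_x\ \xrightarrow{\ \sim\ }\ [x]^* .$$
   Context: Standing assumptions. $\mathbb K$ is an algebraically closed field of characteristic $0$. $\mathcal A$ is a finitely complete category with terminal object $\ast$. Monomorphisms are called injective ($\hookrightarrow$) and define subobjects of their target; the image of a morphism $y\to x$ is the smallest subobject of $x$ through which it factors; a morphism is surjective ($\twoheadrightarrow$) if its image is its whole target. $\mathcal A$ is assumed regular (every morphism has an image and surjectivity is preserved under pullback), subobject finite (each object has finitely many subobjects), exact (every equivalence relation $r\subseteq x\times x$ is effective, i.e. is the kernel pair of a surjective $x\twoheadrightarrow x/r$), Mal'cev (every reflexive relation $r\subseteq x\times x$ is an equivalence relation), and $\ast$ has no proper subobject. A degree function $\delta$ assigns to each surjective morphism $e$ an element $\delta(e)\in\mathbb K$ with $\delta(\mathrm{id}_x)=1$, $\delta(e')=\delta(e)$ whenever $e'$ is a pullback of $e$, and $\delta(ef)=\delta(e)\delta(f)$ for composable surjective $e,f$. For surjective $e:x\twoheadrightarrow z$ put $\omega_e:=\sum_{y\subseteq x,\ e(y)=z}\mu_{\mathrm s}(y,x)\,\delta(e|_y)$,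 where $\mu_{\mathrm s}$ is the Möbius function of the finite poset $\mathrm s(x)$ of subobjects of $x$ ordered by inclusion. $\delta$ is assumed non-degenerate: $\omega_e\neq0$ for all surjective $e$. The category $\mathcal T=\mathcal T(\mathcal A,\delta)$. Let $\mathcal T^0$ have objects $[x]$, $x\in\mathcal A$, where $\mathrm{Hom}([x],[y])$ is the $\mathbb K$-vector space with basis $\langle r\rangle$, $r\subseteq x\times y$ a subobject; $\langle r\rangle:[x]\to[y]$ followed by $\langle s\rangle:[y]\to[z]$ is $\delta(r\times_ys\twoheadrightarrow r\circ s)\langle r\circ s\rangle$ with $r\circ s=\mathrm{image}(r\times_ys\to x\times z)$. $\mathcal T$ is the pseudo-abelian (idempotent) completion of the additive completion of $\mathcal T^0$. It is a semisimple rigid symmetric monoidal category with $[x]\otimes[y]=[x\times y]$, unit $I=[\ast]$, $[x]^\vee=[x]$ and $\langle r\rangle^\vee=\langle r^\vee\rangle$ (factors swapped). A morphism $f:x\to y$ gives $[f]=\langle\Gamma_f\rangle:[x]\to[y]$ with $\Gamma_f$ its graph, and $[f]^\vee:[y]\to[x]$. $[x]^0$. $z$ is a subquotient of $x$ if there are a subobject $y\subseteq x$ and a surjection $y\twoheadrightarrow z$; it is proper if $z\not\cong x$. $[x]^1$ denotes the unique direct summand of $[x]$ which is isomorphic to a direct summand of a finite direct sum $\bigoplus[z_i]$ with all $z_i$ proper subquotients of $x$, and such that every morphism $[z]\to[x]$ with $z$ a proper subquotient of $x$ factors through $[x]^1$. It has a unique complement $[x]^0$ in $[x]$. Subquotient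 objects. A subquotient object $z_y$ of $x$ is an equivalence class of diagrams $z\overset{e}{\twoheadleftarrow}y\overset{i}{\hookrightarrow}x$ (two diagrams being equivalent if there are isomorphisms $z\cong z'$, $y\cong y'$ commuting with the maps and $\mathrm{id}_x$). $\mathrm{sq}(x)$ is the set of subquotient objects; $\mathrm q(x)$ is the subset of those with $y=x$ (quotient objects). Each $z_y$ induces an injective morphism $\iota=[i][e]^\vee:[z]\to[x]$ (first $[e]^\vee$, then $[i]$), and $[z]^0_y:=\iota([z]^0)\subseteq[x]$. Idempotents. For a subobject $y\subseteq x$, $p_y:=\langle y\rangle\in\mathrm{End}([x])$ is the idempotent given by $y$ embedded diagonally in $x\times x$. $p_y^*:=\sum_{y'\subseteq y}\mu_{\mathrm s}(y',y)\,p_{y'}$ are idempotents, and $[x]^*:=p_x^*[x]$. *)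

theory Defs
  imports
    "HOL-Library.Function_Algebras"
    "HOL-Computational_Algebra.Polynomial"
begin

section \<open>Categories\<close>

text \<open>
  Hom-sets are indexed by their end points and need not be disjoint; accordingly every operation
  on arrows takes the objects involved as arguments. \<open>Comp C x y z g f\<close> is
  \<open>g\<close> after \<open>f\<close> for \<open>f : x \<rightarrow> y\<close> and \<open>g : y \<rightarrow> z\<close>.
\<close>

record ('o, 'm) cat =
  Ob :: "'o set"
  Hom :: "'o \<Rightarrow> 'o \<Rightarrow> 'm set"
  Comp :: "'o \<Rightarrow> 'o \<Rightarrow> 'o \<Rightarrow> 'm \<Rightarrow> 'm \<Rightarrow> 'm"
  Idn :: "'o \<Rightarrow> 'm"

locale category =
  fixes C :: "('o, 'm) cat"
  assumes Idn_in_Hom: "x \<in> Ob C \<Longrightarrow> Idn C x \<in> Hom C x x"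
    and Comp_in_Hom: "\<lbrakk>x \<in> Ob C; y \<in> Ob C; z \<in> Ob C; f \<in> Hom C x y; g \<in> Hom C y z\<rbrakk>
      \<Longrightarrow> Comp C x y z g f \<in> Hom C x z"
    and Comp_Idn_right: "\<lbrakk>x \<in> Ob C; y \<in> Ob C; f \<in> Hom C x y\<rbrakk> \<Longrightarrow> Comp C x x y f (Idn C x) = f"
    and Comp_Idn_left: "\<lbrakk>x \<in> Ob C; y \<in> Ob C; f \<in> Hom C x y\<rbrakk> \<Longrightarrow> Comp C x y y (Idn C y) f = f"
    and Comp_assoc: "\<lbrakk>w \<in> Ob C; x \<in> Ob C; y \<in> Ob C; z \<in> Ob C;
        f \<in> Hom C w x; g \<in> Hom C x y; h \<in> Hom C y z\<rbrakk>
      \<Longrightarrow> Comp C w x z (Comp C x y z h g) f = Comp C w y z h (Comp C w x y g f)"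

definition iso_arr :: "('o, 'm) cat \<Rightarrow> 'o \<Rightarrow> 'o \<Rightarrow> 'm \<Rightarrow> bool" where
  "iso_arr C x y f \<longleftrightarrow> f \<in> Hom C x y \<and>
     (\<exists>g \<in> Hom C y x. Comp C x y x g f = Idn C x \<and> Comp C y x y f g = Idn C y)"

definition isomorphic :: "('o, 'm) cat \<Rightarrow> 'o \<Rightarrow> 'o \<Rightarrow> bool" where
  "isomorphic C x y \<longleftrightarrow> (\<exists>f. iso_arr C x y f)"

definition mono_arr :: "('o, 'm) cat \<Rightarrow> 'o \<Rightarrow> 'o \<Rightarrow> 'm \<Rightarrow> bool" where
  "mono_arr C x y f \<longleftrightarrow> f \<in> Hom C x y \<and>
     (\<forall>t \<in> Ob C. \<forall>g \<in> Hom C t x. \<forall>h \<in> Hom C t x. Comp C t x y f g = Comp C t x y f h \<longrightarrow> g = h)"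

section \<open>Limits\<close>

definition is_functor ::
  "('i, 'a) cat \<Rightarrow> ('o, 'm) cat \<Rightarrow> ('i \<Rightarrow> 'o) \<Rightarrow> ('i \<Rightarrow> 'i \<Rightarrow> 'a \<Rightarrow> 'm) \<Rightarrow> bool" where
  "is_functor J C F Fa \<longleftrightarrow>
     (\<forall>i \<in> Ob J. F i \<in> Ob C \<and> Fa i i (Idn J i) = Idn C (F i)) \<and>
     (\<forall>i \<in> Ob J. \<forall>j \<in> Ob J. \<forall>a \<in> Hom J i j. Fa i j a \<in> Hom C (F i) (F j)) \<and>
     (\<forall>i \<in> Ob J. \<forall>j \<in> Ob J. \<forall>k \<in> Ob J. \<forall>a \<in> Hom J i j. \<forall>b \<in> Hom J j k.
        Fa i k (Comp J i j k b a) = Comp C (F i) (F j) (F k) (Fa j k b) (Fa i j a))"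

definition is_cone ::
  "('i, 'a) cat \<Rightarrow> ('o, 'm) cat \<Rightarrow> ('i \<Rightarrow> 'o) \<Rightarrow> ('i \<Rightarrow> 'i \<Rightarrow> 'a \<Rightarrow> 'm) \<Rightarrow> 'o \<Rightarrow> ('i \<Rightarrow> 'm) \<Rightarrow> bool" where
  "is_cone J C F Fa v c \<longleftrightarrow> v \<in> Ob C \<and> (\<forall>i \<in> Ob J. c i \<in> Hom C v (F i)) \<and>
     (\<forall>i \<in> Ob J. \<forall>j \<in> Ob J. \<forall>a \<in> Hom J i j. Comp C v (F i) (F j) (Fa i j a) (c i) = c j)"

definition is_limit ::
  "('i, 'a) cat \<Rightarrow> ('o, 'm) cat \<Rightarrow> ('i \<Rightarrow> 'o) \<Rightarrow> ('i \<Rightarrow> 'i \<Rightarrow> 'a \<Rightarrow> 'm) \<Rightarrow> 'o \<Rightarrow> ('i \<Rightarrow> 'm) \<Rightarrow> bool" where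
  "is_limit J C F Fa v c \<longleftrightarrow> is_cone J C F Fa v c \<and>
     (\<forall>w d. is_cone J C F Fa w d \<longrightarrow>
        (\<exists>!h. h \<in> Hom C w v \<and> (\<forall>i \<in> Ob J. Comp C w v (F i) (c i) h = d i)))"

text \<open>Every finite category is isomorphic to one whose objects and arrows are natural numbers.\<close>

definition finitely_complete :: "('o, 'm) cat \<Rightarrow> bool" where
  "finitely_complete C \<longleftrightarrow>
     (\<forall>(J :: (nat, nat) cat) F Fa.
        category J \<and> finite (Ob J) \<and> (\<forall>i \<in> Ob J. \<forall>j \<in> Ob J. finite (Hom J i j)) \<and>
        is_functor J C F Fa \<longrightarrow> (\<exists>v c. is_limit J C F Fa v c))"

definition terminal :: "('o, 'm) cat \<Rightarrow> 'o \<Rightarrow> bool" where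
  "terminal C t \<longleftrightarrow> t \<in> Ob C \<and> (\<forall>x \<in> Ob C. \<exists>!f. f \<in> Hom C x t)"

definition is_product :: "('o, 'm) cat \<Rightarrow> 'o \<Rightarrow> 'o \<Rightarrow> 'o \<Rightarrow> 'm \<Rightarrow> 'm \<Rightarrow> bool" where
  "is_product C x y p a b \<longleftrightarrow> p \<in> Ob C \<and> a \<in> Hom C p x \<and> b \<in> Hom C p y \<and>
     (\<forall>t \<in> Ob C. \<forall>f \<in> Hom C t x. \<forall>g \<in> Hom C t y.
        \<exists>!h. h \<in> Hom C t p \<and> Comp C t p x a h = f \<and> Comp C t p y b h = g)"

text \<open>\<open>is_pullback C x y z f g p a b\<close>: the square \<open>f a = g b\<close> over
  \<open>f : x \<rightarrow> z\<close> and \<open>g : y \<rightarrow> z\<close>, with \<open>a : p \<rightarrow> x\<close> and \<open>b : p \<rightarrow> y\<close>, is cartesian.\<close>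

definition is_pullback ::
  "('o, 'm) cat \<Rightarrow> 'o \<Rightarrow> 'o \<Rightarrow> 'o \<Rightarrow> 'm \<Rightarrow> 'm \<Rightarrow> 'o \<Rightarrow> 'm \<Rightarrow> 'm \<Rightarrow> bool" where
  "is_pullback C x y z f g p a b \<longleftrightarrow>
     p \<in> Ob C \<and> a \<in> Hom C p x \<and> b \<in> Hom C p y \<and> Comp C p x z f a = Comp C p y z g b \<and>
     (\<forall>t \<in> Ob C. \<forall>k \<in> Hom C t x. \<forall>l \<in> Hom C t y. Comp C t x z f k = Comp C t y z g l \<longrightarrow>
        (\<exists>!h. h \<in> Hom C t p \<and> Comp C t p x a h = k \<and> Comp C t p y b h = l))"

text \<open>A fixed choice of binary products \<open>x \<times> y\<close>.\<close>

definition product :: "('o, 'm) cat \<Rightarrow> 'o \<Rightarrow> 'o \<Rightarrow> 'o \<times> 'm \<times> 'm" where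
  "product C x y = (SOME (p, a, b). is_product C x y p a b)"

definition prd :: "('o, 'm) cat \<Rightarrow> 'o \<Rightarrow> 'o \<Rightarrow> 'o" where
  "prd C x y = fst (product C x y)"

definition proj1 :: "('o, 'm) cat \<Rightarrow> 'o \<Rightarrow> 'o \<Rightarrow> 'm" where
  "proj1 C x y = fst (snd (product C x y))"

definition proj2 :: "('o, 'm) cat \<Rightarrow> 'o \<Rightarrow> 'o \<Rightarrow> 'm" where
  "proj2 C x y = snd (snd (product C x y))"

definition pair :: "('o, 'm) cat \<Rightarrow> 'o \<Rightarrow> 'o \<Rightarrow> 'o \<Rightarrow> 'm \<Rightarrow> 'm \<Rightarrow> 'm" where
  "pair C t x y f g = (THE h. h \<in> Hom C t (prd C x y) \<and>
     Comp C t (prd C x y) x (proj1 C x y) h = f \<and> Comp C t (prd C x y) y (proj2 C x y) h = g)"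

section \<open>Subobjects, images, surjective morphisms\<close>

text \<open>A subobject of \<open>x\<close> is an isomorphism class of monomorphisms into \<open>x\<close>, encoded as the
  set of all pairs \<open>(y, i)\<close> with \<open>i : y \<rightarrow> x\<close> in the class.\<close>

definition sub_class :: "('o, 'm) cat \<Rightarrow> 'o \<Rightarrow> 'o \<Rightarrow> 'm \<Rightarrow> ('o \<times> 'm) set" where
  "sub_class C x y i =
     {(y', i'). y' \<in> Ob C \<and> mono_arr C y' x i' \<and> (\<exists>h. iso_arr C y y' h \<and> Comp C y y' x i' h = i)}"

definition subobjects :: "('o, 'm) cat \<Rightarrow> 'o \<Rightarrow> ('o \<times> 'm) set set" where
  "subobjects C x = {sub_class C x y i | y i. y \<in> Ob C \<and> mono_arr C y x i}"

definition whole :: "('o, 'm) cat \<Rightarrow> 'o \<Rightarrow> ('o \<times> 'm) set" where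
  "whole C x = sub_class C x x (Idn C x)"

definition rep :: "'a set \<Rightarrow> 'a" where
  "rep S = (SOME p. p \<in> S)"

abbreviation sub_obj :: "('o \<times> 'm) set \<Rightarrow> 'o" where
  "sub_obj S \<equiv> fst (rep S)"

abbreviation sub_arr :: "('o \<times> 'm) set \<Rightarrow> 'm" where
  "sub_arr S \<equiv> snd (rep S)"

definition factors :: "('o, 'm) cat \<Rightarrow> 'o \<Rightarrow> 'o \<Rightarrow> 'm \<Rightarrow> ('o \<times> 'm) set \<Rightarrow> bool" where
  "factors C t x f S \<longleftrightarrow> (\<exists>(y, i) \<in> S. \<exists>g \<in> Hom C t y. Comp C t y x i g = f)"

definition sub_le :: "('o, 'm) cat \<Rightarrow> 'o \<Rightarrow> ('o \<times> 'm) set \<Rightarrow> ('o \<times> 'm) set \<Rightarrow> bool" where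
  "sub_le C x S S' \<longleftrightarrow> (\<exists>(y, i) \<in> S. factors C y x i S')"

definition is_image :: "('o, 'm) cat \<Rightarrow> 'o \<Rightarrow> 'o \<Rightarrow> 'm \<Rightarrow> ('o \<times> 'm) set \<Rightarrow> bool" where
  "is_image C y x f S \<longleftrightarrow> S \<in> subobjects C x \<and> factors C y x f S \<and>
     (\<forall>S' \<in> subobjects C x. factors C y x f S' \<longrightarrow> sub_le C x S S')"

definition img :: "('o, 'm) cat \<Rightarrow> 'o \<Rightarrow> 'o \<Rightarrow> 'm \<Rightarrow> ('o \<times> 'm) set" where
  "img C y x f = (THE S. is_image C y x f S)"

definition surjective :: "('o, 'm) cat \<Rightarrow> 'o \<Rightarrow> 'o \<Rightarrow> 'm \<Rightarrow> bool" where
  "surjective C y x f \<longleftrightarrow> f \<in> Hom C y x \<and> is_image C y x f (whole C x)"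

definition restrict_arr :: "('o, 'm) cat \<Rightarrow> 'o \<Rightarrow> 'o \<Rightarrow> 'm \<Rightarrow> ('o \<times> 'm) set \<Rightarrow> 'm" where
  "restrict_arr C x z f S = Comp C (sub_obj S) x z f (sub_arr S)"

definition direct_image :: "('o, 'm) cat \<Rightarrow> 'o \<Rightarrow> 'o \<Rightarrow> 'm \<Rightarrow> ('o \<times> 'm) set \<Rightarrow> ('o \<times> 'm) set" where
  "direct_image C x z f S = img C (sub_obj S) z (restrict_arr C x z f S)"

section \<open>Exact Mal'cev categories\<close>

definition regular_cat :: "('o, 'm) cat \<Rightarrow> bool" where
  "regular_cat C \<longleftrightarrow>
     (\<forall>x \<in> Ob C. \<forall>y \<in> Ob C. \<forall>f \<in> Hom C x y. \<exists>S. is_image C x y f S) \<and>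
     (\<forall>x \<in> Ob C. \<forall>y \<in> Ob C. \<forall>z \<in> Ob C. \<forall>f g p a b.
        surjective C x z f \<and> g \<in> Hom C y z \<and> is_pullback C x y z f g p a b \<longrightarrow> surjective C p y b)"

definition subobject_finite :: "('o, 'm) cat \<Rightarrow> bool" where
  "subobject_finite C \<longleftrightarrow> (\<forall>x \<in> Ob C. finite (subobjects C x))"

text \<open>The relation on generalized elements \<open>t \<rightarrow> x\<close> determined by a subobject of \<open>x \<times> x\<close>.\<close>

definition rel_at :: "('o, 'm) cat \<Rightarrow> 'o \<Rightarrow> ('o \<times> 'm) set \<Rightarrow> 'o \<Rightarrow> ('m \<times> 'm) set" where
  "rel_at C x r t =
     {(a, b). a \<in> Hom C t x \<and> b \<in> Hom C t x \<and> factors C t (prd C x x) (pair C t x x a b) r}"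

definition reflexive_rel :: "('o, 'm) cat \<Rightarrow> 'o \<Rightarrow> ('o \<times> 'm) set \<Rightarrow> bool" where
  "reflexive_rel C x r \<longleftrightarrow> r \<in> subobjects C (prd C x x) \<and>
     (\<forall>t \<in> Ob C. refl_on (Hom C t x) (rel_at C x r t))"

definition equivalence_rel :: "('o, 'm) cat \<Rightarrow> 'o \<Rightarrow> ('o \<times> 'm) set \<Rightarrow> bool" where
  "equivalence_rel C x r \<longleftrightarrow> r \<in> subobjects C (prd C x x) \<and>
     (\<forall>t \<in> Ob C. equiv (Hom C t x) (rel_at C x r t))"

definition effective_rel :: "('o, 'm) cat \<Rightarrow> 'o \<Rightarrow> ('o \<times> 'm) set \<Rightarrow> bool" where
  "effective_rel C x r \<longleftrightarrow> (\<exists>z \<in> Ob C. \<exists>q. surjective C x z q \<and>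
     is_pullback C x x z q q (sub_obj r)
       (restrict_arr C (prd C x x) x (proj1 C x x) r)
       (restrict_arr C (prd C x x) x (proj2 C x x) r))"

definition exact_cat :: "('o, 'm) cat \<Rightarrow> bool" where
  "exact_cat C \<longleftrightarrow> (\<forall>x \<in> Ob C. \<forall>r. equivalence_rel C x r \<longrightarrow> effective_rel C x r)"

definition malcev_cat :: "('o, 'm) cat \<Rightarrow> bool" where
  "malcev_cat C \<longleftrightarrow> (\<forall>x \<in> Ob C. \<forall>r. reflexive_rel C x r \<longrightarrow> equivalence_rel C x r)"

definition terminal_no_proper_subobject :: "('o, 'm) cat \<Rightarrow> bool" where
  "terminal_no_proper_subobject C \<longleftrightarrow> (\<forall>t. terminal C t \<longrightarrow> subobjects C t = {whole C t})"

section \<open>Degree functions\<close>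

text \<open>The inverse of the zeta function in the incidence algebra of a finite poset, extended by 0.\<close>

definition moebius :: "'a set \<Rightarrow> ('a \<Rightarrow> 'a \<Rightarrow> bool) \<Rightarrow> 'a \<Rightarrow> 'a \<Rightarrow> int" where
  "moebius P le = (THE m.
     (\<forall>a b. \<not> (a \<in> P \<and> b \<in> P \<and> le a b) \<longrightarrow> m a b = 0) \<and>
     (\<forall>a \<in> P. \<forall>b \<in> P. le a b \<longrightarrow>
        (\<Sum>c \<in> {c \<in> P. le a c \<and> le c b}. m a c) = (if a = b then 1 else 0)))"

definition mu_sub :: "('o, 'm) cat \<Rightarrow> 'o \<Rightarrow> ('o \<times> 'm) set \<Rightarrow> ('o \<times> 'm) set \<Rightarrow> int" where
  "mu_sub C x = moebius (subobjects C x) (sub_le C x)"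

text \<open>\<open>\<delta> x z e\<close> is the degree of \<open>e : x \<rightarrow> z\<close>; its values on non-surjective
  arrows are irrelevant.\<close>

definition degree_function :: "('o, 'm) cat \<Rightarrow> ('o \<Rightarrow> 'o \<Rightarrow> 'm \<Rightarrow> 'k::field) \<Rightarrow> bool" where
  "degree_function C \<delta> \<longleftrightarrow>
     (\<forall>x \<in> Ob C. \<delta> x x (Idn C x) = 1) \<and>
     (\<forall>x \<in> Ob C. \<forall>y \<in> Ob C. \<forall>z \<in> Ob C. \<forall>e g p a b.
        surjective C x z e \<and> g \<in> Hom C y z \<and> is_pullback C x y z e g p a b \<longrightarrow>
        \<delta> p y b = \<delta> x z e) \<and>
     (\<forall>x \<in> Ob C. \<forall>y \<in> Ob C. \<forall>z \<in> Ob C. \<forall>f e.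
        surjective C x y f \<and> surjective C y z e \<longrightarrow>
        \<delta> x z (Comp C x y z e f) = \<delta> y z e * \<delta> x y f)"

definition omega :: "('o, 'm) cat \<Rightarrow> ('o \<Rightarrow> 'o \<Rightarrow> 'm \<Rightarrow> 'k::field) \<Rightarrow> 'o \<Rightarrow> 'o \<Rightarrow> 'm \<Rightarrow> 'k" where
  "omega C \<delta> x z e =
     (\<Sum>y \<in> {y \<in> subobjects C x. direct_image C x z e y = whole C z}.
        of_int (mu_sub C x y (whole C x)) * \<delta> (sub_obj y) z (restrict_arr C x z e y))"

definition nondegenerate :: "('o, 'm) cat \<Rightarrow> ('o \<Rightarrow> 'o \<Rightarrow> 'm \<Rightarrow> 'k::field) \<Rightarrow> bool" where
  "nondegenerate C \<delta> \<longleftrightarrow>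
     (\<forall>x \<in> Ob C. \<forall>z \<in> Ob C. \<forall>e. surjective C x z e \<longrightarrow> omega C \<delta> x z e \<noteq> 0)"

section \<open>The category \<open>\<T>\<close>\<close>

text \<open>For subobjects \<open>r \<subseteq> x \<times> y\<close> and \<open>s \<subseteq> y \<times> z\<close>:
  a chosen fibre product \<open>r \<times>\<^sub>y s\<close> with its projections, and its map to \<open>x \<times> z\<close>.\<close>

definition rel_pullback ::
  "('o, 'm) cat \<Rightarrow> 'o \<Rightarrow> 'o \<Rightarrow> 'o \<Rightarrow> ('o \<times> 'm) set \<Rightarrow> ('o \<times> 'm) set \<Rightarrow> 'o \<times> 'm \<times> 'm" where
  "rel_pullback C x y z r s = (SOME (p, a, b).
     is_pullback C (sub_obj r) (sub_obj s) y
       (restrict_arr C (prd C x y) y (proj2 C x y) r)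
       (restrict_arr C (prd C y z) y (proj1 C y z) s) p a b)"

definition rel_pullback_arr ::
  "('o, 'm) cat \<Rightarrow> 'o \<Rightarrow> 'o \<Rightarrow> 'o \<Rightarrow> ('o \<times> 'm) set \<Rightarrow> ('o \<times> 'm) set \<Rightarrow> 'm" where
  "rel_pullback_arr C x y z r s = (case rel_pullback C x y z r s of (p, a, b) \<Rightarrow>
     pair C p x z
       (Comp C p (sub_obj r) x (restrict_arr C (prd C x y) x (proj1 C x y) r) a)
       (Comp C p (sub_obj s) z (restrict_arr C (prd C y z) z (proj2 C y z) s) b))"

definition rel_comp ::
  "('o, 'm) cat \<Rightarrow> 'o \<Rightarrow> 'o \<Rightarrow> 'o \<Rightarrow> ('o \<times> 'm) set \<Rightarrow> ('o \<times> 'm) set \<Rightarrow> ('o \<times> 'm) set" where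
  "rel_comp C x y z r s =
     img C (fst (rel_pullback C x y z r s)) (prd C x z) (rel_pullback_arr C x y z r s)"

definition rel_comp_degree ::
  "('o, 'm) cat \<Rightarrow> ('o \<Rightarrow> 'o \<Rightarrow> 'm \<Rightarrow> 'k::field) \<Rightarrow> 'o \<Rightarrow> 'o \<Rightarrow> 'o \<Rightarrow>
     ('o \<times> 'm) set \<Rightarrow> ('o \<times> 'm) set \<Rightarrow> 'k" where
  "rel_comp_degree C \<delta> x y z r s =
     (let p = fst (rel_pullback C x y z r s); q = sub_obj (rel_comp C x y z r s) in
      \<delta> p q (THE e. e \<in> Hom C p q \<and>
        Comp C p q (prd C x z) (sub_arr (rel_comp C x y z r s)) e = rel_pullback_arr C x y z r s))"

text \<open>\<open>\<langle>r\<rangle>\<close>. Vectors in \<open>Hom([x], [y])\<close> are coefficient functions supported on the finite set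
  of subobjects of \<open>x \<times> y\<close>.\<close>

definition basis_vec :: "('o \<times> 'm) set \<Rightarrow> ('o \<times> 'm) set \<Rightarrow> 'k::field" where
  "basis_vec r = (\<lambda>r'. if r' = r then 1 else 0)"

definition graph :: "('o, 'm) cat \<Rightarrow> 'o \<Rightarrow> 'o \<Rightarrow> 'm \<Rightarrow> ('o \<times> 'm) set" where
  "graph C x y f = sub_class C (prd C x y) x (pair C x x y (Idn C x) f)"

definition rel_op :: "('o, 'm) cat \<Rightarrow> 'o \<Rightarrow> 'o \<Rightarrow> ('o \<times> 'm) set \<Rightarrow> ('o \<times> 'm) set" where
  "rel_op C x y r = sub_class C (prd C y x) (sub_obj r)
     (pair C (sub_obj r) y x
        (restrict_arr C (prd C x y) y (proj2 C x y) r)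
        (restrict_arr C (prd C x y) x (proj1 C x y) r))"

definition T0 ::
  "('o, 'm) cat \<Rightarrow> ('o \<Rightarrow> 'o \<Rightarrow> 'm \<Rightarrow> 'k::field) \<Rightarrow> ('o, ('o \<times> 'm) set \<Rightarrow> 'k) cat" where
  "T0 C \<delta> = \<lparr>
     Ob = Ob C,
     Hom = (\<lambda>x y. {f. \<forall>r. r \<notin> subobjects C (prd C x y) \<longrightarrow> f r = 0}),
     Comp = (\<lambda>x y z g f t.
       \<Sum>r \<in> subobjects C (prd C x y). \<Sum>s \<in> subobjects C (prd C y z).
         f r * g s * (rel_comp_degree C \<delta> x y z r s * basis_vec (rel_comp C x y z r s) t)),
     Idn = (\<lambda>x. basis_vec (graph C x x (Idn C x))) \<rparr>"

text \<open>Objects are finite lists, standing for their formal direct sum; the entry \<open>f j i\<close> of a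
  matrix \<open>f : xs \<rightarrow> ys\<close> is an arrow \<open>xs ! i \<rightarrow> ys ! j\<close>, and entries outside the index
  range vanish.\<close>

definition additive_completion ::
  "('o, 'm::ab_group_add) cat \<Rightarrow> ('o list, nat \<Rightarrow> nat \<Rightarrow> 'm) cat" where
  "additive_completion C = \<lparr>
     Ob = lists (Ob C),
     Hom = (\<lambda>xs ys. {f. \<forall>i j. if i < length xs \<and> j < length ys
                                then f j i \<in> Hom C (xs ! i) (ys ! j) else f j i = 0}),
     Comp = (\<lambda>xs ys zs g f k i. if i < length xs \<and> k < length zs
       then \<Sum>j < length ys. Comp C (xs ! i) (ys ! j) (zs ! k) (g k j) (f j i) else 0),
     Idn = (\<lambda>xs j i. if i = j \<and> i < length xs then Idn C (xs ! i) else 0) \<rparr>"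

definition idempotent_completion :: "('o, 'm) cat \<Rightarrow> ('o \<times> 'm, 'm) cat" where
  "idempotent_completion C = \<lparr>
     Ob = {(x, e). x \<in> Ob C \<and> e \<in> Hom C x x \<and> Comp C x x x e e = e},
     Hom = (\<lambda>(x, e) (y, e'). {f \<in> Hom C x y. Comp C x x y f e = f \<and> Comp C x y y e' f = f}),
     Comp = (\<lambda>(x, _) (y, _) (z, _). Comp C x y z),
     Idn = snd \<rparr>"

type_synonym ('o, 'm, 'k) T_arr = "nat \<Rightarrow> nat \<Rightarrow> ('o \<times> 'm) set \<Rightarrow> 'k"
type_synonym ('o, 'm, 'k) T_obj = "'o list \<times> ('o, 'm, 'k) T_arr"

definition T_cat ::
  "('o, 'm) cat \<Rightarrow> ('o \<Rightarrow> 'o \<Rightarrow> 'm \<Rightarrow> 'k::field) \<Rightarrow> (('o, 'm, 'k) T_obj, ('o, 'm, 'k) T_arr) cat" where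
  "T_cat C \<delta> = idempotent_completion (additive_completion (T0 C \<delta>))"

text \<open>The embedding of \<open>T0\<close> into \<open>\<T>\<close>, on objects and on arrows (as \<open>1 \<times> 1\<close> matrices).\<close>

definition bracket :: "('o, 'm) cat \<Rightarrow> ('o \<Rightarrow> 'o \<Rightarrow> 'm \<Rightarrow> 'k::field) \<Rightarrow> 'o \<Rightarrow> ('o, 'm, 'k) T_obj" where
  "bracket C \<delta> x = ([x], Idn (additive_completion (T0 C \<delta>)) [x])"

definition T_embed :: "(('o \<times> 'm) set \<Rightarrow> 'k::field) \<Rightarrow> ('o, 'm, 'k) T_arr" where
  "T_embed f = (\<lambda>j i. if i = 0 \<and> j = 0 then f else 0)"

text \<open>\<open>[f] : [x] \<rightarrow> [y]\<close> and \<open>[f]\<^sup>\<or> : [y] \<rightarrow> [x]\<close> for \<open>f : x \<rightarrow> y\<close>.\<close>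

definition bracket_arr :: "('o, 'm) cat \<Rightarrow> 'o \<Rightarrow> 'o \<Rightarrow> 'm \<Rightarrow> ('o, 'm, 'k::field) T_arr" where
  "bracket_arr C x y f = T_embed (basis_vec (graph C x y f))"

definition bracket_dual :: "('o, 'm) cat \<Rightarrow> 'o \<Rightarrow> 'o \<Rightarrow> 'm \<Rightarrow> ('o, 'm, 'k::field) T_arr" where
  "bracket_dual C x y f = T_embed (basis_vec (rel_op C x y (graph C x y f)))"

section \<open>Direct sums\<close>

definition biproduct ::
  "('o, 'm::ab_group_add) cat \<Rightarrow> 'i set \<Rightarrow> ('i \<Rightarrow> 'o) \<Rightarrow> ('i \<Rightarrow> 'm) \<Rightarrow> 'o \<Rightarrow> bool" where
  "biproduct C I D d x \<longleftrightarrow> finite I \<and> x \<in> Ob C \<and> (\<forall>i \<in> I. D i \<in> Ob C \<and> d i \<in> Hom C (D i) x) \<and>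
     (\<exists>p. (\<forall>i \<in> I. p i \<in> Hom C x (D i)) \<and>
        (\<forall>i \<in> I. \<forall>j \<in> I. Comp C (D i) x (D j) (p j) (d i) = (if i = j then Idn C (D i) else 0)) \<and>
        (\<Sum>i \<in> I. Comp C x (D i) x (d i) (p i)) = Idn C x)"

text \<open>The subobject \<open>S\<close> of \<open>x\<close> is the internal direct sum of the subobjects \<open>F i\<close> of \<open>x\<close>.\<close>

definition internal_sum ::
  "('o, 'm::ab_group_add) cat \<Rightarrow> 'o \<Rightarrow> ('o \<times> 'm) set \<Rightarrow> 'i set \<Rightarrow> ('i \<Rightarrow> ('o \<times> 'm) set) \<Rightarrow> bool" where
  "internal_sum C x S I F \<longleftrightarrow>
     S \<in> subobjects C x \<and> (\<forall>i \<in> I. F i \<in> subobjects C x) \<and>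
     (\<exists>(v, m) \<in> S. \<exists>D d. biproduct C I D d v \<and> (\<forall>i \<in> I. (D i, Comp C (D i) v x m (d i)) \<in> F i))"

definition complementary ::
  "('o, 'm::ab_group_add) cat \<Rightarrow> 'o \<Rightarrow> ('o \<times> 'm) set \<Rightarrow> ('o \<times> 'm) set \<Rightarrow> bool" where
  "complementary C x S S' \<longleftrightarrow> internal_sum C x (whole C x) UNIV (\<lambda>b :: bool. if b then S else S')"

definition direct_summand :: "('o, 'm::ab_group_add) cat \<Rightarrow> 'o \<Rightarrow> ('o \<times> 'm) set \<Rightarrow> bool" where
  "direct_summand C x S \<longleftrightarrow> (\<exists>S'. complementary C x S S')"

section \<open>Subquotients and the summands \<open>[x]\<^sup>0\<close>\<close>

definition subquotient :: "('o, 'm) cat \<Rightarrow> 'o \<Rightarrow> 'o \<Rightarrow> bool" where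
  "subquotient C z x \<longleftrightarrow> z \<in> Ob C \<and> (\<exists>y \<in> Ob C. \<exists>i e. mono_arr C y x i \<and> surjective C y z e)"

definition proper_subquotient :: "('o, 'm) cat \<Rightarrow> 'o \<Rightarrow> 'o \<Rightarrow> bool" where
  "proper_subquotient C z x \<longleftrightarrow> subquotient C z x \<and> \<not> isomorphic C z x"

definition is_part1 ::
  "('o, 'm) cat \<Rightarrow> ('o \<Rightarrow> 'o \<Rightarrow> 'm \<Rightarrow> 'k::field) \<Rightarrow> 'o \<Rightarrow>
     (('o, 'm, 'k) T_obj \<times> ('o, 'm, 'k) T_arr) set \<Rightarrow> bool" where
  "is_part1 C \<delta> x S \<longleftrightarrow>
     direct_summand (T_cat C \<delta>) (bracket C \<delta> x) S \<and>
     (\<exists>(n :: nat) z Z d W. (\<forall>i < n. proper_subquotient C (z i) x) \<and>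
        biproduct (T_cat C \<delta>) {..<n} (\<lambda>i. bracket C \<delta> (z i)) d Z \<and>
        direct_summand (T_cat C \<delta>) Z W \<and>
        isomorphic (T_cat C \<delta>) (sub_obj S) (sub_obj W)) \<and>
     (\<forall>z f. proper_subquotient C z x \<and> f \<in> Hom (T_cat C \<delta>) (bracket C \<delta> z) (bracket C \<delta> x) \<longrightarrow>
        factors (T_cat C \<delta>) (bracket C \<delta> z) (bracket C \<delta> x) f S)"

definition part1 ::
  "('o, 'm) cat \<Rightarrow> ('o \<Rightarrow> 'o \<Rightarrow> 'm \<Rightarrow> 'k::field) \<Rightarrow> 'o \<Rightarrow>
     (('o, 'm, 'k) T_obj \<times> ('o, 'm, 'k) T_arr) set" where
  "part1 C \<delta> x = (THE S. is_part1 C \<delta> x S)"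

definition part0 ::
  "('o, 'm) cat \<Rightarrow> ('o \<Rightarrow> 'o \<Rightarrow> 'm \<Rightarrow> 'k::field) \<Rightarrow> 'o \<Rightarrow>
     (('o, 'm, 'k) T_obj \<times> ('o, 'm, 'k) T_arr) set" where
  "part0 C \<delta> x = (THE S. complementary (T_cat C \<delta>) (bracket C \<delta> x) (part1 C \<delta> x) S)"

text \<open>A diagram \<open>z \<leftarrow> y \<rightarrow> x\<close> with surjective \<open>e : y \<rightarrow> z\<close> and injective
  \<open>i : y \<rightarrow> x\<close> is encoded as \<open>(z, e, y, i)\<close>.\<close>

definition sq_diagrams :: "('o, 'm) cat \<Rightarrow> 'o \<Rightarrow> ('o \<times> 'm \<times> 'o \<times> 'm) set" where
  "sq_diagrams C x =
     {(z, e, y, i). z \<in> Ob C \<and> y \<in> Ob C \<and> surjective C y z e \<and> mono_arr C y x i}"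

definition sq_equiv ::
  "('o, 'm) cat \<Rightarrow> 'o \<Rightarrow> (('o \<times> 'm \<times> 'o \<times> 'm) \<times> ('o \<times> 'm \<times> 'o \<times> 'm)) set" where
  "sq_equiv C x =
     {((z, e, y, i), (z', e', y', i')).
        (z, e, y, i) \<in> sq_diagrams C x \<and> (z', e', y', i') \<in> sq_diagrams C x \<and>
        (\<exists>a b. iso_arr C z z' a \<and> iso_arr C y y' b \<and>
           Comp C y y' z' e' b = Comp C y z z' a e \<and> Comp C y y' x i' b = i)}"

definition sq :: "('o, 'm) cat \<Rightarrow> 'o \<Rightarrow> ('o \<times> 'm \<times> 'o \<times> 'm) set set" where
  "sq C x = sq_diagrams C x // sq_equiv C x"

definition sq_sub :: "('o, 'm) cat \<Rightarrow> 'o \<Rightarrow> ('o \<times> 'm \<times> 'o \<times> 'm) set \<Rightarrow> ('o \<times> 'm) set" where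
  "sq_sub C x Q = (case rep Q of (z, e, y, i) \<Rightarrow> sub_class C x y i)"

definition quotients :: "('o, 'm) cat \<Rightarrow> 'o \<Rightarrow> ('o \<times> 'm \<times> 'o \<times> 'm) set set" where
  "quotients C x = {Q \<in> sq C x. sq_sub C x Q = whole C x}"

text \<open>\<open>[z]\<^sup>0\<^sub>y\<close>, the image of \<open>[z]\<^sup>0\<close> under \<open>[i] [e]\<^sup>\<or>\<close>.\<close>

definition sq_part ::
  "('o, 'm) cat \<Rightarrow> ('o \<Rightarrow> 'o \<Rightarrow> 'm \<Rightarrow> 'k::field) \<Rightarrow> 'o \<Rightarrow> ('o \<times> 'm \<times> 'o \<times> 'm) set \<Rightarrow>
     (('o, 'm, 'k) T_obj \<times> ('o, 'm, 'k) T_arr) set" where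
  "sq_part C \<delta> x Q = (case rep Q of (z, e, y, i) \<Rightarrow>
     direct_image (T_cat C \<delta>) (bracket C \<delta> z) (bracket C \<delta> x)
       (Comp (T_cat C \<delta>) (bracket C \<delta> z) (bracket C \<delta> y) (bracket C \<delta> x)
          (bracket_arr C y x i) (bracket_dual C y z e))
       (part0 C \<delta> z))"

section \<open>The idempotents \<open>p\<^sub>y\<close> and \<open>p\<^sub>y\<^sup>*\<close>\<close>

definition diag_sub :: "('o, 'm) cat \<Rightarrow> 'o \<Rightarrow> ('o \<times> 'm) set \<Rightarrow> ('o \<times> 'm) set" where
  "diag_sub C x y =
     sub_class C (prd C x x) (sub_obj y) (pair C (sub_obj y) x x (sub_arr y) (sub_arr y))"

definition p_sub :: "('o, 'm) cat \<Rightarrow> 'o \<Rightarrow> ('o \<times> 'm) set \<Rightarrow> ('o, 'm, 'k::field) T_arr" where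
  "p_sub C x y = T_embed (basis_vec (diag_sub C x y))"

definition p_star :: "('o, 'm) cat \<Rightarrow> 'o \<Rightarrow> ('o \<times> 'm) set \<Rightarrow> ('o, 'm, 'k::field) T_arr" where
  "p_star C x y = T_embed (\<lambda>r. \<Sum>y' \<in> {y' \<in> subobjects C x. sub_le C x y' y}.
     of_int (mu_sub C x y' y) * basis_vec (diag_sub C x y') r)"

definition star_part ::
  "('o, 'm) cat \<Rightarrow> ('o \<Rightarrow> 'o \<Rightarrow> 'm \<Rightarrow> 'k::field) \<Rightarrow> 'o \<Rightarrow>
     (('o, 'm, 'k) T_obj \<times> ('o, 'm, 'k) T_arr) set" where
  "star_part C \<delta> x =
     img (T_cat C \<delta>) (bracket C \<delta> x) (bracket C \<delta> x) (p_star C x (whole C x))"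

text \<open>For subobjects \<open>S\<close> and \<open>P\<close> of \<open>X\<close> and an endomorphism \<open>p\<close> of \<open>X\<close> with image \<open>P\<close>: the
  corestriction \<open>X \<rightarrow> P\<close> of \<open>p\<close> restricts to an isomorphism \<open>S \<rightarrow> P\<close>.\<close>

definition induces_iso ::
  "('o, 'm) cat \<Rightarrow> 'o \<Rightarrow> 'm \<Rightarrow> ('o \<times> 'm) set \<Rightarrow> ('o \<times> 'm) set \<Rightarrow> bool" where
  "induces_iso C X p S P \<longleftrightarrow>
     (\<exists>(V, v) \<in> S. \<exists>(W, w) \<in> P. \<exists>\<pi> \<in> Hom C X W.
        Comp C X W X w \<pi> = p \<and> iso_arr C V W (Comp C V X W \<pi> v))"

end

theory Submission
  imports Defs
begin

text \<open>Sending a relation on \<open>x\<close> to the degree of its intersection with the diagonal defines a trace on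
  \<open>T0\<close>. Let \<open>\<beta>\<^sub>v\<close> be the transpose of \<open>p\<^sup>*\<close> of a subobject \<open>v\<close> of \<open>x \<times> y\<close>. By Weisner's theorem the trace of
  \<open>\<beta>\<^sub>v \<langle>r\<rangle>\<close> is \<open>0\<close> unless \<open>v \<subseteq> r\<close>, when it is \<open>\<omega>\<close> of \<open>v \<rightarrow> *\<close>; so the trace form is nondegenerate.
  In an exact Mal'cev category a relation from \<open>x\<close> to \<open>y\<close> is an isomorphism between a subquotient of \<open>x\<close> and
  one of \<open>y\<close>. Modulo morphisms through smaller objects the trace form therefore provides duals of the
  arrows \<open>[i] [e]\<^sup>\<or>\<close>, and induction on the size of \<open>x\<close> splits the identity of \<open>[x]\<close> into orthogonal
  idempotents indexed by \<open>sq x\<close>. The remaining assertions hold because \<open>p\<^sub>y\<close> fixes \<open>[i] [e]\<^sup>\<or>\<close> if the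
  image of \<open>i\<close> lies in \<open>y\<close>, and because \<open>p\<^sub>x\<^sup>*\<close> annihilates \<open>[i] [e]\<^sup>\<or>\<close> if \<open>i\<close> is a proper subobject.\<close>

section \<open>Arrows with end points\<close>

text \<open>\<open>[x]\<^sup>1\<close> and \<open>[x]\<^sup>0\<close> are given by a universal
  property in a completion where neither images nor complements are at hand. The way out is an
  explicit idempotent \<open>eps x\<close> of \<open>T0\<close> which annihilates all morphisms to
  and from objects of smaller size and whose complement is a sum of composites through proper
  subquotients. Two-sidedness is the obstacle. Induction only yields an endomorphism
  \<open>s\<close> that fixes every morphism into \<open>x\<close> from a smaller object; that it
  also fixes those out of \<open>x\<close> is forced by the trace form, since by cyclicity
  \<open>f s\<close> and \<open>f\<close> have equal traces against every \<open>g\<close>.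
  Two-sided annihilation in turn makes \<open>eps\<close> central, and centrality is what makes the
  complement of \<open>[x]\<^sup>1\<close> unique. Sizes are compared instead of isomorphism types
  because a relation passes through a common subquotient of its ends: this is either isomorphic to
  an end or strictly smaller, and the second case is invisible to \<open>eps\<close>. The dual of
  \<open>[i] [e]\<^sup>\<or>\<close> cannot be read off one coefficient: composing \<open>e\<close>
  with automorphisms of its target changes the relation but not the subquotient object, so an orbit
  has to be weighted.\<close>

text \<open>Arrows carry their end points, so that composition needs no object arguments.\<close>

datatype ('o, 'm) arrow = Ar (dm: 'o) (mr: 'm) (cd: 'o)

lemma arrow_eqI: "dm f = dm g \<Longrightarrow> cd f = cd g \<Longrightarrow> mr f = mr g \<Longrightarrow> f = g"
  by (rule arrow.expand) simp

context category
begin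

definition arr :: "('o, 'm) arrow \<Rightarrow> bool" where
  "arr f \<longleftrightarrow> dm f \<in> Ob C \<and> cd f \<in> Ob C \<and> mr f \<in> Hom C (dm f) (cd f)"

definition cmp :: "('o, 'm) arrow \<Rightarrow> ('o, 'm) arrow \<Rightarrow> ('o, 'm) arrow" (infixr "\<cdot>" 70) where
  "g \<cdot> f = Ar (dm f) (Comp C (dm f) (cd f) (cd g) (mr g) (mr f)) (cd g)"

definition ide :: "'o \<Rightarrow> ('o, 'm) arrow" where
  "ide x = Ar x (Idn C x) x"

text \<open>End points of a composite are computed without any composability condition. Hence an
  equation between composites already equates their end points, and many typing facts below are
  obtained by applying \<open>dm\<close> or \<open>cd\<close> to an equation.\<close>

lemma dm_cmp [simp]: "dm (g \<cdot> f) = dm f" by (simp add: cmp_def)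
lemma cd_cmp [simp]: "cd (g \<cdot> f) = cd g" by (simp add: cmp_def)
lemma dm_ide [simp]: "dm (ide x) = x" by (simp add: ide_def)
lemma cd_ide [simp]: "cd (ide x) = x" by (simp add: ide_def)
lemma mr_cmp: "mr (g \<cdot> f) = Comp C (dm f) (cd f) (cd g) (mr g) (mr f)" by (simp add: cmp_def)
lemma mr_ide: "mr (ide x) = Idn C x" by (simp add: ide_def)

lemma arr_cmp [simp]: "arr f \<Longrightarrow> arr g \<Longrightarrow> cd f = dm g \<Longrightarrow> arr (g \<cdot> f)"
  by (auto simp: arr_def cmp_def intro: Comp_in_Hom)

lemma arr_ide [simp]: "x \<in> Ob C \<Longrightarrow> arr (ide x)"
  by (auto simp: arr_def ide_def intro: Idn_in_Hom)

lemma arr_dm [simp]: "arr f \<Longrightarrow> dm f \<in> Ob C" by (simp add: arr_def)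
lemma arr_cd [simp]: "arr f \<Longrightarrow> cd f \<in> Ob C" by (simp add: arr_def)

lemma cmp_assoc [simp]:
  "arr f \<Longrightarrow> arr g \<Longrightarrow> arr h \<Longrightarrow> cd f = dm g \<Longrightarrow> cd g = dm h \<Longrightarrow> (h \<cdot> g) \<cdot> f = h \<cdot> (g \<cdot> f)"
  by (simp add: arr_def cmp_def Comp_assoc del: arr_dm arr_cd)

lemma cmp_ide_right [simp]: "arr f \<Longrightarrow> dm f = x \<Longrightarrow> f \<cdot> ide x = f"
  by (rule arrow_eqI) (auto simp: arr_def mr_cmp mr_ide Comp_Idn_right simp del: arr_dm arr_cd)

lemma cmp_ide_left [simp]: "arr f \<Longrightarrow> cd f = x \<Longrightarrow> ide x \<cdot> f = f"
  by (rule arrow_eqI) (auto simp: arr_def mr_cmp mr_ide Comp_Idn_left simp del: arr_dm arr_cd)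

lemma arr_triple: "arr (Ar x f y) \<longleftrightarrow> x \<in> Ob C \<and> y \<in> Ob C \<and> f \<in> Hom C x y"
  by (simp add: arr_def del: arr_dm arr_cd)

text \<open>Since \<open>cmp_assoc\<close> nests composites to the right, the left side of a known
  equation \<open>h \<cdot> g = k\<close> is no longer a subterm of a longer composite; this form
  still matches.\<close>

lemma cmp_left_eq: "h \<cdot> g = k \<Longrightarrow> arr f \<Longrightarrow> arr g \<Longrightarrow> arr h \<Longrightarrow> cd f = dm g \<Longrightarrow> cd g = dm h \<Longrightarrow>
    h \<cdot> (g \<cdot> f) = k \<cdot> f"
  using cmp_assoc by metis

section \<open>Monos, isomorphisms and extremal epimorphisms\<close>

definition mon :: "('o, 'm) arrow \<Rightarrow> bool" where
  "mon f \<longleftrightarrow> arr f \<and> (\<forall>g h. arr g \<and> arr h \<and> dm g = dm h \<and> cd g = dm f \<and> cd h = dm f \<and> f \<cdot> g = f \<cdot> h \<longrightarrow> g = h)"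

definition iso :: "('o, 'm) arrow \<Rightarrow> bool" where
  "iso f \<longleftrightarrow> arr f \<and> (\<exists>g. arr g \<and> dm g = cd f \<and> cd g = dm f \<and> g \<cdot> f = ide (dm f) \<and> f \<cdot> g = ide (cd f))"

text \<open>Surjectivity in extremal form: a mono through which \<open>f\<close> factors is
  invertible. \<open>surjective_iff\<close> links it to the definition by images; this form is the
  convenient one for orthogonality arguments.\<close>

definition sur :: "('o, 'm) arrow \<Rightarrow> bool" where
  "sur f \<longleftrightarrow> arr f \<and> (\<forall>m g. mon m \<and> arr g \<and> cd g = dm m \<and> f = m \<cdot> g \<longrightarrow> iso m)"

lemma mon_arr [simp]: "mon f \<Longrightarrow> arr f" by (simp add: mon_def)
lemma iso_arr' [simp]: "iso f \<Longrightarrow> arr f" by (simp add: iso_def)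
lemma sur_arr [simp]: "sur f \<Longrightarrow> arr f" by (simp add: sur_def)

lemma monD: "mon f \<Longrightarrow> f \<cdot> g = f \<cdot> h \<Longrightarrow> arr g \<Longrightarrow> arr h \<Longrightarrow> cd g = dm f \<Longrightarrow> cd h = dm f \<Longrightarrow> g = h"
  unfolding mon_def by (metis dm_cmp)

lemma monI:
  assumes "arr f" "\<And>g h. \<lbrakk>arr g; arr h; dm g = dm h; cd g = dm f; cd h = dm f; f \<cdot> g = f \<cdot> h\<rbrakk> \<Longrightarrow> g = h"
  shows "mon f"
  using assms unfolding mon_def by blast

lemma isoE:
  assumes "iso f"
  obtains g where "arr g" "dm g = cd f" "cd g = dm f" "g \<cdot> f = ide (dm f)" "f \<cdot> g = ide (cd f)" "iso g"
  using assms unfolding iso_def by metis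

lemma isoI: "\<lbrakk>arr f; arr g; dm g = cd f; cd g = dm f; g \<cdot> f = ide (dm f); f \<cdot> g = ide (cd f)\<rbrakk> \<Longrightarrow> iso f"
  unfolding iso_def by blast

lemma split_mono_mon:
  assumes "arr f" "arr g" "dm g = cd f" "cd g = dm f" "g \<cdot> f = ide (dm f)"
  shows "mon f"
proof (rule monI)
  fix h k assume a: "arr h" "arr k" "dm h = dm k" "cd h = dm f" "cd k = dm f" "f \<cdot> h = f \<cdot> k"
  have "h = (g \<cdot> f) \<cdot> h" using a assms by simp
  also have "\<dots> = (g \<cdot> f) \<cdot> k" using a assms(1-4) by simp
  also have "\<dots> = k" using a assms by simp
  finally show "h = k" .
qed (use assms in auto)

lemma iso_mon [simp]: "iso f \<Longrightarrow> mon f"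
  by (meson isoE iso_arr' split_mono_mon)

lemma iso_ide [simp]: "x \<in> Ob C \<Longrightarrow> iso (ide x)"
  by (rule isoI[of _ "ide x"]) auto

lemma mon_cmp [simp]:
  assumes "mon f" "mon g" "cd f = dm g"
  shows "mon (g \<cdot> f)"
proof (rule monI)
  fix h k assume a: "arr h" "arr k" "dm h = dm k" "cd h = dm (g \<cdot> f)" "cd k = dm (g \<cdot> f)" "(g \<cdot> f) \<cdot> h = (g \<cdot> f) \<cdot> k"
  then have "g \<cdot> (f \<cdot> h) = g \<cdot> (f \<cdot> k)" using assms by simp
  then have "f \<cdot> h = f \<cdot> k" using a assms by - (rule monD[of g], auto)
  then show "h = k" using a assms by - (rule monD[of f], auto)
qed (use assms in auto)

lemma mon_cancel:
  assumes "mon (g \<cdot> f)" "arr f" "arr g" "cd f = dm g"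
  shows "mon f"
proof (rule monI)
  fix h k assume a: "arr h" "arr k" "dm h = dm k" "cd h = dm f" "cd k = dm f" "f \<cdot> h = f \<cdot> k"
  then have "(g \<cdot> f) \<cdot> h = (g \<cdot> f) \<cdot> k" using assms by simp
  then show "h = k" using a assms by - (rule monD[of "g \<cdot> f"], auto)
qed (use assms in auto)

lemma iso_cmp [simp]:
  assumes "iso f" "iso g" "cd f = dm g"
  shows "iso (g \<cdot> f)"
proof -
  obtain f' where f': "arr f'" "dm f' = cd f" "cd f' = dm f" "f' \<cdot> f = ide (dm f)" "f \<cdot> f' = ide (cd f)"
    using assms(1) by (rule isoE)
  obtain g' where g': "arr g'" "dm g' = cd g" "cd g' = dm g" "g' \<cdot> g = ide (dm g)" "g \<cdot> g' = ide (cd g)"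
    using assms(2) by (rule isoE)
  have 1: "g' \<cdot> (g \<cdot> f) = f" using g' assms f' by (subst cmp_left_eq[OF g'(4)]) auto
  have 2: "f \<cdot> (f' \<cdot> g') = g'" using g' assms f' by (subst cmp_left_eq[OF f'(5)]) auto
  show ?thesis using 1 2 f' g' assms by (intro isoI[of _ "f' \<cdot> g'"]) auto
qed

lemma mon_split_iso:
  assumes "mon m" "arr s" "dm s = cd m" "cd s = dm m" "m \<cdot> s = ide (cd m)"
  shows "iso m"
proof -
  have "m \<cdot> (s \<cdot> m) = m \<cdot> ide (dm m)" using assms by (subst cmp_left_eq[OF assms(5)]) auto
  then have "s \<cdot> m = ide (dm m)" using assms by - (rule monD[OF assms(1)], auto)
  then show ?thesis using assms by (intro isoI[of m s]) auto
qed

lemma surI: "arr f \<Longrightarrow> (\<And>m g. mon m \<Longrightarrow> arr g \<Longrightarrow> cd g = dm m \<Longrightarrow> f = m \<cdot> g \<Longrightarrow> iso m) \<Longrightarrow> sur f"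
  unfolding sur_def by blast

lemma surD: "sur f \<Longrightarrow> f = m \<cdot> g \<Longrightarrow> mon m \<Longrightarrow> arr g \<Longrightarrow> cd g = dm m \<Longrightarrow> iso m"
  unfolding sur_def by blast

lemma iso_sur [simp]:
  assumes "iso f"
  shows "sur f"
proof (rule surI)
  fix m g assume a: "mon m" "arr g" "cd g = dm m" "f = m \<cdot> g"
  obtain f' where f': "arr f'" "dm f' = cd f" "cd f' = dm f" "f' \<cdot> f = ide (dm f)" "f \<cdot> f' = ide (cd f)"
    using assms by (rule isoE)
  have "m \<cdot> (g \<cdot> f') = ide (cd m)" using a f' by simp
  then show "iso m" using a f' by (intro mon_split_iso[of m "g \<cdot> f'"]) auto
qed (use assms in auto)

lemma sur_mon_iso: "sur f \<Longrightarrow> mon f \<Longrightarrow> iso f"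
  by (rule surD[of f f "ide (dm f)"]) auto

lemma sur_cancel:
  assumes "sur (g \<cdot> f)" "arr f" "arr g" "cd f = dm g"
  shows "sur g"
proof (rule surI)
  fix m k assume a: "mon m" "arr k" "cd k = dm m" "g = m \<cdot> k"
  have "dm k = dm g" unfolding a(4) by simp
  then have "g \<cdot> f = m \<cdot> (k \<cdot> f)" by (subst a(4), intro cmp_assoc) (use a(1-3) assms in auto)
  then show "iso m" by (rule surD[OF assms(1)]) (use a(1-3) assms(2-4) \<open>dm k = dm g\<close> in auto)
qed (use assms in auto)

lemma sur_cmp_iso: assumes "sur e" "iso h" "cd e = dm h" shows "sur (h \<cdot> e)"
proof (rule surI)
  fix m g assume a: "mon m" "arr g" "cd g = dm m" "h \<cdot> e = m \<cdot> g"
  obtain h' where h': "arr h'" "dm h' = cd h" "cd h' = dm h" "h' \<cdot> h = ide (dm h)" "h \<cdot> h' = ide (cd h)" "iso h'"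
    using assms(2) by (rule isoE)
  have cm: "cd m = cd h" and dg: "dm g = dm e" using a(4) by (metis cd_cmp, metis dm_cmp)
  have "e = h' \<cdot> (h \<cdot> e)" using assms h' by (subst cmp_left_eq[OF h'(4)]) auto
  also have "\<dots> = (h' \<cdot> m) \<cdot> g" using a h' assms cm by simp
  finally have "iso (h' \<cdot> m)" by (rule surD[OF assms(1)]) (use a h' assms cm in auto)
  then have "iso (h \<cdot> (h' \<cdot> m))" by (rule iso_cmp) (use assms h' cm a in auto)
  moreover have "h \<cdot> (h' \<cdot> m) = m" using a h' assms cm by (subst cmp_left_eq[OF h'(5)]) auto
  ultimately show "iso m" by simp
qed (use assms in auto)

subsection \<open>Subobjects and images\<close>

lemma mono_arr_iff: "x \<in> Ob C \<Longrightarrow> y \<in> Ob C \<Longrightarrow> mono_arr C x y f \<longleftrightarrow> mon (Ar x f y)"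
  unfolding mono_arr_def mon_def arr_triple
proof (safe, goal_cases)
  case (1 g h)
  from 1(4-9) have gh: "mr g \<in> Hom C (dm h) x" "mr h \<in> Hom C (dm h) x" "dm h \<in> Ob C"
    unfolding arr_def by (simp_all del: arr_dm arr_cd)
  have "Comp C (dm h) x y f (mr g) = Comp C (dm h) x y f (mr h)"
    using arg_cong[OF \<open>Ar x f y \<cdot> g = Ar x f y \<cdot> h\<close>, of mr] 1(6-9) by (simp add: mr_cmp)
  then have "mr g = mr h" using 1(4) gh by blast
  then show ?case using 1 by (intro arrow_eqI) simp_all
next
  case (2 t g h)
  have "arr (Ar t g x)" "arr (Ar t h x)" using \<open>t \<in> Ob C\<close> \<open>x \<in> Ob C\<close> \<open>g \<in> Hom C t x\<close> \<open>h \<in> Hom C t x\<close> by (simp_all add: arr_triple)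
  moreover have "Ar x f y \<cdot> Ar t g x = Ar x f y \<cdot> Ar t h x" using \<open>Comp C t x y f g = Comp C t x y f h\<close> by (simp add: cmp_def)
  ultimately have "Ar t g x = Ar t h x" using 2 by (metis arrow.sel(1,3))
  then show ?case by simp
qed

lemma iso_arr_iff: "x \<in> Ob C \<Longrightarrow> y \<in> Ob C \<Longrightarrow> iso_arr C x y f \<longleftrightarrow> iso (Ar x f y)"
  unfolding iso_arr_def iso_def arr_triple
proof (safe, goal_cases)
  case (1 g)
  then show ?case by (intro exI[of _ "Ar y g x"]) (auto simp: cmp_def ide_def arr_triple)
next
  case (2 g)
  then show ?case by (intro bexI[of _ "mr g"]) (auto simp: cmp_def ide_def arr_def simp del: arr_dm arr_cd)
qed

definition cls :: "('o, 'm) arrow \<Rightarrow> ('o \<times> 'm) set" where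
  "cls m = sub_class C (cd m) (dm m) (mr m)"

lemma sub_class_cls: "sub_class C x y i = cls (Ar y i x)" by (simp add: cls_def)

lemma mem_cls_iff:
  assumes "mon m"
  shows "(y, i) \<in> cls m \<longleftrightarrow> mon (Ar y i (cd m)) \<and> (\<exists>h. iso h \<and> dm h = dm m \<and> cd h = y \<and> (Ar y i (cd m)) \<cdot> h = m)"
proof
  assume "(y, i) \<in> cls m"
  then obtain h where h: "y \<in> Ob C" "mono_arr C y (cd m) i" "iso_arr C (dm m) y h" "Comp C (dm m) y (cd m) i h = mr m"
    by (auto simp: cls_def sub_class_def)
  have "(Ar y i (cd m)) \<cdot> (Ar (dm m) h y) = m" using h by (simp add: cmp_def arrow.collapse)
  then show "mon (Ar y i (cd m)) \<and> (\<exists>h. iso h \<and> dm h = dm m \<and> cd h = y \<and> (Ar y i (cd m)) \<cdot> h = m)"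
    using h assms by (auto simp: mono_arr_iff iso_arr_iff intro!: exI[of _ "(Ar (dm m) h y)"])
next
  assume a: "mon (Ar y i (cd m)) \<and> (\<exists>h. iso h \<and> dm h = dm m \<and> cd h = y \<and> (Ar y i (cd m)) \<cdot> h = m)"
  then obtain h where h: "iso h" "dm h = dm m" "cd h = y" "(Ar y i (cd m)) \<cdot> h = m" by blast
  have y: "y \<in> Ob C" using mon_arr[of "(Ar y i (cd m))"] a by (simp add: arr_def del: arr_dm arr_cd)
  have "iso (Ar (dm m) (mr h) y)" using h by (metis arrow.collapse)
  moreover have "Comp C (dm m) y (cd m) i (mr h) = mr m"
    using h by (metis mr_cmp arrow.sel arrow.sel)
  ultimately show "(y, i) \<in> cls m"
    using a y assms by (auto simp: cls_def sub_class_def mono_arr_iff iso_arr_iff intro!: exI[of _ "mr h"])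
qed

lemma cls_eqI:
  assumes "mon m'" "iso h" "cd h = dm m'"
  shows "cls (m' \<cdot> h) = cls m'"
proof -
  obtain h' where h': "arr h'" "dm h' = cd h" "cd h' = dm h" "h' \<cdot> h = ide (dm h)" "h \<cdot> h' = ide (cd h)" "iso h'"
    using assms(2) by (rule isoE)
  have m: "mon (m' \<cdot> h)" using assms by simp
  have "(y, i) \<in> cls (m' \<cdot> h) \<longleftrightarrow> (y, i) \<in> cls m'" for y i
  proof (subst mem_cls_iff[OF m], subst mem_cls_iff[OF assms(1)], intro iffI)
    assume "mon (Ar y i (cd (m' \<cdot> h))) \<and> (\<exists>k. iso k \<and> dm k = dm (m' \<cdot> h) \<and> cd k = y \<and> Ar y i (cd (m' \<cdot> h)) \<cdot> k = m' \<cdot> h)"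
    then obtain k where k: "mon (Ar y i (cd m'))" "iso k" "dm k = dm h" "cd k = y" "Ar y i (cd m') \<cdot> k = m' \<cdot> h"
      by auto
    have "Ar y i (cd m') \<cdot> (k \<cdot> h') = (m' \<cdot> h) \<cdot> h'"
      using k h' assms by (subst cmp_left_eq[OF k(5)]) auto
    also have "\<dots> = m'" using h' assms by simp
    finally show "mon (Ar y i (cd m')) \<and> (\<exists>k. iso k \<and> dm k = dm m' \<and> cd k = y \<and> Ar y i (cd m') \<cdot> k = m')"
      using k h' assms by (intro conjI exI[of _ "k \<cdot> h'"]) auto
  next
    assume "mon (Ar y i (cd m')) \<and> (\<exists>k. iso k \<and> dm k = dm m' \<and> cd k = y \<and> Ar y i (cd m') \<cdot> k = m')"
    then obtain k where k: "mon (Ar y i (cd m'))" "iso k" "dm k = dm m'" "cd k = y" "Ar y i (cd m') \<cdot> k = m'"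
      by auto
    have "Ar y i (cd m') \<cdot> (k \<cdot> h) = m' \<cdot> h"
      using k assms by (subst cmp_left_eq[OF k(5)]) auto
    then show "mon (Ar y i (cd (m' \<cdot> h))) \<and> (\<exists>k. iso k \<and> dm k = dm (m' \<cdot> h) \<and> cd k = y \<and> Ar y i (cd (m' \<cdot> h)) \<cdot> k = m' \<cdot> h)"
      using k assms by (intro conjI exI[of _ "k \<cdot> h"]) auto
  qed
  then show ?thesis by auto
qed

lemma mem_cls_self: "mon m \<Longrightarrow> (dm m, mr m) \<in> cls m"
  by (subst mem_cls_iff) (auto intro!: exI[of _ "ide (dm m)"])

lemma mem_clsD:
  assumes "mon m" "(y, i) \<in> cls m"
  shows "mon (Ar y i (cd m))" "cls (Ar y i (cd m)) = cls m"
proof -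
  obtain h where "mon (Ar y i (cd m))" "iso h" "cd h = y" "Ar y i (cd m) \<cdot> h = m"
    using assms(2) unfolding mem_cls_iff[OF assms(1)] by auto
  then show "mon (Ar y i (cd m))" "cls (Ar y i (cd m)) = cls m" using cls_eqI[of "Ar y i (cd m)" h] by simp_all
qed

lemma cls_eq_iff:
  assumes "mon m" "mon m'" "cd m = cd m'"
  shows "cls m = cls m' \<longleftrightarrow> (\<exists>h. iso h \<and> dm h = dm m \<and> cd h = dm m' \<and> m' \<cdot> h = m)"
proof
  assume "cls m = cls m'"
  then have "(dm m', mr m') \<in> cls m" using mem_cls_self assms by blast
  then show "\<exists>h. iso h \<and> dm h = dm m \<and> cd h = dm m' \<and> m' \<cdot> h = m"
    using assms by (simp add: mem_cls_iff arrow.collapse)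
next
  assume "\<exists>h. iso h \<and> dm h = dm m \<and> cd h = dm m' \<and> m' \<cdot> h = m"
  then show "cls m = cls m'" using cls_eqI assms by metis
qed

lemma subobjects_eq: "x \<in> Ob C \<Longrightarrow> subobjects C x = {cls m | m. mon m \<and> cd m = x}"
  unfolding subobjects_def
proof (safe, goal_cases)
  case (1 _ y i)
  then show ?case by (auto simp: mono_arr_iff sub_class_cls intro!: exI[of _ "(Ar y i x)"])
next
  case (2 _ m)
  then show ?case
    by (auto intro!: exI[of _ "dm m"] exI[of _ "mr m"] simp: mono_arr_iff arrow.collapse cls_def)
qed

lemma cls_in_subobjects [simp]: "mon m \<Longrightarrow> cd m = x \<Longrightarrow> cls m \<in> subobjects C x"
  by (subst subobjects_eq) auto

text \<open>The target must be supplied because a class of pairs does not record it.\<close>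

definition rpr :: "'o \<Rightarrow> ('o \<times> 'm) set \<Rightarrow> ('o, 'm) arrow" where
  "rpr x S = Ar (sub_obj S) (sub_arr S) x"

lemma dm_rpr [simp]: "dm (rpr x S) = sub_obj S" by (simp add: rpr_def)
lemma cd_rpr [simp]: "cd (rpr x S) = x" by (simp add: rpr_def)

lemma rep_mem: "S \<noteq> {} \<Longrightarrow> rep S \<in> S"
  unfolding rep_def by (metis ex_in_conv someI_ex)

lemma rpr:
  assumes "S \<in> subobjects C x" "x \<in> Ob C"
  shows "mon (rpr x S)" "cls (rpr x S) = S"
proof -
  obtain m where m: "mon m" "cd m = x" "S = cls m" using assms by (auto simp: subobjects_eq)
  then have "rep S \<in> S" using mem_cls_self[OF m(1)] rep_mem[of S] by auto
  then have "(sub_obj S, sub_arr S) \<in> cls m" using m by simp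
  then show "mon (rpr x S)" "cls (rpr x S) = S" using mem_clsD[OF m(1), of "sub_obj S" "sub_arr S"] m(2,3) by (simp_all add: rpr_def)
qed

lemma whole_cls: "whole C x = cls (ide x)"
  by (simp add: whole_def cls_def mr_ide)

text \<open>Members of a class differ by isomorphisms over the target, so one representative decides
  whether an arrow factors through the subobject.\<close>

lemma factors_cls:
  assumes "mon m" "arr f" "cd f = cd m"
  shows "factors C (dm f) (cd m) (mr f) (cls m) \<longleftrightarrow> (\<exists>g. arr g \<and> dm g = dm f \<and> cd g = dm m \<and> m \<cdot> g = f)"
proof
  assume "factors C (dm f) (cd m) (mr f) (cls m)"
  then obtain y i g where g: "(y, i) \<in> cls m" "g \<in> Hom C (dm f) y" "Comp C (dm f) y (cd m) i g = mr f"
    by (auto simp: factors_def)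
  let ?i = "(Ar y i (cd m))" and ?g = "(Ar (dm f) g y)"
  have yi: "mon ?i" "\<exists>h. iso h \<and> dm h = dm m \<and> cd h = y \<and> ?i \<cdot> h = m" using g assms by (auto simp: mem_cls_iff)
  then obtain h where h: "iso h" "dm h = dm m" "cd h = y" "?i \<cdot> h = m" by blast
  obtain h' where h': "arr h'" "dm h' = cd h" "cd h' = dm h" "h' \<cdot> h = ide (dm h)" "h \<cdot> h' = ide (cd h)" "iso h'"
    using h(1) by (rule isoE)
  have gg: "arr ?g" "?i \<cdot> ?g = f" using g assms mon_arr[OF yi(1)]
    by (auto simp: arr_def cmp_def arrow.collapse simp del: arr_dm arr_cd) (metis arrow.collapse)
  have "m \<cdot> h' = ?i"
    using h h' yi by (metis arr_cmp arrow.sel cmp_assoc cmp_ide_right arrow.sel iso_arr' mon_arr)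
  then have "m \<cdot> (h' \<cdot> ?g) = f" using gg h h' yi assms by (subst cmp_left_eq) auto
  then show "\<exists>g. arr g \<and> dm g = dm f \<and> cd g = dm m \<and> m \<cdot> g = f"
    using h h' gg by (intro exI[of _ "h' \<cdot> ?g"]) auto
next
  assume "\<exists>g. arr g \<and> dm g = dm f \<and> cd g = dm m \<and> m \<cdot> g = f"
  then obtain g where g: "arr g" "dm g = dm f" "cd g = dm m" "m \<cdot> g = f" by blast
  then have "Comp C (dm f) (dm m) (cd m) (mr m) (mr g) = mr f" by (metis mr_cmp)
  then show "factors C (dm f) (cd m) (mr f) (cls m)"
    unfolding factors_def using mem_cls_self[OF assms(1)] g
    by (intro bexI[of _ "(dm m, mr m)"]) (auto simp: arr_def simp del: arr_dm arr_cd)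
qed

lemma sub_le_cls:
  assumes "mon m" "mon m'" "cd m = cd m'"
  shows "sub_le C (cd m) (cls m) (cls m') \<longleftrightarrow> (\<exists>g. arr g \<and> dm g = dm m \<and> cd g = dm m' \<and> m' \<cdot> g = m)"
proof
  assume "sub_le C (cd m) (cls m) (cls m')"
  then obtain y i where yi: "(y, i) \<in> cls m" "factors C y (cd m) i (cls m')" by (auto simp: sub_le_def)
  let ?i = "(Ar y i (cd m))"
  obtain h where h: "mon ?i" "iso h" "dm h = dm m" "cd h = y" "?i \<cdot> h = m" using yi assms by (auto simp: mem_cls_iff)
  have "factors C (dm ?i) (cd m') (mr ?i) (cls m')" using yi assms by simp
  then obtain g where g: "arr g" "dm g = y" "cd g = dm m'" "m' \<cdot> g = ?i"
    using factors_cls[OF assms(2), of ?i] h(1) assms by auto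
  then show "\<exists>g. arr g \<and> dm g = dm m \<and> cd g = dm m' \<and> m' \<cdot> g = m"
    using h assms by (intro exI[of _ "g \<cdot> h"]) (auto simp: cmp_left_eq)
next
  assume "\<exists>g. arr g \<and> dm g = dm m \<and> cd g = dm m' \<and> m' \<cdot> g = m"
  then have "factors C (dm m) (cd m) (mr m) (cls m')" using factors_cls[of m' m] assms by auto
  then show "sub_le C (cd m) (cls m) (cls m')"
    unfolding sub_le_def using mem_cls_self[OF assms(1)] by (intro bexI[of _ "(dm m, mr m)"]) auto
qed

lemma sub_le_refl: "x \<in> Ob C \<Longrightarrow> S \<in> subobjects C x \<Longrightarrow> sub_le C x S S"
proof -
  assume "x \<in> Ob C" "S \<in> subobjects C x"
  then obtain m where "mon m" "cd m = x" "S = cls m" by (auto simp: subobjects_eq)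
  moreover from this have "m \<cdot> ide (dm m) = m" by simp
  ultimately show ?thesis using sub_le_cls[of m m] by (metis arr_dm arr_ide cd_ide dm_ide mon_arr)
qed

lemma sub_le_antisym:
  assumes "x \<in> Ob C" "S \<in> subobjects C x" "S' \<in> subobjects C x" "sub_le C x S S'" "sub_le C x S' S"
  shows "S = S'"
proof -
  obtain m where m: "mon m" "cd m = x" "S = cls m" using assms by (auto simp: subobjects_eq)
  obtain n where n: "mon n" "cd n = x" "S' = cls n" using assms by (auto simp: subobjects_eq)
  obtain g where g: "arr g" "dm g = dm m" "cd g = dm n" "n \<cdot> g = m" using sub_le_cls[of m n] m n assms by auto
  obtain h where h: "arr h" "dm h = dm n" "cd h = dm m" "m \<cdot> h = n" using sub_le_cls[of n m] m n assms by auto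
  have "n \<cdot> (g \<cdot> h) = n \<cdot> ide (dm n)" using g h n m by (simp add: cmp_left_eq)
  then have 1: "g \<cdot> h = ide (dm n)" using g h n by - (rule monD[of n], auto)
  have "m \<cdot> (h \<cdot> g) = m \<cdot> ide (dm m)" using g h n m by (simp add: cmp_left_eq)
  then have 2: "h \<cdot> g = ide (dm m)" using g h m by - (rule monD[of m], auto)
  have "iso g" using 1 2 g h by (intro isoI[of g h]) auto
  then show ?thesis using cls_eq_iff[OF m(1) n(1)] m n g by auto
qed

lemma sub_le_trans:
  assumes "x \<in> Ob C" "S \<in> subobjects C x" "S' \<in> subobjects C x" "S'' \<in> subobjects C x" "sub_le C x S S'" "sub_le C x S' S''"
  shows "sub_le C x S S''"
proof -
  obtain m where m: "mon m" "cd m = x" "S = cls m" using assms by (auto simp: subobjects_eq)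
  obtain n where n: "mon n" "cd n = x" "S' = cls n" using assms by (auto simp: subobjects_eq)
  obtain k where k: "mon k" "cd k = x" "S'' = cls k" using assms by (auto simp: subobjects_eq)
  obtain g where g: "arr g" "dm g = dm m" "cd g = dm n" "n \<cdot> g = m" using sub_le_cls[of m n] m n assms by auto
  obtain h where h: "arr h" "dm h = dm n" "cd h = dm k" "k \<cdot> h = n" using sub_le_cls[of n k] k n assms by auto
  have "k \<cdot> (h \<cdot> g) = m" using g h k m n by (simp add: cmp_left_eq)
  then have "\<exists>g. arr g \<and> dm g = dm m \<and> cd g = dm k \<and> k \<cdot> g = m" using g h by (intro exI[of _ "h \<cdot> g"]) auto
  then show ?thesis using sub_le_cls[of m k] m k by auto
qed

lemma sub_le_whole: "x \<in> Ob C \<Longrightarrow> S \<in> subobjects C x \<Longrightarrow> sub_le C x S (whole C x)"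
proof -
  assume a: "x \<in> Ob C" "S \<in> subobjects C x"
  then obtain m where "mon m" "cd m = x" "S = cls m" by (auto simp: subobjects_eq)
  then show ?thesis using sub_le_cls[of m "ide x"] a by (auto simp: whole_cls intro!: exI[of _ m])
qed

lemma whole_in_subobjects: "x \<in> Ob C \<Longrightarrow> whole C x \<in> subobjects C x"
  by (simp add: whole_cls)

lemma cls_eq_whole_iff: 
  assumes "mon m"
  shows "cls m = whole C (cd m) \<longleftrightarrow> iso m"
proof -
  have "cls m = whole C (cd m) \<longleftrightarrow> (\<exists>h. iso h \<and> dm h = dm m \<and> cd h = cd m \<and> ide (cd m) \<cdot> h = m)"
    using cls_eq_iff[OF assms, of "ide (cd m)"] assms by (simp add: whole_cls)
  also have "\<dots> \<longleftrightarrow> iso m" by (metis cmp_ide_left iso_arr')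
  finally show ?thesis .
qed

text \<open>The hypothesis on \<open>e\<close> also holds for split epis in an arbitrary category.\<close>

lemma is_image_cls:
  assumes "mon m" "arr e" "cd e = dm m"
    and min: "\<And>n g. mon n \<Longrightarrow> arr g \<Longrightarrow> cd g = dm n \<Longrightarrow> cd n = cd m \<Longrightarrow> m \<cdot> e = n \<cdot> g \<Longrightarrow>
      \<exists>k. arr k \<and> dm k = dm m \<and> cd k = dm n \<and> n \<cdot> k = m"
  shows "is_image C (dm e) (cd m) (mr (m \<cdot> e)) (cls m)"
  unfolding is_image_def
proof (intro conjI ballI impI)
  show "cls m \<in> subobjects C (cd m)" using assms by simp
  show "factors C (dm e) (cd m) (mr (m \<cdot> e)) (cls m)"
    using factors_cls[OF assms(1), of "m \<cdot> e"] assms by auto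
  fix S assume S: "S \<in> subobjects C (cd m)" "factors C (dm e) (cd m) (mr (m \<cdot> e)) S"
  then obtain n where n: "mon n" "cd n = cd m" "S = cls n" using assms by (auto simp: subobjects_eq)
  then obtain g where "arr g" "dm g = dm e" "cd g = dm n" "n \<cdot> g = m \<cdot> e"
    using factors_cls[OF n(1), of "m \<cdot> e"] S assms by auto
  then show "sub_le C (cd m) (cls m) S" using min[of n g] n sub_le_cls[of m n] assms by auto
qed

lemma img_eq:
  assumes "x \<in> Ob C" "is_image C y x f S"
  shows "img C y x f = S"
  unfolding img_def
proof (rule the_equality)
  fix S' assume "is_image C y x f S'"
  then show "S' = S" using assms sub_le_antisym[OF assms(1)] unfolding is_image_def by blast
qed (use assms in auto)

text \<open>Minimality is witnessed by the section: if \<open>m \<cdot> e\<close> factors through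
  \<open>n\<close>, composing with \<open>s\<close> factors \<open>m\<close> through
  \<open>n\<close>. This is how images are computed in \<open>T\<close>, where every map concerned
  is a split epi followed by a split mono.\<close>

lemma img_split:
  assumes "mon m" "arr e" "cd e = dm m" "arr s" "dm s = dm m" "cd s = dm e" "e \<cdot> s = ide (dm m)"
  shows "img C (dm e) (cd m) (mr (m \<cdot> e)) = cls m"
proof (rule img_eq[OF _ is_image_cls])
  fix n g assume n: "mon n" "arr g" "cd g = dm n" "cd n = cd m" "m \<cdot> e = n \<cdot> g"
  have dg: "dm g = dm e" using n(5) by (metis dm_cmp)
  have "n \<cdot> (g \<cdot> s) = (n \<cdot> g) \<cdot> s" using n assms dg by simp
  also have "\<dots> = m" unfolding n(5)[symmetric] using assms by simp
  finally have "n \<cdot> (g \<cdot> s) = m" .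
  then show "\<exists>k. arr k \<and> dm k = dm m \<and> cd k = dm n \<and> n \<cdot> k = m"
    using n assms dg by (intro exI[of _ "g \<cdot> s"]) auto
qed (use assms in auto)

lemma surjective_iff:
  assumes "x \<in> Ob C" "y \<in> Ob C"
  shows "surjective C x y f \<longleftrightarrow> sur (Ar x f y)"
proof (cases "f \<in> Hom C x y")
  case True
  let ?f = "(Ar x f y)"
  have f: "arr ?f" using assms True by (simp add: arr_def del: arr_dm arr_cd)
  show ?thesis
  proof
    assume s: "surjective C x y f"
    show "sur ?f"
    proof (rule surI)
      fix m g assume m: "mon m" "arr g" "cd g = dm m" "?f = m \<cdot> g"
      have cm: "cd m = y" and dg: "dm g = x" using m(4) by (metis cd_cmp arrow.sel, metis dm_cmp arrow.sel)
      have "factors C (dm ?f) (cd m) (mr ?f) (cls m)"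
        by (subst factors_cls[OF m(1) f]) (use cm dg m(2-4) in \<open>auto intro!: exI[of _ g]\<close>)
      then have "factors C x y f (cls m)" using cm by simp
      moreover have "cls m \<in> subobjects C y" using m cm by simp
      ultimately have "sub_le C y (whole C y) (cls m)"
        using s m cm unfolding surjective_def is_image_def by auto
      then have "cls m = whole C (cd m)"
        using sub_le_antisym[OF assms(2)] sub_le_whole whole_in_subobjects m cm assms by auto
      then show "iso m" using cls_eq_whole_iff m by simp
    qed (rule f)
  next
    assume s: "sur ?f"
    have "is_image C (dm ?f) (cd (ide y)) (mr (ide y \<cdot> ?f)) (cls (ide y))"
    proof (rule is_image_cls)
      fix n g assume n: "mon n" "arr g" "cd g = dm n" "cd n = cd (ide y)" "ide y \<cdot> ?f = n \<cdot> g"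
      then have "iso n" using f by (intro surD[OF s, of n g]) auto
      then show "\<exists>k. arr k \<and> dm k = dm (ide y) \<and> cd k = dm n \<and> n \<cdot> k = ide y"
        using n by (metis cd_ide dm_ide isoE)
    qed (use f assms in auto)
    then show "surjective C x y f" using f True unfolding surjective_def by (simp add: whole_cls)
  qed
next
  case False
  then show ?thesis by (metis arr_triple sur_arr surjective_def)
qed

end

section \<open>Finite limits\<close>

context category
begin

text \<open>The companion of \<open>cmp_left_eq\<close> for commuting squares: both sides come out
  nested to the right.\<close>

lemma cmp_square:
  assumes "f \<cdot> a = g \<cdot> b" "arr f" "arr a" "arr g" "arr b" "cd a = dm f" "cd b = dm g" "arr h" "cd h = dm a"
  shows "f \<cdot> (a \<cdot> h) = g \<cdot> (b \<cdot> h)"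
proof -
  have "dm a = dm b" using assms(1) by (metis dm_cmp)
  then show ?thesis using assms cmp_assoc[of h a f] cmp_assoc[of h b g] by simp
qed

text \<open>Existence and uniqueness of the mediating arrow are separate clauses, so that each can
  be applied without taking an \<open>\<exists>!\<close> apart.\<close>

definition pb :: "('o, 'm) arrow \<Rightarrow> ('o, 'm) arrow \<Rightarrow> ('o, 'm) arrow \<Rightarrow> ('o, 'm) arrow \<Rightarrow> bool" where
  "pb f g a b \<longleftrightarrow> arr f \<and> arr g \<and> arr a \<and> arr b \<and> cd f = cd g \<and> dm a = dm b \<and> cd a = dm f \<and> cd b = dm g \<and>
     f \<cdot> a = g \<cdot> b \<and>
     (\<forall>k l. arr k \<and> arr l \<and> dm k = dm l \<and> cd k = dm f \<and> cd l = dm g \<and> f \<cdot> k = g \<cdot> l \<longrightarrow>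
        (\<exists>h. arr h \<and> dm h = dm k \<and> cd h = dm a \<and> a \<cdot> h = k \<and> b \<cdot> h = l)) \<and>
     (\<forall>h h'. arr h \<and> arr h' \<and> dm h = dm h' \<and> cd h = dm a \<and> cd h' = dm a \<and> a \<cdot> h = a \<cdot> h' \<and> b \<cdot> h = b \<cdot> h' \<longrightarrow> h = h')"

lemma pbI:
  assumes "arr f" "arr g" "arr a" "arr b" "cd f = cd g" "dm a = dm b" "cd a = dm f" "cd b = dm g" "f \<cdot> a = g \<cdot> b"
    and "\<And>k l. \<lbrakk>arr k; arr l; dm k = dm l; cd k = dm f; cd l = dm g; f \<cdot> k = g \<cdot> l\<rbrakk> \<Longrightarrow>
        \<exists>h. arr h \<and> dm h = dm k \<and> cd h = dm a \<and> a \<cdot> h = k \<and> b \<cdot> h = l"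
    and "\<And>h h'. \<lbrakk>arr h; arr h'; dm h = dm h'; cd h = dm a; cd h' = dm a; a \<cdot> h = a \<cdot> h'; b \<cdot> h = b \<cdot> h'\<rbrakk> \<Longrightarrow> h = h'"
  shows "pb f g a b"
  unfolding pb_def using assms by blast

lemma pbD:
  assumes "pb f g a b"
  shows "arr f" "arr g" "arr a" "arr b" "cd f = cd g" "dm a = dm b" "cd a = dm f" "cd b = dm g" "f \<cdot> a = g \<cdot> b"
  using assms unfolding pb_def by blast+

lemma pb_lift:
  assumes "pb f g a b" "f \<cdot> k = g \<cdot> l" "arr k" "arr l" "cd k = dm f" "cd l = dm g"
  obtains h where "arr h" "dm h = dm k" "cd h = dm a" "a \<cdot> h = k" "b \<cdot> h = l"
proof -
  have "dm k = dm l" using assms(2) by (metis dm_cmp)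
  then show ?thesis using assms that unfolding pb_def by blast
qed

lemma pb_eq:
  assumes "pb f g a b" "a \<cdot> h = a \<cdot> h'" "b \<cdot> h = b \<cdot> h'" "arr h" "arr h'" "cd h = dm a" "cd h' = dm a"
  shows "h = h'"
proof -
  have "dm h = dm h'" using assms(2) by (metis dm_cmp)
  then show ?thesis using assms unfolding pb_def by blast
qed

lemma pb_sym: assumes "pb f g a b" shows "pb g f b a"
proof (rule pbI)
  fix k l assume a: "arr k" "arr l" "dm k = dm l" "cd k = dm g" "cd l = dm f" "g \<cdot> k = f \<cdot> l"
  obtain h where "arr h" "dm h = dm l" "cd h = dm a" "a \<cdot> h = l" "b \<cdot> h = k"
    by (rule pb_lift[OF assms, of l k]) (use a in auto)
  then show "\<exists>h. arr h \<and> dm h = dm k \<and> cd h = dm b \<and> b \<cdot> h = k \<and> a \<cdot> h = l"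
    using a pbD[OF assms] by auto
next
  fix h h' assume "arr h" "arr h'" "dm h = dm h'" "cd h = dm b" "cd h' = dm b" "b \<cdot> h = b \<cdot> h'" "a \<cdot> h = a \<cdot> h'"
  then show "h = h'" using pb_eq[OF assms] pbD[OF assms] by auto
qed (use pbD[OF assms] in auto)

lemma is_pullback_iff:
  assumes "x \<in> Ob C" "y \<in> Ob C" "z \<in> Ob C" "f \<in> Hom C x z" "g \<in> Hom C y z"
  shows "is_pullback C x y z f g p a b \<longleftrightarrow> pb (Ar x f z) (Ar y g z) (Ar p a x) (Ar p b y)"
proof
  assume P: "is_pullback C x y z f g p a b"
  show "pb (Ar x f z) (Ar y g z) (Ar p a x) (Ar p b y)"
  proof (rule pbI)
    fix k l assume a: "arr k" "arr l" "dm k = dm l" "cd k = dm (Ar x f z)" "cd l = dm (Ar y g z)" "Ar x f z \<cdot> k = Ar y g z \<cdot> l"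
    have kl: "mr k \<in> Hom C (dm k) x" "mr l \<in> Hom C (dm k) y" "dm k \<in> Ob C"
      using a(1-5) unfolding arr_def by (simp_all del: arr_dm arr_cd)
    have "Comp C (dm k) x z f (mr k) = Comp C (dm k) y z g (mr l)"
      using arg_cong[OF a(6), of mr] a(3-5) by (simp add: mr_cmp)
    then obtain h where h: "h \<in> Hom C (dm k) p" "Comp C (dm k) p x a h = mr k" "Comp C (dm k) p y b h = mr l"
      using P kl unfolding is_pullback_def by blast
    have "arr (Ar (dm k) h p)" using h kl P by (simp add: arr_triple is_pullback_def)
    moreover have "Ar p a x \<cdot> Ar (dm k) h p = k" "Ar p b y \<cdot> Ar (dm k) h p = l"
      using h a(3-5) by (auto intro!: arrow_eqI simp: mr_cmp)
    ultimately show "\<exists>h. arr h \<and> dm h = dm k \<and> cd h = dm (Ar p a x) \<and> Ar p a x \<cdot> h = k \<and> Ar p b y \<cdot> h = l"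
      by (intro exI[of _ "Ar (dm k) h p"]) simp
  next
    fix h h' assume a: "arr h" "arr h'" "dm h = dm h'" "cd h = dm (Ar p a x)" "cd h' = dm (Ar p a x)"
      "Ar p a x \<cdot> h = Ar p a x \<cdot> h'" "Ar p b y \<cdot> h = Ar p b y \<cdot> h'"
    have ob: "dm h \<in> Ob C" "mr h \<in> Hom C (dm h) p" "mr h' \<in> Hom C (dm h) p"
      using a(1-5) unfolding arr_def by (simp_all del: arr_dm arr_cd)
    have e: "Comp C (dm h) p x a (mr h') = Comp C (dm h) p x a (mr h)" "Comp C (dm h) p y b (mr h') = Comp C (dm h) p y b (mr h)"
      using arg_cong[OF a(6), of mr] arg_cong[OF a(7), of mr] a(3-5) by (simp_all add: mr_cmp)
    have pab: "p \<in> Ob C" "a \<in> Hom C p x" "b \<in> Hom C p y" "Comp C p x z f a = Comp C p y z g b"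
      using P unfolding is_pullback_def by auto
    let ?k = "Comp C (dm h) p x a (mr h)" and ?l = "Comp C (dm h) p y b (mr h)"
    have 1: "?k \<in> Hom C (dm h) x" "?l \<in> Hom C (dm h) y" using pab ob assms by (auto intro: Comp_in_Hom)
    have 2: "Comp C (dm h) x z f ?k = Comp C (dm h) y z g ?l"
      using pab ob assms Comp_assoc[of "dm h" p x z "mr h" a f] Comp_assoc[of "dm h" p y z "mr h" b g] by simp
    have "\<exists>!j. j \<in> Hom C (dm h) p \<and> Comp C (dm h) p x a j = ?k \<and> Comp C (dm h) p y b j = ?l"
      using P 1 2 ob unfolding is_pullback_def by blast
    then have "mr h = mr h'" using ob e by (elim ex1E) metis
    then show "h = h'" using a by (intro arrow_eqI) simp_all
  qed (use assms P in \<open>auto simp: arr_triple is_pullback_def cmp_def\<close>)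
next
  assume P: "pb (Ar x f z) (Ar y g z) (Ar p a x) (Ar p b y)"
  note D = pbD[OF P]
  show "is_pullback C x y z f g p a b"
    unfolding is_pullback_def
  proof (intro conjI ballI impI)
    show "p \<in> Ob C" "a \<in> Hom C p x" "b \<in> Hom C p y" using D by (simp_all add: arr_triple)
    show "Comp C p x z f a = Comp C p y z g b" using D(9) by (simp add: cmp_def)
    fix t k l assume a: "t \<in> Ob C" "k \<in> Hom C t x" "l \<in> Hom C t y" "Comp C t x z f k = Comp C t y z g l"
    obtain h where h: "arr h" "dm h = t" "cd h = p" "Ar p a x \<cdot> h = Ar t k x" "Ar p b y \<cdot> h = Ar t l y"
      by (rule pb_lift[OF P, of "Ar t k x" "Ar t l y"]) (use a assms in \<open>auto simp: arr_triple cmp_def\<close>)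
    show "\<exists>!h. h \<in> Hom C t p \<and> Comp C t p x a h = k \<and> Comp C t p y b h = l"
    proof (rule ex1I[of _ "mr h"])
      show "mr h \<in> Hom C t p \<and> Comp C t p x a (mr h) = k \<and> Comp C t p y b (mr h) = l"
        using h by (simp add: arr_def cmp_def del: arr_dm arr_cd)
      fix j assume j: "j \<in> Hom C t p \<and> Comp C t p x a j = k \<and> Comp C t p y b j = l"
      have "Ar t j p = h"
        by (rule pb_eq[OF P]) (use j h a D in \<open>auto simp: arr_triple cmp_def\<close>)
      then show "j = mr h" by auto
    qed
  qed
qed

lemma mon_pb: assumes "mon g" "pb f g a b" shows "mon a"
proof (rule monI)
  note D = pbD[OF assms(2)]
  show "arr a" using D by simp
  fix h h' assume a: "arr h" "arr h'" "dm h = dm h'" "cd h = dm a" "cd h' = dm a" "a \<cdot> h = a \<cdot> h'"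
  have "g \<cdot> (b \<cdot> h) = f \<cdot> (a \<cdot> h)" by (rule cmp_square[OF D(9)[symmetric]]) (use D a(1-5) in auto)
  also have "\<dots> = g \<cdot> (b \<cdot> h')" unfolding a(6) by (rule cmp_square[OF D(9)]) (use D a(1-5) in auto)
  finally have "b \<cdot> h = b \<cdot> h'" using a(1-5) D assms by - (rule monD[OF assms(1)], auto)
  then show "h = h'" using a by - (rule pb_eq[OF assms(2)], auto)
qed

lemma pb_unique_iso:
  assumes "pb f g a b" "pb f g a' b'"
  obtains h where "iso h" "dm h = dm a'" "cd h = dm a" "a \<cdot> h = a'" "b \<cdot> h = b'"
proof -
  note D = pbD[OF assms(1)] and D' = pbD[OF assms(2)]
  obtain h where h: "arr h" "dm h = dm a'" "cd h = dm a" "a \<cdot> h = a'" "b \<cdot> h = b'"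
    by (rule pb_lift[OF assms(1), of a' b']) (use D' in auto)
  obtain k where k: "arr k" "dm k = dm a" "cd k = dm a'" "a' \<cdot> k = a" "b' \<cdot> k = b"
    by (rule pb_lift[OF assms(2), of a b]) (use D in auto)
  have 1: "h \<cdot> k = ide (dm a)"
    by (rule pb_eq[OF assms(1)]) (use h k D D' in \<open>auto simp: cmp_left_eq\<close>)
  have 2: "k \<cdot> h = ide (dm a')"
    by (rule pb_eq[OF assms(2)]) (use h k D D' in \<open>auto simp: cmp_left_eq\<close>)
  have "iso h" using h k 1 2 by (intro isoI[of h k]) auto
  then show ?thesis using h that by blast
qed

text \<open>The pasting law: the second square is glued to the first along the leg \<open>s\<close>.
  Associativity of the composition of spans comes down to it.\<close>

lemma pb_paste:
  assumes P: "pb d e s t" and Q: "pb v s k l" and "arr v" "cd v = dm d"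
  shows "pb (d \<cdot> v) e k (t \<cdot> l)"
proof (rule pbI)
  note D = pbD[OF P] pbD[OF Q]
  show "(d \<cdot> v) \<cdot> k = e \<cdot> (t \<cdot> l)"
  proof -
    have "(d \<cdot> v) \<cdot> k = d \<cdot> (s \<cdot> l)" using D assms by simp
    also have "\<dots> = e \<cdot> (t \<cdot> l)" by (rule cmp_square[OF D(9)]) (use D in auto)
    finally show ?thesis .
  qed
  fix m n assume a: "arr m" "arr n" "dm m = dm n" "cd m = dm (d \<cdot> v)" "cd n = dm e" "(d \<cdot> v) \<cdot> m = e \<cdot> n"
  obtain h where h: "arr h" "dm h = dm m" "cd h = dm s" "s \<cdot> h = v \<cdot> m" "t \<cdot> h = n"
    by (rule pb_lift[OF P, of "v \<cdot> m" n]) (use a D assms in auto)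
  obtain j where j: "arr j" "dm j = dm m" "cd j = dm k" "k \<cdot> j = m" "l \<cdot> j = h"
    by (rule pb_lift[OF Q, of m h]) (use a h D assms in auto)
  show "\<exists>h. arr h \<and> dm h = dm m \<and> cd h = dm k \<and> k \<cdot> h = m \<and> (t \<cdot> l) \<cdot> h = n"
    using j h D by (intro exI[of _ j]) auto
next
  note D = pbD[OF P] pbD[OF Q]
  fix h h' assume a: "arr h" "arr h'" "dm h = dm h'" "cd h = dm k" "cd h' = dm k" "k \<cdot> h = k \<cdot> h'" "(t \<cdot> l) \<cdot> h = (t \<cdot> l) \<cdot> h'"
  have "l \<cdot> h = l \<cdot> h'"
  proof (rule pb_eq[OF P])
    show "t \<cdot> (l \<cdot> h) = t \<cdot> (l \<cdot> h')" using a D by simp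
    have "s \<cdot> (l \<cdot> h) = v \<cdot> (k \<cdot> h)" by (rule cmp_square[OF D(18)[symmetric]]) (use a(1-5) D in auto)
    also have "\<dots> = s \<cdot> (l \<cdot> h')" unfolding a(6) by (rule cmp_square[OF D(18)]) (use a(1-5) D in auto)
    finally show "s \<cdot> (l \<cdot> h) = s \<cdot> (l \<cdot> h')" .
  qed (use a D in auto)
  then show "h = h'" using a by - (rule pb_eq[OF Q], auto)
qed (use pbD[OF P] pbD[OF Q] assms in auto)

lemma pb_ide_right: "arr f \<Longrightarrow> z = cd f \<Longrightarrow> x = dm f \<Longrightarrow> pb f (ide z) (ide x) f"
  by (rule pbI) auto

end

locale lex_category = category C for C :: "('o, 'm) cat" +
  assumes complete: "finitely_complete C"
begin

lemma terminal_ex: "\<exists>t. terminal C t"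
proof -
  define J :: "(nat, nat) cat" where "J = \<lparr>Ob = {}, Hom = (\<lambda>_ _. {}), Comp = (\<lambda>_ _ _ _ _. 0), Idn = (\<lambda>_. 0)\<rparr>"
  have "category J" by unfold_locales (auto simp: J_def)
  moreover have "is_functor J C (\<lambda>_. undefined) (\<lambda>_ _ _. undefined)" "finite (Ob J)"
    by (auto simp: J_def is_functor_def)
  moreover have "\<forall>i \<in> Ob J. \<forall>j \<in> Ob J. finite (Hom J i j)" by (simp add: J_def)
  ultimately obtain v c where "is_limit J C (\<lambda>_. undefined) (\<lambda>_ _ _. undefined) v c"
    using complete unfolding finitely_complete_def by blast
  then have "terminal C v" by (auto simp: is_limit_def is_cone_def J_def terminal_def)
  then show ?thesis ..
qed

lemma pullback_ex:
  assumes "arr f" "arr g" "cd f = cd g"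
  obtains a b where "pb f g a b"
proof -
  \<comment> \<open>The shape is the cospan \<open>0 \<rightarrow> 2 \<leftarrow> 1\<close>. Every
    hom-set has at most one element, so the names of arrows carry no information and all composites
    can be named \<open>0\<close>.\<close>
  define J :: "(nat, nat) cat" where "J = \<lparr>Ob = {0,1,2}, Hom = (\<lambda>i j. if i = j \<or> j = 2 then {0} else {}), Comp = (\<lambda>_ _ _ _ _. 0), Idn = (\<lambda>_. 0)\<rparr>"
  define F where "F = (\<lambda>i::nat. if i = 0 then dm f else if i = 1 then dm g else cd f)"
  define Fa where "Fa = (\<lambda>(i::nat) (j::nat) (a::nat). if i = j then Idn C (F i) else if i = 0 then mr f else mr g)"
  have J: "category J" by unfold_locales (auto simp: J_def split: if_splits)
  have O: "dm f \<in> Ob C" "dm g \<in> Ob C" "cd f \<in> Ob C" "mr f \<in> Hom C (dm f) (cd f)" "mr g \<in> Hom C (dm g) (cd f)"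
    using assms unfolding arr_def by auto
  have OJ: "Ob J = {0,1,2}" by (simp add: J_def)
  have F: "is_functor J C F Fa"
    unfolding is_functor_def OJ using O
    by (auto simp: F_def Fa_def J_def Idn_in_Hom Comp_Idn_left Comp_Idn_right split: if_splits)
  have cone: "is_cone J C F Fa w d \<longleftrightarrow> w \<in> Ob C \<and> d 0 \<in> Hom C w (dm f) \<and> d 1 \<in> Hom C w (dm g) \<and>
      d 2 = Comp C w (dm f) (cd f) (mr f) (d 0) \<and> d 2 = Comp C w (dm g) (cd f) (mr g) (d 1)" for w d
    unfolding is_cone_def OJ using O
    by (auto simp: F_def Fa_def J_def Comp_Idn_left Comp_in_Hom split: if_splits)
  have "finite (Ob J) \<and> (\<forall>i \<in> Ob J. \<forall>j \<in> Ob J. finite (Hom J i j))" by (auto simp: J_def)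
  then obtain v c where lim: "is_limit J C F Fa v c"
    using complete J F unfolding finitely_complete_def by blast
  then have c: "v \<in> Ob C" "c 0 \<in> Hom C v (dm f)" "c 1 \<in> Hom C v (dm g)"
      "c 2 = Comp C v (dm f) (cd f) (mr f) (c 0)" "c 2 = Comp C v (dm g) (cd f) (mr g) (c 1)"
    unfolding is_limit_def cone by auto
  have "is_pullback C (dm f) (dm g) (cd f) (mr f) (mr g) v (c 0) (c 1)"
    unfolding is_pullback_def
  proof (intro conjI ballI impI)
    fix t k l assume a: "t \<in> Ob C" "k \<in> Hom C t (dm f)" "l \<in> Hom C t (dm g)"
      "Comp C t (dm f) (cd f) (mr f) k = Comp C t (dm g) (cd f) (mr g) l"
    define d where "d = (\<lambda>i::nat. if i = 0 then k else if i = 1 then l else Comp C t (dm f) (cd f) (mr f) k)"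
    have "is_cone J C F Fa t d" unfolding cone using a by (simp add: d_def)
    then have ex: "\<exists>!h. h \<in> Hom C t v \<and> (\<forall>i \<in> Ob J. Comp C t v (F i) (c i) h = d i)"
      using lim unfolding is_limit_def by blast
    have eq: "h \<in> Hom C t v \<and> (\<forall>i \<in> Ob J. Comp C t v (F i) (c i) h = d i) \<longleftrightarrow>
        h \<in> Hom C t v \<and> Comp C t v (dm f) (c 0) h = k \<and> Comp C t v (dm g) (c 1) h = l" for h
      unfolding OJ using c(1-3) O a by (auto simp: F_def d_def c(4) Comp_assoc)
    show "\<exists>!h. h \<in> Hom C t v \<and> Comp C t v (dm f) (c 0) h = k \<and> Comp C t v (dm g) (c 1) h = l"
      using ex unfolding eq .
  qed (use c in auto)
  then have "pb (Ar (dm f) (mr f) (cd f)) (Ar (dm g) (mr g) (cd f)) (Ar v (c 0) (dm f)) (Ar v (c 1) (dm g))"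
    by (subst (asm) is_pullback_iff) (use O in auto)
  then show ?thesis using that assms by (metis arrow.collapse)
qed

text \<open>A product is a pullback over the terminal object, where every square commutes.\<close>

lemma product_ex:
  assumes "x \<in> Ob C" "y \<in> Ob C"
  shows "\<exists>p a b. is_product C x y p a b"
proof -
  obtain t where t: "terminal C t" using terminal_ex by blast
  obtain f g where fg: "f \<in> Hom C x t" "g \<in> Hom C y t" and tO: "t \<in> Ob C" using t assms unfolding terminal_def by blast
  have tu: "h = h'" if "w \<in> Ob C" "h \<in> Hom C w t" "h' \<in> Hom C w t" for w h h'
    using t that unfolding terminal_def by blast
  obtain a b where ab: "pb (Ar x f t) (Ar y g t) a b"
    by (rule pullback_ex[of "Ar x f t" "Ar y g t"]) (use fg tO assms in \<open>auto simp: arr_triple\<close>)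
  have e: "a = Ar (dm a) (mr a) x" "b = Ar (dm a) (mr b) y"
    using pbD[OF ab] by (auto intro: arrow_eqI)
  have P: "is_pullback C x y t f g (dm a) (mr a) (mr b)"
    using ab e is_pullback_iff[OF assms tO fg, of "dm a" "mr a" "mr b"] by simp
  have "Comp C s x t f k = Comp C s y t g l" if "s \<in> Ob C" "k \<in> Hom C s x" "l \<in> Hom C s y" for s k l
    using that fg tO assms by (intro tu[of s]) (auto intro: Comp_in_Hom)
  then have "is_product C x y (dm a) (mr a) (mr b)"
    using P unfolding is_pullback_def is_product_def by blast
  then show ?thesis by blast
qed

section \<open>Binary products\<close>

definition p1 :: "'o \<Rightarrow> 'o \<Rightarrow> ('o, 'm) arrow" where "p1 x y = Ar (prd C x y) (proj1 C x y) x"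
definition p2 :: "'o \<Rightarrow> 'o \<Rightarrow> ('o, 'm) arrow" where "p2 x y = Ar (prd C x y) (proj2 C x y) y"

definition pr :: "('o, 'm) arrow \<Rightarrow> ('o, 'm) arrow \<Rightarrow> ('o, 'm) arrow" where
  "pr f g = Ar (dm f) (pair C (dm f) (cd f) (cd g) (mr f) (mr g)) (prd C (cd f) (cd g))"

lemma is_product_prd: "x \<in> Ob C \<Longrightarrow> y \<in> Ob C \<Longrightarrow> is_product C x y (prd C x y) (proj1 C x y) (proj2 C x y)"
proof -
  assume "x \<in> Ob C" "y \<in> Ob C"
  then have "\<exists>t. case t of (p, a, b) \<Rightarrow> is_product C x y p a b" using product_ex by auto
  then have "case product C x y of (p, a, b) \<Rightarrow> is_product C x y p a b"
    unfolding product_def by (rule someI_ex)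
  then show ?thesis by (simp add: prd_def proj1_def proj2_def split: prod.splits)
qed

lemma dm_p1 [simp]: "dm (p1 x y) = prd C x y" by (simp add: p1_def)
lemma cd_p1 [simp]: "cd (p1 x y) = x" by (simp add: p1_def)
lemma dm_p2 [simp]: "dm (p2 x y) = prd C x y" by (simp add: p2_def)
lemma cd_p2 [simp]: "cd (p2 x y) = y" by (simp add: p2_def)
lemma dm_pr [simp]: "dm (pr f g) = dm f" by (simp add: pr_def)
lemma cd_pr [simp]: "cd (pr f g) = prd C (cd f) (cd g)" by (simp add: pr_def)

lemma prd_Ob [simp]: "x \<in> Ob C \<Longrightarrow> y \<in> Ob C \<Longrightarrow> prd C x y \<in> Ob C"
  using is_product_prd unfolding is_product_def by blast

lemma arr_p1 [simp]: "x \<in> Ob C \<Longrightarrow> y \<in> Ob C \<Longrightarrow> arr (p1 x y)"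
  using is_product_prd[of x y] unfolding is_product_def by (simp add: p1_def arr_triple)

lemma arr_p2 [simp]: "x \<in> Ob C \<Longrightarrow> y \<in> Ob C \<Longrightarrow> arr (p2 x y)"
  using is_product_prd[of x y] unfolding is_product_def by (simp add: p2_def arr_triple)

lemma pr_ex1:
  assumes "arr f" "arr g" "dm f = dm g"
  shows "\<exists>!h. h \<in> Hom C (dm f) (prd C (cd f) (cd g)) \<and>
     Comp C (dm f) (prd C (cd f) (cd g)) (cd f) (proj1 C (cd f) (cd g)) h = mr f \<and>
     Comp C (dm f) (prd C (cd f) (cd g)) (cd g) (proj2 C (cd f) (cd g)) h = mr g"
proof -
  have "dm f \<in> Ob C" "mr f \<in> Hom C (dm f) (cd f)" "mr g \<in> Hom C (dm f) (cd g)"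
    using assms unfolding arr_def by auto
  then show ?thesis using is_product_prd[of "cd f" "cd g"] assms unfolding is_product_def by simp
qed

lemma pr_props:
  assumes "arr f" "arr g" "dm f = dm g"
  shows "arr (pr f g)" "p1 (cd f) (cd g) \<cdot> pr f g = f" "p2 (cd f) (cd g) \<cdot> pr f g = g"
proof -
  note T = theI'[OF pr_ex1[OF assms], folded pair_def]
  show "arr (pr f g)" using T assms by (simp add: pr_def arr_triple)
  show "p1 (cd f) (cd g) \<cdot> pr f g = f" "p2 (cd f) (cd g) \<cdot> pr f g = g"
    using T assms by (auto intro!: arrow_eqI simp: mr_cmp p1_def p2_def pr_def)
qed

lemma arr_pr [simp]: "arr f \<Longrightarrow> arr g \<Longrightarrow> dm f = dm g \<Longrightarrow> arr (pr f g)"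
  by (rule pr_props)

lemma p1_pr [simp]: "arr f \<Longrightarrow> arr g \<Longrightarrow> dm f = dm g \<Longrightarrow> cd f = x \<Longrightarrow> cd g = y \<Longrightarrow> p1 x y \<cdot> pr f g = f"
  using pr_props by blast

lemma p2_pr [simp]: "arr f \<Longrightarrow> arr g \<Longrightarrow> dm f = dm g \<Longrightarrow> cd f = x \<Longrightarrow> cd g = y \<Longrightarrow> p2 x y \<cdot> pr f g = g"
  using pr_props by blast

lemma prd_eqI:
  assumes "p1 x y \<cdot> h = p1 x y \<cdot> h'" "p2 x y \<cdot> h = p2 x y \<cdot> h'" "arr h" "arr h'" "cd h = prd C x y" "cd h' = prd C x y"
    "x \<in> Ob C" "y \<in> Ob C"
  shows "h = h'"
proof -
  have d: "dm h = dm h'" using assms(1) by (metis dm_cmp)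
  let ?f = "p1 x y \<cdot> h" and ?g = "p2 x y \<cdot> h"
  have fg: "arr ?f" "arr ?g" "dm ?f = dm ?g" using assms by auto
  have m: "mr h \<in> Hom C (dm h) (prd C x y)" "mr h' \<in> Hom C (dm h) (prd C x y)"
    using assms(3-6) d unfolding arr_def by auto
  have "Comp C (dm h) (prd C x y) x (proj1 C x y) (mr h) = mr ?f" "Comp C (dm h) (prd C x y) y (proj2 C x y) (mr h) = mr ?g"
    using assms(5) by (simp_all add: mr_cmp p1_def p2_def)
  moreover have "Comp C (dm h) (prd C x y) x (proj1 C x y) (mr h') = mr ?f" "Comp C (dm h) (prd C x y) y (proj2 C x y) (mr h') = mr ?g"
    unfolding assms(1,2) using assms(6) d by (simp_all add: mr_cmp p1_def p2_def)
  ultimately have "mr h = mr h'" using pr_ex1[OF fg] m by auto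
  then show ?thesis using d assms by (intro arrow_eqI) auto
qed

lemma pr_cmp:
  assumes "arr f" "arr g" "dm f = dm g" "arr h" "cd h = dm f"
  shows "pr f g \<cdot> h = pr (f \<cdot> h) (g \<cdot> h)"
proof (rule prd_eqI[of "cd f" "cd g"])
  have "p1 (cd f) (cd g) \<cdot> (pr f g \<cdot> h) = f \<cdot> h" using assms by (subst cmp_left_eq[OF p1_pr]) auto
  then show "p1 (cd f) (cd g) \<cdot> (pr f g \<cdot> h) = p1 (cd f) (cd g) \<cdot> pr (f \<cdot> h) (g \<cdot> h)" using assms by simp
  have "p2 (cd f) (cd g) \<cdot> (pr f g \<cdot> h) = g \<cdot> h" using assms by (subst cmp_left_eq[OF p2_pr]) auto
  then show "p2 (cd f) (cd g) \<cdot> (pr f g \<cdot> h) = p2 (cd f) (cd g) \<cdot> pr (f \<cdot> h) (g \<cdot> h)" using assms by simp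
qed (use assms in auto)

lemma pr_proj: "arr m \<Longrightarrow> cd m = prd C x y \<Longrightarrow> x \<in> Ob C \<Longrightarrow> y \<in> Ob C \<Longrightarrow> pr (p1 x y \<cdot> m) (p2 x y \<cdot> m) = m"
  by (rule prd_eqI[of x y]) auto

lemma pr_eqD:
  assumes "pr f g = pr f' g'" "arr f" "arr g" "dm f = dm g" "arr f'" "arr g'" "dm f' = dm g'" "cd f = cd f'" "cd g = cd g'"
  shows "f = f'" "g = g'"
  using assms p1_pr[of f g] p1_pr[of f' g'] p2_pr[of f g] p2_pr[of f' g'] by metis+

lemma mon_prI:
  assumes "arr f" "arr g" "dm f = dm g"
    and "\<And>h k. \<lbrakk>arr h; arr k; dm h = dm k; cd h = dm f; cd k = dm f; f \<cdot> h = f \<cdot> k; g \<cdot> h = g \<cdot> k\<rbrakk> \<Longrightarrow> h = k"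
  shows "mon (pr f g)"
proof (rule monI)
  fix h k assume a: "arr h" "arr k" "dm h = dm k" "cd h = dm (pr f g)" "cd k = dm (pr f g)" "pr f g \<cdot> h = pr f g \<cdot> k"
  then have "pr (f \<cdot> h) (g \<cdot> h) = pr (f \<cdot> k) (g \<cdot> k)" using assms by (simp add: pr_cmp)
  then have "f \<cdot> h = f \<cdot> k" "g \<cdot> h = g \<cdot> k" by (rule pr_eqD; use a(1-5) assms in simp)+
  then show "h = k" using a assms by auto
qed (use assms in auto)

lemma mon_prD:
  assumes "mon (pr f g)" "arr f" "arr g" "dm f = dm g" "f \<cdot> h = f \<cdot> k" "g \<cdot> h = g \<cdot> k" "arr h" "arr k" "cd h = dm f" "cd k = dm f"
  shows "h = k"
  by (rule monD[OF assms(1)]) (use assms in \<open>auto simp: pr_cmp\<close>)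

section \<open>Equalizers\<close>

definition eqz :: "('o, 'm) arrow \<Rightarrow> ('o, 'm) arrow \<Rightarrow> ('o, 'm) arrow \<Rightarrow> bool" where
  "eqz a b j \<longleftrightarrow> mon j \<and> arr a \<and> arr b \<and> dm a = dm b \<and> cd a = cd b \<and> cd j = dm a \<and> a \<cdot> j = b \<cdot> j \<and>
     (\<forall>k. arr k \<and> cd k = dm a \<and> a \<cdot> k = b \<cdot> k \<longrightarrow> (\<exists>h. arr h \<and> dm h = dm k \<and> cd h = dm j \<and> j \<cdot> h = k))"

lemma eqzD:
  assumes "eqz a b j"
  shows "mon j" "arr a" "arr b" "dm a = dm b" "cd a = cd b" "cd j = dm a" "a \<cdot> j = b \<cdot> j"
  using assms unfolding eqz_def by blast+

lemma eqz_lift: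
  assumes "eqz a b j" "a \<cdot> k = b \<cdot> k" "arr k" "cd k = dm a"
  obtains h where "arr h" "dm h = dm k" "cd h = dm j" "j \<cdot> h = k"
proof -
  have "\<exists>h. arr h \<and> dm h = dm k \<and> cd h = dm j \<and> j \<cdot> h = k"
    using assms unfolding eqz_def by blast
  then show ?thesis using that by blast
qed

text \<open>The equalizer is the pullback of the diagonal along \<open>(a, b)\<close>; the other leg
  \<open>v\<close> of the square is the common value of \<open>a\<close> and \<open>b\<close> on
  it.\<close>

lemma equalizer_ex:
  assumes "arr a" "arr b" "dm a = dm b" "cd a = cd b"
  obtains j where "eqz a b j"
proof -
  let ?d = "pr (ide (cd a)) (ide (cd a))"
  have d: "arr ?d" using assms by simp
  have md: "mon ?d" by (rule mon_prI) (use assms in auto)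
  obtain u v where uv: "pb (pr a b) ?d u v"
    by (rule pullback_ex[of "pr a b" ?d]) (use assms d in auto)
  note D = pbD[OF uv]
  have cmpd: "?d \<cdot> h = pr h h" if "arr h" "cd h = cd a" for h
    using that assms by (simp add: pr_cmp)
  have "pr (a \<cdot> u) (b \<cdot> u) = pr v v" using D cmpd[of v] assms by (simp add: pr_cmp)
  then have "a \<cdot> u = v" "b \<cdot> u = v" by (rule pr_eqD; use D assms in simp)+
  then have eq: "a \<cdot> u = b \<cdot> u" by simp
  have "eqz a b u"
    unfolding eqz_def
  proof (intro conjI allI impI)
    show "mon u" using mon_pb[OF md uv] .
    fix k assume k: "arr k \<and> cd k = dm a \<and> a \<cdot> k = b \<cdot> k"
    obtain h where "arr h" "dm h = dm k" "cd h = dm u" "u \<cdot> h = k" "v \<cdot> h = a \<cdot> k"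
      by (rule pb_lift[OF uv, of k "a \<cdot> k"]) (use k assms in \<open>auto simp: cmpd pr_cmp\<close>)
    then show "\<exists>h. arr h \<and> dm h = dm k \<and> cd h = dm u \<and> u \<cdot> h = k" by blast
  qed (use D eq assms in auto)
  then show ?thesis using that by blast
qed

end

section \<open>Regular categories\<close>

locale regular_category = lex_category C for C :: "('o, 'm) cat" +
  assumes regular: "regular_cat C"
begin

text \<open>The corestriction of \<open>f\<close> to its image is extremal: if it factored through
  \<open>n\<close>, then \<open>f\<close> would factor through \<open>m \<cdot> n\<close>, and
  minimality of the image would lift \<open>m\<close> through \<open>m \<cdot> n\<close>, which
  gives a section of \<open>n\<close>.\<close>

lemma factorization:
  assumes "arr f"
  obtains e m where "sur e" "mon m" "cd e = dm m" "m \<cdot> e = f"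
proof -
  have "dm f \<in> Ob C" "cd f \<in> Ob C" "mr f \<in> Hom C (dm f) (cd f)" using assms unfolding arr_def by auto
  then obtain S where S: "is_image C (dm f) (cd f) (mr f) S"
    using regular unfolding regular_cat_def by blast
  define m where "m = rpr (cd f) S"
  have m: "mon m" "cls m = S" "cd m = cd f" using S rpr[of S "cd f"] assms unfolding is_image_def m_def by auto
  then obtain e where e: "arr e" "dm e = dm f" "cd e = dm m" "m \<cdot> e = f"
    using S factors_cls[OF m(1) assms] unfolding is_image_def by auto
  have "sur e"
  proof (rule surI)
    fix n g assume n: "mon n" "arr g" "cd g = dm n" "e = n \<cdot> g"
    have cn: "cd n = dm m" and dg: "dm g = dm f" using n(4) e by auto
    have mn: "mon (m \<cdot> n)" using m n cn by simp
    have "(m \<cdot> n) \<cdot> g = f" using m n cn e by simp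
    then have "factors C (dm f) (cd f) (mr f) (cls (m \<cdot> n))"
      using factors_cls[OF mn assms] n m dg by auto
    then have "sub_le C (cd m) (cls m) (cls (m \<cdot> n))"
      using S mn m unfolding is_image_def by simp
    then obtain k where k: "arr k" "dm k = dm m" "cd k = dm n" "(m \<cdot> n) \<cdot> k = m"
      using sub_le_cls[OF m(1) mn] by auto
    have "m \<cdot> (n \<cdot> k) = m \<cdot> ide (dm m)" using k m n cn by simp
    then have "n \<cdot> k = ide (dm m)" using k m n cn by - (rule monD[of m], auto)
    then show "iso n" using n k cn by (intro mon_split_iso[of n k]) auto
  qed (rule e)
  then show ?thesis using that m e by blast
qed

lemma sur_pb: assumes "pb f g a b" "sur f" shows "sur b"
proof -
  note D = pbD[OF assms(1)]
  let ?x = "dm f" and ?y = "dm g" and ?z = "cd f"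
  have O: "?x \<in> Ob C" "?y \<in> Ob C" "?z \<in> Ob C" "dm b \<in> Ob C" "mr f \<in> Hom C ?x ?z" "mr g \<in> Hom C ?y ?z"
    using D unfolding arr_def by auto
  have e: "Ar ?x (mr f) ?z = f" "Ar ?y (mr g) ?z = g" "Ar (dm b) (mr a) ?x = a" "Ar (dm b) (mr b) ?y = b"
    using D by (auto intro: arrow_eqI)
  have "is_pullback C ?x ?y ?z (mr f) (mr g) (dm b) (mr a) (mr b)"
    using is_pullback_iff[of ?x ?y ?z "mr f" "mr g" "dm b" "mr a" "mr b"] O assms(1) unfolding e by simp
  moreover have "surjective C ?x ?z (mr f)" using surjective_iff[of ?x ?z "mr f"] O assms(2) unfolding e by simp
  ultimately have "surjective C (dm b) ?y (mr b)"
    using regular O unfolding regular_cat_def by blast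
  then show ?thesis using surjective_iff[of "dm b" ?y "mr b"] O unfolding e by simp
qed

lemma sur_pb': "pb f g a b \<Longrightarrow> sur g \<Longrightarrow> sur a"
  using sur_pb pb_sym by blast

text \<open>The pullback of \<open>m\<close> along \<open>g\<close> is a subobject through which
  \<open>e\<close> factors. As \<open>e\<close> is extremal this subobject is everything, and its
  inverse provides the diagonal.\<close>

lemma orth:
  assumes "sur e" "mon m" "m \<cdot> f = g \<cdot> e" "arr f" "arr g" "cd f = dm m" "cd e = dm g"
  obtains d where "arr d" "dm d = cd e" "cd d = dm m" "m \<cdot> d = g" "d \<cdot> e = f"
proof -
  have cg: "cd g = cd m" using assms(3) by (metis cd_cmp)
  have df: "dm f = dm e" using assms(3) by (metis dm_cmp)
  obtain a b where ab: "pb m g a b" by (rule pullback_ex[of m g]) (use assms cg in auto)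
  note D = pbD[OF ab]
  have mb: "mon b" using mon_pb[OF assms(2) pb_sym[OF ab]] .
  obtain h where h: "arr h" "dm h = dm f" "cd h = dm a" "a \<cdot> h = f" "b \<cdot> h = e"
    by (rule pb_lift[OF ab, of f e]) (use assms in auto)
  have "iso b" by (rule surD[OF assms(1), of b h]) (use mb h D in auto)
  then obtain b' where b': "arr b'" "dm b' = cd b" "cd b' = dm b" "b' \<cdot> b = ide (dm b)" "b \<cdot> b' = ide (cd b)" by (rule isoE)
  have "m \<cdot> (a \<cdot> b') = g \<cdot> (b \<cdot> b')" by (rule cmp_square[OF D(9)]) (use D b' in auto)
  then have md: "m \<cdot> (a \<cdot> b') = g" using b' D by simp
  have "m \<cdot> ((a \<cdot> b') \<cdot> e) = m \<cdot> f" unfolding assms(3) using md assms D b'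
    by (subst cmp_left_eq[OF md]) auto
  then have "(a \<cdot> b') \<cdot> e = f" by (rule monD[OF assms(2)]) (use assms D b' in auto)
  then show ?thesis using that[of "a \<cdot> b'"] md D b' assms by auto
qed

lemma sur_cmp [simp]: assumes "sur e" "sur f" "cd e = dm f" shows "sur (f \<cdot> e)"
proof (rule surI)
  fix m g assume a: "mon m" "arr g" "cd g = dm m" "f \<cdot> e = m \<cdot> g"
  obtain d where d: "arr d" "dm d = cd e" "cd d = dm m" "m \<cdot> d = f" "d \<cdot> e = g"
    by (rule orth[OF assms(1) a(1) a(4)[symmetric]]) (use a assms in auto)
  show "iso m" by (rule surD[OF assms(2), of m d]) (use a d in auto)
qed (use assms in auto)

text \<open>The equalizer of \<open>g\<close> and \<open>h\<close> is a mono through which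
  \<open>e\<close> factors, hence invertible.\<close>

lemma sur_epi:
  assumes "sur e" "g \<cdot> e = h \<cdot> e" "arr g" "arr h" "dm g = cd e" "dm h = cd e"
  shows "g = h"
proof -
  have c: "cd g = cd h" using assms(2) by (metis cd_cmp)
  obtain j where j: "eqz g h j" by (rule equalizer_ex[of g h]) (use assms c in auto)
  note J = eqzD[OF j]
  obtain k where k: "arr k" "dm k = dm e" "cd k = dm j" "j \<cdot> k = e"
    by (rule eqz_lift[OF j assms(2)]) (use assms in auto)
  have "iso j" by (rule surD[OF assms(1), of j k]) (use J k in auto)
  then obtain j' where j': "arr j'" "dm j' = cd j" "cd j' = dm j" "j \<cdot> j' = ide (cd j)" by (rule isoE)
  have "g \<cdot> (j \<cdot> j') = h \<cdot> (j \<cdot> j')" by (rule cmp_square[OF J(7)]) (use J j' in auto)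
  then show ?thesis using J j' by simp
qed

text \<open>The substitute for choosing preimages: a generalized element of the target of
  \<open>q\<close> lifts to the source after passing to a cover \<open>b\<close> of its domain. What
  is proved on the cover descends by \<open>sur_epi\<close> or \<open>orth\<close>.\<close>

lemma cover:
  assumes "sur q" "arr h" "cd h = cd q"
  obtains a b where "sur b" "arr a" "cd b = dm h" "dm a = dm b" "cd a = dm q" "q \<cdot> a = h \<cdot> b"
proof -
  obtain a b where ab: "pb q h a b" by (rule pullback_ex[of q h]) (use assms in auto)
  show ?thesis by (rule that[of b a]) (use pbD[OF ab] sur_pb[OF ab assms(1)] in auto)
qed

lemma factorization_unique:
  assumes "sur e" "mon m" "cd e = dm m" "sur e'" "mon m'" "cd e' = dm m'" "m \<cdot> e = m' \<cdot> e'"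
  obtains h where "iso h" "dm h = dm m" "cd h = dm m'" "m' \<cdot> h = m" "h \<cdot> e = e'"
proof -
  obtain d where d: "arr d" "dm d = cd e" "cd d = dm m'" "m' \<cdot> d = m" "d \<cdot> e = e'"
    by (rule orth[OF assms(1,5) assms(7)[symmetric]]) (use assms in auto)
  have "sur d" by (rule sur_cancel[of d e]) (use d assms in auto)
  moreover have "mon d" by (rule mon_cancel[of m' d]) (use d assms in auto)
  ultimately have "iso d" by (rule sur_mon_iso)
  then show ?thesis using that d assms by auto
qed

text \<open>The image of \<open>(e, h)\<close> is the graph of the quotient map.\<close>

lemma sur_coeq:
  assumes e: "sur e" and h: "arr h" "dm h = dm e"
    and ker: "\<And>u v. \<lbrakk>arr u; arr v; dm u = dm v; cd u = dm e; cd v = dm e; e \<cdot> u = e \<cdot> v\<rbrakk> \<Longrightarrow> h \<cdot> u = h \<cdot> v"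
  obtains k where "arr k" "dm k = cd e" "cd k = cd h" "k \<cdot> e = h"
proof -
  let ?p1 = "p1 (cd e) (cd h)" and ?p2 = "p2 (cd e) (cd h)"
  have pr: "arr (pr e h)" using e h by simp
  obtain q m where qm: "sur q" "mon m" "cd q = dm m" "m \<cdot> q = pr e h" by (rule factorization[OF pr])
  have cm: "cd m = prd C (cd e) (cd h)" using arg_cong[OF qm(4), of cd] by simp
  have dq: "dm q = dm e" using arg_cong[OF qm(4), of dm] by simp
  have P: "arr ?p1" "arr ?p2" using e h by auto
  have 1: "(?p1 \<cdot> m) \<cdot> q = e" "(?p2 \<cdot> m) \<cdot> q = h" using qm e h P cm by auto
  have s: "sur (?p1 \<cdot> m)" by (rule sur_cancel[of _ q]) (use 1 e qm P cm in auto)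
  \<comment> \<open>Two points of the image with the same first coordinate lift, on a common cover,
    to points of the source of \<open>e\<close> that \<open>e\<close> identifies. By
    \<open>ker\<close> they have the same image under \<open>h\<close>, so the second coordinates
    agree as well.\<close>
  have "mon (?p1 \<cdot> m)"
  proof (rule monI)
    fix g1 g2 assume g: "arr g1" "arr g2" "dm g1 = dm g2" "cd g1 = dm (?p1 \<cdot> m)" "cd g2 = dm (?p1 \<cdot> m)" "(?p1 \<cdot> m) \<cdot> g1 = (?p1 \<cdot> m) \<cdot> g2"
    obtain a1 b1 where 2: "sur b1" "arr a1" "cd b1 = dm g1" "dm a1 = dm b1" "cd a1 = dm q" "q \<cdot> a1 = g1 \<cdot> b1"
      by (rule cover[OF qm(1), of g1]) (use g qm in auto)
    obtain a2 b2 where 3: "sur b2" "arr a2" "cd b2 = dm (g2 \<cdot> b1)" "dm a2 = dm b2" "cd a2 = dm q" "q \<cdot> a2 = (g2 \<cdot> b1) \<cdot> b2"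
      by (rule cover[OF qm(1), of "g2 \<cdot> b1"]) (use g qm 2 in auto)
    have qu: "q \<cdot> (a1 \<cdot> b2) = g1 \<cdot> (b1 \<cdot> b2)" by (rule cmp_square[OF 2(6)]) (use 2 3 g qm in auto)
    have qv: "q \<cdot> a2 = g2 \<cdot> (b1 \<cdot> b2)" using 2 3 g by simp
    have eu: "e \<cdot> a = (?p1 \<cdot> m) \<cdot> (q \<cdot> a)" "h \<cdot> a = (?p2 \<cdot> m) \<cdot> (q \<cdot> a)" if "arr a" "cd a = dm q" for a
      using that P qm cm cmp_left_eq[OF 1(1), of a] cmp_left_eq[OF 1(2), of a] by auto
    have eu': "e \<cdot> a = ?p1 \<cdot> (m \<cdot> (q \<cdot> a))" "h \<cdot> a = ?p2 \<cdot> (m \<cdot> (q \<cdot> a))" if "arr a" "cd a = dm q" for a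
      using eu[OF that] that P qm cm by auto
    have "e \<cdot> (a1 \<cdot> b2) = (?p1 \<cdot> m) \<cdot> (g1 \<cdot> (b1 \<cdot> b2))" using eu(1)[of "a1 \<cdot> b2"] qu 2 3 by simp
    also have "\<dots> = (?p1 \<cdot> m) \<cdot> (g2 \<cdot> (b1 \<cdot> b2))" by (rule cmp_square[OF g(6)]) (use 2 3 g P qm cm in auto)
    also have "\<dots> = e \<cdot> a2" using eu(1)[of a2] qv 3 by simp
    finally have e12: "e \<cdot> (a1 \<cdot> b2) = e \<cdot> a2" .
    have h12: "h \<cdot> (a1 \<cdot> b2) = h \<cdot> a2" by (rule ker) (use e12 2 3 dq in auto)
    have mq: "m \<cdot> (q \<cdot> (a1 \<cdot> b2)) = m \<cdot> (q \<cdot> a2)"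
    proof (rule prd_eqI[of "cd e" "cd h"])
      show "?p1 \<cdot> m \<cdot> q \<cdot> a1 \<cdot> b2 = ?p1 \<cdot> m \<cdot> q \<cdot> a2" using e12 eu'(1)[of "a1 \<cdot> b2"] eu'(1)[of a2] 2(1-5) 3(1-5) by simp
      show "?p2 \<cdot> m \<cdot> q \<cdot> a1 \<cdot> b2 = ?p2 \<cdot> m \<cdot> q \<cdot> a2" using h12 eu'(2)[of "a1 \<cdot> b2"] eu'(2)[of a2] 2(1-5) 3(1-5) by simp
    qed (use 2(1-5) 3(1-5) qm cm e h in auto)
    have "q \<cdot> (a1 \<cdot> b2) = q \<cdot> a2" by (rule monD[OF qm(2) mq]) (use 2(1-5) 3(1-5) g(1-5) qm cm in auto)
    then have "g1 \<cdot> (b1 \<cdot> b2) = g2 \<cdot> (b1 \<cdot> b2)" using qu qv by simp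
    then show "g1 = g2" by - (rule sur_epi[of "b1 \<cdot> b2"], use 2 3 g in auto)
  qed (use P qm cm in auto)
  then have "iso (?p1 \<cdot> m)" using s sur_mon_iso by blast
  then obtain j where j: "arr j" "dm j = cd (?p1 \<cdot> m)" "cd j = dm (?p1 \<cdot> m)" "j \<cdot> (?p1 \<cdot> m) = ide (dm (?p1 \<cdot> m))"
    by (rule isoE)
  have "j \<cdot> e = q"
  proof -
    have "j \<cdot> e = j \<cdot> ((?p1 \<cdot> m) \<cdot> q)" using 1 by simp
    also have "\<dots> = ide (dm m) \<cdot> q" by (subst cmp_left_eq[OF j(4)]) (use j P qm cm in auto)
    finally show ?thesis using qm by simp
  qed
  then have "((?p2 \<cdot> m) \<cdot> j) \<cdot> e = h" using 1(2) j P qm cm e by simp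
  then show ?thesis using that[of "(?p2 \<cdot> m) \<cdot> j"] j P qm cm by simp
qed

text \<open>A pullback along \<open>b \<cdot> e\<close> covers the pullback along \<open>b\<close>
  by a base change of \<open>e\<close>. So when the leg of a span is refined by a surjection, the
  fibre product is refined by a surjection of the same degree.\<close>

lemma pb_sur_left:
  assumes P: "pb (b \<cdot> e) c u v" and P0: "pb b c u0 v0" and "sur e" "arr b" "cd e = dm b"
  obtains k where "sur k" "pb e u0 u k" "dm k = dm u" "cd k = dm u0" "u0 \<cdot> k = e \<cdot> u" "v0 \<cdot> k = v"
proof -
  note D = pbD[OF P] pbD[OF P0]
  obtain k where k: "arr k" "dm k = dm (e \<cdot> u)" "cd k = dm u0" "u0 \<cdot> k = e \<cdot> u" "v0 \<cdot> k = v"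
    by (rule pb_lift[OF P0, of "e \<cdot> u" v]) (use D assms in auto)
  have "pb e u0 u k"
  proof (rule pbI)
    fix m n assume a: "arr m" "arr n" "dm m = dm n" "cd m = dm e" "cd n = dm u0" "e \<cdot> m = u0 \<cdot> n"
    have "b \<cdot> (u0 \<cdot> n) = c \<cdot> (v0 \<cdot> n)" by (rule cmp_square[OF D(18)]) (use a D in auto)
    then obtain h where h: "arr h" "dm h = dm m" "cd h = dm u" "u \<cdot> h = m" "v \<cdot> h = v0 \<cdot> n"
      by - (rule pb_lift[OF P, of m "v0 \<cdot> n"], use a D assms in auto)
    have "k \<cdot> h = n"
    proof (rule pb_eq[OF P0])
      have "u0 \<cdot> (k \<cdot> h) = e \<cdot> (u \<cdot> h)" by (rule cmp_square[OF k(4)]) (use h k D assms in auto)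
      then show "u0 \<cdot> (k \<cdot> h) = u0 \<cdot> n" using h a by simp
      show "v0 \<cdot> (k \<cdot> h) = v0 \<cdot> n" by (subst cmp_left_eq[OF k(5)]) (use h k D in auto)
    qed (use a h k D in auto)
    then show "\<exists>h. arr h \<and> dm h = dm m \<and> cd h = dm u \<and> u \<cdot> h = m \<and> k \<cdot> h = n" using h by blast
  next
    fix h h' assume a: "arr h" "arr h'" "dm h = dm h'" "cd h = dm u" "cd h' = dm u" "u \<cdot> h = u \<cdot> h'" "k \<cdot> h = k \<cdot> h'"
    have "v0 \<cdot> (k \<cdot> h) = v0 \<cdot> (k \<cdot> h')" using a by simp
    then have "v \<cdot> h = v \<cdot> h'"
      using cmp_left_eq[OF k(5), of h] cmp_left_eq[OF k(5), of h'] a k D by simp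
    then show "h = h'" using a by - (rule pb_eq[OF P], auto)
  qed (use D k assms in auto)
  then show ?thesis using that k sur_pb[OF _ assms(3)] D by auto
qed

end

section \<open>Degree functions and spans\<close>

definition smul :: "'k::field \<Rightarrow> ('a \<Rightarrow> 'k) \<Rightarrow> 'a \<Rightarrow> 'k" (infixr "\<star>" 75) where
  "smul c f = (\<lambda>r. c * f r)"

lemma smul_apply: "(c \<star> f) r = c * f r" by (simp add: smul_def)
lemma smul_one [simp]: "1 \<star> f = f" by (simp add: smul_def)
lemma smul_zero_right [simp]: "c \<star> 0 = 0" by (simp add: smul_def fun_eq_iff)
lemma smul_smul [simp]: "c \<star> d \<star> f = (c * d) \<star> f" by (simp add: smul_def mult.assoc)

lemma sum_apply: "(\<Sum>i\<in>I. f i) r = (\<Sum>i\<in>I. f i r)" for f :: "'i \<Rightarrow> 'a \<Rightarrow> 'b::comm_monoid_add"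
  by (induction I rule: infinite_finite_induct) auto

locale degree_category = regular_category C for C :: "('o, 'm) cat" +
  fixes \<delta> :: "'o \<Rightarrow> 'o \<Rightarrow> 'm \<Rightarrow> 'k::field"
  assumes degree: "degree_function C \<delta>"
    and sub_finite: "subobject_finite C"
begin

lemma finite_sub [simp]: "x \<in> Ob C \<Longrightarrow> finite (subobjects C x)"
  using sub_finite unfolding subobject_finite_def by blast

definition dg :: "('o, 'm) arrow \<Rightarrow> 'k" where "dg e = \<delta> (dm e) (cd e) (mr e)"

lemma dg_ide [simp]: "x \<in> Ob C \<Longrightarrow> dg (ide x) = 1"
  using degree unfolding degree_function_def dg_def by (simp add: mr_ide)

lemma dg_cmp: assumes "sur e" "sur f" "cd e = dm f" shows "dg (f \<cdot> e) = dg f * dg e"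
proof -
  have O: "dm e \<in> Ob C" "cd e \<in> Ob C" "cd f \<in> Ob C" using assms by auto
  have "surjective C (dm e) (cd e) (mr e)" "surjective C (cd e) (cd f) (mr f)"
    using surjective_iff[of "dm e" "cd e" "mr e"] surjective_iff[of "cd e" "cd f" "mr f"] O assms(1,2)
    by (simp_all, simp add: assms(3))
  then have "\<delta> (dm e) (cd f) (Comp C (dm e) (cd e) (cd f) (mr f) (mr e)) = \<delta> (cd e) (cd f) (mr f) * \<delta> (dm e) (cd e) (mr e)"
    using degree O unfolding degree_function_def by blast
  then show ?thesis using assms by (simp add: dg_def mr_cmp)
qed

lemma dg_pb: assumes "pb f g a b" "sur f" shows "dg b = dg f"
proof -
  note D = pbD[OF assms(1)]
  let ?x = "dm f" and ?y = "dm g" and ?z = "cd f"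
  have O: "?x \<in> Ob C" "?y \<in> Ob C" "?z \<in> Ob C" "dm b \<in> Ob C" "mr f \<in> Hom C ?x ?z" "mr g \<in> Hom C ?y ?z"
    using D unfolding arr_def by auto
  have e: "Ar ?x (mr f) ?z = f" "Ar ?y (mr g) ?z = g" "Ar (dm b) (mr a) ?x = a" "Ar (dm b) (mr b) ?y = b"
    using D by (auto intro: arrow_eqI)
  have "is_pullback C ?x ?y ?z (mr f) (mr g) (dm b) (mr a) (mr b)"
    using is_pullback_iff[of ?x ?y ?z "mr f" "mr g" "dm b" "mr a" "mr b"] O assms(1) unfolding e by simp
  moreover have "surjective C ?x ?z (mr f)" using surjective_iff[of ?x ?z "mr f"] O assms(2) unfolding e by simp
  ultimately have "\<delta> (dm b) ?y (mr b) = \<delta> ?x ?z (mr f)"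
    using degree O unfolding degree_function_def by blast
  then show ?thesis unfolding dg_def using D by simp
qed

lemma dg_pb': "pb f g a b \<Longrightarrow> sur g \<Longrightarrow> dg a = dg g"
  using dg_pb pb_sym by blast

text \<open>An isomorphism is a pullback of an identity, so stability under pullback forces degree
  1.\<close>

lemma dg_iso [simp]: assumes "iso e" shows "dg e = 1"
proof -
  obtain e' where e': "arr e'" "dm e' = cd e" "cd e' = dm e" "e' \<cdot> e = ide (dm e)" "e \<cdot> e' = ide (cd e)"
    using assms by (rule isoE)
  let ?z = "ide (cd e)"
  have "pb ?z ?z e e"
  proof (rule pbI)
    fix k l assume "arr k" "arr l" "dm k = dm l" "cd k = dm ?z" "cd l = dm ?z" "?z \<cdot> k = ?z \<cdot> l"
    then show "\<exists>h. arr h \<and> dm h = dm k \<and> cd h = dm e \<and> e \<cdot> h = k \<and> e \<cdot> h = l"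
      using e' assms by (intro exI[of _ "e' \<cdot> k"]) (auto simp: cmp_left_eq)
  next
    fix h h' assume "arr h" "arr h'" "dm h = dm h'" "cd h = dm e" "cd h' = dm e" "e \<cdot> h = e \<cdot> h'"
    then show "h = h'" using assms monD[of e h h'] by auto
  qed (use assms in auto)
  then have "dg e = dg ?z" by (rule dg_pb) (use assms in auto)
  then show ?thesis using assms by simp
qed

text \<open>The morphism \<open>[b] [a]\<^sup>\<or>\<close> given by a span \<open>(a, b)\<close>.\<close>

definition sp :: "('o, 'm) arrow \<Rightarrow> ('o, 'm) arrow \<Rightarrow> ('o \<times> 'm) set \<Rightarrow> 'k" where
  "sp a b = (SOME v. \<exists>e m. sur e \<and> mon m \<and> cd e = dm m \<and> m \<cdot> e = pr a b \<and> v = dg e \<star> basis_vec (cls m))"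

text \<open>Makes the choice in \<open>sp\<close> immaterial: two image factorizations of the same
  arrow differ by an isomorphism, which changes neither the class of the mono nor the degree of the
  surjection.\<close>

lemma sp_eq:
  assumes "sur e" "mon m" "cd e = dm m" "m \<cdot> e = pr a b"
  shows "sp a b = dg e \<star> basis_vec (cls m)"
  unfolding sp_def
proof (rule some_equality)
  fix v assume "\<exists>e m. sur e \<and> mon m \<and> cd e = dm m \<and> m \<cdot> e = pr a b \<and> v = dg e \<star> basis_vec (cls m)"
  then obtain e' m' where e': "sur e'" "mon m'" "cd e' = dm m'" "m' \<cdot> e' = pr a b" "v = dg e' \<star> basis_vec (cls m')"
    by blast
  have em: "m' \<cdot> e' = m \<cdot> e" using e' assms by simp
  obtain h where h: "iso h" "dm h = dm m'" "cd h = dm m" "m \<cdot> h = m'" "h \<cdot> e' = e"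
    by (rule factorization_unique[OF e'(1-3) assms(1-3) em])
  have "dg e = dg e'" using dg_cmp[of e' h] e' h by simp
  moreover have "cls m' = cls m" using h assms cls_eqI by metis
  ultimately show "v = dg e \<star> basis_vec (cls m)" using e' by simp
qed (use assms in blast)

lemma sp_mon: "mon (pr a b) \<Longrightarrow> dm a \<in> Ob C \<Longrightarrow> sp a b = basis_vec (cls (pr a b))"
  using sp_eq[of "ide (dm a)" "pr a b" a b] by simp

lemma sp_sur:
  assumes "sur e" "arr a" "arr b" "dm a = dm b" "cd e = dm a"
  shows "sp (a \<cdot> e) (b \<cdot> e) = dg e \<star> sp a b"
proof -
  obtain f m where f: "sur f" "mon m" "cd f = dm m" "m \<cdot> f = pr a b"
    using factorization[of "pr a b"] assms by auto
  have df: "dm f = dm a" using arg_cong[OF f(4), of dm] by simp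
  have "m \<cdot> (f \<cdot> e) = pr a b \<cdot> e" by (rule cmp_left_eq[OF f(4)]) (use f assms df in auto)
  then have "m \<cdot> (f \<cdot> e) = pr (a \<cdot> e) (b \<cdot> e)" using assms by (simp add: pr_cmp)
  then have "sp (a \<cdot> e) (b \<cdot> e) = dg (f \<cdot> e) \<star> basis_vec (cls m)"
    by - (rule sp_eq, use f assms df in auto)
  then show ?thesis using sp_eq[OF f] dg_cmp[of e f] assms f df by (simp add: mult.commute)
qed

lemma sp_iso: "iso e \<Longrightarrow> arr a \<Longrightarrow> arr b \<Longrightarrow> dm a = dm b \<Longrightarrow> cd e = dm a \<Longrightarrow> sp (a \<cdot> e) (b \<cdot> e) = sp a b"
  using sp_sur[of e a b] by simp

section \<open>Linear structure of the morphism spaces of \<open>T0\<close>\<close>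

abbreviation H :: "'o \<Rightarrow> 'o \<Rightarrow> (('o \<times> 'm) set \<Rightarrow> 'k) set" where
  "H \<equiv> Hom (T0 C \<delta>)"

abbreviation co :: "'o \<Rightarrow> 'o \<Rightarrow> 'o \<Rightarrow> (('o \<times> 'm) set \<Rightarrow> 'k) \<Rightarrow> (('o \<times> 'm) set \<Rightarrow> 'k) \<Rightarrow> ('o \<times> 'm) set \<Rightarrow> 'k" where
  "co \<equiv> Comp (T0 C \<delta>)"

abbreviation un :: "'o \<Rightarrow> ('o \<times> 'm) set \<Rightarrow> 'k" where
  "un \<equiv> Idn (T0 C \<delta>)"

lemma H_iff: "f \<in> H x y \<longleftrightarrow> (\<forall>r. r \<notin> subobjects C (prd C x y) \<longrightarrow> f r = 0)"
  by (simp add: T0_def)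

lemma co_def: "co x y z g f t = (\<Sum>r \<in> subobjects C (prd C x y). \<Sum>s \<in> subobjects C (prd C y z).
         f r * g s * (rel_comp_degree C \<delta> x y z r s * basis_vec (rel_comp C x y z r s) t))"
  by (simp add: T0_def)

lemma H_zero [simp]: "0 \<in> H x y" by (simp add: H_iff)
lemma H_add [simp]: "f \<in> H x y \<Longrightarrow> g \<in> H x y \<Longrightarrow> f + g \<in> H x y" by (simp add: H_iff)
lemma H_minus [simp]: "f \<in> H x y \<Longrightarrow> g \<in> H x y \<Longrightarrow> f - g \<in> H x y" by (simp add: H_iff)
lemma H_smul [simp]: "f \<in> H x y \<Longrightarrow> c \<star> f \<in> H x y" by (simp add: H_iff smul_apply)
lemma H_sum [simp]: "(\<And>i. i \<in> I \<Longrightarrow> f i \<in> H x y) \<Longrightarrow> (\<Sum>i\<in>I. f i) \<in> H x y"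
  by (induction I rule: infinite_finite_induct) auto

lemma H_bas [simp]: "r \<in> subobjects C (prd C x y) \<Longrightarrow> basis_vec r \<in> H x y"
  by (auto simp: H_iff basis_vec_def)

lemma H_expand:
  assumes "f \<in> H x y" "x \<in> Ob C" "y \<in> Ob C"
  shows "f = (\<Sum>r\<in>subobjects C (prd C x y). f r \<star> basis_vec r)"
proof
  fix t
  have "(\<Sum>r\<in>subobjects C (prd C x y). f r * (if t = r then 1 else 0)) = (if t \<in> subobjects C (prd C x y) then f t else 0)"
    using assms by (simp add: if_distrib[of "\<lambda>c. _ * c"] cong: if_cong)
  then show "f t = (\<Sum>r\<in>subobjects C (prd C x y). f r \<star> basis_vec r) t"
    using assms(1) by (auto simp: sum_apply smul_apply basis_vec_def H_iff)
qed

lemma H_induct [consumes 3, case_names bas add smul]: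
  assumes "f \<in> H x y" "x \<in> Ob C" "y \<in> Ob C"
    and "\<And>r. r \<in> subobjects C (prd C x y) \<Longrightarrow> P (basis_vec r)"
    and "\<And>f g. f \<in> H x y \<Longrightarrow> g \<in> H x y \<Longrightarrow> P f \<Longrightarrow> P g \<Longrightarrow> P (f + g)"
    and "\<And>c f. f \<in> H x y \<Longrightarrow> P f \<Longrightarrow> P (c \<star> f)"
    and "P 0"
  shows "P f"
proof -
  have "P (\<Sum>r\<in>R. f r \<star> basis_vec r) \<and> (\<Sum>r\<in>R. f r \<star> basis_vec r) \<in> H x y"
    if "finite R" "R \<subseteq> subobjects C (prd C x y)" for R
    using that by (induction R) (auto intro!: assms(4-7))
  then show ?thesis using H_expand[OF assms(1-3)] assms(2,3) by (metis finite_sub prd_Ob subset_refl)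
qed

lemma co_add_left: "co x y z (g + g') f = co x y z g f + co x y z g' f"
  by (simp add: fun_eq_iff co_def sum.distrib[symmetric] algebra_simps)

lemma co_add_right: "co x y z g (f + f') = co x y z g f + co x y z g f'"
  by (simp add: fun_eq_iff co_def sum.distrib[symmetric] algebra_simps)

lemma co_minus_left: "co x y z (g - g') f = co x y z g f - co x y z g' f"
  by (simp add: fun_eq_iff co_def sum_subtractf[symmetric] algebra_simps)

lemma co_minus_right: "co x y z g (f - f') = co x y z g f - co x y z g f'"
  by (simp add: fun_eq_iff co_def sum_subtractf[symmetric] algebra_simps)

lemma co_zero_left [simp]: "co x y z 0 f = 0" by (simp add: fun_eq_iff co_def)
lemma co_zero_right [simp]: "co x y z g 0 = 0" by (simp add: fun_eq_iff co_def)

lemma co_smul_left: "co x y z (c \<star> g) f = c \<star> co x y z g f"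
  by (simp add: fun_eq_iff co_def smul_apply sum_distrib_left algebra_simps)

lemma co_smul_right: "co x y z g (c \<star> f) = c \<star> co x y z g f"
  by (simp add: fun_eq_iff co_def smul_apply sum_distrib_left algebra_simps)

lemma co_sum_left: "co x y z (\<Sum>i\<in>I. g i) f = (\<Sum>i\<in>I. co x y z (g i) f)"
  by (induction I rule: infinite_finite_induct) (simp_all only: sum.infinite sum.empty sum.insert co_zero_left co_add_left not_False_eq_True)

lemma co_sum_right: "co x y z g (\<Sum>i\<in>I. f i) = (\<Sum>i\<in>I. co x y z g (f i))"
  by (induction I rule: infinite_finite_induct) (simp_all only: sum.infinite sum.empty sum.insert co_zero_right co_add_right not_False_eq_True)

lemma sp_in_H [simp]:
  assumes "arr a" "arr b" "dm a = dm b" "cd a = x" "cd b = y"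
  shows "sp a b \<in> H x y"
proof -
  obtain f m where f: "sur f" "mon m" "cd f = dm m" "m \<cdot> f = pr a b"
    using factorization[of "pr a b"] assms by auto
  have "cd m = prd C x y" using arg_cong[OF f(4), of cd] assms by simp
  then show ?thesis using sp_eq[OF f] f by simp
qed

lemma bas_eq_sp:
  assumes "m = rpr (prd C x y) r" "r \<in> subobjects C (prd C x y)" "x \<in> Ob C" "y \<in> Ob C"
  shows "basis_vec r = sp (p1 x y \<cdot> m) (p2 x y \<cdot> m)" "mon m" "cd m = prd C x y"
proof -
  show m: "mon m" "cd m = prd C x y" using rpr[OF assms(2)] assms by auto
  have "pr (p1 x y \<cdot> m) (p2 x y \<cdot> m) = m" using m assms by (simp add: pr_proj)
  then show "basis_vec r = sp (p1 x y \<cdot> m) (p2 x y \<cdot> m)"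
    using rpr[OF assms(2)] m assms(1,3,4) sp_mon[of "p1 x y \<cdot> m" "p2 x y \<cdot> m"] mon_arr[OF m(1), THEN arr_dm] by simp
qed

lemma co_bas:
  assumes "r \<in> subobjects C (prd C x y)" "s \<in> subobjects C (prd C y z)" "x \<in> Ob C" "y \<in> Ob C" "z \<in> Ob C"
  shows "co x y z (basis_vec s) (basis_vec r) = rel_comp_degree C \<delta> x y z r s \<star> basis_vec (rel_comp C x y z r s)"
proof
  fix t
  let ?K = "\<lambda>r s. rel_comp_degree C \<delta> x y z r s * basis_vec (rel_comp C x y z r s) t"
  have "co x y z (basis_vec s) (basis_vec r) t =
    (\<Sum>r'\<in>subobjects C (prd C x y). \<Sum>s'\<in>subobjects C (prd C y z). (if s' = s then (if r' = r then ?K r' s' else 0) else 0))"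
    unfolding co_def by (intro sum.cong refl) (auto simp: basis_vec_def)
  also have "\<dots> = (\<Sum>r'\<in>subobjects C (prd C x y). if r' = r then ?K r' s else 0)"
    by (intro sum.cong refl) (use assms in \<open>simp add: sum.delta\<close>)
  also have "\<dots> = ?K r s" using assms by (simp add: sum.delta)
  finally show "co x y z (basis_vec s) (basis_vec r) t = (rel_comp_degree C \<delta> x y z r s \<star> basis_vec (rel_comp C x y z r s)) t"
    by (simp add: smul_apply)
qed

text \<open>Unfolds, once and for all, the chosen fibre product, the image and the degree in the
  definition of composition. Afterwards composition is handled through spans and arbitrary
  pullbacks.\<close>

lemma co_bas_sp:
  assumes rs: "r \<in> subobjects C (prd C x y)" "s \<in> subobjects C (prd C y z)" and O: "x \<in> Ob C" "y \<in> Ob C" "z \<in> Ob C"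
  defines "m \<equiv> rpr (prd C x y) r" and "n \<equiv> rpr (prd C y z) s"
  obtains u v where "pb (p2 x y \<cdot> m) (p1 y z \<cdot> n) u v"
    "co x y z (basis_vec s) (basis_vec r) = sp (p1 x y \<cdot> m \<cdot> u) (p2 y z \<cdot> n \<cdot> v)"
proof -
  have m: "mon m" "cd m = prd C x y" and n: "mon n" "cd n = prd C y z"
    using rpr[OF rs(1)] rpr[OF rs(2)] O by (auto simp: m_def n_def)
  let ?f = "restrict_arr C (prd C x y) y (proj2 C x y) r" and ?g = "restrict_arr C (prd C y z) y (proj1 C y z) s"
  have f: "p2 x y \<cdot> m = Ar (sub_obj r) ?f y" and g: "p1 y z \<cdot> n = Ar (sub_obj s) ?g y"
    by (auto intro!: arrow_eqI simp: mr_cmp restrict_arr_def p1_def p2_def m_def n_def rpr_def)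
  have f': "p1 x y \<cdot> m = Ar (sub_obj r) (restrict_arr C (prd C x y) x (proj1 C x y) r) x"
    and g': "p2 y z \<cdot> n = Ar (sub_obj s) (restrict_arr C (prd C y z) z (proj2 C y z) s) z"
    by (auto intro!: arrow_eqI simp: mr_cmp restrict_arr_def p1_def p2_def m_def n_def rpr_def)
  have "arr (p2 x y \<cdot> m)" "arr (p1 y z \<cdot> n)" using m n O by auto
  then have fg: "sub_obj r \<in> Ob C" "sub_obj s \<in> Ob C" "?f \<in> Hom C (sub_obj r) y" "?g \<in> Hom C (sub_obj s) y"
    unfolding f g arr_triple by auto
  obtain a b where ab: "pb (p2 x y \<cdot> m) (p1 y z \<cdot> n) a b"
    by (rule pullback_ex[of "p2 x y \<cdot> m" "p1 y z \<cdot> n"]) (use m n O in auto)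
  have "a = Ar (dm a) (mr a) (sub_obj r)" "b = Ar (dm a) (mr b) (sub_obj s)"
    using pbD[OF ab] by (auto intro!: arrow_eqI simp: m_def n_def)
  then have "is_pullback C (sub_obj r) (sub_obj s) y ?f ?g (dm a) (mr a) (mr b)"
    using ab is_pullback_iff[OF fg(1,2) O(2) fg(3,4), of "dm a" "mr a" "mr b"] f g by simp
  then have "\<exists>t. case t of (p, a, b) \<Rightarrow> is_pullback C (sub_obj r) (sub_obj s) y ?f ?g p a b" by auto
  then have "case rel_pullback C x y z r s of (p, a, b) \<Rightarrow> is_pullback C (sub_obj r) (sub_obj s) y ?f ?g p a b"
    unfolding rel_pullback_def by (rule someI_ex)
  then obtain p a b where pab: "rel_pullback C x y z r s = (p, a, b)" "is_pullback C (sub_obj r) (sub_obj s) y ?f ?g p a b"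
    by (cases "rel_pullback C x y z r s") auto
  define u v where "u = Ar p a (sub_obj r)" and "v = Ar p b (sub_obj s)"
  have uv: "pb (p2 x y \<cdot> m) (p1 y z \<cdot> n) u v"
    using is_pullback_iff[OF fg(1,2) O(2) fg(3,4)] pab f g unfolding u_def v_def by simp
  note D = pbD[OF uv]
  let ?a = "p1 x y \<cdot> m \<cdot> u" and ?b = "p2 y z \<cdot> n \<cdot> v"
  have ab: "arr ?a" "arr ?b" "dm ?a = dm ?b" using D m n O by auto
  have pa: "rel_pullback_arr C x y z r s = mr (pr ?a ?b)"
  proof -
    have "?a = (p1 x y \<cdot> m) \<cdot> u" "?b = (p2 y z \<cdot> n) \<cdot> v" using D m n O by auto
    then have "mr ?a = Comp C p (sub_obj r) x (restrict_arr C (prd C x y) x (proj1 C x y) r) a"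
      "mr ?b = Comp C p (sub_obj s) z (restrict_arr C (prd C y z) z (proj2 C y z) s) b"
      unfolding f' g' by (simp_all add: mr_cmp u_def v_def)
    then show ?thesis unfolding rel_pullback_arr_def pab by (simp add: pr_def u_def)
  qed
  obtain e k where ek: "sur e" "mon k" "cd e = dm k" "k \<cdot> e = pr ?a ?b"
    using factorization[of "pr ?a ?b"] ab by auto
  have ck: "cd k = prd C x z" and de: "dm e = p" using arg_cong[OF ek(4), of cd] arg_cong[OF ek(4), of dm] by (auto simp: u_def)
  have "is_image C (dm e) (cd k) (mr (k \<cdot> e)) (cls k)"
  proof (rule is_image_cls)
    fix n g assume a: "mon n" "arr g" "cd g = dm n" "cd n = cd k" "k \<cdot> e = n \<cdot> g"
    obtain d where "arr d" "dm d = cd e" "cd d = dm n" "n \<cdot> d = k" "d \<cdot> e = g"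
      by (rule orth[OF ek(1) a(1) a(5)[symmetric]]) (use a ek in auto)
    then show "\<exists>k'. arr k' \<and> dm k' = dm k \<and> cd k' = dm n \<and> n \<cdot> k' = k" using ek by auto
  qed (use ek in auto)
  then have "img C p (prd C x z) (rel_pullback_arr C x y z r s) = cls k"
    using img_eq[of "prd C x z"] ck de ek(4) pa O by auto
  then have rc: "rel_comp C x y z r s = cls k" by (simp add: rel_comp_def pab)
  define k' where "k' = rpr (prd C x z) (cls k)"
  have k': "mon k'" "cls k' = cls k" "cd k' = prd C x z"
    using rpr[of "cls k" "prd C x z"] ek ck O by (auto simp: k'_def)
  then obtain h where h: "iso h" "dm h = dm k" "cd h = dm k'" "k' \<cdot> h = k" using cls_eq_iff[of k k'] ek ck by auto
  have s: "sur (h \<cdot> e)" and c: "k' \<cdot> (h \<cdot> e) = pr ?a ?b" using h ek k' by (auto simp: cmp_left_eq)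
  \<comment> \<open>The degree is that of the map onto the chosen representative \<open>k'\<close>
    of the image, so the surjection \<open>e\<close> onto \<open>k\<close> has to be transported
    along \<open>h\<close>.\<close>
  have "(THE e. e \<in> Hom C p (dm k') \<and> Comp C p (dm k') (prd C x z) (mr k') e = mr (pr ?a ?b)) = mr (h \<cdot> e)"
  proof (rule the_equality)
    show "mr (h \<cdot> e) \<in> Hom C p (dm k') \<and> Comp C p (dm k') (prd C x z) (mr k') (mr (h \<cdot> e)) = mr (pr ?a ?b)"
    proof
      show "mr (h \<cdot> e) \<in> Hom C p (dm k')" using sur_arr[OF s] de h unfolding arr_def by simp
      show "Comp C p (dm k') (prd C x z) (mr k') (mr (h \<cdot> e)) = mr (pr ?a ?b)"
        using arg_cong[OF c, of mr] mr_cmp[of k' "h \<cdot> e"] de h k' by simp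
    qed
    fix j assume j: "j \<in> Hom C p (dm k') \<and> Comp C p (dm k') (prd C x z) (mr k') j = mr (pr ?a ?b)"
    have "k' \<cdot> Ar p j (dm k') = k' \<cdot> (h \<cdot> e)" unfolding c
      using j k' by (auto intro!: arrow_eqI simp: mr_cmp u_def)
    moreover have "arr (Ar p j (dm k'))" using j k' de ek by (simp add: arr_triple) (metis arr_dm sur_arr)
    ultimately have "Ar p j (dm k') = h \<cdot> e" using k' s h by - (rule monD[of k'], auto)
    then show "j = mr (h \<cdot> e)" by (metis arrow.sel(2))
  qed
  then have "rel_comp_degree C \<delta> x y z r s = dg (h \<cdot> e)"
    unfolding rel_comp_degree_def Let_def rc pab pa by (simp add: k'_def rpr_def dg_def de h pa[symmetric])
  then have "co x y z (basis_vec s) (basis_vec r) = sp ?a ?b"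
    using sp_eq[OF s k'(1) _ c] rc k' h co_bas[OF rs O] by simp
  then show ?thesis using that uv by blast
qed

text \<open>Spans compose by any pullback, jointly monic or not. Passing from the image relations
  back to the given spans covers the fibre product by \<open>i \<cdot> j\<close>, whose degree
  \<open>dg e * dg f\<close> is exactly the product of the scalars produced by
  \<open>sp_eq\<close>.\<close>

lemma co_sp:
  assumes P: "pb b c u v" and "arr a" "arr d" "dm a = dm b" "dm c = dm d" "cd a = x" "cd b = y" "cd d = z"
  shows "co x y z (sp c d) (sp a b) = sp (a \<cdot> u) (d \<cdot> v)"
proof -
  note D = pbD[OF P]
  have O: "x \<in> Ob C" "y \<in> Ob C" "z \<in> Ob C" using assms D by auto
  obtain e m where em: "sur e" "mon m" "cd e = dm m" "m \<cdot> e = pr a b" using factorization[of "pr a b"] assms D by auto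
  obtain f n where fn: "sur f" "mon n" "cd f = dm n" "n \<cdot> f = pr c d" using factorization[of "pr c d"] assms D by auto
  have cm: "cd m = prd C x y" and de: "dm e = dm a" using arg_cong[OF em(4), of cd] arg_cong[OF em(4), of dm] assms by auto
  have cn: "cd n = prd C y z" and df: "dm f = dm c" using arg_cong[OF fn(4), of cd] arg_cong[OF fn(4), of dm] assms D by auto
  have rs: "cls m \<in> subobjects C (prd C x y)" "cls n \<in> subobjects C (prd C y z)" using em fn cm cn by auto
  define m' where "m' = rpr (prd C x y) (cls m)"
  define n' where "n' = rpr (prd C y z) (cls n)"
  have m': "mon m'" "cls m' = cls m" "cd m' = prd C x y" using rpr[OF rs(1)] O by (auto simp: m'_def)
  have n': "mon n'" "cls n' = cls n" "cd n' = prd C y z" using rpr[OF rs(2)] O by (auto simp: n'_def)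
  obtain h where h: "iso h" "dm h = dm m" "cd h = dm m'" "m' \<cdot> h = m" using cls_eq_iff[of m m'] m' em cm by auto
  obtain k where k: "iso k" "dm k = dm n" "cd k = dm n'" "n' \<cdot> k = n" using cls_eq_iff[of n n'] n' fn cn by auto
  define e' where "e' = h \<cdot> e"
  define f' where "f' = k \<cdot> f"
  have e': "sur e'" "cd e' = dm m'" "dm e' = dm a" "dg e' = dg e" "m' \<cdot> e' = pr a b"
    using h em m' de dg_cmp[of e h] by (auto simp: e'_def cmp_left_eq)
  have f': "sur f'" "cd f' = dm n'" "dm f' = dm c" "dg f' = dg f" "n' \<cdot> f' = pr c d"
    using k fn n' df dg_cmp[of f k] by (auto simp: f'_def cmp_left_eq)
  have ae: "p1 x y \<cdot> (m' \<cdot> e') = a" "p2 x y \<cdot> (m' \<cdot> e') = b" unfolding e' using assms D by auto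
  have cf: "p1 y z \<cdot> (n' \<cdot> f') = c" "p2 y z \<cdot> (n' \<cdot> f') = d" unfolding f' using assms D by auto
  obtain u0 v0 where uv0: "pb (p2 x y \<cdot> m') (p1 y z \<cdot> n') u0 v0"
    and c0: "co x y z (basis_vec (cls n)) (basis_vec (cls m)) = sp (p1 x y \<cdot> m' \<cdot> u0) (p2 y z \<cdot> n' \<cdot> v0)"
    using co_bas_sp[OF rs O] unfolding m'_def n'_def by metis
  note D0 = pbD[OF uv0]
  \<comment> \<open>An intermediate fibre product in which only the first span has been replaced by
    its image; the two replacements are then instances of \<open>pb_sur_left\<close>.\<close>
  obtain u1 v1 where uv1: "pb (p2 x y \<cdot> m') c u1 v1" by (rule pullback_ex[of "p2 x y \<cdot> m'" c]) (use m' D O assms in auto)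
  note D1 = pbD[OF uv1]
  have P2: "pb ((p2 x y \<cdot> m') \<cdot> e') c u v" using P ae e' m' O by simp
  obtain j where j: "sur j" "pb e' u1 u j" "dm j = dm u" "cd j = dm u1" "u1 \<cdot> j = e' \<cdot> u" "v1 \<cdot> j = v"
    by (rule pb_sur_left[OF P2 uv1]) (use e' m' O in auto)
  have P3: "pb ((p1 y z \<cdot> n') \<cdot> f') (p2 x y \<cdot> m') v1 u1" using pb_sym[OF uv1] cf f' n' O by simp
  obtain i where i: "sur i" "pb f' v0 v1 i" "dm i = dm v1" "cd i = dm v0" "v0 \<cdot> i = f' \<cdot> v1" "u0 \<cdot> i = u1"
    by (rule pb_sur_left[OF P3 pb_sym[OF uv0]]) (use f' n' O in auto)
  have dg: "dg j = dg e" "dg i = dg f" using dg_pb[OF j(2) e'(1)] dg_pb[OF i(2) f'(1)] e' f' by auto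
  have ij: "sur (i \<cdot> j)" "cd (i \<cdot> j) = dm u0" "dg (i \<cdot> j) = dg e * dg f"
    using i j D0 D1 dg dg_cmp[of j i] by (auto simp: mult.commute)
  have cij: "cd j = dm i" using i j D1 by simp
  have 1: "u0 \<cdot> (i \<cdot> j) = e' \<cdot> u" using cmp_left_eq[OF i(6), of j] i j D0 D1 by simp
  have 2: "v0 \<cdot> (i \<cdot> j) = f' \<cdot> v"
  proof -
    have "v0 \<cdot> (i \<cdot> j) = f' \<cdot> (v1 \<cdot> j)" by (rule cmp_square[OF i(5)]) (use i j f' D0 D1 in auto)
    then show ?thesis using j by simp
  qed
  have "sp (a \<cdot> u) (d \<cdot> v) = sp ((p1 x y \<cdot> m' \<cdot> u0) \<cdot> (i \<cdot> j)) ((p2 y z \<cdot> n' \<cdot> v0) \<cdot> (i \<cdot> j))"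
  proof -
    have "(p1 x y \<cdot> m' \<cdot> u0) \<cdot> (i \<cdot> j) = p1 x y \<cdot> (m' \<cdot> (e' \<cdot> u))" using 1 ij D0 m' O i j cij by simp
    also have "m' \<cdot> (e' \<cdot> u) = pr a b \<cdot> u" by (rule cmp_left_eq[OF e'(5)]) (use m' e' D assms in auto)
    also have "p1 x y \<cdot> (pr a b \<cdot> u) = a \<cdot> u" by (rule cmp_left_eq[OF p1_pr]) (use O D assms in auto)
    finally have A: "(p1 x y \<cdot> m' \<cdot> u0) \<cdot> (i \<cdot> j) = a \<cdot> u" .
    have "(p2 y z \<cdot> n' \<cdot> v0) \<cdot> (i \<cdot> j) = p2 y z \<cdot> (n' \<cdot> (f' \<cdot> v))" using 2 ij D0 n' O i j cij by simp
    also have "n' \<cdot> (f' \<cdot> v) = pr c d \<cdot> v" by (rule cmp_left_eq[OF f'(5)]) (use n' f' D assms in auto)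
    also have "p2 y z \<cdot> (pr c d \<cdot> v) = d \<cdot> v" by (rule cmp_left_eq[OF p2_pr]) (use O D assms in auto)
    finally show ?thesis using A by simp
  qed
  also have "\<dots> = (dg e * dg f) \<star> sp (p1 x y \<cdot> m' \<cdot> u0) (p2 y z \<cdot> n' \<cdot> v0)"
    unfolding ij(3)[symmetric] by (rule sp_sur) (use ij D0 m' n' O in auto)
  also have "\<dots> = co x y z (sp c d) (sp a b)"
    unfolding sp_eq[OF em] sp_eq[OF fn] co_smul_left co_smul_right c0 by (simp add: mult.commute)
  finally show ?thesis by simp
qed

end

text \<open>Evaluating sums of coefficient functions pointwise would defeat the linearity lemmas below.\<close>

declare plus_fun_apply [simp del] zero_fun_apply [simp del]

section \<open>Moebius functions of finite posets\<close>

locale fin_poset =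
  fixes P :: "'a set" and le :: "'a \<Rightarrow> 'a \<Rightarrow> bool"
  assumes fin: "finite P"
    and refl: "a \<in> P \<Longrightarrow> le a a"
    and antisym: "a \<in> P \<Longrightarrow> b \<in> P \<Longrightarrow> le a b \<Longrightarrow> le b a \<Longrightarrow> a = b"
    and trans: "a \<in> P \<Longrightarrow> b \<in> P \<Longrightarrow> c \<in> P \<Longrightarrow> le a b \<Longrightarrow> le b c \<Longrightarrow> le a c"
begin

lemma dual: "fin_poset P (\<lambda>a b. le b a)"
proof
  fix a b c assume "a \<in> P" "b \<in> P" "c \<in> P" "le b a" "le c b"
  then show "le c a" using trans[of c b a] by simp
next
  fix a b assume "a \<in> P" "b \<in> P" "le b a" "le a b"
  then show "a = b" using antisym[of a b] by simp
qed (use fin refl in auto)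

lemma sub_poset: "Q \<subseteq> P \<Longrightarrow> fin_poset Q le"
proof
  assume Q: "Q \<subseteq> P"
  show "finite Q" using Q fin by (rule finite_subset)
  fix a assume a: "a \<in> Q"
  show "le a a" using a Q refl by blast
  fix b assume b: "b \<in> Q"
  show "a = b" if "le a b" "le b a" using that a b Q antisym[of a b] by blast
  fix c assume "c \<in> Q" "le a b" "le b c"
  then show "le a c" using a b Q trans[of a b c] by blast
qed

lemma down_card_less:
  assumes "a \<in> P" "b \<in> P" "le a b" "a \<noteq> b"
  shows "card {c \<in> P. le c a} < card {c \<in> P. le c b}"
proof (rule psubset_card_mono)
  have "b \<in> {c \<in> P. le c b} - {c \<in> P. le c a}" using assms refl antisym by blast
  moreover have "{c \<in> P. le c a} \<subseteq> {c \<in> P. le c b}" using assms trans by blast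
  ultimately show "{c \<in> P. le c a} \<subset> {c \<in> P. le c b}" by blast
qed (use fin in simp)

lemma down_induct [consumes 1, case_names less]:
  assumes "a \<in> P" and "\<And>b. b \<in> P \<Longrightarrow> (\<And>c. c \<in> P \<Longrightarrow> le c b \<Longrightarrow> c \<noteq> b \<Longrightarrow> Q c) \<Longrightarrow> Q b"
  shows "Q a"
  using assms(1)
proof (induction "card {c \<in> P. le c a}" arbitrary: a rule: less_induct)
  case less
  show ?case by (rule assms(2)[OF less.prems]) (use less down_card_less in blast)
qed

lemma split_top: "b \<in> P \<Longrightarrow> (\<Sum>c \<in> {c \<in> P. le c b}. g c) = g b + (\<Sum>c \<in> {c \<in> P. le c b \<and> c \<noteq> b}. g c)"
  for g :: "'a \<Rightarrow> 'b::ab_group_add"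
proof -
  assume b: "b \<in> P"
  have "{c \<in> P. le c b} = insert b {c \<in> P. le c b \<and> c \<noteq> b}" using b refl by blast
  then show ?thesis using fin by simp
qed

text \<open>The uniqueness half of Moebius inversion, by induction from the bottom.\<close>

lemma down_sums_unique:
  fixes g h :: "'a \<Rightarrow> 'b::ab_group_add"
  assumes "\<And>b. b \<in> P \<Longrightarrow> (\<Sum>c \<in> {c \<in> P. le c b}. g c) = (\<Sum>c \<in> {c \<in> P. le c b}. h c)" "a \<in> P"
  shows "g a = h a"
  using assms(2)
proof (induction rule: down_induct)
  case (less b)
  have "(\<Sum>c \<in> {c \<in> P. le c b \<and> c \<noteq> b}. g c) = (\<Sum>c \<in> {c \<in> P. le c b \<and> c \<noteq> b}. h c)"
    by (rule sum.cong) (use less in auto)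
  then show ?case using assms(1)[OF less(1)] split_top[OF less(1), of g] split_top[OF less(1), of h] by simp
qed

lemma maximal_ex:
  assumes "P \<noteq> {}"
  obtains t where "t \<in> P" "\<And>b. b \<in> P \<Longrightarrow> le t b \<Longrightarrow> b = t"
proof -
  let ?f = "\<lambda>a. card {c \<in> P. le c a}"
  have "Max (?f ` P) \<in> ?f ` P" using fin assms by (intro Max_in) auto
  then obtain t where t: "t \<in> P" "?f t = Max (?f ` P)" by (metis (no_types, lifting) imageE)
  have "b = t" if "b \<in> P" "le t b" for b
  proof (rule ccontr)
    assume "b \<noteq> t"
    then have "?f t < ?f b" using down_card_less that t by blast
    moreover have "?f b \<le> Max (?f ` P)" using fin that by (intro Max_ge) auto
    ultimately show False using t by simp
  qed
  then show ?thesis using that t by blast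
qed

end

text \<open>The existence half of Moebius inversion. A maximal element \<open>t\<close> lies in no
  down-set but its own, so after solving on the rest the value at \<open>t\<close> can be adjusted
  freely.\<close>

lemma down_sums_solvable:
  fixes F :: "'a \<Rightarrow> 'b::ab_group_add"
  assumes "fin_poset P le"
  shows "\<exists>g. \<forall>b\<in>P. (\<Sum>c \<in> {c \<in> P. le c b}. g c) = F b"
  using assms
proof (induction "card P" arbitrary: P)
  case 0
  then have "P = {}" using fin_poset.fin by fastforce
  then show ?case by simp
next
  case (Suc n)
  interpret fin_poset P le by fact
  obtain t where t: "t \<in> P" "\<And>b. b \<in> P \<Longrightarrow> le t b \<Longrightarrow> b = t" using maximal_ex Suc(2) by (metis card.empty nat.distinct(1))
  let ?Q = "P - {t}"
  have "n = card ?Q" "fin_poset ?Q le" using Suc(2) t fin sub_poset[of ?Q] by auto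
  then obtain g where g: "\<And>b. b \<in> ?Q \<Longrightarrow> (\<Sum>c \<in> {c \<in> ?Q. le c b}. g c) = F b" using Suc(1) by blast
  define g' where "g' = g(t := F t - (\<Sum>c \<in> {c \<in> P. le c t \<and> c \<noteq> t}. g c))"
  have "(\<Sum>c \<in> {c \<in> P. le c b}. g' c) = F b" if b: "b \<in> P" for b
  proof (cases "b = t")
    case True
    have "(\<Sum>c \<in> {c \<in> P. le c t \<and> c \<noteq> t}. g' c) = (\<Sum>c \<in> {c \<in> P. le c t \<and> c \<noteq> t}. g c)"
      by (rule sum.cong) (auto simp: g'_def)
    then show ?thesis unfolding True split_top[OF t(1)] by (simp add: g'_def)
  next
    case False
    have "(\<Sum>c \<in> {c \<in> P. le c b}. g' c) = (\<Sum>c \<in> {c \<in> ?Q. le c b}. g c)"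
      by (rule sum.cong) (use False t b in \<open>auto simp: g'_def\<close>)
    then show ?thesis using g[of b] False b by simp
  qed
  then show ?case by blast
qed

context fin_poset
begin

text \<open>The definite description in \<open>moebius\<close> denotes: for fixed \<open>a\<close>
  the row is the unique solution of a triangular system on the up-set of \<open>a\<close>.\<close>

lemma moebius_spec:
  "(\<forall>a b. \<not> (a \<in> P \<and> b \<in> P \<and> le a b) \<longrightarrow> moebius P le a b = 0) \<and>
   (\<forall>a \<in> P. \<forall>b \<in> P. le a b \<longrightarrow> (\<Sum>c \<in> {c \<in> P. le a c \<and> le c b}. moebius P le a c) = (if a = b then 1 else 0))"
proof -
  let ?U = "\<lambda>a. {c \<in> P. le a c}"
  have U: "fin_poset (?U a) le" for a by (rule sub_poset) auto
  have S: "{c \<in> P. le a c \<and> le c b} = {c \<in> ?U a. le c b}" for a b by auto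
  have "\<exists>g. \<forall>b \<in> ?U a. (\<Sum>c \<in> {c \<in> ?U a. le c b}. g c) = (if a = b then 1 else (0::int))" for a
    using down_sums_solvable[OF U] .
  then obtain g where "\<forall>a. \<forall>b \<in> ?U a. (\<Sum>c \<in> {c \<in> ?U a. le c b}. g a c) = (if a = b then 1 else (0::int))"
    using choice[of "\<lambda>a g. \<forall>b \<in> ?U a. (\<Sum>c \<in> {c \<in> ?U a. le c b}. g c) = (if a = b then 1 else (0::int))"] by blast
  then have g: "\<And>a b. b \<in> ?U a \<Longrightarrow> (\<Sum>c \<in> {c \<in> ?U a. le c b}. g a c) = (if a = b then 1 else (0::int))"
    by blast
  define m where "m a b = (if a \<in> P \<and> b \<in> P \<and> le a b then g a b else 0)" for a b
  have m: "(\<Sum>c \<in> {c \<in> ?U a. le c b}. m a c) = (if a = b then 1 else 0)" if "a \<in> P" "b \<in> P" "le a b" for a b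
  proof -
    have "(\<Sum>c \<in> {c \<in> ?U a. le c b}. m a c) = (\<Sum>c \<in> {c \<in> ?U a. le c b}. g a c)"
      by (rule sum.cong) (use that in \<open>auto simp: m_def\<close>)
    then show ?thesis using g[of b a] that by simp
  qed
  have ex: "\<exists>!m. (\<forall>a b. \<not> (a \<in> P \<and> b \<in> P \<and> le a b) \<longrightarrow> m a b = 0) \<and>
     (\<forall>a \<in> P. \<forall>b \<in> P. le a b \<longrightarrow> (\<Sum>c \<in> {c \<in> P. le a c \<and> le c b}. m a c) = (if a = b then 1 else (0::int)))"
    unfolding S
  proof (rule ex1I[of _ m])
    show "(\<forall>a b. \<not> (a \<in> P \<and> b \<in> P \<and> le a b) \<longrightarrow> m a b = 0) \<and>
     (\<forall>a \<in> P. \<forall>b \<in> P. le a b \<longrightarrow> (\<Sum>c \<in> {c \<in> ?U a. le c b}. m a c) = (if a = b then 1 else 0))"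
      using m by (auto simp: m_def)
    fix m' assume m': "(\<forall>a b. \<not> (a \<in> P \<and> b \<in> P \<and> le a b) \<longrightarrow> m' a b = 0) \<and>
     (\<forall>a \<in> P. \<forall>b \<in> P. le a b \<longrightarrow> (\<Sum>c \<in> {c \<in> ?U a. le c b}. m' a c) = (if a = b then 1 else (0::int)))"
    show "m' = m"
    proof (intro ext)
      fix a b
      show "m' a b = m a b"
      proof (cases "a \<in> P \<and> b \<in> P \<and> le a b")
        case True
        interpret Ua: fin_poset "?U a" le by (rule U)
        show ?thesis by (rule Ua.down_sums_unique) (use m m' True in auto)
      next
        case False
        then show ?thesis using m' by (auto simp: m_def)
      qed
    qed
  qed
  show ?thesis unfolding moebius_def by (rule theI'[OF ex])
qed

text \<open>In the incidence algebra the definition says \<open>\<mu> \<zeta> = 1\<close>, whereas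
  sums over the first argument need \<open>\<zeta> \<mu> = 1\<close>. A column \<open>n\<close> of a
  right inverse of \<open>\<zeta>\<close> exists by solving in the dual order, and
  \<open>\<mu> = \<mu> (\<zeta> n) = (\<mu> \<zeta>) n = n\<close> on that column.\<close>

lemma moebius_right:
  assumes "a \<in> P" "b \<in> P" "le a b"
  shows "(\<Sum>c \<in> {c \<in> P. le a c \<and> le c b}. moebius P le c b) = (if a = b then 1 else 0)"
proof -
  let ?m = "moebius P le"
  let ?D = "{c \<in> P. le c b}"
  have D: "fin_poset ?D (\<lambda>a b. le b a)" by (rule fin_poset.sub_poset[OF dual]) auto
  obtain n where "\<forall>a \<in> ?D. (\<Sum>c \<in> {c \<in> ?D. le a c}. n c) = (if a = b then 1 else (0::int))"
    using down_sums_solvable[OF D, of "\<lambda>a. if a = b then 1 else (0::int)"] by blast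
  then have n: "\<And>a. a \<in> ?D \<Longrightarrow> (\<Sum>c \<in> {c \<in> ?D. le a c}. n c) = (if a = b then 1 else (0::int))"
    by blast
  have mn: "?m a b = n a" if a: "a \<in> P" "le a b" for a
  proof -
    let ?I = "{c \<in> P. le a c \<and> le c b}"
    have fI: "finite ?I" using fin by simp
    have "?m a b = (\<Sum>c\<in>?I. if c = b then ?m a c else 0)"
      using fI a assms refl by (subst sum.delta) auto
    also have "\<dots> = (\<Sum>c\<in>?I. ?m a c * (\<Sum>d \<in> {d \<in> ?D. le c d}. n d))"
    proof (rule sum.cong[OF HOL.refl])
      fix c assume "c \<in> ?I"
      then have c: "c \<in> ?D" by blast
      show "(if c = b then ?m a c else 0) = ?m a c * (\<Sum>d \<in> {d \<in> ?D. le c d}. n d)"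
        unfolding n[OF c] by simp
    qed
    also have "\<dots> = (\<Sum>c\<in>?I. \<Sum>d \<in> ?I. if le c d then ?m a c * n d else 0)"
    proof (rule sum.cong[OF HOL.refl])
      fix c assume c: "c \<in> ?I"
      have "{d \<in> ?D. le c d} = {d \<in> ?I. le c d}" using c a trans by blast
      then show "?m a c * (\<Sum>d \<in> {d \<in> ?D. le c d}. n d) = (\<Sum>d \<in> ?I. if le c d then ?m a c * n d else 0)"
        unfolding sum_distrib_left by (simp only: sum.inter_filter[OF fI])
    qed
    also have "\<dots> = (\<Sum>d\<in>?I. \<Sum>c \<in> ?I. if le c d then ?m a c * n d else 0)"
      by (rule sum.swap)
    also have "\<dots> = (\<Sum>d\<in>?I. (\<Sum>c \<in> {c \<in> P. le a c \<and> le c d}. ?m a c) * n d)"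
    proof (rule sum.cong[OF HOL.refl])
      fix d assume d: "d \<in> ?I"
      have "{c \<in> P. le a c \<and> le c d} = {c \<in> ?I. le c d}" using d assms trans by blast
      then show "(\<Sum>c \<in> ?I. if le c d then ?m a c * n d else 0) = (\<Sum>c \<in> {c \<in> P. le a c \<and> le c d}. ?m a c) * n d"
        unfolding sum_distrib_right by (simp only: sum.inter_filter[OF fI])
    qed
    also have "\<dots> = (\<Sum>d\<in>?I. if d = a then n d else 0)"
      by (rule sum.cong) (use moebius_spec a in auto)
    also have "\<dots> = n a" using fI a refl by (subst sum.delta) auto
    finally show ?thesis .
  qed
  have "(\<Sum>c \<in> {c \<in> P. le a c \<and> le c b}. ?m c b) = (\<Sum>c \<in> {c \<in> ?D. le a c}. n c)"
    by (rule sum.cong) (auto simp: mn)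
  then show ?thesis using n[of a] assms by simp
qed

text \<open>Here \<open>i y\<close> is the meet of \<open>y\<close> and \<open>c\<close>, given by
  its universal property because the subobjects come without chosen meets. Group the sum by the
  value \<open>s\<close> of \<open>i y\<close>. The partial sums \<open>S s\<close> vanish because
  their sums over all up-sets do: if \<open>b\<close> is below \<open>c\<close>, then
  \<open>i y\<close> lies above \<open>b\<close> exactly when \<open>y\<close> does, and the Moebius
  sum from \<open>b\<close> to \<open>t\<close> is 0 since \<open>b \<noteq> t\<close>; otherwise
  nothing contributes.\<close>

lemma weisner:
  fixes h :: "'a \<Rightarrow> 'b::comm_ring_1"
  assumes top: "t \<in> P" "\<And>a. a \<in> P \<Longrightarrow> le a t" and c: "c \<in> P" "c \<noteq> t"
    and i: "\<And>y. y \<in> P \<Longrightarrow> i y \<in> P" "\<And>y s. y \<in> P \<Longrightarrow> s \<in> P \<Longrightarrow> le s (i y) \<longleftrightarrow> le s y \<and> le s c"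
  shows "(\<Sum>y\<in>P. of_int (moebius P le y t) * h (i y)) = 0"
proof -
  let ?m = "moebius P le"
  define S where "S s = (\<Sum>y \<in> {y \<in> P. i y = s}. ?m y t)" for s
  interpret dual: fin_poset P "\<lambda>a b. le b a" by (rule dual)
  have S0: "S s = 0" if "s \<in> P" for s
  proof (rule dual.down_sums_unique[of S "\<lambda>_. 0", OF _ that])
    fix b assume b: "b \<in> P"
    have "(\<Sum>s \<in> {s \<in> P. le b s}. S s) = (\<Sum>y \<in> {y \<in> P. le b (i y)}. ?m y t)"
    proof -
      have "(\<Sum>s \<in> {s \<in> P. le b s}. S s) = (\<Sum>s \<in> {s \<in> P. le b s}. \<Sum>y \<in> {y \<in> {y \<in> P. le b (i y)}. i y = s}. ?m y t)"
        unfolding S_def by (intro sum.cong) auto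
      also have "\<dots> = (\<Sum>y \<in> {y \<in> P. le b (i y)}. ?m y t)"
        by (rule sum.group) (use fin i in auto)
      finally show ?thesis .
    qed
    also have "\<dots> = 0"
    proof (cases "le b c")
      case True
      have "b \<noteq> t" using True antisym top c by blast
      have "{y \<in> P. le b (i y)} = {y \<in> P. le b y \<and> le y t}" using i b True top by blast
      then show ?thesis using moebius_right[OF b top(1) top(2)[OF b]] \<open>b \<noteq> t\<close> by simp
    next
      case False
      then have "{y \<in> P. le b (i y)} = {}" using i b by blast
      then show ?thesis by (simp only: sum.empty)
    qed
    finally show "(\<Sum>s \<in> {s \<in> P. le b s}. S s) = (\<Sum>s \<in> {s \<in> P. le b s}. 0)" by simp
  qed
  have "(\<Sum>y\<in>P. of_int (?m y t) * h (i y)) = (\<Sum>s\<in>P. \<Sum>y \<in> {y \<in> P. i y = s}. of_int (?m y t) * h (i y))"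
    by (rule sum.group[symmetric]) (use fin i in auto)
  also have "\<dots> = (\<Sum>s\<in>P. of_int (S s) * h s)"
    unfolding S_def of_int_sum sum_distrib_right by (intro sum.cong) auto
  also have "\<dots> = 0" using S0 by simp
  finally show ?thesis .
qed

end

section \<open>The category of relations\<close>

context degree_category
begin

lemma fin_poset_sub: "x \<in> Ob C \<Longrightarrow> fin_poset (subobjects C x) (sub_le C x)"
proof
  assume x: "x \<in> Ob C"
  show "finite (subobjects C x)" using x by simp
  fix a assume a: "a \<in> subobjects C x"
  show "sub_le C x a a" using sub_le_refl x a by blast
  fix b assume b: "b \<in> subobjects C x"
  show "a = b" if "sub_le C x a b" "sub_le C x b a" using sub_le_antisym[OF x a b that] .
  fix c assume c: "c \<in> subobjects C x" "sub_le C x a b" "sub_le C x b c"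
  show "sub_le C x a c" using sub_le_trans[OF x a b c(1,2,3)] .
qed

text \<open>Basis vectors are spans, so linear identities may be checked on spans, where composition
  is merely a pullback and no image has to be formed.\<close>

lemma H_induct_sp [consumes 3, case_names sp add smul zero]:
  assumes "f \<in> H x y" "x \<in> Ob C" "y \<in> Ob C"
    and "\<And>a b. arr a \<Longrightarrow> arr b \<Longrightarrow> dm a = dm b \<Longrightarrow> cd a = x \<Longrightarrow> cd b = y \<Longrightarrow> P (sp a b)"
    and "\<And>f g. f \<in> H x y \<Longrightarrow> g \<in> H x y \<Longrightarrow> P f \<Longrightarrow> P g \<Longrightarrow> P (f + g)"
    and "\<And>c f. f \<in> H x y \<Longrightarrow> P f \<Longrightarrow> P (c \<star> f)"
    and "P 0"
  shows "P f"
  using assms(1-3)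
proof (induction rule: H_induct)
  case (bas r)
  show ?case unfolding bas_eq_sp(1)[OF HOL.refl bas assms(2,3)]
    by (rule assms(4)) (use bas_eq_sp(2,3)[OF HOL.refl bas assms(2,3)] assms(2,3) in auto)
qed (use assms in auto)

lemma co_sp_obtain:
  assumes "arr a" "arr b" "arr c" "arr d" "dm a = dm b" "dm c = dm d" "cd a = x" "cd b = y" "cd c = y" "cd d = z"
  obtains u v where "pb b c u v" "co x y z (sp c d) (sp a b) = sp (a \<cdot> u) (d \<cdot> v)"
proof -
  obtain u v where uv: "pb b c u v" by (rule pullback_ex[of b c]) (use assms in auto)
  then show ?thesis using that co_sp[OF uv, of a d x y z] assms by simp
qed

lemma co_in_H [simp]:
  assumes "f \<in> H x y" "g \<in> H y z" "x \<in> Ob C" "y \<in> Ob C" "z \<in> Ob C"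
  shows "co x y z g f \<in> H x z"
  using assms(1,3,4)
proof (induction rule: H_induct_sp)
  case (sp a b)
  show ?case using assms(2,4,5)
  proof (induction rule: H_induct_sp)
    case (sp c d)
    obtain u v where uv: "pb b c u v" "co x y z (sp c d) (sp a b) = sp (a \<cdot> u) (d \<cdot> v)"
      by (rule co_sp_obtain[of a b c d x y z]) (use sp \<open>arr a\<close> \<open>arr b\<close> \<open>dm a = dm b\<close> \<open>cd a = x\<close> \<open>cd b = y\<close> in auto)
    show ?case unfolding uv(2) by (rule sp_in_H) (use pbD[OF uv(1)] sp \<open>arr a\<close> \<open>dm a = dm b\<close> \<open>cd a = x\<close> in auto)
  qed (simp_all add: co_add_left co_smul_left)
qed (simp_all add: co_add_right co_smul_right)

lemma un_eq: "x \<in> Ob C \<Longrightarrow> un x = sp (ide x) (ide x)"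
proof -
  assume x: "x \<in> Ob C"
  have "un x = basis_vec (cls (pr (ide x) (ide x)))"
    by (simp add: T0_def graph_def cls_def pr_def mr_ide)
  moreover have "mon (pr (ide x) (ide x))" by (rule mon_prI) (use x in auto)
  ultimately show ?thesis using x sp_mon by simp
qed

lemma co_un_right [simp]:
  assumes "f \<in> H x y" "x \<in> Ob C" "y \<in> Ob C"
  shows "co x x y f (un x) = f"
  using assms
proof (induction rule: H_induct_sp)
  case (sp a b)
  have "pb (ide x) a a (ide (dm a))" using pb_sym[OF pb_ide_right[of a x "dm a"]] sp by simp
  then show ?case using sp un_eq[of x] co_sp[of "ide x" a a "ide (dm a)" "ide x" b x x y] assms by simp
qed (simp_all add: co_add_left co_smul_left)

lemma co_un_left [simp]:
  assumes "f \<in> H x y" "x \<in> Ob C" "y \<in> Ob C"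
  shows "co x y y (un y) f = f"
  using assms
proof (induction rule: H_induct_sp)
  case (sp a b)
  have "pb b (ide y) (ide (dm b)) b" using pb_ide_right[of b y "dm b"] sp by simp
  then show ?case using sp un_eq[of y] co_sp[of b "ide y" "ide (dm b)" b a "ide y" x y y] assms by simp
qed (simp_all add: co_add_right co_smul_right)

lemma un_in_H [simp]: "x \<in> Ob C \<Longrightarrow> un x \<in> H x x"
  by (simp add: un_eq)

text \<open>Both bracketings are the span with apex the limit of the zigzag of the three spans;
  pasting of pullbacks identifies them.\<close>

lemma co_assoc_sp:
  assumes "arr a" "arr b" "dm a = dm b" "cd a = w" "cd b = x"
    and "arr c" "arr d" "dm c = dm d" "cd c = x" "cd d = y"
    and "arr e" "arr k" "dm e = dm k" "cd e = y" "cd k = z"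
  shows "co w x z (co x y z (sp e k) (sp c d)) (sp a b) = co w y z (sp e k) (co w x y (sp c d) (sp a b))"
proof -
  obtain u v where uv: "pb b c u v" by (rule pullback_ex[of b c]) (use assms in auto)
  obtain s t where st: "pb d e s t" by (rule pullback_ex[of d e]) (use assms in auto)
  note D = pbD[OF uv] pbD[OF st]
  obtain p q where pq: "pb v s p q" by (rule pullback_ex[of v s]) (use assms D in auto)
  note E = pbD[OF pq]
  have 1: "pb b (c \<cdot> s) (u \<cdot> p) q"
    by (rule pb_sym, rule pb_paste[OF pb_sym[OF uv] pb_sym[OF pq]]) (use D assms in auto)
  have 2: "pb (d \<cdot> v) e p (t \<cdot> q)"
    by (rule pb_paste[OF st pq]) (use D assms in auto)
  have "co w x z (co x y z (sp e k) (sp c d)) (sp a b) = co w x z (sp (c \<cdot> s) (k \<cdot> t)) (sp a b)"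
    using co_sp[OF st, of c k x y z] assms by simp
  also have "\<dots> = sp (a \<cdot> (u \<cdot> p)) ((k \<cdot> t) \<cdot> q)"
    by (rule co_sp[OF 1]) (use assms D in auto)
  also have "\<dots> = sp ((a \<cdot> u) \<cdot> p) (k \<cdot> (t \<cdot> q))" using assms D E by simp
  also have "\<dots> = co w y z (sp e k) (sp (a \<cdot> u) (d \<cdot> v))"
    by (rule co_sp[OF 2, symmetric]) (use assms D in auto)
  also have "\<dots> = co w y z (sp e k) (co w x y (sp c d) (sp a b))"
    using co_sp[OF uv, of a d w x y] assms by simp
  finally show ?thesis .
qed

lemma co_assoc:
  assumes "f \<in> H w x" "g \<in> H x y" "h \<in> H y z" "w \<in> Ob C" "x \<in> Ob C" "y \<in> Ob C" "z \<in> Ob C"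
  shows "co w x z (co x y z h g) f = co w y z h (co w x y g f)"
  using assms(1,4,5)
proof (induction rule: H_induct_sp)
  case (sp a b)
  note ab = sp
  show ?case using assms(2,5,6)
  proof (induction rule: H_induct_sp)
    case (sp c d)
    note cd = sp
    show ?case using assms(3,6,7)
    proof (induction rule: H_induct_sp)
      case (sp e k)
      show ?case by (rule co_assoc_sp) (use ab cd sp in auto)
    qed (simp_all add: co_add_left co_smul_left)
  qed (simp_all add: co_add_left co_smul_left co_add_right co_smul_right)
qed (simp_all add: co_add_right co_smul_right)

lemma Ob_T0 [simp]: "Ob (T0 C \<delta>) = Ob C" by (simp add: T0_def)

lemma category_T0: "category (T0 C \<delta>)"
  by unfold_locales (auto simp: co_assoc)

end

section \<open>The trace form\<close>

locale relation_category = degree_category C \<delta> for C :: "('o, 'm) cat" and \<delta> :: "'o \<Rightarrow> 'o \<Rightarrow> 'm \<Rightarrow> 'k::field" +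
  assumes no_proper: "terminal_no_proper_subobject C"
    and nondeg: "nondegenerate C \<delta>"
begin

definition tt :: 'o where "tt = (SOME t. terminal C t)"

lemma terminal_tt: "terminal C tt"
  using terminal_ex unfolding tt_def by (rule someI_ex)

lemma tt_Ob [simp]: "tt \<in> Ob C" using terminal_tt unfolding terminal_def by blast

definition bang :: "'o \<Rightarrow> ('o, 'm) arrow" where "bang x = Ar x (THE f. f \<in> Hom C x tt) tt"

lemma bang [simp]: "dm (bang x) = x" "cd (bang x) = tt" by (simp_all add: bang_def)

lemma arr_bang [simp]: "x \<in> Ob C \<Longrightarrow> arr (bang x)"
  using terminal_tt theI'[of "\<lambda>f. f \<in> Hom C x tt"] unfolding terminal_def bang_def arr_triple by auto

lemma bang_eqI: "arr f \<Longrightarrow> cd f = tt \<Longrightarrow> f = bang (dm f)"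
proof -
  assume f: "arr f" "cd f = tt"
  have "mr f \<in> Hom C (dm f) tt" "mr (bang (dm f)) \<in> Hom C (dm f) tt" "dm f \<in> Ob C"
    using f arr_bang[of "dm f"] unfolding arr_def by auto
  then have "mr f = mr (bang (dm f))" using terminal_tt unfolding terminal_def by blast
  then show ?thesis using f by (intro arrow_eqI) auto
qed

text \<open>A factorization of \<open>bang x\<close> through \<open>m\<close> makes \<open>m\<close>
  a subobject of the terminal object, hence everything. So each object has a degree
  \<open>D x\<close>, the dimension of \<open>[x]\<close>.\<close>

lemma sur_bang [simp]: assumes "x \<in> Ob C" shows "sur (bang x)"
proof (rule surI)
  fix m g assume a: "mon m" "arr g" "cd g = dm m" "bang x = m \<cdot> g"
  have cm: "cd m = tt" using arg_cong[OF a(4), of cd] by simp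
  have "cls m \<in> subobjects C tt" using a cm by simp
  then have "cls m = whole C (cd m)" using no_proper terminal_tt cm unfolding terminal_no_proper_subobject_def by auto
  then show "iso m" using cls_eq_whole_iff a by blast
qed (use assms in auto)

definition D :: "'o \<Rightarrow> 'k" where "D x = dg (bang x)"

lemma D_sur: assumes "sur e" shows "D (dm e) = dg e * D (cd e)"
proof -
  have "bang (cd e) \<cdot> e = bang (dm e)" using bang_eqI[of "bang (cd e) \<cdot> e"] assms by simp
  then show ?thesis using dg_cmp[of e "bang (cd e)"] assms by (simp add: D_def mult.commute)
qed

lemma D_iso: "iso e \<Longrightarrow> D (dm e) = D (cd e)"
  using D_sur[of e] by simp

text \<open>The degree of the intersection of \<open>r\<close> with the diagonal. With this value on basis vectors,
  \<open>tr\<close> is the categorical trace.\<close>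

definition tau :: "'o \<Rightarrow> ('o \<times> 'm) set \<Rightarrow> 'k" where
  "tau x r = D (dm (SOME j. eqz (p1 x x \<cdot> rpr (prd C x x) r) (p2 x x \<cdot> rpr (prd C x x) r) j))"

definition tr :: "'o \<Rightarrow> (('o \<times> 'm) set \<Rightarrow> 'k) \<Rightarrow> 'k" where
  "tr x f = (\<Sum>r\<in>subobjects C (prd C x x). f r * tau x r)"

lemma tr_add: "tr x (f + g) = tr x f + tr x g"
  by (simp add: tr_def plus_fun_apply sum.distrib algebra_simps)

lemma tr_minus: "tr x (f - g) = tr x f - tr x g"
  by (simp add: tr_def sum_subtractf algebra_simps)

lemma tr_smul: "tr x (c \<star> f) = c * tr x f"
  by (simp add: tr_def smul_apply sum_distrib_left algebra_simps)

lemma tr_zero [simp]: "tr x 0 = 0" by (simp add: tr_def zero_fun_apply)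

lemma tr_sum: "tr x (\<Sum>i\<in>I. f i) = (\<Sum>i\<in>I. tr x (f i))"
  by (induction I rule: infinite_finite_induct) (simp_all only: sum.infinite sum.empty sum.insert tr_zero tr_add not_False_eq_True)

lemma tr_bas: "x \<in> Ob C \<Longrightarrow> r \<in> subobjects C (prd C x x) \<Longrightarrow> tr x (basis_vec r) = tau x r"
  by (simp add: tr_def basis_vec_def if_distrib[of "\<lambda>c. c * _"] cong: if_cong)

text \<open>Lets the trace be read off a span that is not jointly monic: replacing the span by its
  image covers the equalizer by a base change of \<open>e\<close>, and the degree of this cover is
  the scalar in \<open>sp_eq\<close>.\<close>

lemma tr_sp:
  assumes j: "eqz a b j" and x: "cd a = x"
  shows "tr x (sp a b) = D (dm j)"
proof -
  note J = eqzD[OF j]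
  have O: "x \<in> Ob C" using J x by auto
  obtain e m where em: "sur e" "mon m" "cd e = dm m" "m \<cdot> e = pr a b" using factorization[of "pr a b"] J by auto
  have cm: "cd m = prd C x x" and de: "dm e = dm a" using arg_cong[OF em(4), of cd] arg_cong[OF em(4), of dm] J x by auto
  define m' where "m' = rpr (prd C x x) (cls m)"
  have r: "cls m \<in> subobjects C (prd C x x)" using em cm by simp
  have m': "mon m'" "cls m' = cls m" "cd m' = prd C x x" using rpr[OF r] O by (auto simp: m'_def)
  obtain h where h: "iso h" "dm h = dm m" "cd h = dm m'" "m' \<cdot> h = m" using cls_eq_iff[of m m'] m' em cm by auto
  define e' where "e' = h \<cdot> e"
  have e': "sur e'" "cd e' = dm m'" "dm e' = dm a" "dg e' = dg e" "m' \<cdot> e' = pr a b"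
    using h em m' de dg_cmp[of e h] by (auto simp: e'_def cmp_left_eq)
  let ?a = "p1 x x \<cdot> m'" and ?b = "p2 x x \<cdot> m'"
  have ab: "arr ?a" "arr ?b" "dm ?a = dm ?b" "cd ?a = cd ?b" using m' O by auto
  have ae: "?a \<cdot> e' = a" "?b \<cdot> e' = b" using ab e' m' O J x by auto
  define j0 where "j0 = (SOME j. eqz ?a ?b j)"
  have j0: "eqz ?a ?b j0" unfolding j0_def using equalizer_ex[OF ab] someI_ex by metis
  note J0 = eqzD[OF j0]
  have ea: "?a \<cdot> (e' \<cdot> k) = a \<cdot> k" "?b \<cdot> (e' \<cdot> k) = b \<cdot> k" if "arr k" "cd k = dm a" for k
    using cmp_left_eq[OF ae(1), of k] cmp_left_eq[OF ae(2), of k] that ab e' by auto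
  obtain k where k: "arr k" "dm k = dm (e' \<cdot> j)" "cd k = dm j0" "j0 \<cdot> k = e' \<cdot> j"
    by (rule eqz_lift[OF j0, of "e' \<cdot> j"]) (use ea J e' in auto)
  \<comment> \<open>The equalizer of the span is the preimage under \<open>e'\<close> of the
    equalizer of the image relation.\<close>
  have P: "pb e' j0 j k"
  proof (rule pbI)
    fix s t assume a: "arr s" "arr t" "dm s = dm t" "cd s = dm e'" "cd t = dm j0" "e' \<cdot> s = j0 \<cdot> t"
    have "?a \<cdot> (j0 \<cdot> t) = ?b \<cdot> (j0 \<cdot> t)" by (rule cmp_square[OF J0(7)]) (use a J0 in auto)
    then have "?a \<cdot> (e' \<cdot> s) = ?b \<cdot> (e' \<cdot> s)" unfolding a(6) .
    then have "a \<cdot> s = b \<cdot> s" using ea[of s] a(1,4) e' by simp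
    then obtain h where h: "arr h" "dm h = dm s" "cd h = dm j" "j \<cdot> h = s" by (rule eqz_lift[OF j]) (use a e' in auto)
    have "j0 \<cdot> (k \<cdot> h) = e' \<cdot> (j \<cdot> h)" by (rule cmp_square[OF k(4)]) (use h k J J0 e' in auto)
    then have "j0 \<cdot> (k \<cdot> h) = j0 \<cdot> t" using h a by simp
    then have "k \<cdot> h = t" by (rule monD[OF J0(1)]) (use h k a in auto)
    then show "\<exists>h. arr h \<and> dm h = dm s \<and> cd h = dm j \<and> j \<cdot> h = s \<and> k \<cdot> h = t" using h by blast
  next
    fix h h' assume "arr h" "arr h'" "dm h = dm h'" "cd h = dm j" "cd h' = dm j" "j \<cdot> h = j \<cdot> h'"
    then show "h = h'" using J monD[of j h h'] by auto
  qed (use k J J0 e' in auto)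
  have "sur k" "dg k = dg e" using sur_pb[OF P e'(1)] dg_pb[OF P e'(1)] e' by auto
  then have "D (dm j) = dg e * D (dm j0)" using D_sur[of k] k by simp
  moreover have "tau x (cls m) = D (dm j0)" unfolding tau_def j0_def m'_def ..
  ultimately show ?thesis using sp_eq[OF em] tr_smul tr_bas[OF O r] by simp
qed

lemma pr_cmp_eq_iff:
  assumes "arr a" "arr b" "arr c" "arr d" "dm a = dm b" "dm c = dm d" "cd a = cd c" "cd b = cd d"
    "arr s" "arr t" "cd s = dm a" "cd t = dm c" "dm s = dm t"
  shows "pr a b \<cdot> s = pr c d \<cdot> t \<longleftrightarrow> a \<cdot> s = c \<cdot> t \<and> b \<cdot> s = d \<cdot> t"
proof
  assume "pr a b \<cdot> s = pr c d \<cdot> t"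
  then have e: "pr (a \<cdot> s) (b \<cdot> s) = pr (c \<cdot> t) (d \<cdot> t)" using assms by (simp add: pr_cmp)
  show "a \<cdot> s = c \<cdot> t \<and> b \<cdot> s = d \<cdot> t"
    using pr_eqD[OF e] assms by simp
qed (use assms in \<open>simp add: pr_cmp\<close>)

lemma pb_pr_swap:
  assumes "pb (pr a b) (pr d c) s t" "arr a" "arr b" "arr c" "arr d" "dm a = dm b" "dm c = dm d" "cd a = cd d" "cd b = cd c"
  shows "pb (pr c d) (pr b a) t s"
proof (rule pbI)
  note E = pbD[OF assms(1)]
  have "a \<cdot> s = d \<cdot> t \<and> b \<cdot> s = c \<cdot> t" using E(9) assms E(1-8) by (subst (asm) pr_cmp_eq_iff) auto
  then show "pr c d \<cdot> t = pr b a \<cdot> s" using assms E(1-8) by (subst pr_cmp_eq_iff) auto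
  fix k l assume a: "arr k" "arr l" "dm k = dm l" "cd k = dm (pr c d)" "cd l = dm (pr b a)" "pr c d \<cdot> k = pr b a \<cdot> l"
  have "c \<cdot> k = b \<cdot> l \<and> d \<cdot> k = a \<cdot> l" using a(6) assms a(1-5) by (subst (asm) pr_cmp_eq_iff) auto
  then have "pr a b \<cdot> l = pr d c \<cdot> k" using assms a(1-5) by (subst pr_cmp_eq_iff) auto
  then obtain h where "arr h" "dm h = dm l" "cd h = dm s" "s \<cdot> h = l" "t \<cdot> h = k"
    by (rule pb_lift[OF assms(1)]) (use a assms in auto)
  then show "\<exists>h. arr h \<and> dm h = dm k \<and> cd h = dm t \<and> t \<cdot> h = k \<and> s \<cdot> h = l" using a E by auto
next
  note E = pbD[OF assms(1)]
  fix h h' assume "arr h" "arr h'" "dm h = dm h'" "cd h = dm t" "cd h' = dm t" "t \<cdot> h = t \<cdot> h'" "s \<cdot> h = s \<cdot> h'"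
  then show "h = h'" using pb_eq[OF assms(1), of h h'] E by auto
qed (use pbD[OF assms(1)] assms in auto)

text \<open>Closing up the composite of two spans produces their fibre product over
  \<open>w \<times> x\<close>. This is symmetric in the two factors up to a flip of coordinates, and
  \<open>tr_comm\<close> rests on it.\<close>

lemma tr_co_sp:
  assumes P: "pb (pr a b) (pr d c) s t" and "arr a" "arr b" "arr c" "arr d" "dm a = dm b" "dm c = dm d"
    "cd a = w" "cd d = w" "cd b = x" "cd c = x"
  shows "tr w (co w x w (sp c d) (sp a b)) = D (dm s)"
proof -
  obtain u v where uv: "pb b c u v" "co w x w (sp c d) (sp a b) = sp (a \<cdot> u) (d \<cdot> v)"
    by (rule co_sp_obtain[of a b c d w x w]) (use assms in auto)
  note E = pbD[OF uv(1)]
  obtain j where j: "eqz (a \<cdot> u) (d \<cdot> v) j" by (rule equalizer_ex[of "a \<cdot> u" "d \<cdot> v"]) (use E assms in auto)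
  note J = eqzD[OF j]
  have "pb (pr a b) (pr d c) (u \<cdot> j) (v \<cdot> j)"
  proof (rule pbI)
    have "b \<cdot> (u \<cdot> j) = c \<cdot> (v \<cdot> j)" by (rule cmp_square[OF E(9)]) (use E J assms in auto)
    moreover have "a \<cdot> (u \<cdot> j) = d \<cdot> (v \<cdot> j)" using J(7) J(1-6) E assms by simp
    ultimately show "pr a b \<cdot> (u \<cdot> j) = pr d c \<cdot> (v \<cdot> j)" using E J assms by (subst pr_cmp_eq_iff) auto
    fix k l assume a: "arr k" "arr l" "dm k = dm l" "cd k = dm (pr a b)" "cd l = dm (pr d c)" "pr a b \<cdot> k = pr d c \<cdot> l"
    have kl: "a \<cdot> k = d \<cdot> l" "b \<cdot> k = c \<cdot> l" using a(6) assms a(1-5) by (subst (asm) pr_cmp_eq_iff; simp)+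
    obtain h where h: "arr h" "dm h = dm k" "cd h = dm u" "u \<cdot> h = k" "v \<cdot> h = l"
      by (rule pb_lift[OF uv(1) kl(2)]) (use a assms in auto)
    have "(a \<cdot> u) \<cdot> h = (d \<cdot> v) \<cdot> h" using h kl E assms by simp
    then obtain i where i: "arr i" "dm i = dm h" "cd i = dm j" "j \<cdot> i = h"
      by (rule eqz_lift[OF j]) (use h in auto)
    show "\<exists>h. arr h \<and> dm h = dm k \<and> cd h = dm (u \<cdot> j) \<and> (u \<cdot> j) \<cdot> h = k \<and> (v \<cdot> j) \<cdot> h = l"
      using i h E J by (intro exI[of _ i]) auto
  next
    fix h h' assume a: "arr h" "arr h'" "dm h = dm h'" "cd h = dm (u \<cdot> j)" "cd h' = dm (u \<cdot> j)"
      "(u \<cdot> j) \<cdot> h = (u \<cdot> j) \<cdot> h'" "(v \<cdot> j) \<cdot> h = (v \<cdot> j) \<cdot> h'"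
    have "j \<cdot> h = j \<cdot> h'" by (rule pb_eq[OF uv(1)]) (use a E J in auto)
    then show "h = h'" by (rule monD[OF J(1)]) (use a in auto)
  qed (use E J assms in auto)
  then obtain i where "iso i" "dm i = dm s" "cd i = dm (u \<cdot> j)"
    by (rule pb_unique_iso[OF _ P]) auto
  then show ?thesis using tr_sp[OF j, of w] D_iso[of i] uv(2) assms by simp
qed

lemma tr_comm:
  assumes "f \<in> H w x" "g \<in> H x w" "w \<in> Ob C" "x \<in> Ob C"
  shows "tr w (co w x w g f) = tr x (co x w x f g)"
  using assms(1,3,4)
proof (induction rule: H_induct_sp)
  case (sp a b)
  note ab = sp
  show ?case using assms(2,4,3)
  proof (induction rule: H_induct_sp)
    case (sp c d)
    obtain s t where st: "pb (pr a b) (pr d c) s t" by (rule pullback_ex[of "pr a b" "pr d c"]) (use ab sp in auto)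
    have st': "pb (pr c d) (pr b a) t s" by (rule pb_pr_swap[OF st]) (use ab sp in auto)
    have "tr w (co w x w (sp c d) (sp a b)) = D (dm s)" by (rule tr_co_sp[OF st]) (use ab sp in auto)
    moreover have "tr x (co x w x (sp a b) (sp c d)) = D (dm t)" by (rule tr_co_sp[OF st']) (use ab sp in auto)
    ultimately show ?case using pbD(6)[OF st] by simp
  qed (simp_all add: co_add_left co_smul_left co_add_right co_smul_right tr_add tr_smul)
qed (simp_all add: co_add_left co_smul_left co_add_right co_smul_right tr_add tr_smul)

text \<open>The sum is \<open>omega\<close> of the map from \<open>x\<close> to the terminal object:
  each subobject of \<open>x\<close> surjects onto it, so the condition under the summation sign
  always holds.\<close>

lemma omega_bang:
  assumes "x \<in> Ob C"
  shows "(\<Sum>y\<in>subobjects C x. of_int (mu_sub C x y (whole C x)) * D (sub_obj y)) \<noteq> 0"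
proof -
  have b: "bang x = Ar x (mr (bang x)) tt" by (auto intro: arrow_eqI)
  have "surjective C x tt (mr (bang x))" using surjective_iff[of x tt "mr (bang x)"] b sur_bang[OF assms] assms by simp
  then have om: "omega C \<delta> x tt (mr (bang x)) \<noteq> 0" using nondeg assms unfolding nondegenerate_def by auto
  have "direct_image C x tt (mr (bang x)) y = whole C tt \<and> \<delta> (sub_obj y) tt (restrict_arr C x tt (mr (bang x)) y) = D (sub_obj y)"
    if y: "y \<in> subobjects C x" for y
  proof -
    have m: "mon (rpr x y)" using rpr[OF y assms] by simp
    then have o: "sub_obj y \<in> Ob C" using mon_arr[THEN arr_dm, of "rpr x y"] by simp
    have "bang x \<cdot> rpr x y = bang (sub_obj y)" using bang_eqI[of "bang x \<cdot> rpr x y"] m assms by simp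
    then have r: "restrict_arr C x tt (mr (bang x)) y = mr (bang (sub_obj y))"
      unfolding restrict_arr_def using arg_cong[of _ _ mr] by (metis bang cd_rpr dm_rpr mr_cmp rpr_def arrow.sel(2))
    have "img C (dm (bang (sub_obj y))) (cd (ide tt)) (mr (ide tt \<cdot> bang (sub_obj y))) = cls (ide tt)"
    proof (rule img_eq[OF _ is_image_cls])
      fix n g assume n: "mon n" "arr g" "cd g = dm n" "cd n = cd (ide tt)" "ide tt \<cdot> bang (sub_obj y) = n \<cdot> g"
      then have "iso n" using surD[OF sur_bang[OF o], of n g] o by auto
      then show "\<exists>k. arr k \<and> dm k = dm (ide tt) \<and> cd k = dm n \<and> n \<cdot> k = ide tt"
        using n by (metis cd_ide dm_ide isoE)
    qed (use o in auto)
    then have "img C (sub_obj y) tt (mr (bang (sub_obj y))) = whole C tt" using o by (simp add: whole_cls)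
    then show ?thesis unfolding direct_image_def r by (simp add: D_def dg_def)
  qed
  note K = this
  have "{y \<in> subobjects C x. direct_image C x tt (mr (bang x)) y = whole C tt} = subobjects C x" using K by blast
  moreover have "(\<Sum>y\<in>subobjects C x. of_int (mu_sub C x y (whole C x)) * \<delta> (sub_obj y) tt (restrict_arr C x tt (mr (bang x)) y))
      = (\<Sum>y\<in>subobjects C x. of_int (mu_sub C x y (whole C x)) * D (sub_obj y))"
    by (rule sum.cong) (use K in auto)
  ultimately show ?thesis using om unfolding omega_def by simp
qed

text \<open>The transpose of \<open>p\<^sup>*\<close> of a subobject \<open>v\<close> of \<open>w \<times> x\<close>.\<close>

definition beta :: "'o \<Rightarrow> 'o \<Rightarrow> ('o, 'm) arrow \<Rightarrow> ('o \<times> 'm) set \<Rightarrow> 'k" where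
  "beta w x v = (\<Sum>y\<in>subobjects C (dm v). of_int (mu_sub C (dm v) y (whole C (dm v))) \<star>
     sp (p2 w x \<cdot> v \<cdot> rpr (dm v) y) (p1 w x \<cdot> v \<cdot> rpr (dm v) y))"

text \<open>The fibre product of two subobjects is their meet, in the form required by
  \<open>weisner\<close>.\<close>

lemma meet_props:
  assumes "mon m" "mon n" "pb m n k l" 
  shows "mon (m \<cdot> k)" "s \<in> subobjects C (cd m) \<Longrightarrow>
    sub_le C (cd m) s (cls (m \<cdot> k)) \<longleftrightarrow> sub_le C (cd m) s (cls m) \<and> sub_le C (cd m) s (cls n)"
proof -
  note E = pbD[OF assms(3)]
  have mk: "mon k" using mon_pb[OF assms(2,3)] .
  show mmk: "mon (m \<cdot> k)" by (rule mon_cmp) (use mk assms E in auto)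
  assume s: "s \<in> subobjects C (cd m)"
  define r where "r = rpr (cd m) s"
  have r: "mon r" "cls r = s" "cd r = cd m" using rpr[OF s] assms by (auto simp: r_def)
  have "sub_le C (cd m) (cls r) (cls (m \<cdot> k)) \<longleftrightarrow> sub_le C (cd m) (cls r) (cls m) \<and> sub_le C (cd m) (cls r) (cls n)"
  proof (intro iffI conjI)
    assume "sub_le C (cd m) (cls r) (cls (m \<cdot> k))"
    then obtain g where g: "arr g" "dm g = dm r" "cd g = dm k" "(m \<cdot> k) \<cdot> g = r"
      using sub_le_cls[OF r(1) mmk] r by auto
    have 1: "m \<cdot> (k \<cdot> g) = r" using cmp_assoc[of g k m] g E(1-8) by simp
    have 2: "n \<cdot> (l \<cdot> g) = r" unfolding 1[symmetric] by (rule cmp_square[OF E(9)[symmetric]]) (use g E in auto)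
    have "\<exists>h. arr h \<and> dm h = dm r \<and> cd h = dm m \<and> m \<cdot> h = r" using 1 g E by (intro exI[of _ "k \<cdot> g"]) auto
    then show "sub_le C (cd m) (cls r) (cls m)" using sub_le_cls[OF r(1) assms(1)] r by auto
    have "\<exists>h. arr h \<and> dm h = dm r \<and> cd h = dm n \<and> n \<cdot> h = r" using 2 g E by (intro exI[of _ "l \<cdot> g"]) auto
    then show "sub_le C (cd m) (cls r) (cls n)" using sub_le_cls[OF r(1) assms(2)] r E by auto
  next
    assume a: "sub_le C (cd m) (cls r) (cls m) \<and> sub_le C (cd m) (cls r) (cls n)"
    obtain g where g: "arr g" "dm g = dm r" "cd g = dm m" "m \<cdot> g = r" using a sub_le_cls[OF r(1) assms(1)] r by auto
    obtain h where h: "arr h" "dm h = dm r" "cd h = dm n" "n \<cdot> h = r" using a sub_le_cls[OF r(1) assms(2)] r E by auto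
    obtain i where i: "arr i" "dm i = dm g" "cd i = dm k" "k \<cdot> i = g" "l \<cdot> i = h"
      by (rule pb_lift[OF assms(3), of g h]) (use g h in auto)
    have "(m \<cdot> k) \<cdot> i = r" using cmp_assoc[of i k m] i g E(1-8) by simp
    then have "\<exists>h. arr h \<and> dm h = dm r \<and> cd h = dm (m \<cdot> k) \<and> (m \<cdot> k) \<cdot> h = r" using i g by (intro exI[of _ i]) auto
    then show "sub_le C (cd m) (cls r) (cls (m \<cdot> k))" using sub_le_cls[OF r(1) mmk] r by auto
  qed
  then show "sub_le C (cd m) s (cls (m \<cdot> k)) \<longleftrightarrow> sub_le C (cd m) s (cls m) \<and> sub_le C (cd m) s (cls n)" using r by simp
qed

lemma D_sub_obj_cls: "mon m \<Longrightarrow> D (sub_obj (cls m)) = D (dm m)"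
proof -
  assume m: "mon m"
  have n: "mon (rpr (cd m) (cls m))" "cls (rpr (cd m) (cls m)) = cls m" using rpr[of "cls m" "cd m"] m by auto
  then obtain h where "iso h" "dm h = dm m" "cd h = dm (rpr (cd m) (cls m))"
    using cls_eq_iff[OF m n(1)] by auto
  then show ?thesis using D_iso[of h] by simp
qed

text \<open>The summand of \<open>beta\<close> at \<open>y\<close> pairs with \<open>r\<close> to
  the degree of the meet of \<open>y\<close> with \<open>c\<close>, where \<open>c\<close> is the
  intersection of \<open>v\<close> and \<open>r\<close> seen inside \<open>v\<close>. If
  \<open>c\<close> is a proper subobject of \<open>v\<close>, the Moebius sum vanishes by
  \<open>weisner\<close>. If \<open>c\<close> is all of \<open>v\<close>, the meet is
  \<open>y\<close> itself.\<close>

lemma tr_beta: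
  assumes w: "w \<in> Ob C" and x: "x \<in> Ob C" and v: "mon v" "cd v = prd C w x" and r: "r \<in> subobjects C (prd C w x)"
  shows "tr w (co w x w (beta w x v) (basis_vec r)) = (if sub_le C (prd C w x) (cls v) r
    then \<Sum>y\<in>subobjects C (dm v). of_int (mu_sub C (dm v) y (whole C (dm v))) * D (sub_obj y) else 0)"
proof -
  let ?V = "dm v" and ?X = "prd C w x"
  define m where "m = rpr ?X r"
  have m: "mon m" "cls m = r" "cd m = ?X" using rpr[OF r] w x by (auto simp: m_def)
  have V: "?V \<in> Ob C" using v by simp
  obtain c s0 where c: "pb v m c s0" by (rule pullback_ex[of v m]) (use v m in auto)
  note E = pbD[OF c]
  have mc: "mon c" using mon_pb[OF m(1) c] .
  define kk where "kk y = (SOME k. \<exists>l. pb (rpr ?V y) c k l)" for y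
  have kk: "\<exists>l. pb (rpr ?V y) c (kk y) l" if "y \<in> subobjects C ?V" for y
  proof -
    have "\<exists>k l. pb (rpr ?V y) c k l"
      using pullback_ex[of "rpr ?V y" c] rpr[OF that V] E mc by (metis cd_rpr mon_arr)
    then show ?thesis unfolding kk_def by (rule someI_ex)
  qed
  define i where "i y = cls (rpr ?V y \<cdot> kk y)" for y
  have trm: "tr w (co w x w (sp (p2 w x \<cdot> v \<cdot> rpr ?V y) (p1 w x \<cdot> v \<cdot> rpr ?V y)) (basis_vec r)) = D (sub_obj (i y))"
    if y: "y \<in> subobjects C ?V" for y
  proof -
    obtain l where l: "pb (rpr ?V y) c (kk y) l" using kk[OF y] by blast
    note L = pbD[OF l]
    let ?y = "rpr ?V y"
    have my: "mon ?y" "cd ?y = ?V" using rpr[OF y V] by auto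
    have p: "pb (v \<cdot> ?y) m (kk y) (s0 \<cdot> l)" by (rule pb_paste[OF c l]) (use my in auto)
    have "pr (p1 w x \<cdot> m) (p2 w x \<cdot> m) = m" using m w x by (simp add: pr_proj)
    moreover have "pr (p1 w x \<cdot> v \<cdot> ?y) (p2 w x \<cdot> v \<cdot> ?y) = v \<cdot> ?y" using my v w x by (simp add: pr_proj)
    ultimately have "pb (pr (p1 w x \<cdot> m) (p2 w x \<cdot> m)) (pr (p1 w x \<cdot> v \<cdot> ?y) (p2 w x \<cdot> v \<cdot> ?y)) (s0 \<cdot> l) (kk y)"
      using pb_sym[OF p] by simp
    then have "tr w (co w x w (sp (p2 w x \<cdot> v \<cdot> ?y) (p1 w x \<cdot> v \<cdot> ?y)) (sp (p1 w x \<cdot> m) (p2 w x \<cdot> m))) = D (dm (s0 \<cdot> l))"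
      by (rule tr_co_sp) (use m my v w x in auto)
    moreover have "mon (?y \<cdot> kk y)" using meet_props(1)[OF my(1) mc l] .
    ultimately show ?thesis using D_sub_obj_cls[of "?y \<cdot> kk y"] L bas_eq_sp(1)[OF m_def r w x] by (simp add: i_def)
  qed
  have "tr w (co w x w (beta w x v) (basis_vec r)) =
      (\<Sum>y\<in>subobjects C ?V. of_int (mu_sub C ?V y (whole C ?V)) * D (sub_obj (i y)))"
    unfolding beta_def co_sum_left tr_sum co_smul_left tr_smul by (rule sum.cong) (simp_all add: trm)
  also have "\<dots> = (if sub_le C ?X (cls v) r
    then \<Sum>y\<in>subobjects C ?V. of_int (mu_sub C ?V y (whole C ?V)) * D (sub_obj y) else 0)"
  proof (cases "sub_le C ?X (cls v) r")
    case True
    then obtain g where g: "arr g" "dm g = dm v" "cd g = dm m" "m \<cdot> g = v"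
      using sub_le_cls[OF v(1) m(1)] v m by auto
    obtain h where h: "arr h" "dm h = ?V" "cd h = dm c" "c \<cdot> h = ide ?V" "s0 \<cdot> h = g"
      using pb_lift[OF c, of "ide ?V" g] g v by auto
    have ic: "iso c" by (rule mon_split_iso[OF mc, of h]) (use h E in auto)
    have "D (sub_obj (i y)) = D (sub_obj y)" if y: "y \<in> subobjects C ?V" for y
    proof -
      obtain l where l: "pb (rpr ?V y) c (kk y) l" using kk[OF y] by blast
      have my: "mon (rpr ?V y)" using rpr[OF y V] by simp
      have mk: "mon (kk y)" using mon_pb[OF mc l] .
      have "sur (kk y)" using sur_pb'[OF l] ic by simp
      then have "iso (kk y)" using mk sur_mon_iso by blast
      then show ?thesis using D_sub_obj_cls[OF meet_props(1)[OF my mc l]] D_iso[of "kk y"] pbD[OF l] by (simp add: i_def)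
    qed
    then show ?thesis using True by (simp cong: sum.cong)
  next
    case False
    interpret fin_poset "subobjects C ?V" "sub_le C ?V" by (rule fin_poset_sub[OF V])
    have cV: "cd c = ?V" using E by simp
    have "cls c \<noteq> whole C ?V"
    proof
      assume "cls c = whole C ?V"
      then have "iso c" using cls_eq_whole_iff[OF mc] cV by simp
      then obtain c' where c': "arr c'" "dm c' = cd c" "cd c' = dm c" "c \<cdot> c' = ide (cd c)" by (rule isoE)
      have "m \<cdot> (s0 \<cdot> c') = v \<cdot> (c \<cdot> c')" by (rule cmp_square[OF E(9)[symmetric]]) (use c' E in auto)
      then have "\<exists>g. arr g \<and> dm g = dm v \<and> cd g = dm m \<and> m \<cdot> g = v" using c' E v by (intro exI[of _ "s0 \<cdot> c'"]) auto
      then show False using False sub_le_cls[OF v(1) m(1)] v m by auto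
    qed
    moreover have "i y \<in> subobjects C ?V \<and> (s \<in> subobjects C ?V \<longrightarrow> sub_le C ?V s (i y) \<longleftrightarrow> sub_le C ?V s y \<and> sub_le C ?V s (cls c))"
      if y: "y \<in> subobjects C ?V" for y s
    proof -
      obtain l where l: "pb (rpr ?V y) c (kk y) l" using kk[OF y] by blast
      have my: "mon (rpr ?V y)" "cls (rpr ?V y) = y" using rpr[OF y V] by auto
      show ?thesis using meet_props(1)[OF my(1) mc l] meet_props(2)[OF my(1) mc l, of s] my by (simp add: i_def)
    qed
    ultimately have "(\<Sum>y\<in>subobjects C ?V. of_int (moebius (subobjects C ?V) (sub_le C ?V) y (whole C ?V)) * D (sub_obj (i y))) = 0"
      by (intro weisner[where c = "cls c" and h = "\<lambda>s. D (sub_obj s)"])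
        (use V mc cV whole_in_subobjects sub_le_whole in auto)
    then show ?thesis using False by (simp add: mu_sub_def)
  qed
  finally show ?thesis .
qed

lemma beta_in_H: "w \<in> Ob C \<Longrightarrow> x \<in> Ob C \<Longrightarrow> mon v \<Longrightarrow> cd v = prd C w x \<Longrightarrow> beta w x v \<in> H x w"
  unfolding beta_def
  by (intro H_sum H_smul sp_in_H) (use rpr in auto)

text \<open>By \<open>tr_beta\<close> the matrix of the pairing between the \<open>beta\<close> and
  the basis is the zeta matrix of the subobjects of \<open>w \<times> x\<close> with rows scaled by
  nonzero numbers. Being triangular it can be inverted from the top.\<close>

lemma dual_basis:
  assumes w: "w \<in> Ob C" and x: "x \<in> Ob C" and u: "u \<in> subobjects C (prd C w x)"
  shows "\<exists>b\<in>H x w. \<forall>r\<in>subobjects C (prd C w x). tr w (co w x w b (basis_vec r)) = (if r = u then 1 else 0)"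
proof -
  let ?S = "subobjects C (prd C w x)" and ?le = "sub_le C (prd C w x)"
  have X: "prd C w x \<in> Ob C" using w x by simp
  interpret fin_poset ?S ?le by (rule fin_poset_sub[OF X])
  interpret dual: fin_poset ?S "\<lambda>a b. ?le b a" by (rule dual)
  from u show ?thesis
  proof (induction rule: dual.down_induct)
    case (less u)
    let ?U = "{s \<in> ?S. ?le u s \<and> s \<noteq> u}"
    have "\<forall>s\<in>?U. \<exists>b. b \<in> H x w \<and> (\<forall>r\<in>?S. tr w (co w x w b (basis_vec r)) = (if r = s then 1 else 0))"
      using less(2) by blast
    from bchoice[OF this] obtain b where b: "\<And>s. s \<in> ?U \<Longrightarrow> b s \<in> H x w"
      "\<And>s r. s \<in> ?U \<Longrightarrow> r \<in> ?S \<Longrightarrow> tr w (co w x w (b s) (basis_vec r)) = (if r = s then 1 else 0)"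
      by blast
    define v where "v = rpr (prd C w x) u"
    have v: "mon v" "cls v = u" "cd v = prd C w x" using rpr[OF less(1) X] by (auto simp: v_def)
    define om where "om = (\<Sum>y\<in>subobjects C (dm v). of_int (mu_sub C (dm v) y (whole C (dm v))) * D (sub_obj y))"
    have om: "om \<noteq> 0" unfolding om_def by (rule omega_bang) (use v in simp)
    \<comment> \<open>Up to the factor \<open>om\<close>, \<open>beta\<close> detects all relations
      above \<open>u\<close>; subtracting the duals of the strictly larger ones leaves
      \<open>u\<close> alone.\<close>
    define b' where "b' = (1 / om) \<star> beta w x v - (\<Sum>s\<in>?U. b s)"
    have "b' \<in> H x w" unfolding b'_def using beta_in_H[OF w x v(1,3)] b(1) by (intro H_minus H_smul H_sum) auto
    moreover have "tr w (co w x w b' (basis_vec r)) = (if r = u then 1 else 0)" if r: "r \<in> ?S" for r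
    proof -
      have "(\<Sum>s\<in>?U. tr w (co w x w (b s) (basis_vec r))) = (\<Sum>s\<in>?U. if r = s then 1 else 0)"
        by (rule sum.cong) (use b r in auto)
      also have "\<dots> = (if r \<in> ?U then 1 else 0)" using X by simp
      finally have 1: "(\<Sum>s\<in>?U. tr w (co w x w (b s) (basis_vec r))) = (if r \<in> ?U then 1 else 0)" .
      have "tr w (co w x w b' (basis_vec r)) = (1 / om) * (if ?le u r then om else 0) - (if r \<in> ?U then 1 else 0)"
        unfolding b'_def co_minus_left co_smul_left co_sum_left tr_minus tr_smul tr_sum 1
          tr_beta[OF w x v(1,3) r] v(2) om_def[symmetric] ..
      also have "\<dots> = (if r = u then 1 else 0)" using om r refl by auto
      finally show ?thesis .
    qed
    ultimately show ?case by blast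
  qed
qed

text \<open>The trace pairing is perfect, with a prescribed functional \<open>\<phi>\<close> given
  by its values on the basis; \<open>dual_iota\<close> exploits the freedom in
  \<open>\<phi>\<close>.\<close>

lemma functional_rep:
  assumes w: "w \<in> Ob C" and x: "x \<in> Ob C"
  shows "\<exists>b\<in>H x w. \<forall>a\<in>H w x. tr w (co w x w b a) = (\<Sum>r\<in>subobjects C (prd C w x). a r * \<phi> r)"
proof -
  let ?S = "subobjects C (prd C w x)"
  have "\<forall>u\<in>?S. \<exists>b. b \<in> H x w \<and> (\<forall>r\<in>?S. tr w (co w x w b (basis_vec r)) = (if r = u then 1 else 0))"
    using dual_basis[OF w x] by blast
  from bchoice[OF this] obtain d where d: "\<And>u. u \<in> ?S \<Longrightarrow> d u \<in> H x w"
      "\<And>u r. u \<in> ?S \<Longrightarrow> r \<in> ?S \<Longrightarrow> tr w (co w x w (d u) (basis_vec r)) = (if r = u then 1 else 0)"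
    by blast
  define b where "b = (\<Sum>u\<in>?S. \<phi> u \<star> d u)"
  have bas: "tr w (co w x w b (basis_vec r)) = \<phi> r" if r: "r \<in> ?S" for r
  proof -
    have "tr w (co w x w b (basis_vec r)) = (\<Sum>u\<in>?S. if r = u then \<phi> u else 0)"
      unfolding b_def co_sum_left tr_sum co_smul_left tr_smul by (rule sum.cong) (use d r in auto)
    then show ?thesis using w x r by simp
  qed
  have "b \<in> H x w" unfolding b_def using d by (intro H_sum H_smul) auto
  moreover have "tr w (co w x w b a) = (\<Sum>r\<in>?S. a r * \<phi> r)" if a: "a \<in> H w x" for a
  proof -
    have "tr w (co w x w b a) = tr w (co w x w b (\<Sum>r\<in>?S. a r \<star> basis_vec r))"
      using H_expand[OF a w x] by simp
    also have "\<dots> = (\<Sum>r\<in>?S. a r * \<phi> r)"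
      unfolding co_sum_right co_smul_right tr_sum tr_smul by (rule sum.cong) (use bas in auto)
    finally show ?thesis .
  qed
  ultimately show ?thesis by blast
qed

lemma trace_nondegenerate:
  assumes "a \<in> H w x" "w \<in> Ob C" "x \<in> Ob C" "\<And>b. b \<in> H x w \<Longrightarrow> tr w (co w x w b a) = 0"
  shows "a = 0"
proof
  fix r
  show "a r = 0 r"
  proof (cases "r \<in> subobjects C (prd C w x)")
    case True
    obtain b where b: "b \<in> H x w" "\<forall>a\<in>H w x. tr w (co w x w b a) = (\<Sum>s\<in>subobjects C (prd C w x). a s * (if s = r then 1 else 0))"
      using functional_rep[OF assms(2,3), of "\<lambda>s. if s = r then 1 else 0"] by blast
    have "(\<Sum>s\<in>subobjects C (prd C w x). a s * (if s = r then 1 else 0)) = 0"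
      using assms(4)[OF b(1)] unfolding bspec[OF b(2) assms(1)] .
    then show ?thesis using True assms(2,3) by (simp add: zero_fun_apply if_distrib[of "\<lambda>c. _ * c"] cong: if_cong)
  next
    case False
    then show ?thesis using assms(1) by (simp add: H_iff zero_fun_apply)
  qed
qed

end

section \<open>Relations in exact Mal'cev categories\<close>

locale malcev_category = relation_category C \<delta> for C :: "('o, 'm) cat" and \<delta> :: "'o \<Rightarrow> 'o \<Rightarrow> 'm \<Rightarrow> 'k::field" +
  assumes exact: "exact_cat C"
    and malcev: "malcev_cat C"
begin

text \<open>Membership of the generalized element \<open>(a, b)\<close> in the relation
  \<open>m\<close>.\<close>

definition rl :: "('o, 'm) arrow \<Rightarrow> ('o, 'm) arrow \<Rightarrow> ('o, 'm) arrow \<Rightarrow> bool" where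
  "rl m a b \<longleftrightarrow> (\<exists>h. arr h \<and> dm h = dm a \<and> cd h = dm m \<and> m \<cdot> h = pr a b)"

lemma rel_at_iff:
  assumes "mon m" "cd m = prd C x x" "t \<in> Ob C" "x \<in> Ob C"
  shows "(a, b) \<in> rel_at C x (cls m) t \<longleftrightarrow> arr (Ar t a x) \<and> arr (Ar t b x) \<and> rl m (Ar t a x) (Ar t b x)"
proof (cases "arr (Ar t a x) \<and> arr (Ar t b x)")
  case True
  let ?f = "pr (Ar t a x) (Ar t b x)"
  have "factors C (dm ?f) (cd m) (mr ?f) (cls m) \<longleftrightarrow> (\<exists>g. arr g \<and> dm g = dm ?f \<and> cd g = dm m \<and> m \<cdot> g = ?f)"
    by (rule factors_cls[OF assms(1)]) (use True assms in auto)
  then show ?thesis using True assms by (simp add: rel_at_def rl_def pr_def arr_triple)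
next
  case False
  then show ?thesis using assms by (auto simp: rel_at_def arr_triple)
qed

text \<open>It is enough to test reflexivity on the generic element \<open>ide x\<close>, since any
  pair \<open>(a, a)\<close> is obtained from it by precomposition with \<open>a\<close>.\<close>

lemma malcev_equivalence:
  assumes m: "mon m" "cd m = prd C x x" "x \<in> Ob C" and d: "rl m (ide x) (ide x)"
  shows "equivalence_rel C x (cls m)"
proof -
  have "refl_on (Hom C t x) (rel_at C x (cls m) t)" if t: "t \<in> Ob C" for t
  proof -
    have "(a, a) \<in> rel_at C x (cls m) t" if a: "a \<in> Hom C t x" for a
    proof -
      let ?a = "Ar t a x"
      have A: "arr ?a" using a t m by (simp add: arr_triple)
      obtain h where h: "arr h" "dm h = x" "cd h = dm m" "m \<cdot> h = pr (ide x) (ide x)" using d by (auto simp: rl_def)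
      have "m \<cdot> (h \<cdot> ?a) = pr (ide x) (ide x) \<cdot> ?a" by (rule cmp_left_eq[OF h(4)]) (use h m A in auto)
      also have "\<dots> = pr ?a ?a" using A m by (subst pr_cmp) auto
      finally have "rl m ?a ?a" unfolding rl_def using h A by (intro exI[of _ "h \<cdot> ?a"]) auto
      then show ?thesis using rel_at_iff[OF m(1,2) t m(3)] A by simp
    qed
    moreover have "rel_at C x (cls m) t \<subseteq> Hom C t x \<times> Hom C t x" by (auto simp: rel_at_def)
    ultimately show ?thesis unfolding refl_on_def by blast
  qed
  then have "reflexive_rel C x (cls m)" unfolding reflexive_rel_def using m by auto
  then show ?thesis using malcev m unfolding malcev_cat_def by blast
qed

lemma malcev_trans:
  assumes m: "mon m" "cd m = prd C x x" "x \<in> Ob C" and d: "rl m (ide x) (ide x)"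
    and a: "arr a" "arr b" "arr c" "dm a = dm b" "dm b = dm c" "cd a = x" "cd b = x" "cd c = x"
    and r: "rl m a b" "rl m b c"
  shows "rl m a c"
proof -
  let ?t = "dm a"
  have t: "?t \<in> Ob C" using a by simp
  have e: "Ar ?t (mr a) x = a" "Ar ?t (mr b) x = b" "Ar ?t (mr c) x = c" using a by (auto intro: arrow_eqI)
  have "trans (rel_at C x (cls m) ?t)"
    using malcev_equivalence[OF m d] t unfolding equivalence_rel_def by (auto elim: equivE)
  moreover have "(mr a, mr b) \<in> rel_at C x (cls m) ?t" "(mr b, mr c) \<in> rel_at C x (cls m) ?t"
    using rel_at_iff[OF m(1,2) t m(3)] e a r by auto
  ultimately have "(mr a, mr c) \<in> rel_at C x (cls m) ?t" by (rule transD)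
  then show ?thesis using rel_at_iff[OF m(1,2) t m(3)] e by auto
qed

text \<open>Difunctionality: apply transitivity to the relation \<open>u \<sim> v \<longleftrightarrow> (u\<^sub>1, v\<^sub>2) \<in> m\<close> on the elements of \<open>m\<close>.\<close>

lemma difunctional:
  assumes m: "mon m" "cd m = prd C x y" "x \<in> Ob C" "y \<in> Ob C"
    and h: "arr h1" "arr h2" "arr h3" "cd h1 = dm m" "cd h2 = dm m" "cd h3 = dm m"
    and e: "p2 x y \<cdot> m \<cdot> h1 = p2 x y \<cdot> m \<cdot> h2" "p1 x y \<cdot> m \<cdot> h2 = p1 x y \<cdot> m \<cdot> h3"
  obtains k where "arr k" "dm k = dm h1" "cd k = dm m"
    "p1 x y \<cdot> m \<cdot> k = p1 x y \<cdot> m \<cdot> h1" "p2 x y \<cdot> m \<cdot> k = p2 x y \<cdot> m \<cdot> h3"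
proof -
  let ?R = "dm m"
  let ?a = "p1 x y \<cdot> m" and ?b = "p2 x y \<cdot> m"
  have R: "?R \<in> Ob C" using m by simp
  have ab: "arr ?a" "arr ?b" "dm ?a = ?R" "dm ?b = ?R" "cd ?a = x" "cd ?b = y" using m by auto
  have dd: "dm h1 = dm h2" "dm h2 = dm h3" using arg_cong[OF e(1), of dm] arg_cong[OF e(2), of dm] by auto
  let ?w = "pr (?a \<cdot> p1 ?R ?R) (?b \<cdot> p2 ?R ?R)"
  have w: "arr ?w" using ab R by auto
  obtain n l where nl: "pb ?w m n l" by (rule pullback_ex[of ?w m]) (use w m ab in auto)
  note N = pbD[OF nl]
  have mn: "mon n" using mon_pb[OF m(1) nl] .
  have cn: "cd n = prd C ?R ?R" using N ab by simp
  have wuv: "?w \<cdot> pr u v = pr (?a \<cdot> u) (?b \<cdot> v)" if "arr u" "arr v" "dm u = dm v" "cd u = ?R" "cd v = ?R" for u v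
  proof -
    have "?w \<cdot> pr u v = pr ((?a \<cdot> p1 ?R ?R) \<cdot> pr u v) ((?b \<cdot> p2 ?R ?R) \<cdot> pr u v)"
      by (rule pr_cmp) (use that ab R in auto)
    also have "(?a \<cdot> p1 ?R ?R) \<cdot> pr u v = ?a \<cdot> (p1 ?R ?R \<cdot> pr u v)" by (rule cmp_assoc) (use that ab R in auto)
    also have "(?b \<cdot> p2 ?R ?R) \<cdot> pr u v = ?b \<cdot> (p2 ?R ?R \<cdot> pr u v)" by (rule cmp_assoc) (use that ab R in auto)
    finally show ?thesis using that by simp
  qed
  have rn: "rl n u v \<longleftrightarrow> rl m (?a \<cdot> u) (?b \<cdot> v)"
    if uv: "arr u" "arr v" "dm u = dm v" "cd u = ?R" "cd v = ?R" for u v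
  proof
    assume "rl n u v"
    then obtain h where h: "arr h" "dm h = dm u" "cd h = dm n" "n \<cdot> h = pr u v" by (auto simp: rl_def)
    have "m \<cdot> (l \<cdot> h) = ?w \<cdot> (n \<cdot> h)" by (rule cmp_square[OF N(9)[symmetric]]) (use N(1-8) h(1-3) in auto)
    then have "m \<cdot> (l \<cdot> h) = pr (?a \<cdot> u) (?b \<cdot> v)" using h wuv[OF uv] by simp
    then show "rl m (?a \<cdot> u) (?b \<cdot> v)" unfolding rl_def using h N by (intro exI[of _ "l \<cdot> h"]) auto
  next
    assume "rl m (?a \<cdot> u) (?b \<cdot> v)"
    then obtain g where g: "arr g" "dm g = dm u" "cd g = dm m" "m \<cdot> g = pr (?a \<cdot> u) (?b \<cdot> v)" by (auto simp: rl_def)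
    have "?w \<cdot> pr u v = m \<cdot> g" using wuv[OF uv] g by simp
    then obtain h where "arr h" "dm h = dm (pr u v)" "cd h = dm n" "n \<cdot> h = pr u v" "l \<cdot> h = g"
      by (rule pb_lift[OF nl]) (use uv g ab R in auto)
    then show "rl n u v" unfolding rl_def by auto
  qed
  have am: "pr (?a \<cdot> u) (?b \<cdot> u) = m \<cdot> u" if "arr u" "cd u = ?R" for u
  proof -
    have "pr (?a \<cdot> u) (?b \<cdot> u) = pr ?a ?b \<cdot> u" by (rule pr_cmp[symmetric]) (use that ab in auto)
    also have "pr ?a ?b = m" using m by (simp add: pr_proj)
    finally show ?thesis .
  qed
  have diag: "rl n u u" if "arr u" "cd u = ?R" for u
  proof -
    have "rl m (?a \<cdot> u) (?b \<cdot> u)" unfolding rl_def using am[OF that] that by (intro exI[of _ u]) auto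
    then show ?thesis using rn[of u u] that by simp
  qed
  have e': "?b \<cdot> h1 = ?b \<cdot> h2" "?a \<cdot> h2 = ?a \<cdot> h3" using e m h by auto
  \<comment> \<open>\<open>h1 \<sim> h2\<close> because the second coordinates of \<open>h1\<close>
    and \<open>h2\<close> agree, and \<open>h2 \<sim> h3\<close> because the first coordinates of
    \<open>h2\<close> and \<open>h3\<close> do. Transitivity then produces the point
    \<open>k\<close>.\<close>
  have 1: "rl n h1 h2"
  proof -
    have "rl m (?a \<cdot> h1) (?b \<cdot> h1)" unfolding rl_def using am[OF h(1,4)] h by (intro exI[of _ h1]) auto
    then show ?thesis using rn[OF h(1,2) dd(1) h(4,5)] e'(1) by simp
  qed
  have 2: "rl n h2 h3"
  proof -
    have "rl m (?a \<cdot> h3) (?b \<cdot> h3)" unfolding rl_def using am[OF h(3,6)] h by (intro exI[of _ h3]) auto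
    then show ?thesis using rn[OF h(2,3) dd(2) h(5,6)] e'(2) by simp
  qed
  have "rl n h1 h3"
    by (rule malcev_trans[OF mn cn R diag _ _ _ _ _ _ _ _ 1 2]) (use h dd R in auto)
  then have "rl m (?a \<cdot> h1) (?b \<cdot> h3)" using rn[of h1 h3] h dd by simp
  then obtain k where k: "arr k" "dm k = dm h1" "cd k = ?R" "m \<cdot> k = pr (?a \<cdot> h1) (?b \<cdot> h3)" by (auto simp: rl_def)
  have "p1 x y \<cdot> (m \<cdot> k) = ?a \<cdot> h1" "p2 x y \<cdot> (m \<cdot> k) = ?b \<cdot> h3"
    unfolding k(4) using h ab dd m by auto
  then show ?thesis using that k h m by simp
qed

text \<open>Effectiveness in terms of generalized elements: the reflexive relation is an equivalence
  relation by the Mal'cev property, hence the kernel pair of its quotient map.\<close>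

lemma rl_iff_kernel:
  assumes "mon n" "cd n = prd C x x" "x \<in> Ob C" "rl n (ide x) (ide x)"
  obtains e where "sur e" "dm e = x"
    "\<And>u v. \<lbrakk>arr u; arr v; dm u = dm v; cd u = x; cd v = x\<rbrakk> \<Longrightarrow> e \<cdot> u = e \<cdot> v \<longleftrightarrow> rl n u v"
proof -
  have "effective_rel C x (cls n)"
    using exact malcev_equivalence[OF assms] assms unfolding exact_cat_def by blast
  then obtain z q where z: "z \<in> Ob C" and q: "surjective C x z q"
    and P: "is_pullback C x x z q q (sub_obj (cls n))
       (restrict_arr C (prd C x x) x (proj1 C x x) (cls n)) (restrict_arr C (prd C x x) x (proj2 C x x) (cls n))"
    unfolding effective_rel_def by blast
  define e where "e = Ar x q z"
  have e: "sur e" "dm e = x" "cd e = z" using q surjective_iff[OF assms(3) z] by (auto simp: e_def)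
  define n' where "n' = rpr (prd C x x) (cls n)"
  have n': "mon n'" "cls n' = cls n" "cd n' = prd C x x" using rpr[of "cls n" "prd C x x"] assms by (auto simp: n'_def)
  have f: "p1 x x \<cdot> n' = Ar (sub_obj (cls n)) (restrict_arr C (prd C x x) x (proj1 C x x) (cls n)) x"
    "p2 x x \<cdot> n' = Ar (sub_obj (cls n)) (restrict_arr C (prd C x x) x (proj2 C x x) (cls n)) x"
    by (auto intro!: arrow_eqI simp: mr_cmp restrict_arr_def p1_def p2_def n'_def rpr_def)
  have "q \<in> Hom C x z" using sur_arr[OF e(1)] by (simp add: e_def arr_triple)
  then have pb: "pb e e (p1 x x \<cdot> n') (p2 x x \<cdot> n')"
    using is_pullback_iff[OF assms(3,3) z, of q q] P unfolding f e_def by simp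
  note B = pbD[OF pb]
  obtain h where h: "iso h" "dm h = dm n" "cd h = dm n'" "n' \<cdot> h = n" using cls_eq_iff[of n n'] n' assms by auto
  obtain h' where h': "arr h'" "dm h' = dm n'" "cd h' = dm n" "n \<cdot> h' = n'"
  proof -
    obtain h' where "iso h'" "dm h' = dm n'" "cd h' = dm n" "n \<cdot> h' = n'" using cls_eq_iff[of n' n] n' assms by auto
    then show thesis using that iso_arr' by blast
  qed
  have "e \<cdot> u = e \<cdot> v \<longleftrightarrow> rl n u v" if uv: "arr u" "arr v" "dm u = dm v" "cd u = x" "cd v = x" for u v
  proof
    assume "e \<cdot> u = e \<cdot> v"
    then obtain g where g: "arr g" "dm g = dm u" "cd g = dm (p1 x x \<cdot> n')" "(p1 x x \<cdot> n') \<cdot> g = u" "(p2 x x \<cdot> n') \<cdot> g = v"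
      by (rule pb_lift[OF pb]) (use uv e in auto)
    have "n' \<cdot> g = pr u v"
      by (rule prd_eqI[of x x]) (use g n' uv assms in auto)
    then have "n \<cdot> (h' \<cdot> g) = pr u v" using cmp_left_eq[OF h'(4), of g] h' g assms by simp
    then show "rl n u v" unfolding rl_def using h' g by (intro exI[of _ "h' \<cdot> g"]) auto
  next
    assume "rl n u v"
    then obtain g where g: "arr g" "dm g = dm u" "cd g = dm n" "n \<cdot> g = pr u v" by (auto simp: rl_def)
    have ng: "n' \<cdot> (h \<cdot> g) = pr u v" using cmp_left_eq[OF h(4), of g] h g n' by simp
    have "p1 x x \<cdot> (n' \<cdot> (h \<cdot> g)) = u" "p2 x x \<cdot> (n' \<cdot> (h \<cdot> g)) = v" unfolding ng using uv by auto
    then have uv': "(p1 x x \<cdot> n') \<cdot> (h \<cdot> g) = u" "(p2 x x \<cdot> n') \<cdot> (h \<cdot> g) = v" using h g n' assms by auto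
    have "e \<cdot> ((p1 x x \<cdot> n') \<cdot> (h \<cdot> g)) = e \<cdot> ((p2 x x \<cdot> n') \<cdot> (h \<cdot> g))"
      by (rule cmp_square[OF B(9)]) (use B h g n' assms in auto)
    then show "e \<cdot> u = e \<cdot> v" unfolding uv' .
  qed
  then show ?thesis using that e by blast
qed

text \<open>Let \<open>e\<close> be the quotient of the first end by the relation \<open>n\<close>
  of having a common partner at the second end. Then \<open>e \<cdot> a\<close> is constant on the
  fibres of \<open>b\<close> and induces \<open>f\<close>. A point of the fibre product of
  \<open>e\<close> and \<open>f\<close> gives a zigzag of related pairs, which difunctionality
  contracts to a single pair.\<close>

lemma surjective_relation_pullback:
  assumes a: "sur a" "sur b" "dm a = dm b" and m: "mon (pr a b)"
  obtains e f where "sur e" "sur f" "dm e = cd a" "dm f = cd b" "pb e f a b"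
proof -
  let ?x = "cd a" and ?y = "cd b" and ?m = "pr a b"
  have O: "?x \<in> Ob C" "?y \<in> Ob C" using a by auto
  obtain s t where st: "pb b b s t" by (rule pullback_ex[of b b]) (use a in auto)
  note S = pbD[OF st]
  have as: "arr (a \<cdot> s)" "arr (a \<cdot> t)" "dm (a \<cdot> s) = dm (a \<cdot> t)" using a S by auto
  then obtain q n where qn: "sur q" "mon n" "cd q = dm n" "n \<cdot> q = pr (a \<cdot> s) (a \<cdot> t)"
    using factorization[of "pr (a \<cdot> s) (a \<cdot> t)"] by auto
  have cn: "cd n = prd C ?x ?x" and dq: "dm q = dm s" using arg_cong[OF qn(4), of cd] arg_cong[OF qn(4), of dm] by auto
  have rlI: "rl n (a \<cdot> u) (a \<cdot> v)" if uv: "arr u" "arr v" "cd u = dm b" "cd v = dm b" "b \<cdot> u = b \<cdot> v" for u v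
  proof -
    have duv: "dm u = dm v" using arg_cong[OF uv(5), of dm] by simp
    obtain h where h: "arr h" "dm h = dm u" "cd h = dm s" "s \<cdot> h = u" "t \<cdot> h = v"
      by (rule pb_lift[OF st uv(5)]) (use uv in auto)
    have "n \<cdot> (q \<cdot> h) = pr (a \<cdot> s) (a \<cdot> t) \<cdot> h" by (rule cmp_left_eq[OF qn(4)]) (use qn h dq in auto)
    also have "\<dots> = pr ((a \<cdot> s) \<cdot> h) ((a \<cdot> t) \<cdot> h)" by (rule pr_cmp) (use as h in auto)
    also have "\<dots> = pr (a \<cdot> u) (a \<cdot> v)" using h S a by simp
    finally show ?thesis unfolding rl_def using h qn dq by (intro exI[of _ "q \<cdot> h"]) auto
  qed
  \<comment> \<open>Reflexivity is clear for elements of the form \<open>a \<cdot> u\<close>; it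
    descends along the surjection \<open>a\<close> by orthogonality.\<close>
  have diag: "rl n (ide ?x) (ide ?x)"
  proof -
    have "rl n (a \<cdot> ide (dm a)) (a \<cdot> ide (dm a))" by (rule rlI) (use a in auto)
    then obtain h where h: "arr h" "dm h = dm a" "cd h = dm n" "n \<cdot> h = pr a a" using a by (auto simp: rl_def)
    have "n \<cdot> h = pr (ide ?x) (ide ?x) \<cdot> a" using h a by (simp add: pr_cmp)
    then obtain d where "arr d" "dm d = cd a" "cd d = dm n" "n \<cdot> d = pr (ide ?x) (ide ?x)" "d \<cdot> a = h"
      by (rule orth[OF a(1) qn(2)]) (use h a in auto)
    then show ?thesis unfolding rl_def by auto
  qed
  obtain e where e: "sur e" "dm e = ?x"
    and ker: "\<And>u v. \<lbrakk>arr u; arr v; dm u = dm v; cd u = ?x; cd v = ?x\<rbrakk> \<Longrightarrow> e \<cdot> u = e \<cdot> v \<longleftrightarrow> rl n u v"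
    using rl_iff_kernel[OF qn(2) cn O(1) diag] by blast
  obtain f where f: "arr f" "dm f = cd b" "cd f = cd (e \<cdot> a)" "f \<cdot> b = e \<cdot> a"
  proof (rule sur_coeq[OF a(2), of "e \<cdot> a"])
    fix u v assume uv: "arr u" "arr v" "dm u = dm v" "cd u = dm b" "cd v = dm b" "b \<cdot> u = b \<cdot> v"
    have "e \<cdot> (a \<cdot> u) = e \<cdot> (a \<cdot> v)" using rlI[OF uv(1,2,4,5,6)] ker[of "a \<cdot> u" "a \<cdot> v"] uv a by simp
    then show "(e \<cdot> a) \<cdot> u = (e \<cdot> a) \<cdot> v" using uv a e by simp
  qed (use a e in auto)
  have sf: "sur f" by (rule sur_cancel[of f b]) (use f a e in auto)
  have "pb e f a b"
  proof (rule pbI)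
    fix k l assume kl: "arr k" "arr l" "dm k = dm l" "cd k = dm e" "cd l = dm f" "e \<cdot> k = f \<cdot> l"
    obtain d c where c: "sur c" "arr d" "cd c = dm l" "dm d = dm c" "cd d = dm b" "b \<cdot> d = l \<cdot> c"
      by (rule cover[OF a(2), of l]) (use kl f in auto)
    have "e \<cdot> (k \<cdot> c) = f \<cdot> (l \<cdot> c)" by (rule cmp_square[OF kl(6)]) (use kl c e f in auto)
    also have "\<dots> = e \<cdot> (a \<cdot> d)" unfolding c(6)[symmetric] by (rule cmp_square[OF f(4)]) (use c a e f in auto)
    finally have "rl n (k \<cdot> c) (a \<cdot> d)" using ker[of "k \<cdot> c" "a \<cdot> d"] kl c a e by simp
    then obtain g where g: "arr g" "dm g = dm c" "cd g = dm n" "n \<cdot> g = pr (k \<cdot> c) (a \<cdot> d)" by (auto simp: rl_def)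
    \<comment> \<open>\<open>n\<close> is only an image, so the common partner of \<open>k\<close>
      and \<open>a \<cdot> d\<close> exists on a further cover \<open>c2\<close>.\<close>
    obtain g2 c2 where c2: "sur c2" "arr g2" "cd c2 = dm g" "dm g2 = dm c2" "cd g2 = dm q" "q \<cdot> g2 = g \<cdot> c2"
      by (rule cover[OF qn(1), of g]) (use g qn in auto)
    have "pr (a \<cdot> s) (a \<cdot> t) \<cdot> g2 = n \<cdot> (q \<cdot> g2)" by (rule cmp_left_eq[OF qn(4), symmetric]) (use qn c2 in auto)
    also have "\<dots> = pr (k \<cdot> c) (a \<cdot> d) \<cdot> c2" unfolding c2(6) by (rule cmp_left_eq[OF g(4)]) (use qn g c2 in auto)
    finally have pq: "pr (a \<cdot> s) (a \<cdot> t) \<cdot> g2 = pr (k \<cdot> c) (a \<cdot> d) \<cdot> c2" .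
    have "(a \<cdot> s) \<cdot> g2 = (k \<cdot> c) \<cdot> c2 \<and> (a \<cdot> t) \<cdot> g2 = (a \<cdot> d) \<cdot> c2"
      by (rule pr_cmp_eq_iff[THEN iffD1, OF _ _ _ _ _ _ _ _ _ _ _ _ _ pq]) (use as c2(1-5) c(1-5) kl(1-5) g(1-3) dq a e(2) S(1-8) in auto)
    then have eq: "a \<cdot> (s \<cdot> g2) = (k \<cdot> c) \<cdot> c2" "a \<cdot> (t \<cdot> g2) = (a \<cdot> d) \<cdot> c2"
      using c2(1-5) dq a S(1-8) by auto
    have bst: "b \<cdot> (s \<cdot> g2) = b \<cdot> (t \<cdot> g2)" by (rule cmp_square[OF S(9)]) (use S c2 dq in auto)
    have cc: "sur (c \<cdot> c2)" using c c2 g by simp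
    have ppr: "p1 ?x ?y \<cdot> ?m \<cdot> h = a \<cdot> h" "p2 ?x ?y \<cdot> ?m \<cdot> h = b \<cdot> h" if "arr h" "cd h = dm a" for h
      using cmp_left_eq[OF p1_pr[of a b ?x ?y], of h] cmp_left_eq[OF p2_pr[of a b ?x ?y], of h] that a O by auto
    \<comment> \<open>The zigzag: \<open>s \<cdot> g2\<close> lies over \<open>k\<close> and shares
      its second coordinate with \<open>t \<cdot> g2\<close>, which shares its first coordinate with
      \<open>d \<cdot> c2\<close>, which lies over \<open>l\<close>. So \<open>h\<close> lies over
      \<open>(k, l)\<close> on the cover, and \<open>j\<close> is its descent.\<close>
    obtain h where h: "arr h" "dm h = dm (s \<cdot> g2)" "cd h = dm ?m"
      "p1 ?x ?y \<cdot> ?m \<cdot> h = p1 ?x ?y \<cdot> ?m \<cdot> (s \<cdot> g2)" "p2 ?x ?y \<cdot> ?m \<cdot> h = p2 ?x ?y \<cdot> ?m \<cdot> (d \<cdot> c2)"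
    proof (rule difunctional[OF m _ O, of "s \<cdot> g2" "t \<cdot> g2" "d \<cdot> c2"])
      show "p2 ?x ?y \<cdot> ?m \<cdot> s \<cdot> g2 = p2 ?x ?y \<cdot> ?m \<cdot> t \<cdot> g2"
        using ppr(2)[of "s \<cdot> g2"] ppr(2)[of "t \<cdot> g2"] bst S c2 dq a by simp
      show "p1 ?x ?y \<cdot> ?m \<cdot> t \<cdot> g2 = p1 ?x ?y \<cdot> ?m \<cdot> d \<cdot> c2"
        using ppr(1)[of "t \<cdot> g2"] ppr(1)[of "d \<cdot> c2"] eq S c c2 g dq a by simp
    qed (use S c c2 g dq a in auto)
    have ah: "a \<cdot> h = (k \<cdot> c) \<cdot> c2" using h(1-4) ppr(1)[of h] ppr(1)[of "s \<cdot> g2"] eq(1) S c2 dq a by simp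
    have bh: "b \<cdot> h = l \<cdot> (c \<cdot> c2)"
    proof -
      have "b \<cdot> h = b \<cdot> (d \<cdot> c2)" using h(1-3,5) ppr(2)[of h] ppr(2)[of "d \<cdot> c2"] c c2 g a by simp
      also have "\<dots> = l \<cdot> (c \<cdot> c2)" by (rule cmp_square[OF c(6)]) (use c c2 g a kl f in auto)
      finally show ?thesis .
    qed
    have "?m \<cdot> h = pr (a \<cdot> h) (b \<cdot> h)" by (rule pr_cmp) (use h a in auto)
    also have "\<dots> = pr (k \<cdot> (c \<cdot> c2)) (l \<cdot> (c \<cdot> c2))" using ah bh kl c c2 g by simp
    also have "\<dots> = pr k l \<cdot> (c \<cdot> c2)" by (rule pr_cmp[symmetric]) (use kl c c2 g in auto)
    finally have "?m \<cdot> h = pr k l \<cdot> (c \<cdot> c2)" .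
    then obtain j where j: "arr j" "dm j = cd (c \<cdot> c2)" "cd j = dm ?m" "?m \<cdot> j = pr k l" "j \<cdot> (c \<cdot> c2) = h"
      by (rule orth[OF cc m]) (use h kl c in auto)
    have "a \<cdot> j = k" "b \<cdot> j = l"
      using ppr(1)[of j] ppr(2)[of j] j(1-3) kl e f unfolding j(4) by auto
    then show "\<exists>h. arr h \<and> dm h = dm k \<and> cd h = dm a \<and> a \<cdot> h = k \<and> b \<cdot> h = l"
      using j c kl by (intro exI[of _ j]) auto
  next
    fix h h' assume "arr h" "arr h'" "dm h = dm h'" "cd h = dm a" "cd h' = dm a" "a \<cdot> h = a \<cdot> h'" "b \<cdot> h = b \<cdot> h'"
    then show "h = h'" using mon_prD[OF m _ _ a(3), of h h'] a by simp
  qed (use a e f in auto)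
  then show ?thesis using that e sf f by blast
qed

text \<open>Goursat's lemma: after replacing the ends by the images of the two projections, the
  relation has surjective projections, and it is the fibre product over the common target of
  \<open>e\<close> and \<open>f\<close>.\<close>

lemma relation_factor:
  assumes m: "mon m" "cd m = prd C x y" "x \<in> Ob C" "y \<in> Ob C"
  obtains i a j b e f where "mon i" "mon j" "sur a" "sur b" "sur e" "sur f" "cd i = x" "cd j = y"
    "cd a = dm i" "cd b = dm j" "dm e = dm i" "dm f = dm j" "pb e f a b" "p1 x y \<cdot> m = i \<cdot> a" "p2 x y \<cdot> m = j \<cdot> b"
proof -
  have "arr (p1 x y \<cdot> m)" "arr (p2 x y \<cdot> m)" using m by auto
  then obtain a i b j where ai: "sur a" "mon i" "cd a = dm i" "i \<cdot> a = p1 x y \<cdot> m"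
    and bj: "sur b" "mon j" "cd b = dm j" "j \<cdot> b = p2 x y \<cdot> m"
    using factorization by metis
  have d: "dm a = dm m" "dm b = dm m" "cd i = x" "cd j = y"
    using arg_cong[OF ai(4), of dm] arg_cong[OF bj(4), of dm] arg_cong[OF ai(4), of cd] arg_cong[OF bj(4), of cd] by auto
  have "mon (pr a b)"
  proof (rule mon_prI)
    fix h k assume hk: "arr h" "arr k" "dm h = dm k" "cd h = dm a" "cd k = dm a" "a \<cdot> h = a \<cdot> k" "b \<cdot> h = b \<cdot> k"
    have "p1 x y \<cdot> (m \<cdot> u) = i \<cdot> (a \<cdot> u)" "p2 x y \<cdot> (m \<cdot> u) = j \<cdot> (b \<cdot> u)" if "arr u" "cd u = dm m" for u
      using cmp_square[OF ai(4), of u] cmp_square[OF bj(4), of u] that ai bj d m by auto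
    then have "m \<cdot> h = m \<cdot> k" using hk d m by - (rule prd_eqI[of x y], auto)
    then show "h = k" using hk d m by - (rule monD[of m], auto)
  qed (use ai bj d in auto)
  then obtain e f where "sur e" "sur f" "dm e = cd a" "dm f = cd b" "pb e f a b"
    using surjective_relation_pullback[OF ai(1) bj(1)] d by metis
  then show ?thesis using that[of i j a b e f] ai bj d by simp
qed

section \<open>The size of an object\<close>

text \<open>Subobjects of \<open>x \<times> x\<close> are counted because proper quotients of \<open>x\<close>, too, have fewer of them.\<close>

definition sz :: "'o \<Rightarrow> nat" where "sz x = card (subobjects C (prd C x x))"

lemma split_epi_sur: "arr f \<Longrightarrow> arr s \<Longrightarrow> cd s = dm f \<Longrightarrow> dm s = cd f \<Longrightarrow> f \<cdot> s = ide (cd f) \<Longrightarrow> sur f"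
  by (rule sur_cancel[of f s]) auto

lemma sur_p1: "x \<in> Ob C \<Longrightarrow> sur (p1 x x)"
  by (rule split_epi_sur[of _ "pr (ide x) (ide x)"]) auto

text \<open>Pushing subobjects forward along a mono is injective. If it is also onto, the whole
  target is a pushforward, so \<open>n\<close> is surjective.\<close>

lemma mon_card:
  assumes n: "mon n"
  shows "card (subobjects C (dm n)) \<le> card (subobjects C (cd n))"
    "card (subobjects C (dm n)) = card (subobjects C (cd n)) \<Longrightarrow> iso n"
proof -
  let ?X = "dm n" and ?Y = "cd n"
  have O: "?X \<in> Ob C" "?Y \<in> Ob C" using n by auto
  let ?F = "\<lambda>s. cls (n \<cdot> rpr ?X s)"
  have F: "?F s \<in> subobjects C ?Y" if "s \<in> subobjects C ?X" for s using rpr[OF that O(1)] n by simp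
  have inj: "inj_on ?F (subobjects C ?X)"
  proof (rule inj_onI)
    fix s s' assume s: "s \<in> subobjects C ?X" "s' \<in> subobjects C ?X" "?F s = ?F s'"
    note r = rpr[OF s(1) O(1)] rpr[OF s(2) O(1)]
    obtain h where h: "iso h" "dm h = dm (rpr ?X s)" "cd h = dm (rpr ?X s')" "(n \<cdot> rpr ?X s') \<cdot> h = n \<cdot> rpr ?X s"
      using cls_eq_iff[of "n \<cdot> rpr ?X s" "n \<cdot> rpr ?X s'"] s(3) r n by auto
    have "n \<cdot> (rpr ?X s' \<cdot> h) = n \<cdot> rpr ?X s" using h r n by simp
    then have "rpr ?X s' \<cdot> h = rpr ?X s" using h r n by - (rule monD[OF n], auto)
    then have "cls (rpr ?X s) = cls (rpr ?X s')" using cls_eqI[of "rpr ?X s'" h] r h by simp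
    then show "s = s'" using r by simp
  qed
  have sub: "?F ` subobjects C ?X \<subseteq> subobjects C ?Y" using F by blast
  show "card (subobjects C ?X) \<le> card (subobjects C ?Y)" using card_inj_on_le[OF inj sub] O by simp
  assume "card (subobjects C ?X) = card (subobjects C ?Y)"
  then have "?F ` subobjects C ?X = subobjects C ?Y"
    using card_subset_eq[OF _ sub] card_image[OF inj] O by simp
  then obtain s where s: "s \<in> subobjects C ?X" "whole C ?Y = ?F s" using whole_in_subobjects[OF O(2)] by blast
  have "iso (n \<cdot> rpr ?X s)" using cls_eq_whole_iff[of "n \<cdot> rpr ?X s"] s rpr[OF s(1) O(1)] n by simp
  then have "sur n" using rpr[OF s(1) O(1)] n by (intro sur_cancel[of n "rpr ?X s"]) auto
  then show "iso n" using n sur_mon_iso by blast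
qed

text \<open>Apply \<open>mon_card\<close> to \<open>i \<times> i\<close>. If that is invertible, a
  projection shows that \<open>i\<close> is surjective.\<close>

lemma sz_mon:
  assumes i: "mon i"
  shows "sz (dm i) \<le> sz (cd i)" "sz (dm i) = sz (cd i) \<Longrightarrow> iso i"
proof -
  let ?y = "dm i" and ?x = "cd i"
  have O: "?y \<in> Ob C" "?x \<in> Ob C" using i by auto
  let ?n = "pr (i \<cdot> p1 ?y ?y) (i \<cdot> p2 ?y ?y)"
  have n: "mon ?n"
  proof (rule mon_prI)
    fix h k assume a: "arr h" "arr k" "dm h = dm k" "cd h = dm (i \<cdot> p1 ?y ?y)" "cd k = dm (i \<cdot> p1 ?y ?y)"
      "(i \<cdot> p1 ?y ?y) \<cdot> h = (i \<cdot> p1 ?y ?y) \<cdot> k" "(i \<cdot> p2 ?y ?y) \<cdot> h = (i \<cdot> p2 ?y ?y) \<cdot> k"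
    have "i \<cdot> (p1 ?y ?y \<cdot> h) = i \<cdot> (p1 ?y ?y \<cdot> k)" "i \<cdot> (p2 ?y ?y \<cdot> h) = i \<cdot> (p2 ?y ?y \<cdot> k)" using a O i by auto
    then have "p1 ?y ?y \<cdot> h = p1 ?y ?y \<cdot> k" "p2 ?y ?y \<cdot> h = p2 ?y ?y \<cdot> k"
      using a(1-5) O i by (auto intro: monD[OF i])
    then show "h = k" using a O by - (rule prd_eqI[of ?y ?y], auto)
  qed (use i O in auto)
  show "sz ?y \<le> sz ?x" using mon_card(1)[OF n] by (simp add: sz_def)
  assume "sz ?y = sz ?x"
  then have "iso ?n" using mon_card(2)[OF n] by (simp add: sz_def)
  then have "sur (p1 ?x ?x \<cdot> ?n)" using O i by (intro sur_cmp) (auto simp: sur_p1)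
  then have "sur (i \<cdot> p1 ?y ?y)" using i O by simp
  then have "sur i" using i O by (intro sur_cancel[of i "p1 ?y ?y"]) auto
  then show "iso i" using i sur_mon_iso by blast
qed

text \<open>Subobjects pull back injectively along the surjection \<open>e \<times> e\<close>. If
  the counts agree, the diagonal of the source is itself such a pullback; it then contains every
  pair identified by \<open>e\<close>, so \<open>e\<close> is mono. No such test subobject is
  available on the source alone, hence the square in \<open>sz\<close>.\<close>

lemma sz_sur:
  assumes e: "sur e"
  shows "sz (cd e) \<le> sz (dm e)" "sz (cd e) = sz (dm e) \<Longrightarrow> iso e"
proof -
  let ?y = "dm e" and ?z = "cd e"
  have O: "?y \<in> Ob C" "?z \<in> Ob C" using e by auto
  let ?Y = "prd C ?y ?y" and ?Z = "prd C ?z ?z"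
  let ?q = "pr (e \<cdot> p1 ?y ?y) (e \<cdot> p2 ?y ?y)"
  have OY: "?Y \<in> Ob C" "?Z \<in> Ob C" using O by auto
  have qa: "arr ?q" "dm ?q = ?Y" "cd ?q = ?Z" using e O by auto
  have qpr: "?q \<cdot> pr u v = pr (e \<cdot> u) (e \<cdot> v)" if "arr u" "arr v" "dm u = dm v" "cd u = ?y" "cd v = ?y" for u v
  proof -
    have "?q \<cdot> pr u v = pr ((e \<cdot> p1 ?y ?y) \<cdot> pr u v) ((e \<cdot> p2 ?y ?y) \<cdot> pr u v)"
      by (rule pr_cmp) (use that e O in auto)
    also have "\<dots> = pr (e \<cdot> (p1 ?y ?y \<cdot> pr u v)) (e \<cdot> (p2 ?y ?y \<cdot> pr u v))"
      using that e O cmp_assoc[of "pr u v" "p1 ?y ?y" e] cmp_assoc[of "pr u v" "p2 ?y ?y" e] by (simp del: p1_pr p2_pr)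
    finally show ?thesis using that by simp
  qed
  \<comment> \<open>Lifting the two coordinates of the generic point of \<open>z \<times> z\<close>
    along \<open>e\<close> on successive covers factors the cover \<open>b1 \<cdot> b2\<close>
    through \<open>e \<times> e\<close>.\<close>
  have q: "sur ?q"
  proof -
    obtain a1 b1 where 1: "sur b1" "arr a1" "cd b1 = dm (p1 ?z ?z)" "dm a1 = dm b1" "cd a1 = dm e" "e \<cdot> a1 = p1 ?z ?z \<cdot> b1"
      by (rule cover[OF e, of "p1 ?z ?z"]) (use O in auto)
    obtain a2 b2 where 2: "sur b2" "arr a2" "cd b2 = dm (p2 ?z ?z \<cdot> b1)" "dm a2 = dm b2" "cd a2 = dm e" "e \<cdot> a2 = (p2 ?z ?z \<cdot> b1) \<cdot> b2"
      by (rule cover[OF e, of "p2 ?z ?z \<cdot> b1"]) (use O 1 in auto)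
    have "?q \<cdot> pr (a1 \<cdot> b2) a2 = pr (e \<cdot> (a1 \<cdot> b2)) (e \<cdot> a2)" by (rule qpr) (use 1 2 in auto)
    also have "e \<cdot> (a1 \<cdot> b2) = p1 ?z ?z \<cdot> (b1 \<cdot> b2)" by (rule cmp_square[OF 1(6)]) (use 1 2 e O in auto)
    also have "e \<cdot> a2 = p2 ?z ?z \<cdot> (b1 \<cdot> b2)" unfolding 2(6) by (rule cmp_assoc) (use 1 2 O in auto)
    also have "pr (p1 ?z ?z \<cdot> (b1 \<cdot> b2)) (p2 ?z ?z \<cdot> (b1 \<cdot> b2)) = b1 \<cdot> b2" by (rule pr_proj) (use 1 2 O in auto)
    finally have eq: "?q \<cdot> pr (a1 \<cdot> b2) a2 = b1 \<cdot> b2" .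
    have "sur (b1 \<cdot> b2)" using 1 2 by simp
    then have "sur (?q \<cdot> pr (a1 \<cdot> b2) a2)" unfolding eq .
    then show ?thesis by (rule sur_cancel) (use 1 2 qa in auto)
  qed
  have "\<exists>a b. pb ?q (rpr ?Z s) a b" if s: "s \<in> subobjects C ?Z" for s
  proof -
    obtain a b where "pb ?q (rpr ?Z s) a b"
      by (rule pullback_ex[of ?q "rpr ?Z s"]) (use rpr[OF s OY(2)] qa in auto)
    then show ?thesis by blast
  qed
  then obtain A B where AB: "\<And>s. s \<in> subobjects C ?Z \<Longrightarrow> pb ?q (rpr ?Z s) (A s) (B s)" by metis
  let ?F = "\<lambda>s. cls (A s)"
  have mA: "mon (A s)" "cd (A s) = ?Y" "sur (B s)" if s: "s \<in> subobjects C ?Z" for s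
    using mon_pb[OF _ AB[OF s]] rpr[OF s OY(2)] pbD[OF AB[OF s]] sur_pb[OF AB[OF s] q] qa by auto
  have inj: "inj_on ?F (subobjects C ?Z)"
  proof (rule inj_onI)
    fix s s' assume s: "s \<in> subobjects C ?Z" "s' \<in> subobjects C ?Z" "?F s = ?F s'"
    note r = rpr[OF s(1) OY(2)] rpr[OF s(2) OY(2)]
    note P = pbD[OF AB[OF s(1)]] pbD[OF AB[OF s(2)]]
    obtain h where h: "iso h" "dm h = dm (A s)" "cd h = dm (A s')" "A s' \<cdot> h = A s"
      using cls_eq_iff[of "A s" "A s'"] s(3) mA[OF s(1)] mA[OF s(2)] by auto
    have "rpr ?Z s' \<cdot> (B s' \<cdot> h) = ?q \<cdot> (A s' \<cdot> h)" by (rule cmp_square[OF P(18)[symmetric]]) (use P h in auto)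
    then have eq: "rpr ?Z s \<cdot> B s = rpr ?Z s' \<cdot> (B s' \<cdot> h)" using h(4) P(9) by simp
    obtain k where "iso k" "dm k = dm (rpr ?Z s)" "cd k = dm (rpr ?Z s')" "rpr ?Z s' \<cdot> k = rpr ?Z s"
      by (rule factorization_unique[OF mA(3)[OF s(1)] r(1) _ _ r(3) _ eq]) (use P h mA[OF s(2)] in auto)
    then show "s = s'" using cls_eqI[of "rpr ?Z s'" k] r by simp
  qed
  have sub: "?F ` subobjects C ?Z \<subseteq> subobjects C ?Y" using mA by auto
  show "sz ?z \<le> sz ?y" using card_inj_on_le[OF inj sub] OY by (simp add: sz_def)
  assume "sz ?z = sz ?y"
  then have im: "?F ` subobjects C ?Z = subobjects C ?Y"
    using card_subset_eq[OF _ sub] card_image[OF inj] OY by (simp add: sz_def)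
  let ?d = "pr (ide ?y) (ide ?y)"
  have md: "mon ?d" by (rule mon_prI) (use O in auto)
  have "cls ?d \<in> subobjects C ?Y" using md by simp
  then obtain s where s: "s \<in> subobjects C ?Z" "cls ?d = cls (A s)" unfolding im[symmetric] by blast
  note r = rpr[OF s(1) OY(2)]
  note P = pbD[OF AB[OF s(1)]]
  obtain h where h: "iso h" "dm h = dm ?d" "cd h = dm (A s)" "A s \<cdot> h = ?d"
    using cls_eq_iff[of ?d "A s"] s(2) mA[OF s(1)] md by auto
  obtain h' where h': "iso h'" "dm h' = dm (A s)" "cd h' = dm ?d" "?d \<cdot> h' = A s"
    using cls_eq_iff[of "A s" ?d] s(2) mA[OF s(1)] md by auto
  have "mon e"
  proof (rule monI)
    fix a b assume ab: "arr a" "arr b" "dm a = dm b" "cd a = dm e" "cd b = dm e" "e \<cdot> a = e \<cdot> b"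
    have "rpr ?Z s \<cdot> (B s \<cdot> (h \<cdot> a)) = ?q \<cdot> (A s \<cdot> (h \<cdot> a))"
      by (rule cmp_square[OF P(9)[symmetric]]) (use P h ab in auto)
    also have "A s \<cdot> (h \<cdot> a) = ?d \<cdot> a" by (rule cmp_left_eq[OF h(4)]) (use P h ab in auto)
    also have "?d \<cdot> a = pr a a" using ab O by (subst pr_cmp) auto
    also have "?q \<cdot> pr a a = pr (e \<cdot> a) (e \<cdot> a)" by (rule qpr) (use ab in auto)
    also have "\<dots> = ?q \<cdot> pr a b" using qpr[of a b] ab by simp
    finally have "?q \<cdot> pr a b = rpr ?Z s \<cdot> (B s \<cdot> (h \<cdot> a))" by simp
    then obtain g where g: "arr g" "dm g = dm (pr a b)" "cd g = dm (A s)" "A s \<cdot> g = pr a b" "B s \<cdot> g = B s \<cdot> (h \<cdot> a)"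
      by (rule pb_lift[OF AB[OF s(1)]]) (use ab P h qa in auto)
    have "?d \<cdot> (h' \<cdot> g) = pr a b" using cmp_left_eq[OF h'(4), of g] g h' md by simp
    moreover have "?d \<cdot> (h' \<cdot> g) = pr (h' \<cdot> g) (h' \<cdot> g)" using g h' O by (subst pr_cmp) auto
    ultimately have "pr (h' \<cdot> g) (h' \<cdot> g) = pr a b" by simp
    then have "h' \<cdot> g = a" "h' \<cdot> g = b" by (rule pr_eqD; use g h' ab in simp)+
    then show "a = b" by simp
  qed (use e in auto)
  then show "iso e" using e sur_mon_iso by blast
qed

lemma sz_iso: "iso h \<Longrightarrow> sz (dm h) = sz (cd h)"
  using sz_mon(1)[of h] sz_sur(1)[of h] by simp

lemma subquotient_sz:
  assumes "mon i" "sur e" "dm e = dm i"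
  shows "sz (cd e) \<le> sz (cd i)" "sz (cd e) = sz (cd i) \<Longrightarrow> iso i \<and> iso e"
  using sz_mon[OF assms(1)] sz_sur[OF assms(2)] assms(3) by auto

lemma isomorphic_iff: "x \<in> Ob C \<Longrightarrow> y \<in> Ob C \<Longrightarrow> isomorphic C x y \<longleftrightarrow> (\<exists>h. iso h \<and> dm h = x \<and> cd h = y)"
  unfolding isomorphic_def using iso_arr_iff[of x y]
  by (metis arrow.collapse arrow.sel(1,3))

text \<open>A subquotient of full size has both \<open>i\<close> and \<open>e\<close> invertible. So
  being proper is a strict inequality of numbers, on which one can induct.\<close>

lemma proper_subquotient_iff:
  assumes "x \<in> Ob C"
  shows "proper_subquotient C z x \<longleftrightarrow> (\<exists>i e. mon i \<and> sur e \<and> dm e = dm i \<and> cd i = x \<and> cd e = z) \<and> sz z < sz x"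
proof -
  have sq: "subquotient C z x \<longleftrightarrow> (\<exists>i e. mon i \<and> sur e \<and> dm e = dm i \<and> cd i = x \<and> cd e = z)"
  proof
    assume "subquotient C z x"
    then obtain y i e where "z \<in> Ob C" "y \<in> Ob C" "mono_arr C y x i" "surjective C y z e"
      unfolding subquotient_def by blast
    then show "\<exists>i e. mon i \<and> sur e \<and> dm e = dm i \<and> cd i = x \<and> cd e = z"
      using mono_arr_iff[of y x i] surjective_iff[of y z e] assms
      by (intro exI[of _ "Ar y i x"] exI[of _ "Ar y e z"]) auto
  next
    assume "\<exists>i e. mon i \<and> sur e \<and> dm e = dm i \<and> cd i = x \<and> cd e = z"
    then obtain i e where ie: "mon i" "sur e" "dm e = dm i" "cd i = x" "cd e = z" by blast
    have O: "z \<in> Ob C" "dm i \<in> Ob C" using ie by auto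
    have "Ar (dm i) (mr i) x = i" "Ar (dm i) (mr e) z = e" using ie by (auto intro: arrow_eqI)
    then have "mono_arr C (dm i) x (mr i)" "surjective C (dm i) z (mr e)"
      using mono_arr_iff[OF O(2) assms] surjective_iff[OF O(2,1)] ie by auto
    then show "subquotient C z x" unfolding subquotient_def using O by blast
  qed
  show ?thesis
  proof
    assume p: "proper_subquotient C z x"
    then obtain i e where ie: "mon i" "sur e" "dm e = dm i" "cd i = x" "cd e = z"
      using sq unfolding proper_subquotient_def by blast
    have "\<not> isomorphic C z x" using p unfolding proper_subquotient_def by blast
    moreover have "isomorphic C z x" if "sz z = sz x"
    proof -
      have "iso i \<and> iso e" using subquotient_sz[OF ie(1-3)] ie that by simp
      then obtain e' where "arr e'" "dm e' = cd e" "cd e' = dm e" "iso e'" by (meson isoE)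
      then have "iso (i \<cdot> e')" "dm (i \<cdot> e') = z" "cd (i \<cdot> e') = x" using ie \<open>iso i \<and> iso e\<close> by auto
      then show ?thesis using isomorphic_iff[of z x] assms ie by (metis arr_cd sur_arr)
    qed
    ultimately have "sz z < sz x" using subquotient_sz(1)[OF ie(1-3)] ie by force
    then show "(\<exists>i e. mon i \<and> sur e \<and> dm e = dm i \<and> cd i = x \<and> cd e = z) \<and> sz z < sz x" using ie by blast
  next
    assume a: "(\<exists>i e. mon i \<and> sur e \<and> dm e = dm i \<and> cd i = x \<and> cd e = z) \<and> sz z < sz x"
    have "\<not> isomorphic C z x"
    proof
      assume "isomorphic C z x"
      moreover have "z \<in> Ob C" using a by auto
      ultimately obtain h where "iso h" "dm h = z" "cd h = x" using isomorphic_iff[of z x] assms by auto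
      then show False using sz_iso[of h] a by simp
    qed
    then show "proper_subquotient C z x" unfolding proper_subquotient_def sq using a by blast
  qed
qed

end

section \<open>Subquotient objects\<close>

context malcev_category
begin

definition diagram :: "'o \<Rightarrow> ('o, 'm) arrow \<Rightarrow> ('o, 'm) arrow \<Rightarrow> bool" where
  "diagram x e i \<longleftrightarrow> sur e \<and> mon i \<and> dm e = dm i \<and> cd i = x"

definition diagram_eq :: "('o, 'm) arrow \<Rightarrow> ('o, 'm) arrow \<Rightarrow> ('o, 'm) arrow \<Rightarrow> ('o, 'm) arrow \<Rightarrow> bool" where
  "diagram_eq e i e' i' \<longleftrightarrow> (\<exists>a b. iso a \<and> iso b \<and> dm a = cd e \<and> cd a = cd e' \<and> dm b = dm e \<and> cd b = dm e' \<and>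
     e' \<cdot> b = a \<cdot> e \<and> i' \<cdot> b = i)"

definition enc :: "('o, 'm) arrow \<Rightarrow> ('o, 'm) arrow \<Rightarrow> 'o \<times> 'm \<times> 'o \<times> 'm" where
  "enc e i = (cd e, mr e, dm e, mr i)"

text \<open>\<open>qe Q\<close> and \<open>qi x Q\<close> are the legs of the representative
  \<open>rep Q\<close>. The same representative is read by \<open>sq_sub\<close> and
  \<open>sq_part\<close>, so no independence of choices has to be shown.\<close>

definition qe :: "('o \<times> 'm \<times> 'o \<times> 'm) set \<Rightarrow> ('o, 'm) arrow" where
  "qe Q = (case rep Q of (z, e, y, i) \<Rightarrow> Ar y e z)"

definition qi :: "'o \<Rightarrow> ('o \<times> 'm \<times> 'o \<times> 'm) set \<Rightarrow> ('o, 'm) arrow" where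
  "qi x Q = (case rep Q of (z, e, y, i) \<Rightarrow> Ar y i x)"

lemma sq_diagrams_iff:
  assumes "x \<in> Ob C"
  shows "(z, e, y, i) \<in> sq_diagrams C x \<longleftrightarrow> diagram x (Ar y e z) (Ar y i x)"
proof -
  have "diagram x (Ar y e z) (Ar y i x) \<Longrightarrow> z \<in> Ob C \<and> y \<in> Ob C"
    unfolding diagram_def by (metis arr_triple sur_arr)
  then show ?thesis unfolding sq_diagrams_def diagram_def
    using mono_arr_iff[of y x i] surjective_iff[of y z e] assms by auto
qed

lemma enc_mem: "x \<in> Ob C \<Longrightarrow> diagram x e i \<Longrightarrow> enc e i \<in> sq_diagrams C x"
  using sq_diagrams_iff[of x "cd e" "mr e" "dm e" "mr i"] arrow.collapse[of e] arrow.collapse[of i]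
  by (simp add: enc_def diagram_def)

lemma sq_equiv_enc:
  assumes x: "x \<in> Ob C" and d: "diagram x e i" "diagram x e' i'"
  shows "(enc e i, enc e' i') \<in> sq_equiv C x \<longleftrightarrow> diagram_eq e i e' i'"
proof -
  have O: "dm e \<in> Ob C" "cd e \<in> Ob C" "dm e' \<in> Ob C" "cd e' \<in> Ob C" using d by (auto simp: diagram_def)
  have "(enc e i, enc e' i') \<in> sq_equiv C x \<longleftrightarrow> (\<exists>a b. iso_arr C (cd e) (cd e') a \<and> iso_arr C (dm e) (dm e') b \<and>
           Comp C (dm e) (dm e') (cd e') (mr e') b = Comp C (dm e) (cd e) (cd e') a (mr e) \<and>
           Comp C (dm e) (dm e') x (mr i') b = mr i)"
    using enc_mem[OF x d(1)] enc_mem[OF x d(2)] unfolding sq_equiv_def enc_def by simp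
  also have "\<dots> \<longleftrightarrow> diagram_eq e i e' i'"
  proof
    assume "\<exists>a b. iso_arr C (cd e) (cd e') a \<and> iso_arr C (dm e) (dm e') b \<and>
           Comp C (dm e) (dm e') (cd e') (mr e') b = Comp C (dm e) (cd e) (cd e') a (mr e) \<and>
           Comp C (dm e) (dm e') x (mr i') b = mr i"
    then obtain a b where ab: "iso_arr C (cd e) (cd e') a" "iso_arr C (dm e) (dm e') b"
           "Comp C (dm e) (dm e') (cd e') (mr e') b = Comp C (dm e) (cd e) (cd e') a (mr e)"
           "Comp C (dm e) (dm e') x (mr i') b = mr i" by blast
    have "iso (Ar (cd e) a (cd e'))" "iso (Ar (dm e) b (dm e'))"
      using ab iso_arr_iff[OF O(2,4)] iso_arr_iff[OF O(1,3)] by auto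
    moreover have "e' \<cdot> Ar (dm e) b (dm e') = Ar (cd e) a (cd e') \<cdot> e"
      using ab(3) by (simp add: cmp_def)
    moreover have "i' \<cdot> Ar (dm e) b (dm e') = i"
      using ab(4) d by (intro arrow_eqI) (auto simp: diagram_def mr_cmp)
    ultimately show "diagram_eq e i e' i'" unfolding diagram_eq_def
      by (intro exI[of _ "Ar (cd e) a (cd e')"] exI[of _ "Ar (dm e) b (dm e')"]) auto
  next
    assume "diagram_eq e i e' i'"
    then obtain a b where ab: "iso a" "iso b" "dm a = cd e" "cd a = cd e'" "dm b = dm e" "cd b = dm e'"
      "e' \<cdot> b = a \<cdot> e" "i' \<cdot> b = i" unfolding diagram_eq_def by blast
    have "Ar (cd e) (mr a) (cd e') = a" "Ar (dm e) (mr b) (dm e') = b" using ab by (auto intro: arrow_eqI)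
    then have "iso_arr C (cd e) (cd e') (mr a)" "iso_arr C (dm e) (dm e') (mr b)"
      using ab iso_arr_iff[OF O(2,4)] iso_arr_iff[OF O(1,3)] by auto
    moreover have "Comp C (dm e) (dm e') (cd e') (mr e') (mr b) = Comp C (dm e) (cd e) (cd e') (mr a) (mr e)"
      using arg_cong[OF ab(7), of mr] ab(3-6) by (simp add: mr_cmp)
    moreover have "Comp C (dm e) (dm e') x (mr i') (mr b) = mr i"
      using arg_cong[OF ab(8), of mr] ab(3-6) d by (simp add: mr_cmp diagram_def)
    ultimately show "\<exists>a b. iso_arr C (cd e) (cd e') a \<and> iso_arr C (dm e) (dm e') b \<and>
           Comp C (dm e) (dm e') (cd e') (mr e') b = Comp C (dm e) (cd e) (cd e') a (mr e) \<and>
           Comp C (dm e) (dm e') x (mr i') b = mr i" by blast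
  qed
  finally show ?thesis .
qed

lemma diagram_eq_refl: "diagram x e i \<Longrightarrow> diagram_eq e i e i"
  unfolding diagram_eq_def diagram_def by (intro exI[of _ "ide (cd e)"] exI[of _ "ide (dm e)"]) auto

lemma diagram_eq_sym:
  assumes "diagram x e i" "diagram x e' i'" "diagram_eq e i e' i'"
  shows "diagram_eq e' i' e i"
proof -
  obtain a b where ab: "iso a" "iso b" "dm a = cd e" "cd a = cd e'" "dm b = dm e" "cd b = dm e'"
    "e' \<cdot> b = a \<cdot> e" "i' \<cdot> b = i" using assms(3) unfolding diagram_eq_def by blast
  obtain a' where a': "arr a'" "dm a' = cd a" "cd a' = dm a" "a' \<cdot> a = ide (dm a)" "a \<cdot> a' = ide (cd a)" "iso a'"
    using ab(1) by (rule isoE)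
  obtain b' where b': "arr b'" "dm b' = cd b" "cd b' = dm b" "b' \<cdot> b = ide (dm b)" "b \<cdot> b' = ide (cd b)" "iso b'"
    using ab(2) by (rule isoE)
  have D: "arr e" "arr i" "arr e'" "arr i'" "dm e = dm i" "dm e' = dm i'" using assms unfolding diagram_def by auto
  have "a \<cdot> (e \<cdot> b') = e' \<cdot> (b \<cdot> b')" by (rule cmp_square[OF ab(7)[symmetric]]) (use ab b' D in auto)
  then have "a \<cdot> (e \<cdot> b') = e'" using b' ab D by simp
  then have "a' \<cdot> e' = a' \<cdot> (a \<cdot> (e \<cdot> b'))" by simp
  also have "\<dots> = ide (dm a) \<cdot> (e \<cdot> b')" by (rule cmp_left_eq[OF a'(4)]) (use ab a' b' D in auto)
  finally have 1: "e \<cdot> b' = a' \<cdot> e'" using ab b' D by simp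
  have "i \<cdot> b' = i' \<cdot> (b \<cdot> b')" unfolding ab(8)[symmetric] by (rule cmp_assoc) (use ab b' D in auto)
  then have 2: "i \<cdot> b' = i'" using ab b' D by simp
  show ?thesis unfolding diagram_eq_def using 1 2 a' b' ab by (intro exI[of _ a'] exI[of _ b']) auto
qed

lemma diagram_eq_trans:
  assumes "diagram x e i" "diagram x e' i'" "diagram x e'' i''" "diagram_eq e i e' i'" "diagram_eq e' i' e'' i''"
  shows "diagram_eq e i e'' i''"
proof -
  obtain a b where ab: "iso a" "iso b" "dm a = cd e" "cd a = cd e'" "dm b = dm e" "cd b = dm e'"
    "e' \<cdot> b = a \<cdot> e" "i' \<cdot> b = i" using assms(4) unfolding diagram_eq_def by blast
  obtain c d where cd: "iso c" "iso d" "dm c = cd e'" "cd c = cd e''" "dm d = dm e'" "cd d = dm e''"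
    "e'' \<cdot> d = c \<cdot> e'" "i'' \<cdot> d = i'" using assms(5) unfolding diagram_eq_def by blast
  have D: "arr e" "arr i" "arr e'" "arr i'" "arr e''" "arr i''" "dm e = dm i" "dm e' = dm i'" "dm e'' = dm i''"
    using assms unfolding diagram_def by auto
  have "e'' \<cdot> (d \<cdot> b) = c \<cdot> (e' \<cdot> b)" by (rule cmp_square[OF cd(7)]) (use ab cd D in auto)
  then have 1: "e'' \<cdot> (d \<cdot> b) = (c \<cdot> a) \<cdot> e" unfolding ab(7) using ab(1-6) cd(1-6) D by simp
  have 2: "i'' \<cdot> (d \<cdot> b) = i" using cmp_left_eq[OF cd(8), of b] ab(1-6,8) cd(1-6) D by simp
  show ?thesis unfolding diagram_eq_def using 1 2 ab(1-6) cd(1-6) by (intro exI[of _ "c \<cdot> a"] exI[of _ "d \<cdot> b"]) auto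
qed

lemma diagram_cases:
  assumes "x \<in> Ob C" "q \<in> sq_diagrams C x"
  obtains e i where "diagram x e i" "q = enc e i"
proof -
  obtain z e y i where q: "q = (z, e, y, i)" by (cases q) auto
  show ?thesis by (rule that[of "Ar y e z" "Ar y i x"])
      (use assms q sq_diagrams_iff[OF assms(1), of z e y i] in \<open>auto simp: enc_def\<close>)
qed

lemma equiv_sq: assumes x: "x \<in> Ob C" shows "equiv (sq_diagrams C x) (sq_equiv C x)"
proof (rule equivI)
  have sub: "sq_equiv C x \<subseteq> sq_diagrams C x \<times> sq_diagrams C x" unfolding sq_equiv_def by auto
  then show "sq_equiv C x \<subseteq> sq_diagrams C x \<times> sq_diagrams C x" .
  show "refl_on (sq_diagrams C x) (sq_equiv C x)"
  proof -
    have "(q, q) \<in> sq_equiv C x" if q: "q \<in> sq_diagrams C x" for q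
    proof -
      obtain e i where "diagram x e i" "q = enc e i" using diagram_cases[OF x q] .
      then show ?thesis using sq_equiv_enc[OF x] diagram_eq_refl by blast
    qed
    then show ?thesis using sub unfolding refl_on_def by blast
  qed
  show "sym (sq_equiv C x)"
  proof (rule symI)
    fix q q' assume qq: "(q, q') \<in> sq_equiv C x"
    then have m: "q \<in> sq_diagrams C x" "q' \<in> sq_diagrams C x" using sub by auto
    obtain e i where 1: "diagram x e i" "q = enc e i" using diagram_cases[OF x m(1)] .
    obtain e' i' where 2: "diagram x e' i'" "q' = enc e' i'" using diagram_cases[OF x m(2)] .
    show "(q', q) \<in> sq_equiv C x"
      using qq diagram_eq_sym[OF 1(1) 2(1)] sq_equiv_enc[OF x 1(1) 2(1)] sq_equiv_enc[OF x 2(1) 1(1)] 1 2 by simp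
  qed
  show "trans (sq_equiv C x)"
  proof (rule transI)
    fix q q' q'' assume qq: "(q, q') \<in> sq_equiv C x" "(q', q'') \<in> sq_equiv C x"
    then have m: "q \<in> sq_diagrams C x" "q' \<in> sq_diagrams C x" "q'' \<in> sq_diagrams C x" using sub by auto
    obtain e i where 1: "diagram x e i" "q = enc e i" using diagram_cases[OF x m(1)] .
    obtain e' i' where 2: "diagram x e' i'" "q' = enc e' i'" using diagram_cases[OF x m(2)] .
    obtain e'' i'' where 3: "diagram x e'' i''" "q'' = enc e'' i''" using diagram_cases[OF x m(3)] .
    show "(q, q'') \<in> sq_equiv C x"
      using qq diagram_eq_trans[OF 1(1) 2(1) 3(1)] sq_equiv_enc[OF x 1(1) 2(1)] sq_equiv_enc[OF x 2(1) 3(1)]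
        sq_equiv_enc[OF x 1(1) 3(1)] 1 2 3 by simp
  qed
qed

lemma sq_rep:
  assumes x: "x \<in> Ob C" and Q: "Q \<in> sq C x"
  shows "diagram x (qe Q) (qi x Q)" "Q = sq_equiv C x `` {enc (qe Q) (qi x Q)}" "rep Q = enc (qe Q) (qi x Q)"
    "sq_sub C x Q = cls (qi x Q)"
proof -
  have Q': "Q \<in> sq_diagrams C x // sq_equiv C x" using Q unfolding sq_def .
  then have "Q \<noteq> {}" using in_quotient_imp_non_empty[OF equiv_sq[OF x]] by blast
  then have r: "rep Q \<in> Q" by (rule rep_mem)
  then have rd: "rep Q \<in> sq_diagrams C x" using in_quotient_imp_subset[OF equiv_sq[OF x] Q'] by blast
  obtain z e y i where zz: "rep Q = (z, e, y, i)" by (cases "rep Q") auto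
  show d: "diagram x (qe Q) (qi x Q)" using rd sq_diagrams_iff[OF x, of z e y i] unfolding zz qe_def qi_def by simp
  show re: "rep Q = enc (qe Q) (qi x Q)" unfolding enc_def qe_def qi_def zz by simp
  show "sq_sub C x Q = cls (qi x Q)" unfolding sq_sub_def qi_def zz by (simp add: cls_def)
  obtain a where a: "a \<in> sq_diagrams C x" "Q = sq_equiv C x `` {a}" using Q' by (rule quotientE)
  then have "(a, rep Q) \<in> sq_equiv C x" using r by auto
  then show "Q = sq_equiv C x `` {enc (qe Q) (qi x Q)}"
    using equiv_class_eq[OF equiv_sq[OF x]] a(2) re by metis
qed

lemma sq_unique:
  assumes x: "x \<in> Ob C" and Q: "Q \<in> sq C x" "Q' \<in> sq C x" "diagram_eq (qe Q) (qi x Q) (qe Q') (qi x Q')"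
  shows "Q = Q'"
proof -
  note r = sq_rep[OF x Q(1)] and r' = sq_rep[OF x Q(2)]
  have "(enc (qe Q) (qi x Q), enc (qe Q') (qi x Q')) \<in> sq_equiv C x"
    using sq_equiv_enc[OF x r(1) r'(1)] Q(3) by simp
  then show ?thesis using equiv_class_eq[OF equiv_sq[OF x]] r(2) r'(2) by metis
qed

lemma sq_exists:
  assumes x: "x \<in> Ob C" and d: "diagram x e i"
  obtains Q where "Q \<in> sq C x" "diagram_eq e i (qe Q) (qi x Q)"
proof -
  define Q where "Q = sq_equiv C x `` {enc e i}"
  have Q: "Q \<in> sq C x" unfolding sq_def Q_def by (rule quotientI[OF enc_mem[OF x d]])
  note r = sq_rep[OF x Q]
  have "enc (qe Q) (qi x Q) \<in> Q" using r rep_mem[of Q] in_quotient_imp_non_empty[OF equiv_sq[OF x]] Q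
    unfolding sq_def by metis
  then have "(enc e i, enc (qe Q) (qi x Q)) \<in> sq_equiv C x" unfolding Q_def by auto
  then have "diagram_eq e i (qe Q) (qi x Q)" using sq_equiv_enc[OF x d r(1)] by simp
  then show ?thesis using that Q by blast
qed

text \<open>The kernel pair of \<open>e\<close>, pushed into \<open>x \<times> x\<close> by
  \<open>i\<close>, remembers the diagram: its diagonal recovers \<open>i\<close>, and its pairs
  tell what \<open>e\<close> identifies. This gives the comparison maps in one direction;
  \<open>finite_sq\<close> uses it in both.\<close>

lemma kernel_determines:
  assumes d: "diagram x e i" "diagram x e' i'"
    and k: "pb e e k1 k2" "pb e' e' k1' k2'"
    and h: "iso h" "dm h = dm k1" "cd h = dm k1'" "i' \<cdot> (k1' \<cdot> h) = i \<cdot> k1" "i' \<cdot> (k2' \<cdot> h) = i \<cdot> k2"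
  obtains b a where "arr b" "dm b = dm e" "cd b = dm e'" "i' \<cdot> b = i" "arr a" "dm a = cd e" "cd a = cd e'" "a \<cdot> e = e' \<cdot> b"
proof -
  note K = pbD[OF k(1)] pbD[OF k(2)]
  have D: "sur e" "mon i" "sur e'" "mon i'" "dm e = dm i" "dm e' = dm i'" using d unfolding diagram_def by auto
  \<comment> \<open>The diagonal of the kernel pair; transported by \<open>h\<close> it compares the
    two subobjects.\<close>
  obtain t where t: "arr t" "dm t = dm e" "cd t = dm k1" "k1 \<cdot> t = ide (dm e)" "k2 \<cdot> t = ide (dm e)"
    using pb_lift[OF k(1), of "ide (dm e)" "ide (dm e)"] D by auto
  define b where "b = (k1' \<cdot> h) \<cdot> t"
  have b: "arr b" "dm b = dm e" "cd b = dm e'" using h t K by (auto simp: b_def)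
  have "i' \<cdot> b = i \<cdot> (k1 \<cdot> t)" unfolding b_def
    by (rule cmp_square[OF h(4)]) (use h t K D in auto)
  then have ib: "i' \<cdot> b = i" using t D by simp
  have kb: "k1' \<cdot> h = b \<cdot> k1" "k2' \<cdot> h = b \<cdot> k2"
  proof -
    have "i' \<cdot> (b \<cdot> k1) = i \<cdot> k1" "i' \<cdot> (b \<cdot> k2) = i \<cdot> k2" by (rule cmp_left_eq[OF ib]; use b K D in simp)+
    then have "i' \<cdot> (k1' \<cdot> h) = i' \<cdot> (b \<cdot> k1)" "i' \<cdot> (k2' \<cdot> h) = i' \<cdot> (b \<cdot> k2)" using h by auto
    note eq = this
    show "k1' \<cdot> h = b \<cdot> k1" by (rule monD[OF D(4) eq(1)]) (use b h K D in auto)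
    show "k2' \<cdot> h = b \<cdot> k2" by (rule monD[OF D(4) eq(2)]) (use b h K D in auto)
  qed
  obtain a where "arr a" "dm a = cd e" "cd a = cd (e' \<cdot> b)" "a \<cdot> e = e' \<cdot> b"
  proof (rule sur_coeq[OF D(1), of "e' \<cdot> b"])
    fix u v assume uv: "arr u" "arr v" "dm u = dm v" "cd u = dm e" "cd v = dm e" "e \<cdot> u = e \<cdot> v"
    obtain s where s: "arr s" "dm s = dm u" "cd s = dm k1" "k1 \<cdot> s = u" "k2 \<cdot> s = v"
      by (rule pb_lift[OF k(1) uv(6)]) (use uv in auto)
    have "e' \<cdot> (k1' \<cdot> (h \<cdot> s)) = e' \<cdot> (k2' \<cdot> (h \<cdot> s))" by (rule cmp_square[OF K(18)]) (use K h s in auto)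
    moreover have "k1' \<cdot> (h \<cdot> s) = b \<cdot> (k1 \<cdot> s)" by (rule cmp_square[OF kb(1)]) (use K h s b in auto)
    moreover have "k2' \<cdot> (h \<cdot> s) = b \<cdot> (k2 \<cdot> s)" by (rule cmp_square[OF kb(2)]) (use K h s b in auto)
    ultimately have "e' \<cdot> (b \<cdot> u) = e' \<cdot> (b \<cdot> v)" using s by simp
    then show "(e' \<cdot> b) \<cdot> u = (e' \<cdot> b) \<cdot> v" using uv b D by simp
  qed (use b D in auto)
  then show ?thesis using that b ib by simp
qed

text \<open>A subquotient object is encoded by the subobject of \<open>x \<times> x\<close> that
  \<open>kernel_determines\<close> describes, and there are only finitely many of those.\<close>

lemma finite_sq: assumes x: "x \<in> Ob C" shows "finite (sq C x)"
proof -
  let ?X = "prd C x x"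
  have "\<exists>k1 k2. pb (qe Q) (qe Q) k1 k2" if Q: "Q \<in> sq C x" for Q
  proof -
    have "arr (qe Q)" using sq_rep(1)[OF x Q] unfolding diagram_def by simp
    then show ?thesis using pullback_ex[of "qe Q" "qe Q"] by blast
  qed
  then obtain K1 K2 where K: "\<And>Q. Q \<in> sq C x \<Longrightarrow> pb (qe Q) (qe Q) (K1 Q) (K2 Q)" by metis
  let ?m = "\<lambda>Q. pr (qi x Q \<cdot> K1 Q) (qi x Q \<cdot> K2 Q)"
  have m: "mon (?m Q)" "cd (?m Q) = ?X" if Q: "Q \<in> sq C x" for Q
  proof -
    note k = pbD[OF K[OF Q]]
    have d: "mon (qi x Q)" "dm (qe Q) = dm (qi x Q)" "cd (qi x Q) = x" using sq_rep(1)[OF x Q] unfolding diagram_def by auto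
    show "mon (?m Q)"
    proof (rule mon_prI)
      fix h h' assume a: "arr h" "arr h'" "dm h = dm h'" "cd h = dm (qi x Q \<cdot> K1 Q)" "cd h' = dm (qi x Q \<cdot> K1 Q)"
        "(qi x Q \<cdot> K1 Q) \<cdot> h = (qi x Q \<cdot> K1 Q) \<cdot> h'" "(qi x Q \<cdot> K2 Q) \<cdot> h = (qi x Q \<cdot> K2 Q) \<cdot> h'"
      then have "qi x Q \<cdot> (K1 Q \<cdot> h) = qi x Q \<cdot> (K1 Q \<cdot> h')" "qi x Q \<cdot> (K2 Q \<cdot> h) = qi x Q \<cdot> (K2 Q \<cdot> h')"
        using k(1-8) d by auto
      note eq = this
      have "K1 Q \<cdot> h = K1 Q \<cdot> h'" by (rule monD[OF d(1) eq(1)]) (use a(1-5) k(1-8) d in auto)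
      moreover have "K2 Q \<cdot> h = K2 Q \<cdot> h'" by (rule monD[OF d(1) eq(2)]) (use a(1-5) k(1-8) d in auto)
      ultimately show "h = h'" using a(1-5) k(1-8) by - (rule pb_eq[OF K[OF Q]], auto)
    qed (use k d in auto)
    show "cd (?m Q) = ?X" using d by simp
  qed
  have inj: "inj_on (\<lambda>Q. cls (?m Q)) (sq C x)"
  proof (rule inj_onI)
    fix Q Q' assume Q: "Q \<in> sq C x" "Q' \<in> sq C x" and eq: "cls (?m Q) = cls (?m Q')"
    note d = sq_rep(1)[OF x Q(1)] and d' = sq_rep(1)[OF x Q(2)]
    note k = pbD[OF K[OF Q(1)]] and k' = pbD[OF K[OF Q(2)]]
    let ?e = "qe Q" and ?i = "qi x Q" and ?e' = "qe Q'" and ?i' = "qi x Q'"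
    have D: "sur ?e" "mon ?i" "sur ?e'" "mon ?i'" "dm ?e = dm ?i" "dm ?e' = dm ?i'" "cd ?i = x" "cd ?i' = x"
      using d d' unfolding diagram_def by auto
    obtain h where h: "iso h" "dm h = dm (?m Q)" "cd h = dm (?m Q')" "?m Q' \<cdot> h = ?m Q"
      using cls_eq_iff[OF m(1)[OF Q(1)] m(1)[OF Q(2)]] m(2)[OF Q(1)] m(2)[OF Q(2)] eq by auto
    obtain g where g: "iso g" "dm g = dm (?m Q')" "cd g = dm (?m Q)" "?m Q \<cdot> g = ?m Q'"
      using cls_eq_iff[OF m(1)[OF Q(2)] m(1)[OF Q(1)]] m(2)[OF Q(1)] m(2)[OF Q(2)] eq by auto
    have "pr ((?i' \<cdot> K1 Q') \<cdot> h) ((?i' \<cdot> K2 Q') \<cdot> h) = ?m Q" using h k' D by (subst pr_cmp[symmetric]) auto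
    then have "(?i' \<cdot> K1 Q') \<cdot> h = ?i \<cdot> K1 Q" "(?i' \<cdot> K2 Q') \<cdot> h = ?i \<cdot> K2 Q" by (rule pr_eqD; use h(1-3) k(1-8) k'(1-8) D in simp)+
    then have h12: "?i' \<cdot> (K1 Q' \<cdot> h) = ?i \<cdot> K1 Q" "?i' \<cdot> (K2 Q' \<cdot> h) = ?i \<cdot> K2 Q" using h(1-3) k(1-8) k'(1-8) D by auto
    have "pr ((?i \<cdot> K1 Q) \<cdot> g) ((?i \<cdot> K2 Q) \<cdot> g) = ?m Q'" using g k D by (subst pr_cmp[symmetric]) auto
    then have "(?i \<cdot> K1 Q) \<cdot> g = ?i' \<cdot> K1 Q'" "(?i \<cdot> K2 Q) \<cdot> g = ?i' \<cdot> K2 Q'" by (rule pr_eqD; use g(1-3) k(1-8) k'(1-8) D in simp)+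
    then have g12: "?i \<cdot> (K1 Q \<cdot> g) = ?i' \<cdot> K1 Q'" "?i \<cdot> (K2 Q \<cdot> g) = ?i' \<cdot> K2 Q'" using g(1-3) k(1-8) k'(1-8) D by auto
    obtain b a where ba: "arr b" "dm b = dm ?e" "cd b = dm ?e'" "?i' \<cdot> b = ?i" "arr a" "dm a = cd ?e" "cd a = cd ?e'" "a \<cdot> ?e = ?e' \<cdot> b"
      by (rule kernel_determines[OF d d' K[OF Q(1)] K[OF Q(2)] h(1) _ _ h12]) (use h k(1-8) k'(1-8) in auto)
    obtain b' a' where ba': "arr b'" "dm b' = dm ?e'" "cd b' = dm ?e" "?i \<cdot> b' = ?i'" "arr a'" "dm a' = cd ?e'" "cd a' = cd ?e" "a' \<cdot> ?e' = ?e \<cdot> b'"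
      by (rule kernel_determines[OF d' d K[OF Q(2)] K[OF Q(1)] g(1) _ _ g12]) (use g k(1-8) k'(1-8) in auto)
    have "?i' \<cdot> (b \<cdot> b') = ?i \<cdot> b'" by (rule cmp_left_eq[OF ba(4)]) (use ba ba' D in auto)
    then have "?i' \<cdot> (b \<cdot> b') = ?i' \<cdot> ide (dm ?e')" using ba' D by simp
    then have bb: "b \<cdot> b' = ide (dm ?e')" by (rule monD[OF D(4)]) (use ba ba' D in auto)
    have "?i \<cdot> (b' \<cdot> b) = ?i' \<cdot> b" by (rule cmp_left_eq[OF ba'(4)]) (use ba ba' D in auto)
    then have "?i \<cdot> (b' \<cdot> b) = ?i \<cdot> ide (dm ?e)" using ba D by simp
    then have bb': "b' \<cdot> b = ide (dm ?e)" by (rule monD[OF D(2)]) (use ba ba' D in auto)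
    have ib: "iso b" by (rule isoI[of b b']) (use ba ba' bb bb' in auto)
    have "a \<cdot> (a' \<cdot> ?e') = a \<cdot> (?e \<cdot> b')" using ba'(8) by simp
    also have "\<dots> = ?e' \<cdot> (b \<cdot> b')" by (rule cmp_square[OF ba(8)]) (use ba ba' D in auto)
    finally have "(a \<cdot> a') \<cdot> ?e' = ide (cd ?e') \<cdot> ?e'" using bb ba(5-7) ba'(5-7) D by simp
    then have aa: "a \<cdot> a' = ide (cd ?e')" by (rule sur_epi[OF D(3)]) (use ba(5-7) ba'(5-7) D in auto)
    have "a' \<cdot> (a \<cdot> ?e) = a' \<cdot> (?e' \<cdot> b)" using ba(8) by simp
    also have "\<dots> = ?e \<cdot> (b' \<cdot> b)" by (rule cmp_square[OF ba'(8)]) (use ba ba' D in auto)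
    finally have "(a' \<cdot> a) \<cdot> ?e = ide (cd ?e) \<cdot> ?e" using bb' ba(5-7) ba'(5-7) D by simp
    then have aa': "a' \<cdot> a = ide (cd ?e)" by (rule sur_epi[OF D(1)]) (use ba(5-7) ba'(5-7) D in auto)
    have ia: "iso a" by (rule isoI[of a a']) (use ba ba' aa aa' in auto)
    have "diagram_eq ?e ?i ?e' ?i'" unfolding diagram_eq_def using ia ib ba by (intro exI[of _ a] exI[of _ b]) auto
    then show "Q = Q'" using sq_unique[OF x Q] by simp
  qed
  have "(\<lambda>Q. cls (?m Q)) ` sq C x \<subseteq> subobjects C ?X" using m by auto
  then have "finite ((\<lambda>Q. cls (?m Q)) ` sq C x)" using finite_subset[of _ "subobjects C ?X"] x by simp
  then show ?thesis using finite_imageD inj by blast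
qed

section \<open>Morphisms through smaller objects\<close>

lemma diagram_sp: 
  assumes "diagram x e i" "cd e = w"
  shows "mon (pr e i)" "sp e i = basis_vec (cls (pr e i))" "cls (pr e i) \<in> subobjects C (prd C w x)"
    "sp e i \<in> H w x" "sp i e \<in> H x w" "w \<in> Ob C" "x \<in> Ob C"
proof -
  have D: "sur e" "mon i" "dm e = dm i" "cd i = x" using assms unfolding diagram_def by auto
  show m: "mon (pr e i)" by (rule mon_prI) (use D monD in auto)
  show "sp e i = basis_vec (cls (pr e i))" using sp_mon[OF m] D by simp
  show "cls (pr e i) \<in> subobjects C (prd C w x)" using m D assms by simp
qed (use assms in \<open>auto simp: diagram_def\<close>)

text \<open>In contrast to \<open>diagram_eq\<close>, no automorphism of the common quotient may
  intervene: one subquotient object gives rise to a whole orbit of relations.\<close>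

lemma cls_pr_eq_iff:
  assumes "diagram x e i" "diagram x e' i'" "cd e = cd e'"
  shows "cls (pr e i) = cls (pr e' i') \<longleftrightarrow> (\<exists>k. iso k \<and> dm k = dm e \<and> cd k = dm e' \<and> e' \<cdot> k = e \<and> i' \<cdot> k = i)"
proof -
  have D: "arr e" "arr i" "arr e'" "arr i'" "dm e = dm i" "dm e' = dm i'" "cd i = cd i'" using assms unfolding diagram_def by auto
  have "pr e' i' \<cdot> k = pr e i \<longleftrightarrow> e' \<cdot> k = e \<and> i' \<cdot> k = i" if "arr k" "dm k = dm e" "cd k = dm e'" for k
  proof
    assume "pr e' i' \<cdot> k = pr e i"
    then have "pr (e' \<cdot> k) (i' \<cdot> k) = pr e i" using that D by (simp add: pr_cmp)
    then have "e' \<cdot> k = e" "i' \<cdot> k = i" by (rule pr_eqD; use that D assms in simp)+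
    then show "e' \<cdot> k = e \<and> i' \<cdot> k = i" by simp
  qed (use that D in \<open>simp add: pr_cmp\<close>)
  then show ?thesis
    using cls_eq_iff[OF diagram_sp(1)[OF assms(1) HOL.refl] diagram_sp(1)[OF assms(2) HOL.refl]] assms D
    by (auto dest: iso_arr')
qed

text \<open>\<open>relation_factor\<close> for basis vectors: \<open>\<langle>r\<rangle>\<close> is
  a composite through the common subquotient of its ends. The last clause describes the relations
  for which this subquotient is no smaller than \<open>w\<close>.\<close>

lemma relation_split:
  assumes r: "r \<in> subobjects C (prd C w x)" and O: "w \<in> Ob C" "x \<in> Ob C"
  obtains i e f j where "diagram w e i" "diagram x f j" "cd e = cd f" "basis_vec r = co w (cd e) x (sp f j) (sp i e)"
    "iso i \<Longrightarrow> iso e \<Longrightarrow> \<exists>e' i'. diagram x e' i' \<and> cd e' = w \<and> r = cls (pr e' i')"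
proof -
  define m where "m = rpr (prd C w x) r"
  have m: "mon m" "cls m = r" "cd m = prd C w x" using rpr[OF r] O by (auto simp: m_def)
  obtain i a j b e f where F: "mon i" "mon j" "sur a" "sur b" "sur e" "sur f" "cd i = w" "cd j = x"
    "cd a = dm i" "cd b = dm j" "dm e = dm i" "dm f = dm j" "pb e f a b" "p1 w x \<cdot> m = i \<cdot> a" "p2 w x \<cdot> m = j \<cdot> b"
    by (rule relation_factor[OF m(1) m(3) O])
  note B = pbD[OF F(13)]
  have "basis_vec r = sp (i \<cdot> a) (j \<cdot> b)" using bas_eq_sp(1)[OF m_def r O] F by simp
  also have "\<dots> = co w (cd e) x (sp f j) (sp i e)" by (rule co_sp[OF F(13), symmetric]) (use F B in auto)
  finally have 1: "basis_vec r = co w (cd e) x (sp f j) (sp i e)" .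
  have 2: "\<exists>e' i'. diagram x e' i' \<and> cd e' = w \<and> r = cls (pr e' i')" if "iso i" "iso e"
  proof -
    have "mon b" by (rule mon_pb[OF _ pb_sym[OF F(13)]]) (use that in simp)
    moreover have "pr (i \<cdot> a) (j \<cdot> b) = m" using pr_proj[of m w x] F m O by simp
    ultimately show ?thesis
      using that F B m by (intro exI[of _ "i \<cdot> a"] exI[of _ "j \<cdot> b"]) (auto simp: diagram_def)
  qed
  show ?thesis by (rule that[of e i f j]) (use F B 1 2 in \<open>auto simp: diagram_def\<close>)
qed

text \<open>Suppose the relation \<open>(e0, i0)\<close> occurred, and factor the relation from
  \<open>w\<close> to \<open>z\<close> by \<open>relation_factor\<close>. Surjectivity of
  \<open>e0\<close> makes the subobject \<open>i\<close> of \<open>w\<close> everything, and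
  injectivity of \<open>i0\<close> makes the quotient map \<open>e\<close> mono. So \<open>w\<close>
  would be a subquotient of \<open>z\<close>, against the sizes.\<close>

lemma small_composite:
  assumes f: "f \<in> H w z" and g: "g \<in> H z x" and O: "w \<in> Ob C" "z \<in> Ob C" "x \<in> Ob C" and s: "sz z < sz w"
    and d: "diagram x e0 i0" "cd e0 = w"
  shows "co w z x g f (cls (pr e0 i0)) = 0"
  using f O(1,2)
proof (induction rule: H_induct)
  case (bas r)
  define m where "m = rpr (prd C w z) r"
  have m: "mon m" "cls m = r" "cd m = prd C w z" using rpr[OF bas] O by (auto simp: m_def)
  show ?case using g O(2,3)
  proof (induction rule: H_induct_sp)
    case (sp c d)
    note cd = this
    obtain i a j b e f where F: "mon i" "mon j" "sur a" "sur b" "sur e" "sur f" "cd i = w" "cd j = z"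
      "cd a = dm i" "cd b = dm j" "dm e = dm i" "dm f = dm j" "pb e f a b" "p1 w z \<cdot> m = i \<cdot> a" "p2 w z \<cdot> m = j \<cdot> b"
      by (rule relation_factor[OF m(1) m(3) O(1,2)])
    note B = pbD[OF F(13)]
    have br: "basis_vec r = sp (i \<cdot> a) (j \<cdot> b)" using bas_eq_sp(1)[OF m_def bas O(1,2)] F by simp
    obtain u v where uv: "pb (j \<cdot> b) c u v" "co w z x (sp c d) (sp (i \<cdot> a) (j \<cdot> b)) = sp ((i \<cdot> a) \<cdot> u) (d \<cdot> v)"
      by (rule co_sp_obtain[of "i \<cdot> a" "j \<cdot> b" c d w z x]) (use F B cd in auto)
    note U = pbD[OF uv(1)]
    have "arr (pr ((i \<cdot> a) \<cdot> u) (d \<cdot> v))" using F B U cd by simp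
    then obtain q t where qt: "sur q" "mon t" "cd q = dm t" "t \<cdot> q = pr ((i \<cdot> a) \<cdot> u) (d \<cdot> v)" by (rule factorization)
    have spq: "sp ((i \<cdot> a) \<cdot> u) (d \<cdot> v) = dg q \<star> basis_vec (cls t)" using sp_eq[OF qt] .
    show ?case
    proof (cases "cls t = cls (pr e0 i0)")
      case False
      then show ?thesis unfolding br uv(2) spq by (simp add: smul_apply basis_vec_def)
    next
      case True
      have ct: "cd t = prd C w x" and dq: "dm q = dm u" using arg_cong[OF qt(4), of cd] arg_cong[OF qt(4), of dm] F cd by auto
      have D0: "sur e0" "mon i0" "dm e0 = dm i0" "cd i0 = x" using d unfolding diagram_def by auto
      have "cls t = cls (pr e0 i0) \<longleftrightarrow> (\<exists>h. iso h \<and> dm h = dm t \<and> cd h = dm (pr e0 i0) \<and> pr e0 i0 \<cdot> h = t)"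
        by (rule cls_eq_iff[OF qt(2) diagram_sp(1)[OF d]]) (use ct d D0 in auto)
      then obtain h where h: "iso h" "dm h = dm t" "cd h = dm e0" "pr e0 i0 \<cdot> h = t" using True by auto
      define q' where "q' = h \<cdot> q"
      have q': "sur q'" "dm q' = dm u" "cd q' = dm e0" using h qt dq by (auto simp: q'_def)
      have "pr e0 i0 \<cdot> q' = t \<cdot> q" unfolding q'_def by (rule cmp_left_eq[OF h(4)]) (use h qt D0 in auto)
      then have "pr (e0 \<cdot> q') (i0 \<cdot> q') = pr ((i \<cdot> a) \<cdot> u) (d \<cdot> v)" using qt(4) q' D0 by (simp add: pr_cmp)
      then have eq: "e0 \<cdot> q' = (i \<cdot> a) \<cdot> u" "i0 \<cdot> q' = d \<cdot> v"
        by (rule pr_eqD; use q' D0 F(1-12) B(1-8) U(1-8) cd d in simp)+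
      have iau: "sur ((i \<cdot> a) \<cdot> u)" unfolding eq(1)[symmetric] using q' D0 by simp
      then have iau': "sur (i \<cdot> (a \<cdot> u))" using F B U by simp
      then have "sur i" by (rule sur_cancel) (use F B U in auto)
      then have ii: "iso i" using F sur_mon_iso by blast
      obtain i' where i': "arr i'" "dm i' = cd i" "cd i' = dm i" "i' \<cdot> i = ide (dm i)" "iso i'" using ii by (meson isoE)
      have "sur (i' \<cdot> (i \<cdot> (a \<cdot> u)))" using sur_cmp_iso[OF iau' i'(5)] i' by simp
      moreover have "i' \<cdot> (i \<cdot> (a \<cdot> u)) = ide (dm i) \<cdot> (a \<cdot> u)" by (rule cmp_left_eq[OF i'(4)]) (use i' F B U in auto)
      ultimately have au: "sur (a \<cdot> u)" using F B U by simp
      \<comment> \<open>Points with the same image under \<open>e\<close> are related to the same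
        point of \<open>z\<close>, hence by the composite relation to the same point of
        \<open>x\<close>. Since \<open>i0\<close> is mono, they agree.\<close>
      have "mon e"
      proof (rule monI)
        fix k1 k2 assume k: "arr k1" "arr k2" "dm k1 = dm k2" "cd k1 = dm e" "cd k2 = dm e" "e \<cdot> k1 = e \<cdot> k2"
        obtain g1 c1 where 1: "sur c1" "arr g1" "cd c1 = dm k1" "dm g1 = dm c1" "cd g1 = dm (a \<cdot> u)" "(a \<cdot> u) \<cdot> g1 = k1 \<cdot> c1"
          by (rule cover[OF au, of k1]) (use k F B in auto)
        have g1: "a \<cdot> (u \<cdot> g1) = k1 \<cdot> c1" using 1 F B U by simp
        have "e \<cdot> (k2 \<cdot> c1) = e \<cdot> (k1 \<cdot> c1)" by (rule cmp_square[OF k(6)[symmetric]]) (use k 1 F in auto)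
        also have "\<dots> = f \<cdot> (b \<cdot> (u \<cdot> g1))" unfolding g1[symmetric] by (rule cmp_square[OF B(9)]) (use 1 F B U in auto)
        finally obtain h1 where h1: "arr h1" "dm h1 = dm (k2 \<cdot> c1)" "cd h1 = dm a" "a \<cdot> h1 = k2 \<cdot> c1" "b \<cdot> h1 = b \<cdot> (u \<cdot> g1)"
          by (rule pb_lift[OF F(13)]) (use k 1 F B U in auto)
        have "(j \<cdot> b) \<cdot> h1 = j \<cdot> (b \<cdot> (u \<cdot> g1))" using h1 F B by simp
        also have "\<dots> = (j \<cdot> b) \<cdot> (u \<cdot> g1)" by (rule cmp_assoc[symmetric]) (use 1 F B U in auto)
        also have "\<dots> = c \<cdot> (v \<cdot> g1)" by (rule cmp_square[OF U(9)]) (use 1 F B U cd in auto)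
        finally obtain g2 where g2: "arr g2" "dm g2 = dm h1" "cd g2 = dm u" "u \<cdot> g2 = h1" "v \<cdot> g2 = v \<cdot> g1"
          by (rule pb_lift[OF uv(1)]) (use 1 h1 F B U cd in auto)
        have "i0 \<cdot> (q' \<cdot> g2) = d \<cdot> (v \<cdot> g2)" by (rule cmp_square[OF eq(2)]) (use q' g2 D0 cd U in auto)
        also have "\<dots> = i0 \<cdot> (q' \<cdot> g1)" unfolding g2(5) by (rule cmp_square[OF eq(2)[symmetric]]) (use q' 1 D0 cd U in auto)
        finally have qg: "q' \<cdot> g2 = q' \<cdot> g1" by (rule monD[OF D0(2)]) (use q' g2 1 D0 in auto)
        have ea: "e0 \<cdot> (q' \<cdot> gg) = i \<cdot> (a \<cdot> (u \<cdot> gg))" if "arr gg" "cd gg = dm u" for gg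
        proof -
          have "e0 \<cdot> (q' \<cdot> gg) = (i \<cdot> a) \<cdot> (u \<cdot> gg)" by (rule cmp_square[OF eq(1)]) (use that q' D0 F B U in auto)
          then show ?thesis using that F B U by simp
        qed
        have "i \<cdot> (a \<cdot> (u \<cdot> g1)) = i \<cdot> (a \<cdot> (u \<cdot> g2))" using ea[of g1] ea[of g2] qg 1 g2 by simp
        then have "a \<cdot> (u \<cdot> g1) = a \<cdot> (u \<cdot> g2)" by (rule monD[OF F(1)]) (use 1(1-5) g2(1-3) F B U in auto)
        then have "k1 \<cdot> c1 = k2 \<cdot> c1" using g1 g2 h1 by simp
        then show "k1 = k2" by (rule sur_epi[OF 1(1)]) (use 1 k in auto)
      qed (use F in auto)
      then have "iso e" using F sur_mon_iso by blast
      then have "sz w = sz (cd e)" using sz_iso[OF ii] sz_iso[of e] F by simp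
      moreover have "sz (cd f) \<le> sz z" using subquotient_sz(1)[of j f] F by simp
      ultimately show ?thesis using s B(5) by simp
    qed
  qed (simp_all add: co_add_left co_smul_left, simp_all add: plus_fun_apply smul_apply zero_fun_apply)
qed (simp_all add: co_add_right co_smul_right, simp_all add: plus_fun_apply smul_apply zero_fun_apply)

text \<open>The ideal of endomorphisms that factor through a direct sum of proper subquotients. A
  list is used because the intermediate object varies from term to term.\<close>

definition through_proper :: "'o \<Rightarrow> (('o \<times> 'm) set \<Rightarrow> 'k) \<Rightarrow> bool" where
  "through_proper w u \<longleftrightarrow> (\<exists>L. (\<forall>(z, g, f) \<in> set L. proper_subquotient C z w \<and> f \<in> H w z \<and> g \<in> H z w) \<and>
     u = (\<Sum>(z, g, f) \<leftarrow> L. co w z w g f))"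

lemma through_proper_zero: "through_proper w 0"
  unfolding through_proper_def by (intro exI[of _ "[]"]) simp

lemma through_proper_add: "through_proper w u \<Longrightarrow> through_proper w v \<Longrightarrow> through_proper w (u + v)"
  unfolding through_proper_def
proof (elim exE conjE, goal_cases)
  case (1 L M)
  then show ?case by (intro exI[of _ "L @ M"]) auto
qed

lemma through_proper_sum: "(\<And>i. i \<in> I \<Longrightarrow> through_proper w (u i)) \<Longrightarrow> through_proper w (\<Sum>i\<in>I. u i)"
proof (induction I rule: infinite_finite_induct)
  case (insert i I)
  then show ?case using through_proper_add[of w "u i" "sum u I"] by simp
qed (simp_all add: through_proper_zero)

lemma through_proper_single: "proper_subquotient C z w \<Longrightarrow> f \<in> H w z \<Longrightarrow> g \<in> H z w \<Longrightarrow> through_proper w (co w z w g f)"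
  unfolding through_proper_def by (intro exI[of _ "[(z, g, f)]"]) simp

lemma through_proper_induct [consumes 2, case_names single zero add]:
  assumes "through_proper w u" "w \<in> Ob C"
    and "\<And>z f g. z \<in> Ob C \<Longrightarrow> sz z < sz w \<Longrightarrow> f \<in> H w z \<Longrightarrow> g \<in> H z w \<Longrightarrow>
      proper_subquotient C z w \<Longrightarrow> P (co w z w g f)"
    and "P 0" and "\<And>u v. u \<in> H w w \<Longrightarrow> v \<in> H w w \<Longrightarrow> P u \<Longrightarrow> P v \<Longrightarrow> P (u + v)"
  shows "P u" "u \<in> H w w"
proof -
  obtain L where L: "\<forall>(z, g, f) \<in> set L. proper_subquotient C z w \<and> f \<in> H w z \<and> g \<in> H z w"
    "u = (\<Sum>(z, g, f) \<leftarrow> L. co w z w g f)" using assms(1) unfolding through_proper_def by blast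
  have "P (\<Sum>(z, g, f) \<leftarrow> L. co w z w g f) \<and> (\<Sum>(z, g, f) \<leftarrow> L. co w z w g f) \<in> H w w" using L(1)
  proof (induction L)
    case Nil
    then show ?case using assms(4) by simp
  next
    case (Cons a L)
    obtain z g f where a: "a = (z, g, f)" by (cases a) auto
    have p: "proper_subquotient C z w" "f \<in> H w z" "g \<in> H z w" using Cons(2) a by auto
    then have z: "z \<in> Ob C" "sz z < sz w" using proper_subquotient_iff[OF assms(2), of z] by auto
    have "P (co w z w g f)" "co w z w g f \<in> H w w" using assms(2,3) z p by auto
    then show ?case using Cons assms(5) a by simp
  qed
  then show "P u" "u \<in> H w w" using L(2) by auto
qed

text \<open>Such an \<open>\<epsilon>\<close> is the projection of \<open>[w]\<close> onto \<open>[w]\<^sup>0\<close>.\<close>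

definition is_eps :: "'o \<Rightarrow> (('o \<times> 'm) set \<Rightarrow> 'k) \<Rightarrow> bool" where
  "is_eps w \<epsilon> \<longleftrightarrow> w \<in> Ob C \<and> \<epsilon> \<in> H w w \<and> through_proper w (un w - \<epsilon>) \<and>
     (\<forall>z\<in>Ob C. sz z < sz w \<longrightarrow> (\<forall>f\<in>H w z. co w w z f \<epsilon> = 0) \<and> (\<forall>g\<in>H z w. co z w w \<epsilon> g = 0))"

lemma isepD:
  assumes "is_eps w \<epsilon>"
  shows "w \<in> Ob C" "\<epsilon> \<in> H w w" "through_proper w (un w - \<epsilon>)"
    "\<And>z f. z \<in> Ob C \<Longrightarrow> sz z < sz w \<Longrightarrow> f \<in> H w z \<Longrightarrow> co w w z f \<epsilon> = 0"
    "\<And>z g. z \<in> Ob C \<Longrightarrow> sz z < sz w \<Longrightarrow> g \<in> H z w \<Longrightarrow> co z w w \<epsilon> g = 0"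
  using assms unfolding is_eps_def by blast+

text \<open>\<open>un w - \<epsilon>\<close> is a sum of composites through objects smaller than
  \<open>w\<close>, hence smaller than \<open>w'\<close>, and morphisms from \<open>w'\<close> to
  such objects vanish on \<open>\<epsilon>'\<close>.\<close>

lemma eps_absorb_left:
  assumes e: "is_eps w \<epsilon>" "is_eps w' \<epsilon>'" "sz w = sz w'" and f: "f \<in> H w' w"
  shows "co w' w w \<epsilon> (co w' w' w f \<epsilon>') = co w' w' w f \<epsilon>'"
proof -
  note E = isepD[OF e(1)] and E' = isepD[OF e(2)]
  have fe: "co w' w' w f \<epsilon>' \<in> H w' w" using f E E' by simp
  have "co w' w w (un w - \<epsilon>) (co w' w' w f \<epsilon>') = 0"
    using E(3,1)
  proof (induction rule: through_proper_induct(1))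
    case (single z k g)
    have "co w' w w (co w z w g k) (co w' w' w f \<epsilon>') = co w' z w g (co w' w' z (co w' w z k f) \<epsilon>')"
      using single f E(1,2) E'(1,2) co_assoc[of "co w' w' w f \<epsilon>'" w' w k z g w] co_assoc[of \<epsilon>' w' w' f w k z] by simp
    also have "co w' w' z (co w' w z k f) \<epsilon>' = 0" using E'(4)[of z "co w' w z k f"] single f E(1) E'(1) e(3) by simp
    finally show ?case by simp
  qed (simp_all add: co_add_left)
  then show ?thesis using fe E(1) E'(1) by (simp add: co_minus_left)
qed

lemma eps_absorb_right:
  assumes e: "is_eps w \<epsilon>" "is_eps w' \<epsilon>'" "sz w = sz w'" and f: "f \<in> H w' w"
  shows "co w' w' w (co w' w w \<epsilon> f) \<epsilon>' = co w' w w \<epsilon> f"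
proof -
  note E = isepD[OF e(1)] and E' = isepD[OF e(2)]
  have fe: "co w' w w \<epsilon> f \<in> H w' w" using f E E' by simp
  have "co w' w' w (co w' w w \<epsilon> f) (un w' - \<epsilon>') = 0"
    using E'(3,1)
  proof (induction rule: through_proper_induct(1))
    case (single z k g)
    have "co w' w' w (co w' w w \<epsilon> f) (co w' z w' g k) = co w' z w (co z w w \<epsilon> (co z w' w f g)) k"
      using single f E(1,2) E'(1,2) co_assoc[of k w' z g w' "co w' w w \<epsilon> f" w] co_assoc[of g z w' f w \<epsilon> w] by simp
    also have "co z w w \<epsilon> (co z w' w f g) = 0" using E(5)[of z "co z w' w f g"] single f E(1) E'(1) e(3) by simp
    finally show ?case by simp
  qed (simp_all add: co_add_right)
  then show ?thesis using fe E(1) E'(1) by (simp add: co_minus_right)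
qed

text \<open>For \<open>w = w'\<close> and \<open>f\<close> the identity this shows that
  \<open>\<epsilon>\<close> is unique; then, for arbitrary \<open>f\<close>, that it is central in
  the endomorphism ring of \<open>[w]\<close>.\<close>

lemma eps_commute:
  assumes e: "is_eps w \<epsilon>" "is_eps w' \<epsilon>'" "sz w = sz w'" and f: "f \<in> H w' w"
  shows "co w' w w \<epsilon> f = co w' w' w f \<epsilon>'"
  using eps_absorb_left[OF assms] eps_absorb_right[OF assms] co_assoc[of \<epsilon>' w' w' f w \<epsilon> w] isepD[OF e(1)] isepD[OF e(2)] f
  by simp

lemma eps_idem: "is_eps w \<epsilon> \<Longrightarrow> co w w w \<epsilon> \<epsilon> = \<epsilon>"
  using eps_absorb_left[of w \<epsilon> w \<epsilon> "un w"] isepD[of w \<epsilon>] by simp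

text \<open>A relation from \<open>w'\<close> to \<open>w\<close> splits through a common
  subquotient. Unless this is isomorphic to both ends, it is smaller than one of them and is
  annihilated by the corresponding idempotent.\<close>

lemma eps_kill:
  assumes e: "is_eps w \<epsilon>" "is_eps w' \<epsilon>'" and no: "\<not> (\<exists>h. iso h \<and> dm h = w' \<and> cd h = w)" and f: "f \<in> H w' w"
  shows "co w' w w \<epsilon> (co w' w' w f \<epsilon>') = 0"
proof -
  note E = isepD[OF e(1)] and E' = isepD[OF e(2)]
  show ?thesis using f E'(1) E(1)
  proof (induction rule: H_induct)
    case (bas r)
    obtain i e f j where F: "diagram w' e i" "diagram w f j" "cd e = cd f" "basis_vec r = co w' (cd e) w (sp f j) (sp i e)"
      using relation_split[OF bas E'(1) E(1)] by metis
    let ?v = "cd e"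
    have D: "sur e" "mon i" "dm e = dm i" "cd i = w'" "sur f" "mon j" "dm f = dm j" "cd j = w" using F unfolding diagram_def by auto
    have V: "?v \<in> Ob C" using D by simp
    have S: "sp i e \<in> H w' ?v" "sp f j \<in> H ?v w" using D F by auto
    have "sz ?v < sz w' \<or> sz ?v < sz w"
    proof (rule ccontr)
      assume "\<not> ?thesis"
      then have "iso i \<and> iso e" "iso j \<and> iso f"
        using subquotient_sz[of i e] subquotient_sz[of j f] D F(3) by force+
      moreover obtain i' where "dm i' = cd i" "cd i' = dm i" "iso i'" using calculation by (meson isoE)
      moreover obtain f' where "dm f' = cd f" "cd f' = dm f" "iso f'" using calculation by (meson isoE)
      ultimately have "iso (j \<cdot> (f' \<cdot> (e \<cdot> i')))" "dm (j \<cdot> (f' \<cdot> (e \<cdot> i'))) = w'" "cd (j \<cdot> (f' \<cdot> (e \<cdot> i'))) = w"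
        using D F(3) by auto
      then show False using no by blast
    qed
    then show ?case
    proof
      assume v: "sz ?v < sz w'"
      have "co w' w' w (co w' ?v w (sp f j) (sp i e)) \<epsilon>' = co w' ?v w (sp f j) (co w' w' ?v (sp i e) \<epsilon>')"
        using S V E(1) E'(1,2) co_assoc[of \<epsilon>' w' w' "sp i e" ?v "sp f j" w] by simp
      then show ?thesis using E'(4)[OF V v S(1)] F(4) by simp
    next
      assume v: "sz ?v < sz w"
      have "co w' w w \<epsilon> (co w' w' w (co w' ?v w (sp f j) (sp i e)) \<epsilon>') = co w' ?v w (co ?v w w \<epsilon> (sp f j)) (co w' w' ?v (sp i e) \<epsilon>')"
        using S V E(1,2) E'(1,2) co_assoc[of \<epsilon>' w' w' "sp i e" ?v "sp f j" w]
          co_assoc[of "co w' w' ?v (sp i e) \<epsilon>'" w' ?v "sp f j" w \<epsilon> w] by simp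
      then show ?thesis using E(5)[OF V v S(2)] F(4) by simp
    qed
  qed (simp_all add: co_add_left co_add_right co_smul_left co_smul_right)
qed

lemma sp_precompose_dual:
  assumes d: "diagram x e i" "cd e = w" and h: "iso h" "dm h = w" "cd h = w'"
  shows "co w' w x (sp e i) (sp h (ide w)) = sp (h \<cdot> e) i"
proof -
  have D: "sur e" "mon i" "dm e = dm i" "cd i = x" using d unfolding diagram_def by auto
  have "pb (ide w) e e (ide (dm e))" using pb_sym[OF pb_ide_right[of e w "dm e"]] D d by simp
  then have "co w' w x (sp e i) (sp h (ide w)) = sp (h \<cdot> e) (i \<cdot> ide (dm e))"
    by (rule co_sp) (use D d h in auto)
  then show ?thesis using D by simp
qed

text \<open>Moves a subquotient diagram to an isomorphic quotient object, so that diagrams with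
  isomorphic quotients can be compared over the same \<open>w\<close>.\<close>

lemma iota_shift:
  assumes d: "diagram x e i" and h: "iso h" "dm h = cd e"
  shows "co (cd e) (cd h) x (sp (h \<cdot> e) i) (sp (ide (cd e)) h) = sp e i"
proof -
  have D: "sur e" "mon i" "dm e = dm i" "cd i = x" using d unfolding diagram_def by auto
  have "pb h (h \<cdot> e) e (ide (dm e))"
  proof (rule pbI)
    fix k l assume a: "arr k" "arr l" "dm k = dm l" "cd k = dm h" "cd l = dm (h \<cdot> e)" "h \<cdot> k = (h \<cdot> e) \<cdot> l"
    have "h \<cdot> k = h \<cdot> (e \<cdot> l)" using a h D by simp
    then have "k = e \<cdot> l" by (rule monD[OF iso_mon[OF h(1)]]) (use a h D in auto)
    then show "\<exists>u. arr u \<and> dm u = dm k \<and> cd u = dm e \<and> e \<cdot> u = k \<and> ide (dm e) \<cdot> u = l"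
      using a by (intro exI[of _ l]) auto
  qed (use D h in auto)
  then have "co (cd e) (cd h) x (sp (h \<cdot> e) i) (sp (ide (cd e)) h) = sp (ide (cd e) \<cdot> e) (i \<cdot> ide (dm e))"
    by (rule co_sp) (use D h in auto)
  then show ?thesis using D by simp
qed

section \<open>Dual elements\<close>

text \<open>The morphism dual to \<open>[i\<^sub>0] [e\<^sub>0]\<^sup>\<or>\<close> represents, via the trace form, the functional that
  reads off the coefficients of the relations \<open>(g e\<^sub>0, i\<^sub>0)\<close>, \<open>g \<in> Aut w\<close>, with weights making it
  \<open>Aut w\<close>-equivariant.\<close>

lemma dual_iota:
  assumes ep: "is_eps w \<epsilon>" and d0: "diagram x e0 i0" "cd e0 = w"
  shows "\<exists>b\<in>H x w. co x w w \<epsilon> b = b \<and> co w x w b (co w w x (sp e0 i0) \<epsilon>) = \<epsilon> \<and>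
    (\<forall>e i. diagram x e i \<and> cd e = w \<and> \<not> diagram_eq e i e0 i0 \<longrightarrow> co w x w b (co w w x (sp e i) \<epsilon>) = 0)"
proof -
  note E = isepD[OF ep]
  have D0: "sur e0" "mon i0" "dm e0 = dm i0" "cd i0 = x" using d0 unfolding diagram_def by auto
  have O: "w \<in> Ob C" "x \<in> Ob C" using E d0 diagram_sp by auto
  define aut where "aut g \<longleftrightarrow> iso g \<and> dm g = w \<and> cd g = w" for g
  \<comment> \<open>\<open>bk g\<close> is \<open>[g]\<^sup>\<or>\<close>, which is why composition
    reverses the order in \<open>bkc\<close>.\<close>
  define bk where "bk g = sp g (ide w)" for g
  have bkH: "bk g \<in> H w w" if "aut g" for g using that O by (simp add: bk_def aut_def)
  have dg0: "diagram x (g \<cdot> e) i" "cd (g \<cdot> e) = w" if "aut g" "diagram x e i" "cd e = w" for g e i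
    using that by (auto simp: diagram_def aut_def)
  have bkc: "co w w w (bk g) (bk h) = bk (h \<cdot> g)" if "aut g" "aut h" for g h
  proof -
    have "diagram w g (ide w)" "cd g = w" using that O by (auto simp: diagram_def aut_def)
    then show ?thesis using sp_precompose_dual[of w g "ide w" w h w] that by (simp add: bk_def aut_def)
  qed
  have iobk: "co w w x (sp e i) (bk h) = sp (h \<cdot> e) i" if "aut h" "diagram x e i" "cd e = w" for h e i
    using sp_precompose_dual[OF that(2,3), of h w] that by (simp add: bk_def aut_def)
  \<comment> \<open>The forced weight: if \<open>b\<close> sends
    \<open>[i\<^sub>0] [e\<^sub>0]\<^sup>\<or> \<epsilon>\<close> to \<open>\<epsilon>\<close>, then
    it must send \<open>[i\<^sub>0] [e\<^sub>0]\<^sup>\<or> [g]\<^sup>\<or> \<epsilon>\<close> to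
    \<open>[g]\<^sup>\<or> \<epsilon>\<close>, whose trace this is.\<close>
  define psi where "psi g = tr w (co w w w (bk g) \<epsilon>)" for g
  define rel where "rel r g \<longleftrightarrow> aut g \<and> r = cls (pr (g \<cdot> e0) i0)" for r g
  \<comment> \<open>The automorphisms act freely on these relations: \<open>i0\<close> being mono
    forces \<open>k\<close> to be the identity, and then \<open>e0\<close> being epi forces
    \<open>g = g'\<close>.\<close>
  have rel_unique: "g = g'" if "rel r g" "rel r g'" for r g g'
  proof -
    have a: "aut g" "aut g'" "cls (pr (g \<cdot> e0) i0) = cls (pr (g' \<cdot> e0) i0)" using that by (auto simp: rel_def)
    obtain k where k: "iso k" "dm k = dm (g \<cdot> e0)" "cd k = dm (g' \<cdot> e0)" "(g' \<cdot> e0) \<cdot> k = g \<cdot> e0" "i0 \<cdot> k = i0"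
      using cls_pr_eq_iff[OF dg0(1)[OF a(1) d0] dg0(1)[OF a(2) d0]] a by (auto simp: aut_def)
    have "i0 \<cdot> k = i0 \<cdot> ide (dm i0)" using k D0 by simp
    then have "k = ide (dm i0)" by (rule monD[OF D0(2)]) (use k D0 in auto)
    then have "g' \<cdot> e0 = g \<cdot> e0" using k D0 a d0(2) by (simp add: aut_def)
    then show "g = g'" by (rule sur_epi[OF D0(1), symmetric]) (use a d0 in \<open>auto simp: aut_def\<close>)
  qed
  define phi where "phi r = (if \<exists>g. rel r g then psi (THE g. rel r g) else 0)" for r
  have phi1: "phi r = psi g" if "rel r g" for r g
  proof -
    have "(THE g. rel r g) = g" using that rel_unique by (intro the_equality) auto
    then show ?thesis using that unfolding phi_def by auto
  qed
  have phi0: "phi r = 0" if "\<not> (\<exists>g. rel r g)" for r unfolding phi_def by (rule if_not_P[OF that])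
  obtain b0 where b0: "b0 \<in> H x w" "\<forall>a\<in>H w x. tr w (co w x w b0 a) = (\<Sum>r\<in>subobjects C (prd C w x). a r * phi r)"
    using functional_rep[OF O, of phi] by blast
  define b where "b = co x w w \<epsilon> b0"
  have bH: "b \<in> H x w" using b0 E O by (simp add: b_def)
  have eb: "co x w w \<epsilon> b = b" unfolding b_def using co_assoc[of b0 x w \<epsilon> w \<epsilon> w] b0 E O eps_idem[OF ep] by simp
  \<comment> \<open>Inserting \<open>\<epsilon>\<close> does not affect the functional: the
    difference is a sum of composites through smaller objects, and by \<open>small_composite\<close>
    these have coefficient 0 at every relation on which \<open>phi\<close> is nonzero.\<close>
  have T: "tr w (co w x w b0 (co w w x (sp e i) \<epsilon>)) = phi (cls (pr e i))" if e: "diagram x e i" "cd e = w" for e i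
  proof -
    let ?S = "subobjects C (prd C w x)" and ?c = "cls (pr e i)"
    note s = diagram_sp[OF e]
    have v: "(co w w x (sp e i) (un w - \<epsilon>)) r * phi r = 0" for r
    proof (cases "\<exists>g. rel r g")
      case True
      then obtain g where g: "aut g" "r = cls (pr (g \<cdot> e0) i0)" by (auto simp: rel_def)
      have "(co w w x (sp e i) (un w - \<epsilon>)) r = 0"
        using E(3) O(1)
      proof (induction rule: through_proper_induct(1))
        case (single z k l)
        have "co w w x (sp e i) (co w z w l k) = co w z x (co z w x (sp e i) l) k"
          using co_assoc[of k w z l w "sp e i" x] single s O by simp
        then show ?case unfolding g(2)
          using small_composite[of k w z "co z w x (sp e i) l" x "g \<cdot> e0" i0] single s O dg0[OF g(1) d0] by simp
      qed (simp_all add: co_add_right, simp_all add: plus_fun_apply zero_fun_apply)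
      then show ?thesis by simp
    qed (simp add: phi0)
    have v': "(co w w x (sp e i) \<epsilon>) r * phi r = sp e i r * phi r" for r
      using v[of r] s(4) O by (auto simp: co_minus_right)
    have "tr w (co w x w b0 (co w w x (sp e i) \<epsilon>)) = (\<Sum>r\<in>?S. (co w w x (sp e i) \<epsilon>) r * phi r)"
      using bspec[OF b0(2), of "co w w x (sp e i) \<epsilon>"] s(4) E(2) O by simp
    also have "\<dots> = (\<Sum>r\<in>?S. sp e i r * phi r)" by (rule sum.cong[OF HOL.refl]) (rule v')
    finally have "tr w (co w x w b0 (co w w x (sp e i) \<epsilon>)) = (\<Sum>r\<in>?S. sp e i r * phi r)" .
    also have "\<dots> = (\<Sum>r\<in>?S. if r = ?c then phi ?c else 0)"
      unfolding s(2) by (rule sum.cong) (auto simp: basis_vec_def)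
    also have "\<dots> = phi ?c" using s O by simp
    finally show ?thesis .
  qed
  \<comment> \<open>The claimed value \<open>d'\<close> is compared with the composite
    \<open>d\<close> through the trace form on the endomorphisms of \<open>[w]\<close>. Relations
    through a smaller object pair to 0 with both because of the factor \<open>\<epsilon>\<close>.
    The others are \<open>[h]\<^sup>\<or>\<close> for an automorphism \<open>h\<close>, and
    centrality of \<open>\<epsilon>\<close> reduces the pairing to \<open>T\<close> for the diagram
    shifted by \<open>h\<close>.\<close>
  have main: "co w x w b (co w w x (sp e i) \<epsilon>) = d'"
    if e: "diagram x e i" "cd e = w" and d': "(\<exists>g. rel (cls (pr e i)) g \<and> d' = co w w w (bk g) \<epsilon>) \<or> \<not> (\<exists>g. rel (cls (pr e i)) g) \<and> d' = 0" for e i d'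
  proof -
    note s = diagram_sp[OF e]
    define d where "d = co w x w b (co w w x (sp e i) \<epsilon>)"
    have d'H: "d' \<in> H w w" using d' bkH E O by (auto simp: rel_def)
    have dH: "d \<in> H w w" using bH s E O by (simp add: d_def)
    have de: "co w w w d \<epsilon> = d" "co w w w d' \<epsilon> = d'"
    proof -
      show "co w w w d \<epsilon> = d" unfolding d_def
        using co_assoc[of \<epsilon> w w "co w w x (sp e i) \<epsilon>" x b w] co_assoc[of \<epsilon> w w \<epsilon> w "sp e i" x] eps_idem[OF ep] bH s E O by simp
      show "co w w w d' \<epsilon> = d'" using d'
      proof
        assume "\<exists>g. rel (cls (pr e i)) g \<and> d' = co w w w (bk g) \<epsilon>"
        then obtain g where g: "aut g" "d' = co w w w (bk g) \<epsilon>" by (auto simp: rel_def)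
        then show ?thesis using co_assoc[of \<epsilon> w w \<epsilon> w "bk g" w] bkH[OF g(1)] eps_idem[OF ep] E O by simp
      qed simp
    qed
    have "tr w (co w w w t (d - d')) = 0" if t: "t \<in> H w w" for t
      using t O(1,1)
    proof (induction rule: H_induct)
      case (bas r)
      obtain i' e' f j where F: "diagram w e' i'" "diagram w f j" "cd e' = cd f" "basis_vec r = co w (cd e') w (sp f j) (sp i' e')"
        "iso i' \<Longrightarrow> iso e' \<Longrightarrow> \<exists>e'' i''. diagram w e'' i'' \<and> cd e'' = w \<and> r = cls (pr e'' i'')"
        using relation_split[OF bas O(1,1)] by metis
      let ?v = "cd e'"
      have D: "sur e'" "mon i'" "dm e' = dm i'" "cd i' = w" "sur f" "mon j" "dm f = dm j" "cd j = w" using F unfolding diagram_def by auto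
      have V: "?v \<in> Ob C" using D by simp
      have S: "sp i' e' \<in> H w ?v" "sp f j \<in> H ?v w" using D F by auto
      have bH': "basis_vec r \<in> H w w" using bas by simp
      show ?case
      proof (cases "sz ?v < sz w")
        case True
        have z: "tr w (co w w w (basis_vec r) t) = 0" if t: "t \<in> H w w" "co w w w t \<epsilon> = t" for t
        proof -
          have "co w w w t (co w ?v w (sp f j) (sp i' e')) = co w ?v w (co ?v w w t (sp f j)) (sp i' e')"
            using co_assoc[of "sp i' e'" w ?v "sp f j" w t w] S t V O by simp
          also have "co ?v w w t (sp f j) = co ?v w w t (co ?v w w \<epsilon> (sp f j))"
            using co_assoc[of "sp f j" ?v w \<epsilon> w t w] S t V O E by simp
          also have "co ?v w w \<epsilon> (sp f j) = 0" using E(5)[OF V True S(2)] .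
          finally have "co w w w t (basis_vec r) = 0" using F(4) by simp
          then show ?thesis using tr_comm[OF t(1) bH' O(1,1)] by simp
        qed
        show ?thesis using z[OF dH de(1)] z[OF d'H de(2)] by (simp add: co_minus_right tr_minus del: minus_apply)
      next
        case False
        then have "iso i'" "iso e'" using subquotient_sz[of i' e'] D by force+
        then obtain e'' i'' where F2: "diagram w e'' i''" "cd e'' = w" "r = cls (pr e'' i'')" using F(5) by blast
        have D2: "sur e''" "mon i''" "dm e'' = dm i''" "cd i'' = w" using F2 unfolding diagram_def by auto
        have iso2: "iso i''" "iso e''" using subquotient_sz(2)[of i'' e''] D2 F2 by auto
        obtain k where k: "arr k" "dm k = cd i''" "cd k = dm i''" "k \<cdot> i'' = ide (dm i'')" "iso k" using iso2(1) by (meson isoE)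
        define h where "h = e'' \<cdot> k"
        have h: "aut h" using k iso2 D2 F2 by (auto simp: aut_def h_def)
        have "(e'' \<cdot> k) \<cdot> i'' = e''" "ide w \<cdot> i'' = i''" using k D2 by auto
        then have "sp e'' i'' = sp (h \<cdot> i'') (ide w \<cdot> i'')" by (simp add: h_def)
        also have "\<dots> = bk h" unfolding bk_def by (rule sp_iso) (use iso2 h D2 O in \<open>auto simp: aut_def\<close>)
        finally have rb: "basis_vec r = bk h" using diagram_sp(2)[OF F2(1,2)] F2(3) by simp
        have eh: "co w w w \<epsilon> (bk h) = co w w w (bk h) \<epsilon>" using eps_commute[OF ep ep HOL.refl bkH[OF h]] .
        have he: "diagram x (h \<cdot> e) i" "cd (h \<cdot> e) = w" using dg0[OF h e] by auto
        have "tr w (co w w w (bk h) d) = tr w (co w w w d (bk h))" using tr_comm[OF dH bkH[OF h] O(1,1)] by simp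
        also have "co w w w d (bk h) = co w x w b (co w w x (sp e i) (co w w w \<epsilon> (bk h)))"
          unfolding d_def using co_assoc[of "bk h" w w "co w w x (sp e i) \<epsilon>" x b w] co_assoc[of "bk h" w w \<epsilon> w "sp e i" x]
            bkH[OF h] bH s E O by simp
        also have "\<dots> = co w x w b (co w w x (sp (h \<cdot> e) i) \<epsilon>)"
          unfolding eh using co_assoc[of \<epsilon> w w "bk h" w "sp e i" x] iobk[OF h e] bkH[OF h] s E O by simp
        also have "\<dots> = co w w w \<epsilon> (co w x w b0 (co w w x (sp (h \<cdot> e) i) \<epsilon>))"
          unfolding b_def using co_assoc[of "co w w x (sp (h \<cdot> e) i) \<epsilon>" w x b0 w \<epsilon> w] b0(1) diagram_sp(4)[OF he] E O by simp
        also have "tr w \<dots> = tr w (co w w w (co w x w b0 (co w w x (sp (h \<cdot> e) i) \<epsilon>)) \<epsilon>)"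
          by (rule tr_comm) (use b0(1) diagram_sp(4)[OF he] E O in auto)
        also have "co w w w (co w x w b0 (co w w x (sp (h \<cdot> e) i) \<epsilon>)) \<epsilon> = co w x w b0 (co w w x (sp (h \<cdot> e) i) \<epsilon>)"
          using co_assoc[of \<epsilon> w w "co w w x (sp (h \<cdot> e) i) \<epsilon>" x b0 w] co_assoc[of \<epsilon> w w \<epsilon> w "sp (h \<cdot> e) i" x] eps_idem[OF ep]
            b0(1) diagram_sp(4)[OF he] E O by simp
        also have "tr w \<dots> = phi (cls (pr (h \<cdot> e) i))" by (rule T[OF he])
        finally have 1: "tr w (co w w w (bk h) d) = phi (cls (pr (h \<cdot> e) i))" .
        \<comment> \<open>The equivariance of \<open>rel\<close>: composing the quotient map with
          \<open>h'\<close> moves the automorphism by \<open>h'\<close>.\<close>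
        have shift: "rel (cls (pr (h' \<cdot> e1) i1)) (h' \<cdot> g)" if sh: "rel (cls (pr e1 i1)) g" "diagram x e1 i1" "cd e1 = w" "aut h'" for e1 i1 g h'
        proof -
          have g: "aut g" "cls (pr e1 i1) = cls (pr (g \<cdot> e0) i0)" using sh by (auto simp: rel_def)
          note dge = dg0[OF g(1) d0]
          obtain k where k: "iso k" "dm k = dm e1" "cd k = dm (g \<cdot> e0)" "(g \<cdot> e0) \<cdot> k = e1" "i0 \<cdot> k = i1"
            using cls_pr_eq_iff[OF sh(2) dge(1)] sh dge g by auto
          have D1: "sur e1" "arr (g \<cdot> e0)" using sh dge by (auto simp: diagram_def)
          have hg: "h' \<cdot> (g \<cdot> e0) = (h' \<cdot> g) \<cdot> e0" using sh g d0 D0 by (simp add: aut_def)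
          have "(h' \<cdot> (g \<cdot> e0)) \<cdot> k = h' \<cdot> ((g \<cdot> e0) \<cdot> k)" by (rule cmp_assoc) (use sh k D1 dge in \<open>auto simp: aut_def\<close>)
          then have "((h' \<cdot> g) \<cdot> e0) \<cdot> k = h' \<cdot> e1" unfolding hg k(4) .
          moreover have ag: "aut (h' \<cdot> g)" using sh g by (auto simp: aut_def)
          ultimately have "cls (pr (h' \<cdot> e1) i1) = cls (pr ((h' \<cdot> g) \<cdot> e0) i0)"
            using k cls_pr_eq_iff[OF dg0(1)[OF sh(4,2,3)] dg0(1)[OF ag d0]] sh by (auto simp: aut_def)
          then show ?thesis using ag by (simp add: rel_def)
        qed
        have 2: "tr w (co w w w (bk h) d') = phi (cls (pr (h \<cdot> e) i))"
          using d'
        proof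
          assume "\<exists>g. rel (cls (pr e i)) g \<and> d' = co w w w (bk g) \<epsilon>"
          then obtain g where g: "rel (cls (pr e i)) g" "d' = co w w w (bk g) \<epsilon>" by blast
          have ag: "aut g" using g by (simp add: rel_def)
          have "tr w (co w w w (bk h) d') = tr w (co w w w d' (bk h))" using tr_comm[OF d'H bkH[OF h] O(1,1)] by simp
          also have "co w w w d' (bk h) = co w w w (bk g) (co w w w (bk h) \<epsilon>)"
            unfolding g(2) eh[symmetric] using co_assoc[of "bk h" w w \<epsilon> w "bk g" w] bkH[OF h] bkH[OF ag] E O by simp
          also have "\<dots> = co w w w (bk (h \<cdot> g)) \<epsilon>"
            using co_assoc[of \<epsilon> w w "bk h" w "bk g" w] bkH[OF h] bkH[OF ag] bkc[OF ag h] E O by simp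
          finally show ?thesis using phi1[OF shift[OF g(1) e h]] by (simp add: psi_def)
        next
          assume n: "\<not> (\<exists>g. rel (cls (pr e i)) g) \<and> d' = 0"
          have "\<not> (\<exists>g. rel (cls (pr (h \<cdot> e) i)) g)"
          proof
            assume "\<exists>g. rel (cls (pr (h \<cdot> e) i)) g"
            then obtain g where g: "rel (cls (pr (h \<cdot> e) i)) g" by blast
            obtain h' where h': "arr h'" "dm h' = cd h" "cd h' = dm h" "h' \<cdot> h = ide (dm h)" "iso h'" using h by (meson aut_def isoE)
            have "aut h'" using h h' by (simp add: aut_def)
            then have "rel (cls (pr (h' \<cdot> (h \<cdot> e)) i)) (h' \<cdot> g)" by (rule shift[OF g he])
            moreover have "h' \<cdot> (h \<cdot> e) = e" using cmp_left_eq[OF h'(4), of e] h h' e by (simp add: aut_def diagram_def)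
            ultimately show False using n by auto
          qed
          then show ?thesis using phi0 n by simp
        qed
        show ?thesis using 1 2 rb by (simp add: co_minus_right tr_minus del: minus_apply)
      qed
    qed (simp_all add: co_add_left co_smul_left tr_add tr_smul)
    then have "d - d' = 0" using trace_nondegenerate[of "d - d'" w w] dH d'H O by simp
    then show ?thesis by (simp add: d_def)
  qed
  have r0: "rel (cls (pr e0 i0)) (ide w)" using D0 d0 O by (auto simp: rel_def aut_def)
  have "co w x w b (co w w x (sp e0 i0) \<epsilon>) = co w w w (bk (ide w)) \<epsilon>"
    by (rule main[OF d0]) (use r0 in blast)
  also have "bk (ide w) = un w" using un_eq[OF O(1)] by (simp add: bk_def)
  also have "co w w w (un w) \<epsilon> = \<epsilon>" using E(2) O by simp
  finally have b1: "co w x w b (co w w x (sp e0 i0) \<epsilon>) = \<epsilon>" .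
  \<comment> \<open>A relation in the orbit of \<open>(e0, i0)\<close> comes from an equivalent
    diagram, so an inequivalent one falls into the second case of \<open>main\<close>.\<close>
  have b2: "co w x w b (co w w x (sp e i) \<epsilon>) = 0" if e: "diagram x e i" "cd e = w" and n: "\<not> diagram_eq e i e0 i0" for e i
  proof (rule main[OF e])
    have "\<not> (\<exists>g. rel (cls (pr e i)) g)"
    proof
      assume "\<exists>g. rel (cls (pr e i)) g"
      then obtain g where g: "aut g" "cls (pr e i) = cls (pr (g \<cdot> e0) i0)" by (auto simp: rel_def)
      note dge = dg0[OF g(1) d0]
      obtain k where k: "iso k" "dm k = dm e" "cd k = dm (g \<cdot> e0)" "(g \<cdot> e0) \<cdot> k = e" "i0 \<cdot> k = i"
        using cls_pr_eq_iff[OF e(1) dge(1)] e dge g by auto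
      obtain g' where g': "arr g'" "dm g' = cd g" "cd g' = dm g" "g' \<cdot> g = ide (dm g)" "iso g'" using g by (meson aut_def isoE)
      have "g \<cdot> (e0 \<cdot> k) = e" using k g d0 D0 by (simp add: aut_def)
      then have "g' \<cdot> e = g' \<cdot> (g \<cdot> (e0 \<cdot> k))" by simp
      also have "\<dots> = ide w \<cdot> (e0 \<cdot> k)" using g g' k d0 D0 by (subst cmp_left_eq[OF g'(4)]) (auto simp: aut_def)
      finally have "e0 \<cdot> k = g' \<cdot> e" using k d0 D0 by simp
      then have "diagram_eq e i e0 i0" unfolding diagram_eq_def using g g' k e d0 by (intro exI[of _ g'] exI[of _ k]) (auto simp: aut_def)
      then show False using n by simp
    qed
    then show "(\<exists>g. rel (cls (pr e i)) g \<and> 0 = co w w w (bk g) \<epsilon>) \<or> \<not> (\<exists>g. rel (cls (pr e i)) g) \<and> (0::('o \<times> 'm) set \<Rightarrow> 'k) = 0" by simp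
  qed
  show ?thesis using bH eb b1 b2 by blast
qed

end

section \<open>The decomposition of the identity\<close>

context malcev_category
begin

definition eps :: "'o \<Rightarrow> ('o \<times> 'm) set \<Rightarrow> 'k" where "eps w = (SOME \<epsilon>. is_eps w \<epsilon>)"

lemma is_eps_eps: "is_eps w \<epsilon> \<Longrightarrow> is_eps w (eps w)"
  unfolding eps_def by (rule someI[of "is_eps w"])

abbreviation qz :: "('o \<times> 'm \<times> 'o \<times> 'm) set \<Rightarrow> 'o" where "qz Q \<equiv> cd (qe Q)"

abbreviation iota :: "'o \<Rightarrow> ('o \<times> 'm \<times> 'o \<times> 'm) set \<Rightarrow> ('o \<times> 'm) set \<Rightarrow> 'k" where
  "iota x Q \<equiv> sp (qe Q) (qi x Q)"

text \<open>Orthogonality is claimed only against those \<open>Q'\<close> whose \<open>eps\<close>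
  is already known to be valid, because duals are used inside the induction that constructs
  \<open>eps\<close>.\<close>

definition dual_prop :: "'o \<Rightarrow> ('o \<times> 'm \<times> 'o \<times> 'm) set \<Rightarrow> (('o \<times> 'm) set \<Rightarrow> 'k) \<Rightarrow> bool" where
  "dual_prop x Q b \<longleftrightarrow> b \<in> H x (qz Q) \<and> co x (qz Q) (qz Q) (eps (qz Q)) b = b \<and>
     co (qz Q) x (qz Q) b (co (qz Q) (qz Q) x (iota x Q) (eps (qz Q))) = eps (qz Q) \<and>
     (\<forall>Q'\<in>sq C x. Q' \<noteq> Q \<and> is_eps (qz Q') (eps (qz Q')) \<longrightarrow>
       co (qz Q') x (qz Q) b (co (qz Q') (qz Q') x (iota x Q') (eps (qz Q'))) = 0)"

definition dual_arr :: "'o \<Rightarrow> ('o \<times> 'm \<times> 'o \<times> 'm) set \<Rightarrow> ('o \<times> 'm) set \<Rightarrow> 'k" where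
  "dual_arr x Q = (SOME b. dual_prop x Q b)"

text \<open>If the quotient of \<open>Q'\<close> is not isomorphic to that of \<open>Q\<close>,
  orthogonality is \<open>eps_kill\<close>. Otherwise \<open>Q'\<close> is transported along an
  isomorphism to a diagram over the same quotient object, still inequivalent to \<open>Q\<close>,
  and \<open>dual_iota\<close> applies.\<close>

lemma dual_prop_dual_arr:
  assumes x: "x \<in> Ob C" and Q: "Q \<in> sq C x" and ep: "is_eps (qz Q) (eps (qz Q))"
  shows "dual_prop x Q (dual_arr x Q)"
proof -
  let ?w = "qz Q" and ?\<epsilon> = "eps (qz Q)"
  note d = sq_rep(1)[OF x Q]
  note E = isepD[OF ep]
  obtain b where b: "b \<in> H x ?w" "co x ?w ?w ?\<epsilon> b = b" "co ?w x ?w b (co ?w ?w x (iota x Q) ?\<epsilon>) = ?\<epsilon>"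
    "\<And>e i. diagram x e i \<Longrightarrow> cd e = ?w \<Longrightarrow> \<not> diagram_eq e i (qe Q) (qi x Q) \<Longrightarrow> co ?w x ?w b (co ?w ?w x (sp e i) ?\<epsilon>) = 0"
    using dual_iota[OF ep d HOL.refl] by blast
  have "co (qz Q') x ?w b (co (qz Q') (qz Q') x (iota x Q') (eps (qz Q'))) = 0"
    if Q': "Q' \<in> sq C x" "Q' \<noteq> Q" and ep': "is_eps (qz Q') (eps (qz Q'))" for Q'
  proof -
    let ?w' = "qz Q'" and ?\<epsilon>' = "eps (qz Q')"
    note d' = sq_rep(1)[OF x Q'(1)]
    note E' = isepD[OF ep']
    note s' = diagram_sp[OF d' HOL.refl]
    have bi: "co ?w' x ?w b (iota x Q') \<in> H ?w' ?w" using b s' E by simp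
    have as: "co ?w' x ?w b (co ?w' ?w' x (iota x Q') ?\<epsilon>') = co ?w' ?w' ?w (co ?w' x ?w b (iota x Q')) ?\<epsilon>'"
      using co_assoc[of ?\<epsilon>' ?w' ?w' "iota x Q'" x b ?w] b s' E E' by simp
    show ?thesis
    proof (cases "\<exists>h. iso h \<and> dm h = ?w' \<and> cd h = ?w")
      case False
      have "co ?w' ?w ?w ?\<epsilon> (co ?w' ?w' ?w (co ?w' x ?w b (iota x Q')) ?\<epsilon>') = 0"
        by (rule eps_kill[OF ep ep' False bi])
      moreover have "co ?w' ?w ?w ?\<epsilon> (co ?w' x ?w b (co ?w' ?w' x (iota x Q') ?\<epsilon>')) = co ?w' x ?w b (co ?w' ?w' x (iota x Q') ?\<epsilon>')"
        using co_assoc[of "co ?w' ?w' x (iota x Q') ?\<epsilon>'" ?w' x b ?w ?\<epsilon> ?w] b s' E E' by simp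
      ultimately show ?thesis using as by simp
    next
      case True
      then obtain h where h: "iso h" "dm h = ?w'" "cd h = ?w" by blast
      have D': "sur (qe Q')" "mon (qi x Q')" "dm (qe Q') = dm (qi x Q')" "cd (qi x Q') = x" using d' unfolding diagram_def by auto
      have dh: "diagram x (h \<cdot> qe Q') (qi x Q')" "cd (h \<cdot> qe Q') = ?w" using D' h by (auto simp: diagram_def)
      note sh = diagram_sp[OF dh]
      have hH: "sp (ide ?w') h \<in> H ?w' ?w" using h E' by simp
      have "diagram_eq (qe Q') (qi x Q') (h \<cdot> qe Q') (qi x Q')"
        unfolding diagram_eq_def using h D' by (intro exI[of _ h] exI[of _ "ide (dm (qe Q'))"]) auto
      then have n: "\<not> diagram_eq (h \<cdot> qe Q') (qi x Q') (qe Q) (qi x Q)"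
        using diagram_eq_trans[OF d' dh(1) d] sq_unique[OF x Q'(1) Q] Q'(2) by blast
      have "iota x Q' = co ?w' ?w x (sp (h \<cdot> qe Q') (qi x Q')) (sp (ide ?w') h)"
        using iota_shift[OF d' h(1,2)] h by simp
      then have "co ?w' ?w' x (iota x Q') ?\<epsilon>' = co ?w' ?w x (sp (h \<cdot> qe Q') (qi x Q')) (co ?w' ?w' ?w (sp (ide ?w') h) ?\<epsilon>')"
        using co_assoc[of ?\<epsilon>' ?w' ?w' "sp (ide ?w') h" ?w "sp (h \<cdot> qe Q') (qi x Q')" x] hH sh E E' by simp
      also have "co ?w' ?w' ?w (sp (ide ?w') h) ?\<epsilon>' = co ?w' ?w ?w ?\<epsilon> (sp (ide ?w') h)"
        using eps_commute[OF ep ep' _ hH] sz_iso[OF h(1)] h by simp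
      also have "co ?w' ?w x (sp (h \<cdot> qe Q') (qi x Q')) \<dots> = co ?w' ?w x (co ?w ?w x (sp (h \<cdot> qe Q') (qi x Q')) ?\<epsilon>) (sp (ide ?w') h)"
        using co_assoc[of "sp (ide ?w') h" ?w' ?w ?\<epsilon> ?w "sp (h \<cdot> qe Q') (qi x Q')" x] hH sh E E' by simp
      finally have "co ?w' x ?w b (co ?w' ?w' x (iota x Q') ?\<epsilon>') =
          co ?w' ?w ?w (co ?w x ?w b (co ?w ?w x (sp (h \<cdot> qe Q') (qi x Q')) ?\<epsilon>)) (sp (ide ?w') h)"
        using co_assoc[of "sp (ide ?w') h" ?w' ?w "co ?w ?w x (sp (h \<cdot> qe Q') (qi x Q')) ?\<epsilon>" x b ?w] b(1) hH sh E E' by simp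
      then show ?thesis using b(4)[OF dh n] by simp
    qed
  qed
  then have "dual_prop x Q b" unfolding dual_prop_def using b by blast
  then show ?thesis unfolding dual_arr_def by (rule someI[of "dual_prop x Q"])
qed

lemma duD:
  assumes "x \<in> Ob C" "Q \<in> sq C x" "is_eps (qz Q) (eps (qz Q))"
  shows "dual_arr x Q \<in> H x (qz Q)" "co x (qz Q) (qz Q) (eps (qz Q)) (dual_arr x Q) = dual_arr x Q"
    "co (qz Q) x (qz Q) (dual_arr x Q) (co (qz Q) (qz Q) x (iota x Q) (eps (qz Q))) = eps (qz Q)"
    "\<And>Q'. Q' \<in> sq C x \<Longrightarrow> Q' \<noteq> Q \<Longrightarrow> is_eps (qz Q') (eps (qz Q')) \<Longrightarrow>
       co (qz Q') x (qz Q) (dual_arr x Q) (co (qz Q') (qz Q') x (iota x Q') (eps (qz Q'))) = 0"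
  using dual_prop_dual_arr[OF assms] unfolding dual_prop_def by blast+

text \<open>The projection onto the sum of the \<open>[z]\<^sup>0\<^sub>y\<close> with index in \<open>A\<close>.\<close>

definition part_proj :: "'o \<Rightarrow> ('o \<times> 'm \<times> 'o \<times> 'm) set set \<Rightarrow> ('o \<times> 'm) set \<Rightarrow> 'k" where
  "part_proj x A = (\<Sum>Q\<in>A. co x (qz Q) x (iota x Q) (dual_arr x Q))"

lemma part_proj_in_H:
  assumes "x \<in> Ob C" "A \<subseteq> sq C x" "\<And>Q. Q \<in> A \<Longrightarrow> is_eps (qz Q) (eps (qz Q))"
  shows "part_proj x A \<in> H x x"
  unfolding part_proj_def
proof (rule H_sum)
  fix Q assume Q: "Q \<in> A"
  then have q: "Q \<in> sq C x" using assms by blast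
  show "co x (qz Q) x (iota x Q) (dual_arr x Q) \<in> H x x"
    using diagram_sp[OF sq_rep(1)[OF assms(1) q] HOL.refl] duD(1)[OF assms(1) q assms(3)[OF Q]] by simp
qed

lemma part_proj_iota:
  assumes x: "x \<in> Ob C" and A: "A \<subseteq> sq C x" "\<And>Q. Q \<in> A \<Longrightarrow> is_eps (qz Q) (eps (qz Q))"
    and Q: "Q \<in> sq C x" "is_eps (qz Q) (eps (qz Q))"
  shows "co (qz Q) x x (part_proj x A) (co (qz Q) (qz Q) x (iota x Q) (eps (qz Q))) =
    (if Q \<in> A then co (qz Q) (qz Q) x (iota x Q) (eps (qz Q)) else 0)"
proof -
  let ?w = "qz Q" and ?j = "co (qz Q) (qz Q) x (iota x Q) (eps (qz Q))"
  note s = diagram_sp[OF sq_rep(1)[OF x Q(1)] HOL.refl] and E = isepD[OF Q(2)]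
  have j: "?j \<in> H ?w x" using s E x by simp
  have "co ?w x x (part_proj x A) ?j = (\<Sum>Q'\<in>A. if Q' = Q then ?j else 0)"
    unfolding part_proj_def co_sum_left
  proof (rule sum.cong[OF HOL.refl])
    fix Q' assume Q': "Q' \<in> A"
    then have q': "Q' \<in> sq C x" using A by blast
    note s' = diagram_sp[OF sq_rep(1)[OF x q'] HOL.refl] and d' = duD[OF x q' A(2)[OF Q']]
    have "co ?w x x (co x (qz Q') x (iota x Q') (dual_arr x Q')) ?j = co ?w (qz Q') x (iota x Q') (co ?w x (qz Q') (dual_arr x Q') ?j)"
      using co_assoc[of ?j ?w x "dual_arr x Q'" "qz Q'" "iota x Q'" x] j s s' d' x by simp
    then show "co ?w x x (co x (qz Q') x (iota x Q') (dual_arr x Q')) ?j = (if Q' = Q then ?j else 0)"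
      using d'(3) d'(4)[OF Q(1) _ Q(2)] by auto
  qed
  also have "\<dots> = (if Q \<in> A then ?j else 0)" using finite_subset[OF A(1) finite_sq[OF x]] by simp
  finally show ?thesis .
qed

text \<open>The dual absorbs \<open>eps\<close>, so the projection may be written with the
  restricted inclusions, to which \<open>part_proj_iota\<close> applies.\<close>

lemma part_proj_split:
  assumes x: "x \<in> Ob C" and A: "A \<subseteq> sq C x" "\<And>Q. Q \<in> A \<Longrightarrow> is_eps (qz Q) (eps (qz Q))"
  shows "part_proj x A = (\<Sum>Q\<in>A. co x (qz Q) x (co (qz Q) (qz Q) x (iota x Q) (eps (qz Q))) (dual_arr x Q))"
  unfolding part_proj_def
proof (rule sum.cong[OF HOL.refl])
  fix Q assume Q: "Q \<in> A"
  then have q: "Q \<in> sq C x" using A by blast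
  note s = diagram_sp[OF sq_rep(1)[OF x q] HOL.refl] and d = duD[OF x q A(2)[OF Q]] and E = isepD[OF A(2)[OF Q]]
  show "co x (qz Q) x (iota x Q) (dual_arr x Q) = co x (qz Q) x (co (qz Q) (qz Q) x (iota x Q) (eps (qz Q))) (dual_arr x Q)"
    using co_assoc[of "dual_arr x Q" x "qz Q" "eps (qz Q)" "qz Q" "iota x Q" x] s d E x by simp
qed

text \<open>Used with \<open>A = B\<close> for idempotency and with disjoint index sets for
  orthogonality.\<close>

lemma part_proj_part_proj:
  assumes x: "x \<in> Ob C" and A: "A \<subseteq> sq C x" "\<And>Q. Q \<in> A \<Longrightarrow> is_eps (qz Q) (eps (qz Q))"
    and B: "B \<subseteq> sq C x" "\<And>Q. Q \<in> B \<Longrightarrow> is_eps (qz Q) (eps (qz Q))"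
  shows "co x x x (part_proj x A) (part_proj x B) = part_proj x (A \<inter> B)"
proof -
  have sB: "part_proj x B = (\<Sum>Q\<in>B. co x (qz Q) x (co (qz Q) (qz Q) x (iota x Q) (eps (qz Q))) (dual_arr x Q))"
    by (rule part_proj_split[OF x B(1)]) (rule B(2))
  have fB: "finite B" using finite_subset[OF B(1) finite_sq[OF x]] .
  have "co x x x (part_proj x A) (part_proj x B) =
      (\<Sum>Q\<in>B. if Q \<in> A then co x (qz Q) x (co (qz Q) (qz Q) x (iota x Q) (eps (qz Q))) (dual_arr x Q) else 0)"
    unfolding sB co_sum_right
  proof (rule sum.cong[OF HOL.refl])
    fix Q assume Q: "Q \<in> B"
    then have q: "Q \<in> sq C x" using B by blast
    let ?j = "co (qz Q) (qz Q) x (iota x Q) (eps (qz Q))"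
    note s = diagram_sp[OF sq_rep(1)[OF x q] HOL.refl] and d = duD[OF x q B(2)[OF Q]] and E = isepD[OF B(2)[OF Q]]
    have "co x x x (part_proj x A) (co x (qz Q) x ?j (dual_arr x Q)) = co x (qz Q) x (co (qz Q) x x (part_proj x A) ?j) (dual_arr x Q)"
      using co_assoc[of "dual_arr x Q" x "qz Q" ?j x "part_proj x A" x] s d E x part_proj_in_H[OF x A] by simp
    then show "co x x x (part_proj x A) (co x (qz Q) x ?j (dual_arr x Q)) = (if Q \<in> A then co x (qz Q) x ?j (dual_arr x Q) else 0)"
      using part_proj_iota[OF x A q B(2)[OF Q]] by simp
  qed
  also have "\<dots> = (\<Sum>Q\<in>A \<inter> B. co x (qz Q) x (co (qz Q) (qz Q) x (iota x Q) (eps (qz Q))) (dual_arr x Q))"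
    using fB by (simp add: sum.inter_restrict[symmetric] Int_commute flip: sum.inter_restrict)
  also have "\<dots> = part_proj x (A \<inter> B)" by (rule part_proj_split[OF x, symmetric]) (use A B in auto)
  finally show ?thesis .
qed

lemma push_sp:
  assumes m: "mon m" "cd m = x" and d: "arr a" "arr b" "dm a = dm b" "cd b = dm m" "cd a = w"
  shows "co w (dm m) x (sp (ide (dm m)) m) (sp a b) = sp a (m \<cdot> b)"
proof -
  have "pb b (ide (dm m)) (ide (dm b)) b" using pb_ide_right[of b "dm m" "dm b"] d by simp
  then have "co w (dm m) x (sp (ide (dm m)) m) (sp a b) = sp (a \<cdot> ide (dm b)) (m \<cdot> b)"
    by (rule co_sp) (use m d in auto)
  then show ?thesis using d by simp
qed

text \<open>The bound lets one argument serve both the inductive construction of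
  \<open>eps x\<close>, with \<open>N = sz x\<close>, and the full decomposition, with
  \<open>N = Suc (sz x)\<close>.\<close>

definition below :: "'o \<Rightarrow> nat \<Rightarrow> ('o, 'm) arrow \<Rightarrow> ('o \<times> 'm \<times> 'o \<times> 'm) set set" where
  "below x N m = {Q \<in> sq C x. sz (qz Q) < N \<and> sub_le C x (sq_sub C x Q) (cls m)}"

text \<open>By \<open>relation_split\<close> it suffices to treat
  \<open>[m j] [f]\<^sup>\<or>\<close> on a common subquotient \<open>v\<close> of \<open>w\<close>
  and the source of \<open>m\<close>. Write the identity of \<open>[v]\<close> as
  \<open>eps v\<close> plus a rest: on the first part the morphism is, up to an isomorphism of
  quotients, the inclusion of a piece, and the rest passes through objects smaller than
  \<open>v\<close>, where the induction hypothesis applies.\<close>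

lemma part_proj_below:
  assumes x: "x \<in> Ob C" and m: "mon m" "cd m = x"
    and N: "\<And>v. v \<in> Ob C \<Longrightarrow> sz v < N \<Longrightarrow> is_eps v (eps v)"
    and w: "w \<in> Ob C" "sz w < N" and f: "f \<in> H w (dm m)"
  shows "co w x x (part_proj x (below x N m)) (co w (dm m) x (sp (ide (dm m)) m) f) = co w (dm m) x (sp (ide (dm m)) m) f"
  using w f
proof (induction "sz w" arbitrary: w f rule: less_induct)
  case less
  let ?Y = "dm m" and ?A = "below x N m"
  let ?s = "part_proj x ?A" and ?m = "sp (ide (dm m)) m"
  have Y: "?Y \<in> Ob C" using m by simp
  have A: "?A \<subseteq> sq C x" by (auto simp: below_def)
  have Ae: "is_eps (qz Q) (eps (qz Q))" if "Q \<in> ?A" for Q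
  proof -
    have q: "Q \<in> sq C x" "sz (qz Q) < N" using that by (auto simp: below_def)
    show ?thesis using N q diagram_sp(6)[OF sq_rep(1)[OF x q(1)] HOL.refl] by blast
  qed
  have sH: "?s \<in> H x x" using part_proj_in_H[OF x A Ae] .
  have mH: "?m \<in> H ?Y x" using m Y by simp
  show ?case using less(4,2) Y
  proof (induction rule: H_induct)
    case (bas r)
    obtain i e f j where F: "diagram w e i" "diagram ?Y f j" "cd e = cd f" "basis_vec r = co w (cd e) ?Y (sp f j) (sp i e)"
      using relation_split[OF bas less(2) Y] by metis
    let ?v = "cd e"
    have D: "sur e" "mon i" "dm e = dm i" "cd i = w" "sur f" "mon j" "dm f = dm j" "cd j = ?Y" using F unfolding diagram_def by auto
    have V: "?v \<in> Ob C" using D by simp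
    have S: "sp i e \<in> H w ?v" "sp f j \<in> H ?v ?Y" using D F by auto
    have vw: "sz ?v \<le> sz w" using subquotient_sz(1)[of i e] D by simp
    then have ev: "is_eps ?v (eps ?v)" using N V less(3) by simp
    note E = isepD[OF ev]
    have mj: "co ?v ?Y x ?m (sp f j) = sp f (m \<cdot> j)" by (rule push_sp) (use m D F in auto)
    have dj: "diagram x f (m \<cdot> j)" using D m by (auto simp: diagram_def)
    obtain Q where Q: "Q \<in> sq C x" "diagram_eq f (m \<cdot> j) (qe Q) (qi x Q)" by (rule sq_exists[OF x dj])
    then obtain a b where ab: "iso a" "iso b" "dm a = cd f" "cd a = qz Q" "dm b = dm f" "cd b = dm (qe Q)"
      "qe Q \<cdot> b = a \<cdot> f" "qi x Q \<cdot> b = m \<cdot> j" unfolding diagram_eq_def by blast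
    note q = sq_rep[OF x Q(1)]
    have DQ: "sur (qe Q)" "mon (qi x Q)" "dm (qe Q) = dm (qi x Q)" "cd (qi x Q) = x" using q(1) unfolding diagram_def by auto
    have szQ: "sz ?v = sz (qz Q)" using sz_iso[OF ab(1)] ab F by simp
    have eQ: "is_eps (qz Q) (eps (qz Q))" using N szQ vw less(3) DQ by simp
    have QA: "Q \<in> ?A"
    proof -
      have "cls (qi x Q) = cls (m \<cdot> j)" using cls_eqI[of "qi x Q" b] ab DQ by simp
      moreover have "sub_le C (cd (m \<cdot> j)) (cls (m \<cdot> j)) (cls m)"
        using sub_le_cls[of "m \<cdot> j" m] m D by (auto intro!: exI[of _ j])
      ultimately show ?thesis using Q(1) q(4) szQ vw less(3) m by (simp add: below_def)
    qed
    \<comment> \<open>The diagram \<open>(f, m \<cdot> j)\<close> agrees with the representative of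
      \<open>Q\<close> up to the isomorphism \<open>a\<close> of quotients, and \<open>a\<close>
      intertwines the two idempotents by \<open>eps_commute\<close>.\<close>
    have step1: "co ?v x x ?s (co ?v ?v x (sp f (m \<cdot> j)) (eps ?v)) = co ?v ?v x (sp f (m \<cdot> j)) (eps ?v)"
    proof -
      let ?z = "qz Q" and ?a = "sp (ide ?v) a"
      note sQ = diagram_sp[OF q(1) HOL.refl] and EQ = isepD[OF eQ]
      have aH: "?a \<in> H ?v ?z" using ab V F by simp
      have "sp (a \<cdot> f) (m \<cdot> j) = iota x Q" unfolding ab(7)[symmetric] ab(8)[symmetric]
        by (rule sp_iso) (use ab DQ in auto)
      then have "sp f (m \<cdot> j) = co ?v ?z x (iota x Q) ?a" using iota_shift[OF dj ab(1,3)] ab F by simp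
      then have "co ?v ?v x (sp f (m \<cdot> j)) (eps ?v) = co ?v ?z x (iota x Q) (co ?v ?v ?z ?a (eps ?v))"
        using co_assoc[of "eps ?v" ?v ?v ?a ?z "iota x Q" x] aH sQ E x by simp
      also have "co ?v ?v ?z ?a (eps ?v) = co ?v ?z ?z (eps ?z) ?a" using eps_commute[OF eQ ev _ aH] szQ by simp
      also have "co ?v ?z x (iota x Q) \<dots> = co ?v ?z x (co ?z ?z x (iota x Q) (eps ?z)) ?a"
        using co_assoc[of ?a ?v ?z "eps ?z" ?z "iota x Q" x] aH sQ E EQ x by simp
      finally have eq: "co ?v ?v x (sp f (m \<cdot> j)) (eps ?v) = co ?v ?z x (co ?z ?z x (iota x Q) (eps ?z)) ?a" .
      have "co ?v x x ?s (co ?v ?z x (co ?z ?z x (iota x Q) (eps ?z)) ?a) = co ?v ?z x (co ?z x x ?s (co ?z ?z x (iota x Q) (eps ?z))) ?a"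
        using co_assoc[of ?a ?v ?z "co ?z ?z x (iota x Q) (eps ?z)" x ?s x] aH sQ E EQ x sH by simp
      then show ?thesis unfolding eq using part_proj_iota[OF x A Ae Q(1) eQ] QA by simp
    qed
    \<comment> \<open>The induction hypothesis is applied to \<open>z\<close>, which is smaller than
      \<open>v\<close> and therefore smaller than \<open>w\<close>.\<close>
    have step2: "co ?v x x ?s (co ?v ?v x (sp f (m \<cdot> j)) (un ?v - eps ?v)) = co ?v ?v x (sp f (m \<cdot> j)) (un ?v - eps ?v)"
      using E(3) V
    proof (induction rule: through_proper_induct(1))
      case (single z k g)
      let ?g = "co z ?v ?Y (sp f j) g"
      have gH: "?g \<in> H z ?Y" using single S V Y by simp
      have IH: "co z x x ?s (co z ?Y x ?m ?g) = co z ?Y x ?m ?g"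
        by (rule less(1)) (use single vw less(3) gH in auto)
      have mg: "co z ?Y x ?m ?g = co z ?v x (sp f (m \<cdot> j)) g"
        using co_assoc[of g z ?v "sp f j" ?Y ?m x] mj single S V Y mH x by simp
      have fH: "sp f (m \<cdot> j) \<in> H ?v x" using diagram_sp(4)[OF dj] F by simp
      have 1: "co ?v ?v x (sp f (m \<cdot> j)) (co ?v z ?v g k) = co ?v z x (co z ?v x (sp f (m \<cdot> j)) g) k"
        using co_assoc[of k ?v z g ?v "sp f (m \<cdot> j)" x] single fH V x by simp
      have "co ?v x x ?s (co ?v z x (co z ?v x (sp f (m \<cdot> j)) g) k) = co ?v z x (co z x x ?s (co z ?v x (sp f (m \<cdot> j)) g)) k"
        using co_assoc[of k ?v z "co z ?v x (sp f (m \<cdot> j)) g" x ?s x] single fH V x sH by simp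
      then show ?case unfolding 1 using IH mg by simp
    qed (simp_all add: co_add_right)
    have fH: "sp f (m \<cdot> j) \<in> H ?v x" using diagram_sp(4)[OF dj] F by simp
    have "co ?v x x ?s (sp f (m \<cdot> j)) = sp f (m \<cdot> j)"
      using step1 step2 fH V x E(2) by (simp add: co_minus_right)
    moreover have "co w ?Y x ?m (co w ?v ?Y (sp f j) (sp i e)) = co w ?v x (sp f (m \<cdot> j)) (sp i e)"
      using co_assoc[of "sp i e" w ?v "sp f j" ?Y ?m x] mj S V Y less(2) x mH by simp
    moreover have "co w x x ?s (co w ?v x (sp f (m \<cdot> j)) (sp i e)) = co w ?v x (co ?v x x ?s (sp f (m \<cdot> j))) (sp i e)"
      using co_assoc[of "sp i e" w ?v "sp f (m \<cdot> j)" x ?s x] S V less(2) x sH fH by simp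
    ultimately show ?case using F(4) by simp
  qed (simp_all add: co_add_right co_smul_right)
qed

text \<open>Let \<open>s\<close> be the projection onto all pieces whose quotient is smaller than
  \<open>x\<close>; these are available by induction. Then \<open>un x - s\<close> annihilates
  morphisms from smaller objects by \<open>part_proj_below\<close>, and it annihilates morphisms to
  them by the trace form.\<close>

lemma is_eps_exists: "x \<in> Ob C \<Longrightarrow> is_eps x (eps x)"
proof (induction "sz x" arbitrary: x rule: less_induct)
  case less
  note x = less(2)
  let ?m = "ide x" and ?A = "below x (sz x) (ide x)"
  define s where "s = part_proj x ?A"
  have A: "?A \<subseteq> sq C x" by (auto simp: below_def)
  have qO: "qz Q \<in> Ob C" if "Q \<in> sq C x" for Q using diagram_sp(6)[OF sq_rep(1)[OF x that] HOL.refl] .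
  have Ae: "is_eps (qz Q) (eps (qz Q))" if "Q \<in> ?A" for Q
    using that less(1) qO by (auto simp: below_def)
  have sH: "s \<in> H x x" using part_proj_in_H[OF x A Ae] by (simp add: s_def)
  have left: "co w x x s f = f" if w: "w \<in> Ob C" "sz w < sz x" and f: "f \<in> H w x" for w f
  proof -
    have "co w x x (part_proj x ?A) (co w (dm ?m) x (sp (ide (dm ?m)) ?m) f) = co w (dm ?m) x (sp (ide (dm ?m)) ?m) f"
      by (rule part_proj_below[OF x]) (use x w f less(1) in auto)
    then show ?thesis unfolding dm_ide un_eq[OF x, symmetric] s_def using f w x by simp
  qed
  \<comment> \<open>For every \<open>g\<close>, cyclicity gives
    \<open>tr (g f s) = tr (s g f)\<close>, and \<open>s g = g\<close> because \<open>g\<close>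
    starts at a smaller object. So \<open>f s - f\<close> pairs to 0 with everything.\<close>
  have right: "co x x w f s = f" if w: "w \<in> Ob C" "sz w < sz x" and f: "f \<in> H x w" for w f
  proof -
    have "co x x w f s - f = 0"
    proof (rule trace_nondegenerate[of _ x w])
      fix g assume g: "g \<in> H w x"
      have "tr x (co x w x g (co x x w f s)) = tr x (co x x x (co x w x g f) s)"
        using co_assoc[of s x x f w g x] f g w x sH by simp
      also have "\<dots> = tr x (co x x x s (co x w x g f))"
        by (rule tr_comm) (use f g w x sH in auto)
      also have "co x x x s (co x w x g f) = co x w x (co w x x s g) f"
        using co_assoc[of f x w g x s x] f g w x sH by simp
      finally show "tr x (co x w x g (co x x w f s - f)) = 0" using left[OF w g] by (simp add: co_minus_right tr_minus)
    qed (use f w x sH in auto)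
    then show ?thesis by simp
  qed
  have "through_proper x s" unfolding s_def part_proj_def
  proof (rule through_proper_sum)
    fix Q assume Q: "Q \<in> ?A"
    then have q: "Q \<in> sq C x" "sz (qz Q) < sz x" by (auto simp: below_def)
    note r = sq_rep(1)[OF x q(1)]
    have "proper_subquotient C (qz Q) x"
      unfolding proper_subquotient_iff[OF x] using r q unfolding diagram_def by blast
    then show "through_proper x (co x (qz Q) x (iota x Q) (dual_arr x Q))"
      by (rule through_proper_single) (use diagram_sp[OF r HOL.refl] duD(1)[OF x q(1) Ae[OF Q]] in auto)
  qed
  then have "is_eps x (un x - s)"
    unfolding is_eps_def using x sH left right by (auto simp: co_minus_left co_minus_right)
  then show ?case by (rule is_eps_eps)
qed

lemma qz_is_eps: "x \<in> Ob C \<Longrightarrow> Q \<in> sq C x \<Longrightarrow> is_eps (qz Q) (eps (qz Q))"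
  using is_eps_exists diagram_sp(6)[OF sq_rep(1) HOL.refl] by blast

section \<open>The idempotents \<open>p\<^sub>y\<close> and \<open>p\<^sub>x\<^sup>*\<close>\<close>

definition subs_below :: "'o \<Rightarrow> ('o, 'm) arrow \<Rightarrow> ('o \<times> 'm \<times> 'o \<times> 'm) set set" where
  "subs_below x m = {Q \<in> sq C x. sub_le C x (sq_sub C x Q) (cls m)}"

text \<open>This is \<open>p\<^sub>y\<close> for the subobject \<open>y\<close> represented by
  \<open>m\<close>, see \<open>pm_cls\<close>.\<close>

definition pm :: "('o, 'm) arrow \<Rightarrow> ('o \<times> 'm) set \<Rightarrow> 'k" where "pm m = sp m m"

lemma pm_in_H: "mon m \<Longrightarrow> cd m = x \<Longrightarrow> pm m \<in> H x x"
  by (simp add: pm_def)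

lemma pm_ide: "x \<in> Ob C \<Longrightarrow> pm (ide x) = un x"
  by (simp add: pm_def un_eq)

text \<open>\<open>pm m\<close> factors through \<open>[m]\<close>, so it is enough that the
  projection fixes \<open>[m]\<close> itself. This is \<open>part_proj_below\<close> for the
  identity of the source of \<open>m\<close>.\<close>

lemma part_proj_pm:
  assumes x: "x \<in> Ob C" and m: "mon m" "cd m = x"
  shows "co x x x (part_proj x (subs_below x m)) (pm m) = pm m"
proof -
  let ?Y = "dm m" and ?N = "Suc (sz x)"
  \<comment> \<open>A subquotient of \<open>x\<close> is never larger than \<open>x\<close>, so the
    bound in \<open>below\<close> excludes nothing.\<close>
  have "sz (qz Q) < ?N" if "Q \<in> sq C x" for Q
    using subquotient_sz(1)[of "qi x Q" "qe Q"] sq_rep(1)[OF x that] by (simp add: diagram_def)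
  then have b: "below x ?N m = subs_below x m" by (auto simp: below_def subs_below_def)
  have sy: "sz ?Y < ?N" using sz_mon(1)[OF m(1)] m by simp
  have mH: "sp (ide ?Y) m \<in> H ?Y x" "sp m (ide ?Y) \<in> H x ?Y" using m by auto
  have sH: "part_proj x (subs_below x m) \<in> H x x"
    by (rule part_proj_in_H[OF x]) (use qz_is_eps[OF x] in \<open>auto simp: subs_below_def\<close>)
  have "co ?Y x x (part_proj x (below x ?N m)) (co ?Y ?Y x (sp (ide ?Y) m) (un ?Y)) = co ?Y ?Y x (sp (ide ?Y) m) (un ?Y)"
    by (rule part_proj_below[OF x m]) (use is_eps_exists sy m in auto)
  then have 1: "co ?Y x x (part_proj x (subs_below x m)) (sp (ide ?Y) m) = sp (ide ?Y) m" using b mH x m by simp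
  have 2: "pm m = co x ?Y x (sp (ide ?Y) m) (sp m (ide ?Y))"
    using push_sp[OF m, of m "ide ?Y" x] m by (simp add: pm_def)
  have "co x x x (part_proj x (subs_below x m)) (co x ?Y x (sp (ide ?Y) m) (sp m (ide ?Y))) = co x ?Y x (co ?Y x x (part_proj x (subs_below x m)) (sp (ide ?Y) m)) (sp m (ide ?Y))"
    using co_assoc[of "sp m (ide ?Y)" x ?Y "sp (ide ?Y) m" x "part_proj x (subs_below x m)" x] mH sH x m by simp
  then show ?thesis using 1 2 by simp
qed

text \<open>If the image of \<open>i\<close> lies in the subobject, then the fibre product of
  \<open>i\<close> with it is the source of \<open>i\<close>.\<close>

lemma pm_iota:
  assumes x: "x \<in> Ob C" and m: "mon m" "cd m = x" and Q: "Q \<in> subs_below x m"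
  shows "co (qz Q) x x (pm m) (iota x Q) = iota x Q"
proof -
  have q: "Q \<in> sq C x" "sub_le C x (sq_sub C x Q) (cls m)" using Q by (auto simp: subs_below_def)
  note r = sq_rep[OF x q(1)]
  have D: "sur (qe Q)" "mon (qi x Q)" "dm (qe Q) = dm (qi x Q)" "cd (qi x Q) = x" using r unfolding diagram_def by auto
  have "sub_le C (cd (qi x Q)) (cls (qi x Q)) (cls m)" using q(2) r(4) D by simp
  then obtain g where g: "arr g" "dm g = dm (qi x Q)" "cd g = dm m" "m \<cdot> g = qi x Q" using sub_le_cls[of "qi x Q" m] D m by auto
  have "pb (qi x Q) m (ide (dm (qi x Q))) g"
  proof (rule pbI)
    fix k l assume a: "arr k" "arr l" "dm k = dm l" "cd k = dm (qi x Q)" "cd l = dm m" "qi x Q \<cdot> k = m \<cdot> l"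
    have "m \<cdot> (g \<cdot> k) = m \<cdot> l" using cmp_left_eq[OF g(4), of k] a g m by simp
    then have "g \<cdot> k = l" by (rule monD[OF m(1)]) (use a g in auto)
    then show "\<exists>h. arr h \<and> dm h = dm k \<and> cd h = dm (ide (dm (qi x Q))) \<and> ide (dm (qi x Q)) \<cdot> h = k \<and> g \<cdot> h = l"
      using a by (intro exI[of _ k]) auto
  qed (use g D m in auto)
  then have "co (qz Q) x x (sp m m) (iota x Q) = sp (qe Q \<cdot> ide (dm (qi x Q))) (m \<cdot> g)"
    by (rule co_sp) (use D m g in auto)
  then show ?thesis using D g by (simp add: pm_def)
qed

lemma pm_pm:
  assumes x: "x \<in> Ob C" and m: "mon m" "cd m = x" and n: "mon n" "cd n = x" and P: "pb m n k l"
  shows "co x x x (pm n) (pm m) = pm (m \<cdot> k)"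
proof -
  note B = pbD[OF P]
  have "co x x x (sp n n) (sp m m) = sp (m \<cdot> k) (n \<cdot> l)" by (rule co_sp[OF P]) (use m n in auto)
  then show ?thesis using B by (simp add: pm_def)
qed

lemma pm_idem: "x \<in> Ob C \<Longrightarrow> mon m \<Longrightarrow> cd m = x \<Longrightarrow> co x x x (pm m) (pm m) = pm m"
proof -
  assume a: "x \<in> Ob C" "mon m" "cd m = x"
  have "pb m m (ide (dm m)) (ide (dm m))"
  proof (rule pbI)
    fix k l assume "arr k" "arr l" "dm k = dm l" "cd k = dm m" "cd l = dm m" "m \<cdot> k = m \<cdot> l"
    then show "\<exists>h. arr h \<and> dm h = dm k \<and> cd h = dm (ide (dm m)) \<and> ide (dm m) \<cdot> h = k \<and> ide (dm m) \<cdot> h = l"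
      using monD[OF a(2)] by (intro exI[of _ k]) auto
  qed (use a in auto)
  then show ?thesis using pm_pm[OF a a(2,3)] a by simp
qed

lemma pm_cls: "mon m \<Longrightarrow> pm m = basis_vec (diag_sub C (cd m) (cls m))"
proof -
  assume m: "mon m"
  define n where "n = rpr (cd m) (cls m)"
  have n: "mon n" "cls n = cls m" "cd n = cd m" using rpr[of "cls m" "cd m"] m by (auto simp: n_def)
  obtain h where h: "iso h" "dm h = dm m" "cd h = dm n" "n \<cdot> h = m" using cls_eq_iff[OF m n(1)] n by auto
  have "pm m = sp (n \<cdot> h) (n \<cdot> h)" using h by (simp add: pm_def)
  also have "\<dots> = sp n n" by (rule sp_iso) (use h n in auto)
  also have "\<dots> = basis_vec (cls (pr n n))" by (rule sp_mon) (use n in \<open>auto intro!: mon_prI dest: monD\<close>)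
  also have "cls (pr n n) = diag_sub C (cd m) (cls m)"
    unfolding diag_sub_def cls_def pr_def n_def by (simp add: rpr_def)
  finally show ?thesis .
qed

definition pstar :: "'o \<Rightarrow> ('o \<times> 'm) set \<Rightarrow> 'k" where
  "pstar x = (\<Sum>y\<in>subobjects C x. of_int (mu_sub C x y (whole C x)) \<star> pm (rpr x y))"

lemma pstar_in_H: "x \<in> Ob C \<Longrightarrow> pstar x \<in> H x x"
  unfolding pstar_def by (intro H_sum H_smul pm_in_H) (auto dest: rpr)

text \<open>Products of the idempotents \<open>p\<^sub>y\<close> are given by meets. Each
  coefficient of the product is therefore a Moebius sum of a function of the meet with the proper
  subobject \<open>n\<close>, and \<open>weisner\<close> applies.\<close>

lemma pstar_pm_zero:
  assumes x: "x \<in> Ob C" and n: "mon n" "cd n = x" "\<not> iso n"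
  shows "co x x x (pstar x) (pm n) = 0"
proof
  fix r
  interpret fin_poset "subobjects C x" "sub_le C x" by (rule fin_poset_sub[OF x])
  have r0: "mon (rpr x y)" "cls (rpr x y) = y" "cd (rpr x y) = x" if "y \<in> subobjects C x" for y using rpr[OF that x] by auto
  define kk where "kk y = (SOME k. \<exists>l. pb n (rpr x y) k l)" for y
  have kk: "\<exists>l. pb n (rpr x y) (kk y) l" if y: "y \<in> subobjects C x" for y
  proof -
    obtain k l where "pb n (rpr x y) k l" by (rule pullback_ex[of n "rpr x y"]) (use r0[OF y] n in auto)
    then have "\<exists>k l. pb n (rpr x y) k l" by blast
    then show ?thesis unfolding kk_def by (rule someI_ex)
  qed
  have mk: "mon (n \<cdot> kk y)" "s \<in> subobjects C x \<Longrightarrow> sub_le C x s (cls (n \<cdot> kk y)) \<longleftrightarrow> sub_le C x s y \<and> sub_le C x s (cls n)"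
    "co x x x (pm (rpr x y)) (pm n) = basis_vec (diag_sub C x (cls (n \<cdot> kk y)))" if y: "y \<in> subobjects C x" for y s
  proof -
    obtain l where l: "pb n (rpr x y) (kk y) l" using kk[OF y] by blast
    show m: "mon (n \<cdot> kk y)" using meet_props(1)[OF n(1) r0(1)[OF y] l] .
    show "s \<in> subobjects C x \<Longrightarrow> sub_le C x s (cls (n \<cdot> kk y)) \<longleftrightarrow> sub_le C x s y \<and> sub_le C x s (cls n)"
      using meet_props(2)[OF n(1) r0(1)[OF y] l, of s] n r0[OF y] by auto
    show "co x x x (pm (rpr x y)) (pm n) = basis_vec (diag_sub C x (cls (n \<cdot> kk y)))"
      using pm_pm[OF x n(1,2) r0(1,3)[OF y] l] pm_cls[OF m] n by simp
  qed
  have "co x x x (pstar x) (pm n) r = (\<Sum>y\<in>subobjects C x. of_int (moebius (subobjects C x) (sub_le C x) y (whole C x)) *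
      (\<lambda>s. basis_vec (diag_sub C x s) r) (cls (n \<cdot> kk y)))"
    unfolding pstar_def co_sum_left co_smul_left sum_apply smul_apply mu_sub_def
    by (rule sum.cong) (use mk in auto)
  also have "\<dots> = 0"
  proof (rule weisner[where c = "cls n" and i = "\<lambda>y. cls (n \<cdot> kk y)" and h = "\<lambda>s. basis_vec (diag_sub C x s) r"])
    show "cls n \<noteq> whole C x" using cls_eq_whole_iff[OF n(1)] n by simp
  qed (use x n mk whole_in_subobjects sub_le_whole in auto)
  finally show "co x x x (pstar x) (pm n) r = 0 r" by (simp add: zero_fun_apply)
qed

lemma mu_whole: assumes x: "x \<in> Ob C" shows "mu_sub C x (whole C x) (whole C x) = 1"
proof -
  interpret fin_poset "subobjects C x" "sub_le C x" by (rule fin_poset_sub[OF x])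
  let ?t = "whole C x"
  have t: "?t \<in> subobjects C x" using whole_in_subobjects[OF x] .
  have "{c \<in> subobjects C x. sub_le C x ?t c \<and> sub_le C x c ?t} = {?t}"
    using t refl antisym by blast
  then show ?thesis using moebius_right[OF t t refl[OF t]] by (simp add: mu_sub_def)
qed

definition quo :: "'o \<Rightarrow> ('o \<times> 'm \<times> 'o \<times> 'm) set set" where
  "quo x = {Q \<in> sq C x. sq_sub C x Q = whole C x}"

lemma part_proj_all: "x \<in> Ob C \<Longrightarrow> part_proj x (sq C x) = un x"
proof -
  assume x: "x \<in> Ob C"
  have "sub_le C x (sq_sub C x Q) (cls (ide x))" if Q: "Q \<in> sq C x" for Q
    using sub_le_whole[OF x, of "sq_sub C x Q"] sq_rep[OF x Q] by (simp add: whole_cls diagram_def)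
  then have "subs_below x (ide x) = sq C x" by (auto simp: subs_below_def)
  moreover have "part_proj x (sq C x) \<in> H x x" by (rule part_proj_in_H[OF x]) (use qz_is_eps[OF x] in auto)
  ultimately show ?thesis using part_proj_pm[OF x, of "ide x"] x by (simp add: pm_ide)
qed

text \<open>The two relations say that \<open>p\<^sub>x\<^sup>*\<close> and the projection onto the
  quotient pieces have the same kernel. The first holds because \<open>p\<^sub>x\<^sup>*\<close>
  annihilates every piece supported on a proper subobject. For the second, \<open>p\<^sub>y\<close>
  with \<open>y\<close> proper has its image in pieces below \<open>y\<close>, none of which is a
  quotient of \<open>x\<close>; only the term \<open>y = x\<close> survives, and its coefficient is
  1.\<close>

lemma pstar_quo: 
  assumes x: "x \<in> Ob C"
  shows "co x x x (pstar x) (part_proj x (quo x)) = pstar x" "co x x x (part_proj x (quo x)) (pstar x) = part_proj x (quo x)"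
proof -
  let ?E = "part_proj x (quo x)"
  have qs: "quo x \<subseteq> sq C x" by (auto simp: quo_def)
  have EH: "?E \<in> H x x" by (rule part_proj_in_H[OF x qs]) (use qs qz_is_eps[OF x] in auto)
  note pH = pstar_in_H[OF x]
  have z: "co x x x (pstar x) (co x (qz Q) x (iota x Q) (dual_arr x Q)) = 0" if Q: "Q \<in> sq C x - quo x" for Q
  proof -
    have q: "Q \<in> sq C x" using Q by simp
    note r = sq_rep[OF x q]
    have D: "mon (qi x Q)" "cd (qi x Q) = x" using r unfolding diagram_def by auto
    have ni: "\<not> iso (qi x Q)" using Q cls_eq_whole_iff[OF D(1)] D r(4) by (simp add: quo_def)
    have "Q \<in> subs_below x (qi x Q)" using q r sub_le_refl[OF x] D by (simp add: subs_below_def)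
    then have p: "co (qz Q) x x (pm (qi x Q)) (iota x Q) = iota x Q" using pm_iota[OF x D] by simp
    note s = diagram_sp[OF r(1) HOL.refl] and d = duD(1)[OF x q qz_is_eps[OF x q]]
    have "co (qz Q) x x (pstar x) (iota x Q) = co (qz Q) x x (co x x x (pstar x) (pm (qi x Q))) (iota x Q)"
      using co_assoc[of "iota x Q" "qz Q" x "pm (qi x Q)" x "pstar x" x] p s pm_in_H[OF D] pH x by simp
    then have "co (qz Q) x x (pstar x) (iota x Q) = 0" using pstar_pm_zero[OF x D ni] by simp
    then show ?thesis using co_assoc[of "dual_arr x Q" x "qz Q" "iota x Q" x "pstar x" x] s d pH x by simp
  qed
  have "part_proj x (sq C x) = part_proj x (sq C x - quo x) + ?E"
    unfolding part_proj_def by (rule sum.subset_diff[OF qs finite_sq[OF x]])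
  note split = this
  have z0: "co x x x (pstar x) (part_proj x (sq C x - quo x)) = 0"
    unfolding part_proj_def co_sum_right by (rule sum.neutral) (use z in blast)
  have "pstar x = co x x x (pstar x) (part_proj x (sq C x))" using part_proj_all[OF x] pH x by simp
  also have "\<dots> = co x x x (pstar x) ?E" unfolding split co_add_right z0 by simp
  finally show "co x x x (pstar x) ?E = pstar x" by simp
  have y: "co x x x ?E (pm (rpr x y)) = (if y = whole C x then ?E else 0)" if y: "y \<in> subobjects C x" for y
  proof -
    note r = rpr[OF y x]
    have m: "mon (rpr x y)" "cd (rpr x y) = x" using r by auto
    have sb: "subs_below x (rpr x y) \<subseteq> sq C x" by (auto simp: subs_below_def)
    show ?thesis
    proof (cases "y = whole C x")
      case True
      then have "pm (rpr x y) = un x"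
        using pm_cls[OF m(1)] pm_cls[of "ide x"] r x m by (simp add: whole_cls pm_ide)
      then show ?thesis using True EH x by simp
    next
      case False
      have "quo x \<inter> subs_below x (rpr x y) = {}"
      proof -
        have "y = whole C x" if "sub_le C x (whole C x) y"
          using sub_le_antisym[OF x y whole_in_subobjects[OF x] sub_le_whole[OF x y] that] .
        then show ?thesis using False r by (auto simp: quo_def subs_below_def)
      qed
      then have "co x x x ?E (part_proj x (subs_below x (rpr x y))) = 0"
        using part_proj_part_proj[OF x qs _ sb] qs sb qz_is_eps[OF x] by (auto simp: part_proj_def)
      moreover have "part_proj x (subs_below x (rpr x y)) \<in> H x x" by (rule part_proj_in_H[OF x sb]) (use sb qz_is_eps[OF x] in auto)
      ultimately show ?thesis
        using False part_proj_pm[OF x m] co_assoc[of "pm (rpr x y)" x x "part_proj x (subs_below x (rpr x y))" x ?E x] EH pm_in_H[OF m] x by simp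
    qed
  qed
  have "co x x x ?E (pstar x) = (\<Sum>y\<in>subobjects C x. if y = whole C x then of_int (mu_sub C x y (whole C x)) \<star> ?E else 0)"
    unfolding pstar_def co_sum_right co_smul_right by (rule sum.cong) (use y in auto)
  also have "\<dots> = ?E" using whole_in_subobjects[OF x] mu_whole[OF x] x by simp
  finally show "co x x x ?E (pstar x) = ?E" .
qed

end

section \<open>Preadditive categories and their completions\<close>

locale preadditive = category C for C :: "('o, 'm::ab_group_add) cat" +
  assumes zero_in_Hom: "\<lbrakk>x \<in> Ob C; y \<in> Ob C\<rbrakk> \<Longrightarrow> 0 \<in> Hom C x y"
    and add_in_Hom: "\<lbrakk>x \<in> Ob C; y \<in> Ob C; f \<in> Hom C x y; g \<in> Hom C x y\<rbrakk> \<Longrightarrow> f + g \<in> Hom C x y"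
    and diff_in_Hom: "\<lbrakk>x \<in> Ob C; y \<in> Ob C; f \<in> Hom C x y; g \<in> Hom C x y\<rbrakk> \<Longrightarrow> f - g \<in> Hom C x y"
    and Comp_add_left: "\<lbrakk>x \<in> Ob C; y \<in> Ob C; z \<in> Ob C; f \<in> Hom C x y; g \<in> Hom C y z; g' \<in> Hom C y z\<rbrakk>
      \<Longrightarrow> Comp C x y z (g + g') f = Comp C x y z g f + Comp C x y z g' f"
    and Comp_add_right: "\<lbrakk>x \<in> Ob C; y \<in> Ob C; z \<in> Ob C; f \<in> Hom C x y; f' \<in> Hom C x y; g \<in> Hom C y z\<rbrakk>
      \<Longrightarrow> Comp C x y z g (f + f') = Comp C x y z g f + Comp C x y z g f'"
begin

lemma Comp_zero_left: "\<lbrakk>x \<in> Ob C; y \<in> Ob C; z \<in> Ob C; f \<in> Hom C x y\<rbrakk> \<Longrightarrow> Comp C x y z 0 f = 0"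
  using Comp_add_left[of x y z f 0 0] zero_in_Hom by simp

lemma Comp_zero_right: "\<lbrakk>x \<in> Ob C; y \<in> Ob C; z \<in> Ob C; g \<in> Hom C y z\<rbrakk> \<Longrightarrow> Comp C x y z g 0 = 0"
  using Comp_add_right[of x y z 0 0 g] zero_in_Hom by simp

lemma Comp_diff_left: "\<lbrakk>x \<in> Ob C; y \<in> Ob C; z \<in> Ob C; f \<in> Hom C x y; g \<in> Hom C y z; g' \<in> Hom C y z\<rbrakk>
      \<Longrightarrow> Comp C x y z (g - g') f = Comp C x y z g f - Comp C x y z g' f"
  using Comp_add_left[of x y z f "g - g'" g'] diff_in_Hom by simp

lemma Comp_diff_right: "\<lbrakk>x \<in> Ob C; y \<in> Ob C; z \<in> Ob C; f \<in> Hom C x y; f' \<in> Hom C x y; g \<in> Hom C y z\<rbrakk>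
      \<Longrightarrow> Comp C x y z g (f - f') = Comp C x y z g f - Comp C x y z g f'"
  using Comp_add_right[of x y z "f - f'" f' g] diff_in_Hom by simp

lemma sum_in_Hom: "\<lbrakk>x \<in> Ob C; y \<in> Ob C; \<And>i. i \<in> I \<Longrightarrow> f i \<in> Hom C x y\<rbrakk> \<Longrightarrow> (\<Sum>i\<in>I. f i) \<in> Hom C x y"
  by (induction I rule: infinite_finite_induct) (simp_all add: zero_in_Hom add_in_Hom)

lemma Comp_sum_left: "\<lbrakk>x \<in> Ob C; y \<in> Ob C; z \<in> Ob C; f \<in> Hom C x y; \<And>i. i \<in> I \<Longrightarrow> g i \<in> Hom C y z\<rbrakk>
      \<Longrightarrow> Comp C x y z (\<Sum>i\<in>I. g i) f = (\<Sum>i\<in>I. Comp C x y z (g i) f)"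
  by (induction I rule: infinite_finite_induct) (simp_all add: Comp_zero_left Comp_add_left sum_in_Hom)

lemma Comp_sum_right: "\<lbrakk>x \<in> Ob C; y \<in> Ob C; z \<in> Ob C; g \<in> Hom C y z; \<And>i. i \<in> I \<Longrightarrow> f i \<in> Hom C x y\<rbrakk>
      \<Longrightarrow> Comp C x y z g (\<Sum>i\<in>I. f i) = (\<Sum>i\<in>I. Comp C x y z g (f i))"
  by (induction I rule: infinite_finite_induct) (simp_all add: Comp_zero_right Comp_add_right sum_in_Hom)

subsection \<open>Direct summands\<close>

lemma split_mon:
  assumes "x \<in> Ob C" "v \<in> Ob C" "m \<in> Hom C v x" "p \<in> Hom C x v" "Comp C v x v p m = Idn C v"
  shows "mon (Ar v m x)"
  by (rule split_mono_mon[of _ "Ar x p v"]) (use assms in \<open>auto simp: arr_triple cmp_def ide_def\<close>)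

lemma complementaryI:
  assumes x: "x \<in> Ob C" and O: "v \<in> Ob C" "v' \<in> Ob C"
    and h: "m \<in> Hom C v x" "p \<in> Hom C x v" "m' \<in> Hom C v' x" "p' \<in> Hom C x v'"
    and e: "Comp C v x v p m = Idn C v" "Comp C v' x v' p' m' = Idn C v'" "Comp C v' x v p m' = 0" "Comp C v x v' p' m = 0"
      "Comp C x v x m p + Comp C x v' x m' p' = Idn C x"
  shows "complementary C x (cls (Ar v m x)) (cls (Ar v' m' x))"
  unfolding complementary_def internal_sum_def
proof (intro conjI ballI)
  have mm: "mon (Ar v m x)" "mon (Ar v' m' x)" using split_mon x O h e by auto
  show "whole C x \<in> subobjects C x" using whole_in_subobjects[OF x] .
  show "(if b then cls (Ar v m x) else cls (Ar v' m' x)) \<in> subobjects C x" for b using mm by simp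
  have "(x, Idn C x) \<in> whole C x" using mem_cls_self[of "ide x"] x by (simp add: whole_cls mr_ide)
  moreover have "biproduct C UNIV (\<lambda>b. if b then v else v') (\<lambda>b. if b then m else m') x"
    unfolding biproduct_def
  proof (intro conjI ballI exI[of _ "\<lambda>b. if b then p else p'"])
    show "(\<Sum>i\<in>UNIV. Comp C x (if i then v else v') x (if i then m else m') (if i then p else p')) = Idn C x"
      using e by (simp add: UNIV_bool add.commute)
  qed (use x O h e in auto)
  moreover have "(if b then v else v', Comp C (if b then v else v') x x (Idn C x) (if b then m else m')) \<in> (if b then cls (Ar v m x) else cls (Ar v' m' x))" for b
    using mem_cls_self[OF mm(1)] mem_cls_self[OF mm(2)] x O h by (auto simp: Comp_Idn_left)
  ultimately show "\<exists>(v0, m0)\<in>whole C x. \<exists>D d. biproduct C UNIV D d v0 \<and>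
      (\<forall>i\<in>UNIV. (D i, Comp C (D i) v0 x m0 (d i)) \<in> (if i then cls (Ar v m x) else cls (Ar v' m' x)))"
    by (intro bexI[of _ "(x, Idn C x)"]) (simp_all only: prod.case,
      intro exI[of _ "\<lambda>b. if b then v else v'"] exI[of _ "\<lambda>b. if b then m else m'"], simp_all)
qed

text \<open>The biproduct in \<open>complementary\<close> lives on an arbitrary representative
  \<open>v0\<close> of the whole object. Transport along the isomorphism \<open>m0\<close> yields
  inclusions and projections on \<open>x\<close> itself.\<close>

lemma complementaryE:
  assumes x: "x \<in> Ob C" and c: "complementary C x S S'"
  obtains v m p v' m' p' where "v \<in> Ob C" "v' \<in> Ob C" "m \<in> Hom C v x" "p \<in> Hom C x v" "m' \<in> Hom C v' x" "p' \<in> Hom C x v'"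
    "Comp C v x v p m = Idn C v" "Comp C v' x v' p' m' = Idn C v'"
    "Comp C x v x m p + Comp C x v' x m' p' = Idn C x" "S = cls (Ar v m x)" "S' = cls (Ar v' m' x)"
proof -
  let ?F = "\<lambda>b. if b then S else S'"
  obtain v0 m0 D d where 1: "(v0, m0) \<in> whole C x" "biproduct C (UNIV :: bool set) D d v0"
    "\<And>i. (D i, Comp C (D i) v0 x m0 (d i)) \<in> ?F i" and S: "\<And>i. ?F i \<in> subobjects C x"
    using c unfolding complementary_def internal_sum_def by blast
  obtain q where q: "v0 \<in> Ob C" "\<And>i. D i \<in> Ob C" "\<And>i. d i \<in> Hom C (D i) v0" "\<And>i. q i \<in> Hom C v0 (D i)"
    "\<And>i j. Comp C (D i) v0 (D j) (q j) (d i) = (if i = j then Idn C (D i) else 0)"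
    "(\<Sum>i\<in>UNIV. Comp C v0 (D i) v0 (d i) (q i)) = Idn C v0"
    using 1(2) unfolding biproduct_def by blast
  let ?m0 = "Ar v0 m0 x"
  have mx: "mon (ide x)" using x by simp
  obtain h where h: "mon ?m0" "iso h" "dm h = x" "cd h = v0" "?m0 \<cdot> h = ide x"
    using 1(1) mem_cls_iff[OF mx, of v0 m0] by (auto simp: whole_cls)
  have m0: "m0 \<in> Hom C v0 x" using mon_arr[OF h(1)] by (simp add: arr_triple)
  have hH: "mr h \<in> Hom C x v0" using iso_arr'[OF h(2)] h unfolding arr_def by simp
  have mh: "Comp C x v0 x m0 (mr h) = Idn C x" using arg_cong[OF h(5), of mr] h(3,4) by (simp add: mr_cmp mr_ide)
  have "?m0 \<cdot> (h \<cdot> ?m0) = ?m0 \<cdot> ide v0" using cmp_left_eq[OF h(5), of ?m0] h q by simp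
  then have "h \<cdot> ?m0 = ide v0" using h q by - (rule monD[OF h(1)], auto)
  then have hm: "Comp C v0 x v0 (mr h) m0 = Idn C v0" using h by (simp add: cmp_def ide_def)
  define m where "m i = Comp C (D i) v0 x m0 (d i)" for i
  define p where "p i = Comp C x v0 (D i) (q i) (mr h)" for i
  have mp: "m i \<in> Hom C (D i) x" "p i \<in> Hom C x (D i)" for i
    using x q m0 hH by (auto simp: m_def p_def intro: Comp_in_Hom)
  have pm: "Comp C (D i) x (D i) (p i) (m i) = Idn C (D i)" for i
  proof -
    have "Comp C (D i) x (D i) (p i) (m i) = Comp C (D i) v0 (D i) (q i) (Comp C (D i) x v0 (mr h) (m i))"
      unfolding p_def using x q(1-4) hH mp by (intro Comp_assoc) auto
    also have "Comp C (D i) x v0 (mr h) (m i) = Comp C (D i) v0 v0 (Comp C v0 x v0 (mr h) m0) (d i)"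
      unfolding m_def by (rule Comp_assoc[symmetric]) (use x q(1-4) hH m0 in auto)
    finally show ?thesis using hm q by (simp add: Comp_Idn_left)
  qed
  have mpc: "Comp C x (D i) x (m i) (p i) = Comp C x v0 x m0 (Comp C x v0 v0 (Comp C v0 (D i) v0 (d i) (q i)) (mr h))" for i
  proof -
    have "Comp C x (D i) x (m i) (p i) = Comp C x v0 x m0 (Comp C x (D i) v0 (d i) (p i))"
      unfolding m_def using x q(1-4) m0 mp by (intro Comp_assoc) auto
    also have "Comp C x (D i) v0 (d i) (p i) = Comp C x v0 v0 (Comp C v0 (D i) v0 (d i) (q i)) (mr h)"
      unfolding p_def by (rule Comp_assoc[symmetric]) (use x q(1-4) hH in auto)
    finally show ?thesis .
  qed
  have "(\<Sum>i\<in>UNIV. Comp C x (D i) x (m i) (p i)) = Comp C x v0 x m0 (Comp C x v0 v0 (\<Sum>i\<in>UNIV. Comp C v0 (D i) v0 (d i) (q i)) (mr h))"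
    unfolding mpc using x q(1-4) m0 hH
    by (subst Comp_sum_left; (intro Comp_in_Hom sum_in_Hom)?; simp?) (subst Comp_sum_right; (intro Comp_in_Hom)?; simp?)
  also have "\<dots> = Idn C x" unfolding q(6) using mh hH x q by (simp add: Comp_Idn_left)
  finally have sm: "Comp C x (D True) x (m True) (p True) + Comp C x (D False) x (m False) (p False) = Idn C x"
    by (simp add: UNIV_bool add.commute)
  have F: "?F i = cls (Ar (D i) (m i) x)" for i
  proof -
    obtain n where n: "mon n" "cd n = x" "?F i = cls n" using S[of i] x by (auto simp: subobjects_eq)
    then show ?thesis using mem_clsD(2)[OF n(1), of "D i" "m i"] 1(3)[of i] unfolding m_def[symmetric] by simp
  qed
  show ?thesis
    by (rule that[of "D True" "D False" "m True" "p True" "m False" "p False"])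
      (use q mp pm sm F[of True] F[of False] in auto)
qed

lemma direct_summandE:
  assumes x: "x \<in> Ob C" and d: "direct_summand C x S"
  obtains v m p where "v \<in> Ob C" "m \<in> Hom C v x" "p \<in> Hom C x v" "Comp C v x v p m = Idn C v" "S = cls (Ar v m x)"
  using d complementaryE[OF x] unfolding direct_summand_def by metis

lemma sub_obj_cls_iso:
  assumes "mon n"
  obtains h where "iso h" "dm h = sub_obj (cls n)" "cd h = dm n" "n \<cdot> h = rpr (cd n) (cls n)"
proof -
  have r: "mon (rpr (cd n) (cls n))" "cls (rpr (cd n) (cls n)) = cls n" using rpr[of "cls n" "cd n"] assms by auto
  then show ?thesis using that cls_eq_iff[OF r(1) assms] by auto
qed

lemma internal_sumI:
  assumes x: "x \<in> Ob C" and m: "mon (Ar v m x)" and b: "biproduct C I D d v"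
    and F: "\<And>i. i \<in> I \<Longrightarrow> F i = cls (Ar (D i) (Comp C (D i) v x m (d i)) x)"
    and M: "\<And>i. i \<in> I \<Longrightarrow> mon (Ar (D i) (Comp C (D i) v x m (d i)) x)"
  shows "internal_sum C x (cls (Ar v m x)) I F"
  unfolding internal_sum_def
proof (intro conjI ballI bexI[of _ "(v, m)"])
  show "cls (Ar v m x) \<in> subobjects C x" using m by simp
  show "F i \<in> subobjects C x" if "i \<in> I" for i using F[OF that] M[OF that] by simp
  show "(v, m) \<in> cls (Ar v m x)" using mem_cls_self[OF m] by simp
  show "case (v, m) of (v, m) \<Rightarrow> \<exists>D d. biproduct C I D d v \<and> (\<forall>i\<in>I. (D i, Comp C (D i) v x m (d i)) \<in> F i)"
    unfolding prod.case using b F mem_cls_self[OF M] by (intro exI[of _ D] exI[of _ d]) auto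
qed

end

lemma lists_nth: "xs \<in> lists X \<Longrightarrow> i < length xs \<Longrightarrow> xs ! i \<in> X"
  by (metis in_lists_conv_set nth_mem)

context preadditive
begin

section \<open>The additive completion\<close>

abbreviation AC :: "('o list, nat \<Rightarrow> nat \<Rightarrow> 'm) cat" where "AC \<equiv> additive_completion C"

lemma AC_Ob: "Ob AC = lists (Ob C)" by (simp add: additive_completion_def)

lemma AC_Hom: "f \<in> Hom AC xs ys \<longleftrightarrow> (\<forall>i j. if i < length xs \<and> j < length ys then f j i \<in> Hom C (xs ! i) (ys ! j) else f j i = 0)"
  by (simp add: additive_completion_def)

lemma AC_HomD:
  "f \<in> Hom AC xs ys \<Longrightarrow> i < length xs \<Longrightarrow> j < length ys \<Longrightarrow> f j i \<in> Hom C (xs ! i) (ys ! j)"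
  "f \<in> Hom AC xs ys \<Longrightarrow> \<not> (i < length xs \<and> j < length ys) \<Longrightarrow> f j i = 0"
  unfolding AC_Hom by meson+

lemma AC_Comp: "Comp AC xs ys zs g f k i = (if i < length xs \<and> k < length zs
       then \<Sum>j < length ys. Comp C (xs ! i) (ys ! j) (zs ! k) (g k j) (f j i) else 0)"
  by (simp add: additive_completion_def)

lemma AC_Idn: "Idn AC xs j i = (if i = j \<and> i < length xs then Idn C (xs ! i) else 0)"
  by (simp add: additive_completion_def)

lemma category_AC: "category AC"
proof
  fix xs assume x: "xs \<in> Ob AC"
  show "Idn AC xs \<in> Hom AC xs xs"
    unfolding AC_Hom AC_Idn using x by (auto simp: AC_Ob Idn_in_Hom zero_in_Hom lists_nth)
next
  fix xs ys zs f g assume a: "xs \<in> Ob AC" "ys \<in> Ob AC" "zs \<in> Ob AC" "f \<in> Hom AC xs ys" "g \<in> Hom AC ys zs"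
  show "Comp AC xs ys zs g f \<in> Hom AC xs zs"
    unfolding AC_Hom AC_Comp using a lists_nth AC_HomD(1)[OF a(4)] AC_HomD(1)[OF a(5)]
    by (auto simp: AC_Ob intro!: sum_in_Hom Comp_in_Hom)
next
  fix xs ys f assume a: "xs \<in> Ob AC" "ys \<in> Ob AC" "f \<in> Hom AC xs ys"
  note f = AC_HomD[OF a(3)]
  show "Comp AC xs xs ys f (Idn AC xs) = f"
  proof (intro ext)
    fix k i
    show "Comp AC xs xs ys f (Idn AC xs) k i = f k i"
    proof (cases "i < length xs \<and> k < length ys")
      case True
      have "Comp AC xs xs ys f (Idn AC xs) k i = (\<Sum>j<length xs. if j = i then f k i else 0)"
        unfolding AC_Comp if_P[OF True]
      proof (rule sum.cong[OF HOL.refl])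
        fix j assume j: "j \<in> {..<length xs}"
        show "Comp C (xs ! i) (xs ! j) (ys ! k) (f k j) (Idn AC xs j i) = (if j = i then f k i else 0)"
          using True j a f(1)[of j k] f(1)[of i k] lists_nth[of xs "Ob C"] lists_nth[of ys "Ob C"]
          by (auto simp: AC_Idn AC_Ob Comp_Idn_right Comp_zero_right)
      qed
      then show ?thesis using True by simp
    qed (use f(2) in \<open>auto simp: AC_Comp\<close>)
  qed
  show "Comp AC xs ys ys (Idn AC ys) f = f"
  proof (intro ext)
    fix k i
    show "Comp AC xs ys ys (Idn AC ys) f k i = f k i"
    proof (cases "i < length xs \<and> k < length ys")
      case True
      have "Comp AC xs ys ys (Idn AC ys) f k i = (\<Sum>j<length ys. if j = k then f k i else 0)"
        unfolding AC_Comp if_P[OF True]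
      proof (rule sum.cong[OF HOL.refl])
        fix j assume j: "j \<in> {..<length ys}"
        show "Comp C (xs ! i) (ys ! j) (ys ! k) (Idn AC ys k j) (f j i) = (if j = k then f k i else 0)"
          using True j a f(1)[of i j] f(1)[of i k] lists_nth[of xs "Ob C"] lists_nth[of ys "Ob C"]
          by (auto simp: AC_Idn AC_Ob Comp_Idn_left Comp_zero_left)
      qed
      then show ?thesis using True by simp
    qed (use f(2) in \<open>auto simp: AC_Comp\<close>)
  qed
next
  fix ws xs ys zs f g h
  assume a: "ws \<in> Ob AC" "xs \<in> Ob AC" "ys \<in> Ob AC" "zs \<in> Ob AC" "f \<in> Hom AC ws xs" "g \<in> Hom AC xs ys" "h \<in> Hom AC ys zs"
  note f = AC_HomD(1)[OF a(5)] and g = AC_HomD(1)[OF a(6)] and h = AC_HomD(1)[OF a(7)]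
  have O: "\<And>i. i < length ws \<Longrightarrow> ws ! i \<in> Ob C" "\<And>i. i < length xs \<Longrightarrow> xs ! i \<in> Ob C"
    "\<And>i. i < length ys \<Longrightarrow> ys ! i \<in> Ob C" "\<And>i. i < length zs \<Longrightarrow> zs ! i \<in> Ob C"
    using a lists_nth by (auto simp: AC_Ob)
  show "Comp AC ws xs zs (Comp AC xs ys zs h g) f = Comp AC ws ys zs h (Comp AC ws xs ys g f)"
  proof (intro ext)
    fix l i
    show "Comp AC ws xs zs (Comp AC xs ys zs h g) f l i = Comp AC ws ys zs h (Comp AC ws xs ys g f) l i"
    proof (cases "i < length ws \<and> l < length zs")
      case True
      then have i: "i < length ws" and l: "l < length zs" by auto
      have "Comp AC ws xs zs (Comp AC xs ys zs h g) f l i =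
          (\<Sum>j<length xs. \<Sum>k<length ys. Comp C (ws ! i) (xs ! j) (zs ! l) (Comp C (xs ! j) (ys ! k) (zs ! l) (h l k) (g k j)) (f j i))"
        using i l O f g h by (auto simp: AC_Comp intro!: sum.cong Comp_sum_left Comp_in_Hom)
      also have "\<dots> = (\<Sum>k<length ys. \<Sum>j<length xs. Comp C (ws ! i) (xs ! j) (zs ! l) (Comp C (xs ! j) (ys ! k) (zs ! l) (h l k) (g k j)) (f j i))"
        by (rule sum.swap)
      also have "\<dots> = (\<Sum>k<length ys. \<Sum>j<length xs. Comp C (ws ! i) (ys ! k) (zs ! l) (h l k) (Comp C (ws ! i) (xs ! j) (ys ! k) (g k j) (f j i)))"
        by (intro sum.cong HOL.refl) (use i l O f g h in \<open>simp add: Comp_assoc\<close>)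
      also have "\<dots> = Comp AC ws ys zs h (Comp AC ws xs ys g f) l i"
        using i l O f g h by (auto simp: AC_Comp intro!: sum.cong Comp_sum_right[symmetric] Comp_in_Hom)
      finally show ?thesis .
    qed (auto simp: AC_Comp)
  qed
qed

lemma preadditive_AC: "preadditive AC"
proof -
  interpret A: category AC by (rule category_AC)
  show ?thesis
  proof
    fix xs ys assume O: "xs \<in> Ob AC" "ys \<in> Ob AC"
    then have O': "\<And>i. i < length xs \<Longrightarrow> xs ! i \<in> Ob C" "\<And>i. i < length ys \<Longrightarrow> ys ! i \<in> Ob C"
      using lists_nth by (auto simp: AC_Ob)
    show "0 \<in> Hom AC xs ys" unfolding AC_Hom using O' by (simp add: zero_in_Hom zero_fun_apply)
    fix f g assume fg: "f \<in> Hom AC xs ys" "g \<in> Hom AC xs ys"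
    show "f + g \<in> Hom AC xs ys" using fg O' unfolding AC_Hom by (auto simp: add_in_Hom plus_fun_apply split: if_splits)
    show "f - g \<in> Hom AC xs ys" using fg O' unfolding AC_Hom by (auto simp: diff_in_Hom split: if_splits)
  next
    fix xs ys zs f g g' assume a: "xs \<in> Ob AC" "ys \<in> Ob AC" "zs \<in> Ob AC" "f \<in> Hom AC xs ys" "g \<in> Hom AC ys zs" "g' \<in> Hom AC ys zs"
    note h = AC_HomD(1)[OF a(4)] AC_HomD(1)[OF a(5)] AC_HomD(1)[OF a(6)]
    have O: "\<And>i. i < length xs \<Longrightarrow> xs ! i \<in> Ob C" "\<And>i. i < length ys \<Longrightarrow> ys ! i \<in> Ob C" "\<And>i. i < length zs \<Longrightarrow> zs ! i \<in> Ob C"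
      using a lists_nth by (auto simp: AC_Ob)
    show "Comp AC xs ys zs (g + g') f = Comp AC xs ys zs g f + Comp AC xs ys zs g' f"
      using h O by (auto simp: fun_eq_iff AC_Comp plus_fun_apply sum.distrib[symmetric] intro!: sum.cong Comp_add_left)
  next
    fix xs ys zs f f' g assume a: "xs \<in> Ob AC" "ys \<in> Ob AC" "zs \<in> Ob AC" "f \<in> Hom AC xs ys" "f' \<in> Hom AC xs ys" "g \<in> Hom AC ys zs"
    note h = AC_HomD(1)[OF a(4)] AC_HomD(1)[OF a(5)] AC_HomD(1)[OF a(6)]
    have O: "\<And>i. i < length xs \<Longrightarrow> xs ! i \<in> Ob C" "\<And>i. i < length ys \<Longrightarrow> ys ! i \<in> Ob C" "\<And>i. i < length zs \<Longrightarrow> zs ! i \<in> Ob C"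
      using a lists_nth by (auto simp: AC_Ob)
    show "Comp AC xs ys zs g (f + f') = Comp AC xs ys zs g f + Comp AC xs ys zs g f'"
      using h O by (auto simp: fun_eq_iff AC_Comp plus_fun_apply sum.distrib[symmetric] intro!: sum.cong Comp_add_right)
  qed
qed

section \<open>The idempotent completion\<close>

abbreviation IC :: "('o \<times> 'm, 'm) cat" where "IC \<equiv> idempotent_completion C"

lemma IC_Ob: "(x, e) \<in> Ob IC \<longleftrightarrow> x \<in> Ob C \<and> e \<in> Hom C x x \<and> Comp C x x x e e = e"
  by (simp add: idempotent_completion_def)

lemma IC_Hom: "f \<in> Hom IC (x, e) (y, e') \<longleftrightarrow> f \<in> Hom C x y \<and> Comp C x x y f e = f \<and> Comp C x y y e' f = f"
  by (simp add: idempotent_completion_def)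

lemma IC_Comp: "Comp IC (x, e) (y, e') (z, e'') = Comp C x y z"
  by (simp add: idempotent_completion_def)

lemma IC_Idn: "Idn IC (x, e) = e"
  by (simp add: idempotent_completion_def)

lemma category_IC: "category IC"
proof (unfold_locales, goal_cases)
  case (1 x)
  then show ?case by (cases x) (simp add: IC_Ob IC_Hom IC_Idn)
next
  case (2 x y z f g)
  obtain x' a where x: "x = (x', a)" by (cases x)
  obtain y' b where y: "y = (y', b)" by (cases y)
  obtain z' c where z: "z = (z', c)" by (cases z)
  have O: "x' \<in> Ob C" "y' \<in> Ob C" "z' \<in> Ob C" "a \<in> Hom C x' x'" "c \<in> Hom C z' z'" using 2 by (auto simp: x y z IC_Ob)
  have h: "f \<in> Hom C x' y'" "g \<in> Hom C y' z'" "Comp C x' x' y' f a = f" "Comp C y' z' z' c g = g" using 2 by (auto simp: x y z IC_Hom)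
  show ?case unfolding x y z IC_Hom IC_Comp
    using O h Comp_assoc[of x' x' y' z' a f g] Comp_assoc[of x' y' z' z' f g c] by (simp add: Comp_in_Hom)
next
  case (3 x y f)
  then show ?case by (cases x; cases y) (auto simp: IC_Hom IC_Comp IC_Idn)
next
  case (4 x y f)
  then show ?case by (cases x; cases y) (auto simp: IC_Hom IC_Comp IC_Idn)
next
  case (5 w x y z f g h)
  then show ?case by (cases w; cases x; cases y; cases z) (auto simp: IC_Hom IC_Ob IC_Comp intro!: Comp_assoc)
qed

lemma preadditive_IC: "preadditive IC"
proof -
  interpret I: category IC by (rule category_IC)
  show ?thesis
  proof (unfold_locales, goal_cases)
    case (1 x y)
    then show ?case by (cases x; cases y) (auto simp: IC_Ob IC_Hom zero_in_Hom Comp_zero_left Comp_zero_right)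
  next
    case (2 x y f g)
    then show ?case by (cases x; cases y) (auto simp: IC_Ob IC_Hom add_in_Hom Comp_add_left Comp_add_right)
  next
    case (3 x y f g)
    then show ?case by (cases x; cases y) (auto simp: IC_Ob IC_Hom diff_in_Hom Comp_diff_left Comp_diff_right)
  next
    case (4 x y z f g g')
    then show ?case by (cases x; cases y; cases z) (auto simp: IC_Ob IC_Hom IC_Comp Comp_add_left)
  next
    case (5 x y z f f' g)
    then show ?case by (cases x; cases y; cases z) (auto simp: IC_Ob IC_Hom IC_Comp Comp_add_right)
  qed
qed

lemma idempotent_summand:
  assumes x: "(x, a) \<in> Ob IC" and e: "e \<in> Hom IC (x, a) (x, a)" "Comp C x x x e e = e"
  shows "(x, e) \<in> Ob IC" "e \<in> Hom IC (x, e) (x, a)" "e \<in> Hom IC (x, a) (x, e)"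
  using assms by (auto simp: IC_Ob IC_Hom)

lemma idempotent_complementary:
  assumes x: "(x, a) \<in> Ob IC" and e: "e \<in> Hom IC (x, a) (x, a)" "Comp C x x x e e = e"
  shows "complementary IC (x, a) (category.cls IC (Ar (x, e) e (x, a))) (category.cls IC (Ar (x, a - e) (a - e) (x, a)))"
proof -
  interpret I: preadditive IC by (rule preadditive_IC)
  have O: "x \<in> Ob C" "a \<in> Hom C x x" "e \<in> Hom C x x" "Comp C x x x e a = e" "Comp C x x x a e = e" "Comp C x x x a a = a"
    using x e by (auto simp: IC_Ob IC_Hom)
  have f: "a - e \<in> Hom IC (x, a) (x, a)" "Comp C x x x (a - e) (a - e) = a - e"
    "Comp C x x x e (a - e) = 0" "Comp C x x x (a - e) e = 0"
    using O e by (auto simp: IC_Hom diff_in_Hom Comp_diff_left Comp_diff_right)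
  note s = idempotent_summand[OF x e] and s' = idempotent_summand[OF x f(1,2)]
  show ?thesis
    by (rule I.complementaryI[OF x s(1) s'(1) s(2,3) s'(2,3)]) (use f e in \<open>auto simp: IC_Comp IC_Idn\<close>)
qed

text \<open>The retract is isomorphic over \<open>x\<close> to the image of the idempotent
  \<open>m p\<close>. In the idempotent completion \<open>a - m p\<close> splits as well, which
  supplies the complement.\<close>

lemma split_direct_summand:
  assumes x: "(x, a) \<in> Ob IC" and v: "(v, b) \<in> Ob IC" and m: "m \<in> Hom IC (v, b) (x, a)" "p \<in> Hom IC (x, a) (v, b)"
    and pm: "Comp C v x v p m = b"
  shows "direct_summand IC (x, a) (category.cls IC (Ar (v, b) m (x, a)))"
proof -
  interpret I: preadditive IC by (rule preadditive_IC)
  have O: "x \<in> Ob C" "v \<in> Ob C" "m \<in> Hom C v x" "p \<in> Hom C x v" "b \<in> Hom C v v" "a \<in> Hom C x x" "Comp C v v v b b = b"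
    "Comp C v v x m b = m" "Comp C v x x a m = m" "Comp C x v v b p = p" "Comp C x x v p a = p"
    using x v m by (auto simp: IC_Ob IC_Hom)
  define e where "e = Comp C x v x m p"
  have em: "Comp C v x x e m = m"
    unfolding e_def using O pm Comp_assoc[of v x v x m p m] by simp
  have ee: "Comp C x x x e e = e"
    using O em Comp_assoc[of x v x x p m e] by (simp add: e_def Comp_in_Hom)
  have eH: "e \<in> Hom IC (x, a) (x, a)"
    using I.Comp_in_Hom[OF x v x m(2,1)] by (simp add: e_def IC_Comp)
  note s = idempotent_summand[OF x eH ee]
  have mE: "m \<in> Hom IC (v, b) (x, e)" using O em by (simp add: IC_Hom)
  have pE: "p \<in> Hom IC (x, e) (v, b)"
    using O pm Comp_assoc[of x v x v p m p] by (simp add: IC_Hom e_def)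
  have h: "I.iso (Ar (v, b) m (x, e))"
    by (rule I.isoI[of _ "Ar (x, e) p (v, b)"])
      (use s v mE pE pm in \<open>auto simp: I.arr_triple I.cmp_def I.ide_def IC_Comp IC_Idn e_def\<close>)
  have n: "I.mon (Ar (x, e) e (x, a))" by (rule I.split_mon[OF x s(1,2,3)]) (simp add: IC_Comp IC_Idn ee)
  have "I.cls (I.cmp (Ar (x, e) e (x, a)) (Ar (v, b) m (x, e))) = I.cls (Ar (x, e) e (x, a))"
    by (rule I.cls_eqI[OF n h]) simp
  moreover have "I.cmp (Ar (x, e) e (x, a)) (Ar (v, b) m (x, e)) = Ar (v, b) m (x, a)"
    using em by (simp add: I.cmp_def IC_Comp)
  ultimately show ?thesis
    unfolding direct_summand_def using idempotent_complementary[OF x eH ee] by auto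
qed

end

context preadditive
begin

section \<open>Biproducts and images of projections\<close>

lemma biproduct_cong:
  assumes b: "biproduct C I D d x" and D: "\<And>i. i \<in> I \<Longrightarrow> D i = D' i"
  shows "biproduct C I D' d x"
proof -
  obtain p where p: "finite I" "x \<in> Ob C" "\<And>i. i \<in> I \<Longrightarrow> D' i \<in> Ob C \<and> d i \<in> Hom C (D' i) x"
    "\<And>i. i \<in> I \<Longrightarrow> p i \<in> Hom C x (D' i)"
    "\<And>i j. i \<in> I \<Longrightarrow> j \<in> I \<Longrightarrow> Comp C (D' i) x (D' j) (p j) (d i) = (if i = j then Idn C (D' i) else 0)"
    "(\<Sum>i \<in> I. Comp C x (D i) x (d i) (p i)) = Idn C x"
    using b D unfolding biproduct_def by force
  moreover have "(\<Sum>i \<in> I. Comp C x (D i) x (d i) (p i)) = (\<Sum>i \<in> I. Comp C x (D' i) x (d i) (p i))"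
    by (rule sum.cong) (simp_all add: D)
  ultimately show ?thesis unfolding biproduct_def by (intro conjI ballI exI[of _ p]) simp_all
qed

lemma biproduct_IC:
  assumes "biproduct C I D d x"
  shows "biproduct IC I (\<lambda>i. (D i, Idn C (D i))) d (x, Idn C x)"
proof -
  obtain p where p: "finite I" "x \<in> Ob C" "\<And>i. i \<in> I \<Longrightarrow> D i \<in> Ob C" "\<And>i. i \<in> I \<Longrightarrow> d i \<in> Hom C (D i) x"
    "\<And>i. i \<in> I \<Longrightarrow> p i \<in> Hom C x (D i)"
    "\<And>i j. i \<in> I \<Longrightarrow> j \<in> I \<Longrightarrow> Comp C (D i) x (D j) (p j) (d i) = (if i = j then Idn C (D i) else 0)"
    "(\<Sum>i \<in> I. Comp C x (D i) x (d i) (p i)) = Idn C x"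
    using assms unfolding biproduct_def by blast
  then show ?thesis unfolding biproduct_def
    by (auto simp: IC_Ob IC_Hom IC_Comp IC_Idn Idn_in_Hom Comp_Idn_left Comp_Idn_right intro!: exI[of _ p])
qed

lemma biproduct_AC:
  assumes xs: "xs \<in> lists (Ob C)"
  shows "biproduct AC {..<length xs} (\<lambda>i. [xs ! i]) (\<lambda>i j k. if j = i \<and> k = 0 then Idn C (xs ! i) else 0) xs"
  unfolding biproduct_def
proof (intro conjI ballI exI[of _ "\<lambda>i j k. if j = 0 \<and> k = i then Idn C (xs ! i) else 0"])
  have O: "xs ! i \<in> Ob C" if "i < length xs" for i using xs that by (rule lists_nth)
  show "finite {..<length xs}" by simp
  show "xs \<in> Ob AC" using xs by (simp add: AC_Ob)
  fix i assume i: "i \<in> {..<length xs}"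
  show "[xs ! i] \<in> Ob AC" using i O by (simp add: AC_Ob)
  show "(\<lambda>j k. if j = i \<and> k = 0 then Idn C (xs ! i) else 0) \<in> Hom AC [xs ! i] xs"
    using i O unfolding AC_Hom by (auto simp: Idn_in_Hom zero_in_Hom)
  show "(\<lambda>j k. if j = 0 \<and> k = i then Idn C (xs ! i) else 0) \<in> Hom AC xs [xs ! i]"
    using i O unfolding AC_Hom by (auto simp: Idn_in_Hom zero_in_Hom)
  fix j assume j: "j \<in> {..<length xs}"
  show "Comp AC [xs ! i] xs [xs ! j] (\<lambda>ja k. if ja = 0 \<and> k = j then Idn C (xs ! j) else 0)
      (\<lambda>j k. if j = i \<and> k = 0 then Idn C (xs ! i) else 0) = (if i = j then Idn AC [xs ! i] else 0)"
  proof (intro ext)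
    fix k l
    show "Comp AC [xs ! i] xs [xs ! j] (\<lambda>ja k. if ja = 0 \<and> k = j then Idn C (xs ! j) else 0)
      (\<lambda>j k. if j = i \<and> k = 0 then Idn C (xs ! i) else 0) k l = (if i = j then Idn AC [xs ! i] else 0) k l"
    proof (cases "l = 0 \<and> k = 0")
      case True
      have "(\<Sum>t<length xs. Comp C (xs ! i) (xs ! t) (xs ! j) (if t = j then Idn C (xs ! j) else 0) (if t = i then Idn C (xs ! i) else 0))
          = (\<Sum>t<length xs. if t = j then (if i = j then Idn C (xs ! i) else 0) else 0)"
        by (rule sum.cong[OF HOL.refl]) (use i j O in \<open>auto simp: Comp_zero_left Comp_zero_right Comp_Idn_left Idn_in_Hom zero_in_Hom\<close>)
      then show ?thesis using True j by (simp add: AC_Comp AC_Idn zero_fun_apply)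
    qed (auto simp: AC_Comp AC_Idn zero_fun_apply)
  qed
next
  have O: "xs ! i \<in> Ob C" if "i < length xs" for i using xs that by (rule lists_nth)
  show "(\<Sum>i<length xs. Comp AC xs [xs ! i] xs (\<lambda>j k. if j = i \<and> k = 0 then Idn C (xs ! i) else 0)
      (\<lambda>j k. if j = 0 \<and> k = i then Idn C (xs ! i) else 0)) = Idn AC xs"
  proof (intro ext)
    fix k l
    have "(\<Sum>i<length xs. Comp AC xs [xs ! i] xs (\<lambda>j k. if j = i \<and> k = 0 then Idn C (xs ! i) else 0)
      (\<lambda>j k. if j = 0 \<and> k = i then Idn C (xs ! i) else 0)) k l =
      (\<Sum>i<length xs. if i = k then (if l = k then Idn C (xs ! k) else 0) else 0)"
      unfolding sum_apply
      by (rule sum.cong[OF HOL.refl]) (use O in \<open>auto simp: AC_Comp Comp_zero_left Comp_zero_right Comp_Idn_left Idn_in_Hom zero_in_Hom\<close>)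
    then show "(\<Sum>i<length xs. Comp AC xs [xs ! i] xs (\<lambda>j k. if j = i \<and> k = 0 then Idn C (xs ! i) else 0)
      (\<lambda>j k. if j = 0 \<and> k = i then Idn C (xs ! i) else 0)) k l = Idn AC xs k l"
      by (auto simp: AC_Idn)
  qed
qed

text \<open>Turns a finite sum of composites through the \<open>D i\<close> into one composite
  through their direct sum; this converts \<open>through_proper\<close> into a factorization in
  \<open>T\<close>.\<close>

lemma biproduct_factor:
  assumes b: "biproduct C I D d x" and y: "y \<in> Ob C"
    and f: "\<And>i. i \<in> I \<Longrightarrow> f i \<in> Hom C y (D i)" and g: "\<And>i. i \<in> I \<Longrightarrow> g i \<in> Hom C (D i) y"
  obtains F G where "F \<in> Hom C y x" "G \<in> Hom C x y" "Comp C y x y G F = (\<Sum>i\<in>I. Comp C y (D i) y (g i) (f i))"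
proof -
  obtain p where p: "finite I" "x \<in> Ob C" "\<And>i. i \<in> I \<Longrightarrow> D i \<in> Ob C" "\<And>i. i \<in> I \<Longrightarrow> d i \<in> Hom C (D i) x"
    "\<And>i. i \<in> I \<Longrightarrow> p i \<in> Hom C x (D i)"
    "\<And>i j. i \<in> I \<Longrightarrow> j \<in> I \<Longrightarrow> Comp C (D i) x (D j) (p j) (d i) = (if i = j then Idn C (D i) else 0)"
    using b unfolding biproduct_def by blast
  define F where "F = (\<Sum>i\<in>I. Comp C y (D i) x (d i) (f i))"
  define G where "G = (\<Sum>i\<in>I. Comp C x (D i) y (g i) (p i))"
  have FH: "F \<in> Hom C y x" unfolding F_def by (rule sum_in_Hom) (use p y f in \<open>auto intro: Comp_in_Hom\<close>)
  have GH: "G \<in> Hom C x y" unfolding G_def by (rule sum_in_Hom) (use p y g in \<open>auto intro: Comp_in_Hom\<close>)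
  have pF: "Comp C y x (D i) (p i) F = f i" if i: "i \<in> I" for i
  proof -
    have "Comp C y x (D i) (p i) F = (\<Sum>j\<in>I. Comp C y x (D i) (p i) (Comp C y (D j) x (d j) (f j)))"
      unfolding F_def by (rule Comp_sum_right) (use p y f i in \<open>auto intro: Comp_in_Hom\<close>)
    also have "\<dots> = (\<Sum>j\<in>I. if j = i then f i else 0)"
    proof (rule sum.cong[OF HOL.refl])
      fix j assume j: "j \<in> I"
      have "Comp C y x (D i) (p i) (Comp C y (D j) x (d j) (f j)) = Comp C y (D j) (D i) (Comp C (D j) x (D i) (p i) (d j)) (f j)"
        by (rule Comp_assoc[symmetric]) (use p y f i j in auto)
      then show "Comp C y x (D i) (p i) (Comp C y (D j) x (d j) (f j)) = (if j = i then f i else 0)"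
        using p i j y f by (auto simp: Comp_Idn_left Comp_zero_left)
    qed
    also have "\<dots> = f i" using p(1) i by simp
    finally show ?thesis .
  qed
  have "Comp C y x y G F = (\<Sum>i\<in>I. Comp C y x y (Comp C x (D i) y (g i) (p i)) F)"
    unfolding G_def by (rule Comp_sum_left) (use p y g FH in \<open>auto intro: Comp_in_Hom\<close>)
  also have "\<dots> = (\<Sum>i\<in>I. Comp C y (D i) y (g i) (f i))"
  proof (rule sum.cong[OF HOL.refl])
    fix i assume i: "i \<in> I"
    have "Comp C y x y (Comp C x (D i) y (g i) (p i)) F = Comp C y (D i) y (g i) (Comp C y x (D i) (p i) F)"
      by (rule Comp_assoc) (use p y g FH i in auto)
    then show "Comp C y x y (Comp C x (D i) y (g i) (p i)) F = Comp C y (D i) y (g i) (f i)" using pF[OF i] by simp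
  qed
  finally show ?thesis using that FH GH by blast
qed

text \<open>Extend \<open>m\<close> along the retraction to all of \<open>z\<close>; there it is a
  sum of morphisms starting at the \<open>D i\<close>, each fixed by \<open>E\<close>. This bounds a
  candidate for \<open>[x]\<^sup>1\<close> from above.\<close>

lemma biproduct_retract_fixed:
  assumes b: "biproduct C I D d z" and O: "v \<in> Ob C" "x \<in> Ob C"
    and ab: "a \<in> Hom C v z" "r \<in> Hom C z v" "Comp C v z v r a = Idn C v"
    and E: "E \<in> Hom C x x" "\<And>i g. i \<in> I \<Longrightarrow> g \<in> Hom C (D i) x \<Longrightarrow> Comp C (D i) x x E g = g"
    and m: "m \<in> Hom C v x"
  shows "Comp C v x x E m = m"
proof -
  obtain p where p: "finite I" "z \<in> Ob C" "\<And>i. i \<in> I \<Longrightarrow> D i \<in> Ob C" "\<And>i. i \<in> I \<Longrightarrow> d i \<in> Hom C (D i) z"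
    "\<And>i. i \<in> I \<Longrightarrow> p i \<in> Hom C z (D i)"
    "(\<Sum>i \<in> I. Comp C z (D i) z (d i) (p i)) = Idn C z"
    using b unfolding biproduct_def by blast
  define k where "k = Comp C z v x m r"
  have kH: "k \<in> Hom C z x" using p O ab m by (auto simp: k_def intro: Comp_in_Hom)
  have ka: "Comp C v z x k a = m" using Comp_assoc[of v z v x a r m] p O ab m by (simp add: k_def Comp_Idn_right)
  have "Comp C z x x E k = Comp C z x x E (Comp C z z x k (\<Sum>i \<in> I. Comp C z (D i) z (d i) (p i)))"
    using p O kH by (simp add: Comp_Idn_right)
  also have "Comp C z z x k (\<Sum>i \<in> I. Comp C z (D i) z (d i) (p i)) = (\<Sum>i \<in> I. Comp C z z x k (Comp C z (D i) z (d i) (p i)))"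
    by (rule Comp_sum_right) (use p O kH in \<open>auto intro: Comp_in_Hom\<close>)
  also have "Comp C z x x E \<dots> = (\<Sum>i \<in> I. Comp C z x x E (Comp C z z x k (Comp C z (D i) z (d i) (p i))))"
    by (rule Comp_sum_right) (use p O kH E in \<open>auto intro!: Comp_in_Hom\<close>)
  also have "\<dots> = (\<Sum>i \<in> I. Comp C z z x k (Comp C z (D i) z (d i) (p i)))"
  proof (rule sum.cong[OF HOL.refl])
    fix i assume i: "i \<in> I"
    have c: "Comp C z z x k (Comp C z (D i) z (d i) (p i)) = Comp C z (D i) x (Comp C (D i) z x k (d i)) (p i)"
      by (rule Comp_assoc[symmetric]) (use p O kH i in auto)
    have kd: "Comp C (D i) z x k (d i) \<in> Hom C (D i) x" using p O kH i by (auto intro: Comp_in_Hom)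
    have "Comp C z x x E (Comp C z (D i) x (Comp C (D i) z x k (d i)) (p i)) = Comp C z (D i) x (Comp C (D i) x x E (Comp C (D i) z x k (d i))) (p i)"
      by (rule Comp_assoc[symmetric]) (use p O kd E i in auto)
    then show "Comp C z x x E (Comp C z z x k (Comp C z (D i) z (d i) (p i))) = Comp C z z x k (Comp C z (D i) z (d i) (p i))"
      unfolding c using E(2)[OF i kd] by simp
  qed
  also have "\<dots> = Comp C z z x k (\<Sum>i \<in> I. Comp C z (D i) z (d i) (p i))"
    by (rule Comp_sum_right[symmetric]) (use p O kH in \<open>auto intro: Comp_in_Hom\<close>)
  also have "\<dots> = k" using p O kH by (simp add: Comp_Idn_right)
  finally have "Comp C z x x E k = k" .
  then show ?thesis using Comp_assoc[of v z x x a k E] p O ab kH E ka by simp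
qed

text \<open>Two idempotents have the same image as soon as each fixes the other from the
  left.\<close>

lemma cls_eq_projections:
  assumes x: "x \<in> Ob C" and O: "v \<in> Ob C" "v' \<in> Ob C"
    and h: "m \<in> Hom C v x" "p \<in> Hom C x v" "m' \<in> Hom C v' x" "p' \<in> Hom C x v'"
    and e: "Comp C v x v p m = Idn C v" "Comp C v' x v' p' m' = Idn C v'"
    and s: "s = Comp C x v x m p" "s' = Comp C x v' x m' p'" "Comp C x x x s s' = s'" "Comp C x x x s' s = s"
  shows "cls (Ar v m x) = cls (Ar v' m' x)"
proof -
  let ?m = "Ar v m x" and ?m' = "Ar v' m' x" and ?p = "Ar x p v" and ?p' = "Ar x p' v'"
  have M: "mon ?m" "mon ?m'" using split_mon[OF x] O h e by auto
  have A: "arr ?m" "arr ?m'" "arr ?p" "arr ?p'" using x O h by (auto simp: arr_triple)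
  have pm: "?p \<cdot> ?m = ide v" "?p' \<cdot> ?m' = ide v'" using e by (auto simp: cmp_def ide_def)
  have ss: "(?m \<cdot> ?p) \<cdot> (?m' \<cdot> ?p') = ?m' \<cdot> ?p'" "(?m' \<cdot> ?p') \<cdot> (?m \<cdot> ?p) = ?m \<cdot> ?p" using s by (auto simp: cmp_def)
  have 1: "?m' \<cdot> (?p' \<cdot> ?m) = ?m"
  proof -
    have "?m' \<cdot> (?p' \<cdot> ?m) = ((?m' \<cdot> ?p') \<cdot> (?m \<cdot> ?p)) \<cdot> ?m" using A pm by simp
    then show ?thesis unfolding ss using A pm by simp
  qed
  have 2: "?m \<cdot> (?p \<cdot> ?m') = ?m'"
  proof -
    have "?m \<cdot> (?p \<cdot> ?m') = ((?m \<cdot> ?p) \<cdot> (?m' \<cdot> ?p')) \<cdot> ?m'" using A pm by simp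
    then show ?thesis unfolding ss using A pm by simp
  qed
  have "sub_le C x (cls ?m) (cls ?m')" using sub_le_cls[OF M] 1 A by (auto intro!: exI[of _ "?p' \<cdot> ?m"])
  moreover have "sub_le C x (cls ?m') (cls ?m)" using sub_le_cls[OF M(2,1)] 2 A by (auto intro!: exI[of _ "?p \<cdot> ?m'"])
  ultimately show ?thesis using sub_le_antisym[OF x] M by simp
qed

end

section \<open>The category \<open>\<T>\<close>\<close>

context malcev_category
begin

lemma preadditive_T0: "preadditive (T0 C \<delta>)"
proof -
  interpret T: category "T0 C \<delta>" by (rule category_T0)
  show ?thesis by unfold_locales (auto simp: co_add_left co_add_right)
qed

interpretation T0: preadditive "T0 C \<delta>" by (rule preadditive_T0)
interpretation AD: preadditive "additive_completion (T0 C \<delta>)" by (rule T0.preadditive_AC)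

lemma preadditive_T: "preadditive (T_cat C \<delta>)"
  unfolding T_cat_def by (rule AD.preadditive_IC)

interpretation TC: preadditive "T_cat C \<delta>" by (rule preadditive_T)

abbreviation T where "T \<equiv> T_cat C \<delta>"
abbreviation B where "B \<equiv> bracket C \<delta>"

text \<open>The image of an idempotent \<open>a\<close> of \<open>[x]\<close> as an object of
  \<open>T\<close>. The pieces of the decomposition all have this form, so composites between them
  are computed in \<open>T0\<close>.\<close>

definition br :: "'o \<Rightarrow> (('o \<times> 'm) set \<Rightarrow> 'k) \<Rightarrow> ('o, 'm, 'k) T_obj" where
  "br x a = ([x], T_embed a)"

lemma te_simps: "T_embed f j i = (if i = 0 \<and> j = 0 then f else 0)"
  by (simp add: T_embed_def)

lemma te_add: "T_embed f + T_embed g = T_embed (f + g)"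
  by (simp add: T_embed_def fun_eq_iff plus_fun_apply zero_fun_apply)

lemma te_diff: "T_embed f - T_embed g = T_embed (f - g)"
  by (simp add: T_embed_def fun_eq_iff zero_fun_apply)

lemma te_zero: "T_embed 0 = 0"
  by (simp add: T_embed_def fun_eq_iff zero_fun_apply)

lemma te_sum: "(\<Sum>i\<in>I. T_embed (f i)) = T_embed (\<Sum>i\<in>I. f i)"
  by (induction I rule: infinite_finite_induct)
    (simp_all only: sum.infinite sum.empty sum.insert te_zero te_add not_False_eq_True)

lemma te_inject: "T_embed f = T_embed g \<longleftrightarrow> f = g"
  by (metis te_simps)

lemma te_Hom_AD: "T_embed f \<in> Hom (additive_completion (T0 C \<delta>)) [x] [y] \<longleftrightarrow> f \<in> H x y"
  unfolding T0.AC_Hom by (auto simp: te_simps)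

lemma Hom_AD_te:
  assumes "t \<in> Hom (additive_completion (T0 C \<delta>)) [x] [y]"
  obtains f where "f \<in> H x y" "t = T_embed f"
proof
  show "t 0 0 \<in> H x y" using T0.AC_HomD(1)[OF assms, of 0 0] by simp
  show "t = T_embed (t 0 0)"
    using T0.AC_HomD(2)[OF assms] by (auto simp: fun_eq_iff te_simps)
qed

lemma te_Comp_AD: "Comp (additive_completion (T0 C \<delta>)) [x] [y] [z] (T_embed g) (T_embed f) = T_embed (co x y z g f)"
  by (auto simp: fun_eq_iff T0.AC_Comp te_simps)

lemma te_Idn_AD: "Idn (additive_completion (T0 C \<delta>)) [x] = T_embed (un x)"
  by (auto simp: fun_eq_iff T0.AC_Idn te_simps)

lemma bracket_eq: "B x = br x (un x)"
  by (simp add: bracket_def br_def te_Idn_AD)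

lemma br_Ob: "br x a \<in> Ob T \<longleftrightarrow> x \<in> Ob C \<and> a \<in> H x x \<and> co x x x a a = a"
  unfolding br_def T_cat_def AD.IC_Ob by (simp add: T0.AC_Ob te_Hom_AD te_Comp_AD te_inject)

lemma br_Hom: "T_embed f \<in> Hom T (br x a) (br y b) \<longleftrightarrow> f \<in> H x y \<and> co x x y f a = f \<and> co x y y b f = f"
  unfolding br_def T_cat_def AD.IC_Hom by (simp add: te_Hom_AD te_Comp_AD te_inject)

lemma br_Comp: "Comp T (br x a) (br y b) (br z c) (T_embed g) (T_embed f) = T_embed (co x y z g f)"
  unfolding br_def T_cat_def AD.IC_Comp by (rule te_Comp_AD)

lemma br_Idn: "Idn T (br x a) = T_embed a"
  unfolding br_def T_cat_def AD.IC_Idn ..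

lemma br_HomE:
  assumes "t \<in> Hom T (br x a) (br y b)"
  obtains f where "f \<in> H x y" "t = T_embed f"
proof -
  have "t \<in> Hom (additive_completion (T0 C \<delta>)) [x] [y]"
    using assms unfolding br_def T_cat_def AD.IC_Hom by blast
  then show ?thesis using that by (rule Hom_AD_te)
qed

lemma B_Ob: "x \<in> Ob C \<Longrightarrow> B x \<in> Ob T"
  by (simp add: bracket_eq br_Ob)

lemma B_Hom: "x \<in> Ob C \<Longrightarrow> y \<in> Ob C \<Longrightarrow> T_embed f \<in> Hom T (B x) (B y) \<longleftrightarrow> f \<in> H x y"
  by (auto simp: bracket_eq br_Hom)

lemma idem_props:
  assumes "x \<in> Ob C" "a \<in> H x x" "co x x x a a = a"
  shows "br x a \<in> Ob T" "T_embed a \<in> Hom T (br x a) (B x)" "T_embed a \<in> Hom T (B x) (br x a)"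
    "TC.mon (Ar (br x a) (T_embed a) (B x))"
    "Comp T (br x a) (B x) (br x a) (T_embed a) (T_embed a) = Idn T (br x a)"
    "Comp T (B x) (br x a) (B x) (T_embed a) (T_embed a) = T_embed a"
proof -
  show 1: "br x a \<in> Ob T" "T_embed a \<in> Hom T (br x a) (B x)" "T_embed a \<in> Hom T (B x) (br x a)"
    using assms by (auto simp: br_Ob br_Hom bracket_eq)
  show 2: "Comp T (br x a) (B x) (br x a) (T_embed a) (T_embed a) = Idn T (br x a)"
    using assms by (simp add: br_Comp br_Idn bracket_eq)
  show "Comp T (B x) (br x a) (B x) (T_embed a) (T_embed a) = T_embed a"
    using assms by (simp add: br_Comp bracket_eq)
  show "TC.mon (Ar (br x a) (T_embed a) (B x))"
    using TC.split_mon[OF B_Ob[OF assms(1)] 1 2] .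
qed

section \<open>Identification of \<open>[x]\<^sup>1\<close> and \<open>[x]\<^sup>0\<close>\<close>

definition ep1 :: "'o \<Rightarrow> ('o \<times> 'm) set \<Rightarrow> 'k" where "ep1 x = un x - eps x"

lemma eps_props:
  assumes "x \<in> Ob C"
  shows "eps x \<in> H x x" "co x x x (eps x) (eps x) = eps x" "ep1 x \<in> H x x" "co x x x (ep1 x) (ep1 x) = ep1 x"
    "un x - ep1 x = eps x" "through_proper x (ep1 x)"
  using isepD[OF is_eps_exists[OF assms]] eps_idem[OF is_eps_exists[OF assms]] assms
  by (simp_all add: ep1_def co_minus_left co_minus_right)

lemma ep1_fixes: "x \<in> Ob C \<Longrightarrow> z \<in> Ob C \<Longrightarrow> sz z < sz x \<Longrightarrow> f \<in> H z x \<Longrightarrow> co z x x (ep1 x) f = f"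
  using isepD(5)[OF is_eps_exists[of x]] by (simp add: ep1_def co_minus_left)

text \<open>The inclusions of the images of \<open>ep1 x\<close> and \<open>eps x\<close>; they
  represent \<open>[x]\<^sup>1\<close> and \<open>[x]\<^sup>0\<close> by \<open>part1_eq\<close> and
  \<open>part0_eq\<close>.\<close>

abbreviation X1 where "X1 x \<equiv> Ar (br x (ep1 x)) (T_embed (ep1 x)) (B x)"
abbreviation X0 where "X0 x \<equiv> Ar (br x (eps x)) (T_embed (eps x)) (B x)"

lemma complementary_X: assumes x: "x \<in> Ob C" shows "complementary T (B x) (TC.cls (X1 x)) (TC.cls (X0 x))"
proof -
  note e = eps_props[OF x]
  have "complementary (idempotent_completion (additive_completion (T0 C \<delta>))) ([x], T_embed (un x))
     (category.cls (idempotent_completion (additive_completion (T0 C \<delta>))) (Ar ([x], T_embed (ep1 x)) (T_embed (ep1 x)) ([x], T_embed (un x))))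
     (category.cls (idempotent_completion (additive_completion (T0 C \<delta>))) (Ar ([x], T_embed (un x) - T_embed (ep1 x)) (T_embed (un x) - T_embed (ep1 x)) ([x], T_embed (un x))))"
    by (rule AD.idempotent_complementary)
      (use x e in \<open>simp_all add: AD.IC_Ob AD.IC_Hom T0.AC_Ob te_Hom_AD te_Comp_AD te_inject\<close>)
  then show ?thesis unfolding te_diff e(5) by (simp add: T_cat_def br_def bracket_eq)
qed

lemma isomorphic_TI: "TC.iso h \<Longrightarrow> isomorphic T (dm h) (cd h)"
  unfolding isomorphic_def using TC.iso_arr_iff[of "dm h" "cd h" "mr h"] by (metis TC.arr_cd TC.arr_dm TC.iso_arr' arrow.collapse)

lemma isomorphic_TE:
  assumes "isomorphic T a b" "a \<in> Ob T" "b \<in> Ob T"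
  obtains h where "TC.iso h" "dm h = a" "cd h = b"
  using assms TC.iso_arr_iff[of a b] unfolding isomorphic_def by (metis arrow.sel(1,3))

lemma isomorphic_sub_obj:
  assumes "TC.mon m" "TC.mon n" "dm m = dm n"
  shows "isomorphic T (sub_obj (TC.cls m)) (sub_obj (TC.cls n))"
proof -
  obtain h where h: "TC.iso h" "dm h = sub_obj (TC.cls m)" "cd h = dm m" using TC.sub_obj_cls_iso[OF assms(1)] by metis
  obtain k where k: "TC.iso k" "dm k = sub_obj (TC.cls n)" "cd k = dm n" using TC.sub_obj_cls_iso[OF assms(2)] by metis
  obtain k' where k': "TC.iso k'" "dm k' = cd k" "cd k' = dm k" using k(1) by (meson TC.isoE)
  have "TC.iso (TC.cmp k' h)" using h k k' assms(3) by simp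
  then show ?thesis using isomorphic_TI[of "TC.cmp k' h"] h k k' by simp
qed

text \<open>Writing \<open>ep1 x\<close> as a sum through proper subquotients factors it through
  their direct sum \<open>Z\<close>; cut down to the image of \<open>ep1 x\<close>, this
  factorization exhibits the image as a retract of \<open>Z\<close>. Morphisms from proper
  subquotients lift because \<open>ep1 x\<close> fixes them.\<close>

lemma is_part1_X1:
  assumes x: "x \<in> Ob C"
  shows "is_part1 C \<delta> x (TC.cls (X1 x))"
  unfolding is_part1_def
proof (intro conjI allI impI)
  note e = eps_props[OF x] and BO = B_Ob[OF x]
  note i1 = idem_props[OF x e(3,4)]
  show "direct_summand T (B x) (TC.cls (X1 x))" using complementary_X[OF x] unfolding direct_summand_def by blast
  obtain L where L: "\<forall>(z, g, f) \<in> set L. proper_subquotient C z x \<and> f \<in> H x z \<and> g \<in> H z x"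
    "ep1 x = (\<Sum>(z, g, f) \<leftarrow> L. co x z x g f)" using e(6) unfolding through_proper_def by blast
  define n where "n = length L"
  define z g f where "z i = fst (L ! i)" and "g i = fst (snd (L ! i))" and "f i = snd (snd (L ! i))" for i
  have zgf: "proper_subquotient C (z i) x" "f i \<in> H x (z i)" "g i \<in> H (z i) x" if "i < n" for i
  proof -
    have "case L ! i of (z, g, f) \<Rightarrow> proper_subquotient C z x \<and> f \<in> H x z \<and> g \<in> H z x"
      using L(1) that by (simp add: n_def)
    then show "proper_subquotient C (z i) x" "f i \<in> H x (z i)" "g i \<in> H (z i) x"
      by (simp_all add: z_def g_def f_def case_prod_unfold)
  qed
  have zO: "z i \<in> Ob C" if "i < n" for i using zgf(1)[OF that] unfolding proper_subquotient_def subquotient_def by blast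
  have e1: "ep1 x = (\<Sum>i<n. co x (z i) x (g i) (f i))"
    unfolding L(2) sum_list_sum_nth n_def
    by (rule sum.cong) (auto simp: z_def g_def f_def atLeast0LessThan split: prod.splits)
  define zs where "zs = map z [0..<n]"
  have zs: "zs \<in> lists (Ob (T0 C \<delta>))" using zO by (auto simp: zs_def)
  have zsi: "length zs = n" "\<And>i. i < n \<Longrightarrow> zs ! i = z i" by (auto simp: zs_def)
  define d where "d = (\<lambda>i j k. if j = i \<and> k = (0::nat) then Idn (T0 C \<delta>) (zs ! i) else 0)"
  define Z where "Z = (zs, Idn (additive_completion (T0 C \<delta>)) zs)"
  have "biproduct T {..<length zs} (\<lambda>i. ([zs ! i], Idn (additive_completion (T0 C \<delta>)) [zs ! i])) d Z"
    unfolding T_cat_def Z_def d_def by (rule AD.biproduct_IC[OF T0.biproduct_AC[OF zs]])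
  then have bp: "biproduct T {..<n} (\<lambda>i. B (z i)) d Z"
    unfolding zsi(1) by (rule TC.biproduct_cong) (simp add: bracket_def zsi(2))
  obtain F G where FG: "F \<in> Hom T (B x) Z" "G \<in> Hom T Z (B x)"
    "Comp T (B x) Z (B x) G F = (\<Sum>i<n. Comp T (B x) (B (z i)) (B x) (T_embed (g i)) (T_embed (f i)))"
  proof (rule TC.biproduct_factor[OF bp BO])
    fix i assume i: "i \<in> {..<n}"
    show "T_embed (f i) \<in> Hom T (B x) (B (z i))" using B_Hom[OF x zO] zgf i by simp
    show "T_embed (g i) \<in> Hom T (B (z i)) (B x)" using B_Hom[OF zO x] zgf i by simp
  qed
  have ZO: "Z \<in> Ob T" using bp unfolding biproduct_def by blast
  have GF: "Comp T (B x) Z (B x) G F = T_embed (ep1 x)"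
    unfolding FG(3) e1 te_sum[symmetric] by (simp add: bracket_eq br_Comp)
  let ?v = "br x (ep1 x)" and ?E = "T_embed (ep1 x)"
  define a where "a = Comp T ?v (B x) Z F ?E"
  define r where "r = Comp T Z (B x) ?v ?E G"
  have ar: "a \<in> Hom T ?v Z" "r \<in> Hom T Z ?v" using i1 BO ZO FG by (auto simp: a_def r_def intro: TC.Comp_in_Hom)
  have ra: "Comp T ?v Z ?v r a = ?E"
  proof -
    have "Comp T ?v Z ?v r a = Comp T ?v (B x) ?v ?E (Comp T ?v Z (B x) G a)"
      unfolding r_def by (rule TC.Comp_assoc) (use i1 BO ZO FG ar in auto)
    also have "Comp T ?v Z (B x) G a = Comp T ?v (B x) (B x) (Comp T (B x) Z (B x) G F) ?E"
      unfolding a_def by (rule TC.Comp_assoc[symmetric]) (use i1 BO ZO FG in auto)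
    finally show ?thesis unfolding GF using e(3,4) x by (simp add: bracket_eq br_Comp)
  qed
  define W where "W = TC.cls (Ar ?v a Z)"
  have "direct_summand T Z W"
    unfolding W_def T_cat_def Z_def br_def
    by (rule AD.split_direct_summand) (use i1(1) ZO ar ra in \<open>simp_all add: T_cat_def Z_def br_def AD.IC_Comp\<close>)
  moreover have "TC.mon (Ar ?v a Z)"
    by (rule TC.split_mon[OF ZO i1(1) ar]) (simp add: ra br_Idn)
  then have "isomorphic T (sub_obj (TC.cls (X1 x))) (sub_obj W)"
    unfolding W_def by - (rule isomorphic_sub_obj[OF i1(4)], simp_all)
  ultimately show "\<exists>(n :: nat) z Z d W. (\<forall>i<n. proper_subquotient C (z i) x) \<and> biproduct T {..<n} (\<lambda>i. B (z i)) d Z \<and>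
       direct_summand T Z W \<and> isomorphic T (sub_obj (TC.cls (X1 x))) (sub_obj W)"
    using zgf(1) bp by (intro exI[of _ n] exI[of _ z] exI[of _ Z] exI[of _ d] exI[of _ W]) simp
  fix y t assume y: "proper_subquotient C y x \<and> t \<in> Hom T (B y) (B x)"
  have yO: "y \<in> Ob C" "sz y < sz x" using y proper_subquotient_iff[OF x, of y] by auto
  obtain u where u: "u \<in> H y x" "t = T_embed u" using y unfolding bracket_eq by (meson br_HomE)
  have eu: "co y x x (ep1 x) u = u" using ep1_fixes[OF x yO u(1)] .
  let ?t = "Ar (B y) t (B x)"
  have at: "TC.arr ?t" using y yO x by (simp add: TC.arr_triple B_Ob)
  have "T_embed u \<in> Hom T (B y) ?v" using u eu yO x unfolding bracket_eq by (simp add: br_Hom)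
  then have "TC.arr (Ar (B y) t ?v)" using u yO i1 by (simp add: TC.arr_triple B_Ob)
  moreover have "TC.cmp (X1 x) (Ar (B y) t ?v) = ?t"
    unfolding TC.cmp_def using u eu by (simp add: bracket_eq br_Comp)
  ultimately have "\<exists>g. TC.arr g \<and> dm g = dm ?t \<and> cd g = dm (X1 x) \<and> TC.cmp (X1 x) g = ?t"
    by (intro exI[of _ "Ar (B y) t ?v"]) simp
  then show "factors T (B y) (B x) t (TC.cls (X1 x))"
    using TC.factors_cls[OF i1(4) at] by simp
qed

text \<open>Let \<open>s\<close> be an idempotent with image \<open>S\<close>. All morphisms from
  proper subquotients factor through \<open>S\<close>, so \<open>s\<close> fixes
  \<open>ep1 x\<close>. Conversely \<open>S\<close> is a retract of a sum of proper subquotients, so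
  \<open>ep1 x\<close> fixes \<open>s\<close>. Hence both idempotents have the same image.\<close>

lemma is_part1_unique:
  assumes x: "x \<in> Ob C" and S: "is_part1 C \<delta> x S"
  shows "S = TC.cls (X1 x)"
proof -
  note e = eps_props[OF x] and BO = B_Ob[OF x]
  note i1 = idem_props[OF x e(3,4)]
  obtain v m p where v: "v \<in> Ob T" "m \<in> Hom T v (B x)" "p \<in> Hom T (B x) v" "Comp T v (B x) v p m = Idn T v"
    "S = TC.cls (Ar v m (B x))"
    using S TC.direct_summandE[OF BO] unfolding is_part1_def by metis
  have mm: "TC.mon (Ar v m (B x))" using TC.split_mon[OF BO v(1-4)] .
  define s where "s = Comp T (B x) v (B x) m p"
  have sH: "s \<in> Hom T (B x) (B x)" using v BO by (auto simp: s_def intro: TC.Comp_in_Hom)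
  then obtain s0 where s0: "s0 \<in> H x x" "s = T_embed s0" unfolding bracket_eq by (rule br_HomE)
  have sm: "Comp T v (B x) (B x) s m = m"
    using TC.Comp_assoc[of v "B x" v "B x" m p m] v BO by (simp add: s_def TC.Comp_Idn_right)
  have fix_small: "co z x x s0 g = g" if z: "proper_subquotient C z x" "g \<in> H z x" for z g
  proof -
    have zO: "z \<in> Ob C" using z proper_subquotient_iff[OF x, of z] by auto
    have gH: "T_embed g \<in> Hom T (B z) (B x)" using B_Hom[OF zO x] z by simp
    then have "factors T (B z) (B x) (T_embed g) S" using S z unfolding is_part1_def by blast
    then obtain k where k: "TC.arr k" "dm k = B z" "cd k = v" "TC.cmp (Ar v m (B x)) k = Ar (B z) (T_embed g) (B x)"
      using TC.factors_cls[OF mm, of "Ar (B z) (T_embed g) (B x)"] gH zO BO unfolding v(5) by (auto simp: TC.arr_triple B_Ob)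
    have kH: "mr k \<in> Hom T (B z) v" using k(1-3) unfolding TC.arr_def by simp
    have mk: "Comp T (B z) v (B x) m (mr k) = T_embed g" using arg_cong[OF k(4), of mr] k(2,3) by (simp add: TC.mr_cmp)
    have "Comp T (B z) (B x) (B x) s (T_embed g) = T_embed g"
      using TC.Comp_assoc[of "B z" v "B x" "B x" "mr k" m s] B_Ob[OF zO] v BO kH sH mk sm by simp
    then show ?thesis using s0 by (simp add: bracket_eq br_Comp te_inject)
  qed
  have se: "co x x x s0 (ep1 x) = ep1 x"
    using e(6) x
  proof (induction rule: through_proper_induct(1))
    case (single z f g)
    then show ?case using co_assoc[of f x z g x s0 x] fix_small[of z g] s0 x by simp
  qed (simp_all add: co_add_right)
  obtain n z Z d W where nz: "\<forall>i<n. proper_subquotient C (z i) x" "biproduct T {..<(n::nat)} (\<lambda>i. B (z i)) d Z"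
    "direct_summand T Z W" "isomorphic T (sub_obj S) (sub_obj W)"
    using S unfolding is_part1_def by blast
  have ZO: "Z \<in> Ob T" using nz(2) unfolding biproduct_def by blast
  obtain w m' p' where w: "w \<in> Ob T" "m' \<in> Hom T w Z" "p' \<in> Hom T Z w" "Comp T w Z w p' m' = Idn T w" "W = TC.cls (Ar w m' Z)"
    using TC.direct_summandE[OF ZO nz(3)] by metis
  have mm': "TC.mon (Ar w m' Z)" using TC.split_mon[OF ZO w(1-4)] .
  \<comment> \<open>The given isomorphism concerns the chosen representatives of \<open>S\<close>
    and \<open>W\<close>; \<open>h1\<close> and \<open>h2\<close> move it to \<open>v\<close> and
    \<open>w\<close>, so that \<open>v\<close> becomes a retract of \<open>Z\<close>.\<close>
  obtain h1 where h1: "TC.iso h1" "dm h1 = sub_obj S" "cd h1 = v" using TC.sub_obj_cls_iso[OF mm] unfolding v(5) by (metis arrow.sel(1))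
  obtain h2 where h2: "TC.iso h2" "dm h2 = sub_obj W" "cd h2 = w" using TC.sub_obj_cls_iso[OF mm'] unfolding w(5) by (metis arrow.sel(1))
  obtain h3 where h3: "TC.iso h3" "dm h3 = sub_obj S" "cd h3 = sub_obj W"
    using isomorphic_TE[OF nz(4)] h1 h2 by (metis TC.arr_dm TC.iso_arr')
  obtain h1' where h1': "TC.iso h1'" "dm h1' = v" "cd h1' = sub_obj S" using h1 by (metis TC.isoE)
  define h where "h = TC.cmp h2 (TC.cmp h3 h1')"
  have h: "TC.iso h" "dm h = v" "cd h = w" using h1' h2 h3 by (auto simp: h_def)
  obtain h' where h': "TC.arr h'" "dm h' = w" "cd h' = v" "TC.cmp h' h = TC.ide v" using h by (metis TC.isoE)
  have hH: "mr h \<in> Hom T v w" "mr h' \<in> Hom T w v" using h h' TC.iso_arr'[OF h(1)] unfolding TC.arr_def by auto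
  have hh: "Comp T v w v (mr h') (mr h) = Idn T v" using arg_cong[OF h'(4), of mr] h h' by (simp add: TC.cmp_def TC.ide_def)
  define a where "a = Comp T v w Z m' (mr h)"
  define r where "r = Comp T Z w v (mr h') p'"
  have ar: "a \<in> Hom T v Z" "r \<in> Hom T Z v" using v w ZO hH by (auto simp: a_def r_def intro: TC.Comp_in_Hom)
  have ra: "Comp T v Z v r a = Idn T v"
  proof -
    have "Comp T v Z v r a = Comp T v w v (mr h') (Comp T v Z w p' a)"
      unfolding r_def by (rule TC.Comp_assoc) (use v w ZO hH ar in auto)
    also have "Comp T v Z w p' a = Comp T v w w (Comp T w Z w p' m') (mr h)"
      unfolding a_def by (rule TC.Comp_assoc[symmetric]) (use v w ZO hH in auto)
    finally show ?thesis using w v hH hh by (simp add: TC.Comp_Idn_left)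
  qed
  have EH: "T_embed (ep1 x) \<in> Hom T (B x) (B x)" using B_Hom[OF x x] e(3) by simp
  have Em: "Comp T v (B x) (B x) (T_embed (ep1 x)) m = m"
  proof (rule TC.biproduct_retract_fixed[OF nz(2) v(1) BO ar ra EH _ v(2)])
    fix i t assume i: "i \<in> {..<n}" and t: "t \<in> Hom T (B (z i)) (B x)"
    have z: "proper_subquotient C (z i) x" using nz(1) i by simp
    then have zO: "z i \<in> Ob C" "sz (z i) < sz x"
      using proper_subquotient_iff[OF x, of "z i"] unfolding proper_subquotient_def subquotient_def by blast+
    obtain u where u: "u \<in> H (z i) x" "t = T_embed u" using t unfolding bracket_eq by (rule br_HomE)
    then show "Comp T (B (z i)) (B x) (B x) (T_embed (ep1 x)) t = t"
      using ep1_fixes[OF x zO u(1)] by (simp add: bracket_eq br_Comp)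
  qed
  have es: "Comp T (B x) (B x) (B x) (T_embed (ep1 x)) s = s"
    using TC.Comp_assoc[of "B x" v "B x" "B x" p m "T_embed (ep1 x)"] v BO EH Em by (simp add: s_def)
  have se': "Comp T (B x) (B x) (B x) s (T_embed (ep1 x)) = T_embed (ep1 x)"
    using se s0 by (simp add: bracket_eq br_Comp)
  show ?thesis unfolding v(5)
    by (rule TC.cls_eq_projections[OF BO v(1) i1(1) v(2,3) i1(2,3) v(4) i1(5) s_def i1(6)[symmetric] se' es])
qed

lemma part1_eq: "x \<in> Ob C \<Longrightarrow> part1 C \<delta> x = TC.cls (X1 x)"
  unfolding part1_def using is_part1_X1 is_part1_unique by (intro the_equality) auto

text \<open>A complement is in general not unique. Here the projection \<open>s\<close> onto
  \<open>[x]\<^sup>1\<close> along any complement has the image of \<open>ep1 x\<close> and commutes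
  with \<open>ep1 x\<close>, because \<open>eps x\<close> is central; therefore it equals
  \<open>ep1 x\<close>, and the complementary projection is \<open>eps x\<close>.\<close>

lemma part0_eq:
  assumes x: "x \<in> Ob C"
  shows "part0 C \<delta> x = TC.cls (X0 x)"
  unfolding part0_def part1_eq[OF x]
proof (rule the_equality)
  note e = eps_props[OF x] and BO = B_Ob[OF x]
  note i1 = idem_props[OF x e(3,4)] and i0 = idem_props[OF x e(1,2)]
  show "complementary T (B x) (TC.cls (X1 x)) (TC.cls (X0 x))" by (rule complementary_X[OF x])
  fix S assume c: "complementary T (B x) (TC.cls (X1 x)) S"
  obtain v m p v' m' p' where V: "v \<in> Ob T" "v' \<in> Ob T" "m \<in> Hom T v (B x)" "p \<in> Hom T (B x) v" "m' \<in> Hom T v' (B x)" "p' \<in> Hom T (B x) v'"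
    "Comp T v (B x) v p m = Idn T v" "Comp T v' (B x) v' p' m' = Idn T v'"
    "Comp T (B x) v (B x) m p + Comp T (B x) v' (B x) m' p' = Idn T (B x)"
    "TC.cls (X1 x) = TC.cls (Ar v m (B x))" "S = TC.cls (Ar v' m' (B x))"
    by (rule TC.complementaryE[OF BO c])
  have mm: "TC.mon (Ar v m (B x))" using TC.split_mon[OF BO V(1,3,4,7)] .
  let ?E = "T_embed (ep1 x)"
  have EH: "?E \<in> Hom T (B x) (B x)" using B_Hom[OF x x] e(3) by simp
  define s where "s = Comp T (B x) v (B x) m p"
  have sH: "s \<in> Hom T (B x) (B x)" using V BO by (auto simp: s_def intro: TC.Comp_in_Hom)
  then obtain s0 where s0: "s0 \<in> H x x" "s = T_embed s0" unfolding bracket_eq by (rule br_HomE)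
  obtain h where h: "TC.iso h" "dm h = v" "cd h = br x (ep1 x)" "TC.cmp (X1 x) h = Ar v m (B x)"
    using TC.cls_eq_iff[OF mm i1(4)] V(10) by auto
  obtain k where k: "TC.iso k" "dm k = br x (ep1 x)" "cd k = v" "TC.cmp (Ar v m (B x)) k = X1 x"
    using TC.cls_eq_iff[OF i1(4) mm] V(10) by auto
  have hH: "mr h \<in> Hom T v (br x (ep1 x))" "mr k \<in> Hom T (br x (ep1 x)) v"
    using h k TC.iso_arr'[OF h(1)] TC.iso_arr'[OF k(1)] unfolding TC.arr_def by auto
  have mh: "Comp T v (br x (ep1 x)) (B x) ?E (mr h) = m" using arg_cong[OF h(4), of mr] h(2,3) by (simp add: TC.mr_cmp)
  have mk: "Comp T (br x (ep1 x)) v (B x) m (mr k) = ?E" using arg_cong[OF k(4), of mr] k(2,3) by (simp add: TC.mr_cmp)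
  have EE: "Comp T (br x (ep1 x)) (B x) (B x) ?E ?E = ?E" using e by (simp add: bracket_eq br_Comp)
  have "Comp T v (B x) (B x) ?E m = m"
    using TC.Comp_assoc[of v "br x (ep1 x)" "B x" "B x" "mr h" ?E ?E] V(1) i1 BO EH hH mh EE by simp
  then have "Comp T (B x) (B x) (B x) ?E s = s"
    using TC.Comp_assoc[of "B x" v "B x" "B x" p m ?E] V BO EH by (simp add: s_def)
  then have es: "co x x x (ep1 x) s0 = s0" using s0 by (simp add: bracket_eq br_Comp te_inject)
  have sm: "Comp T v (B x) (B x) s m = m"
    using TC.Comp_assoc[of v "B x" v "B x" m p m] V BO by (simp add: s_def TC.Comp_Idn_right)
  have "Comp T (br x (ep1 x)) (B x) (B x) s ?E = ?E"
    using TC.Comp_assoc[of "br x (ep1 x)" v "B x" "B x" "mr k" m s] V i1 BO sH hH mk sm by simp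
  then have se: "co x x x s0 (ep1 x) = ep1 x" using s0 by (simp add: bracket_eq br_Comp te_inject)
  have "co x x x (eps x) s0 = co x x x s0 (eps x)"
    using eps_commute[OF is_eps_exists[OF x] is_eps_exists[OF x] HOL.refl s0(1)] .
  then have "co x x x (ep1 x) s0 = co x x x s0 (ep1 x)"
    using s0 x by (simp add: ep1_def co_minus_left co_minus_right)
  then have "s0 = ep1 x" using es se by simp
  then have "Comp T (B x) v' (B x) m' p' = T_embed (un x) - T_embed (ep1 x)"
    using V(9) s0(2) unfolding s_def[symmetric] unfolding bracket_eq br_Idn by (metis add_diff_cancel_left')
  then have s': "Comp T (B x) v' (B x) m' p' = T_embed (eps x)" unfolding te_diff e(5) .
  have ee: "Comp T (B x) (B x) (B x) (T_embed (eps x)) (T_embed (eps x)) = T_embed (eps x)"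
    using e by (simp add: bracket_eq br_Comp)
  show "S = TC.cls (X0 x)" unfolding V(11)
    by (rule TC.cls_eq_projections[OF BO V(2) i0(1) V(5,6) i0(2,3) V(8) i0(5) s'[symmetric] i0(6)[symmetric] ee ee])
qed

section \<open>The pieces \<open>[z]\<^sup>0\<^sub>y\<close> and the three decompositions\<close>

lemma graph_cls: "arr f \<Longrightarrow> graph C (dm f) (cd f) (mr f) = cls (pr (ide (dm f)) f)"
  by (simp add: graph_def cls_def pr_def mr_ide)

lemma bracket_arr_sp:
  assumes f: "arr f"
  shows "bracket_arr C (dm f) (cd f) (mr f) = (T_embed (sp (ide (dm f)) f) :: ('o, 'm, 'k) T_arr)"
proof -
  have "mon (pr (ide (dm f)) f)" by (rule mon_prI) (use f in auto)
  then show ?thesis unfolding bracket_arr_def graph_cls[OF f] using sp_mon f by simp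
qed

lemma bracket_dual_sp:
  assumes f: "arr f"
  shows "bracket_dual C (dm f) (cd f) (mr f) = (T_embed (sp f (ide (dm f))) :: ('o, 'm, 'k) T_arr)"
proof -
  let ?x = "dm f" and ?y = "cd f"
  have O: "?x \<in> Ob C" "?y \<in> Ob C" using f by auto
  have g: "mon (pr (ide ?x) f)" "mon (pr f (ide ?x))" by (rule mon_prI; use f in auto)+
  define m where "m = rpr (prd C ?x ?y) (cls (pr (ide ?x) f))"
  have m: "mon m" "cls m = cls (pr (ide ?x) f)" "cd m = prd C ?x ?y"
    using rpr[of "cls (pr (ide ?x) f)" "prd C ?x ?y"] g f O by (auto simp: m_def)
  obtain h where h: "iso h" "dm h = ?x" "cd h = dm m" "m \<cdot> h = pr (ide ?x) f"
    using cls_eq_iff[OF g(1) m(1)] m O by auto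
  have "p1 ?x ?y \<cdot> (m \<cdot> h) = ide ?x" "p2 ?x ?y \<cdot> (m \<cdot> h) = f" unfolding h(4) using f by auto
  then have ph: "(p1 ?x ?y \<cdot> m) \<cdot> h = ide ?x" "(p2 ?x ?y \<cdot> m) \<cdot> h = f" using h(1-3) m O by auto
  let ?n = "pr (p2 ?x ?y \<cdot> m) (p1 ?x ?y \<cdot> m)"
  have mn: "mon ?n"
  proof (rule mon_prI)
    fix k l assume a: "arr k" "arr l" "dm k = dm l" "cd k = dm (p2 ?x ?y \<cdot> m)" "cd l = dm (p2 ?x ?y \<cdot> m)"
      "(p2 ?x ?y \<cdot> m) \<cdot> k = (p2 ?x ?y \<cdot> m) \<cdot> l" "(p1 ?x ?y \<cdot> m) \<cdot> k = (p1 ?x ?y \<cdot> m) \<cdot> l"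
    have "m \<cdot> k = m \<cdot> l" by (rule prd_eqI[of ?x ?y]) (use a m O in auto)
    then show "k = l" by (rule monD[OF m(1)]) (use a in auto)
  qed (use m O in auto)
  have "?n \<cdot> h = pr f (ide ?x)" using h m O ph by (subst pr_cmp) auto
  then have "cls ?n = cls (pr f (ide ?x))" using cls_eqI[OF mn h(1)] h m O by simp
  moreover have "rel_op C ?x ?y (graph C ?x ?y (mr f)) = cls ?n"
    unfolding rel_op_def graph_cls[OF f]
    by (simp add: cls_def pr_def mr_cmp restrict_arr_def p1_def p2_def m_def rpr_def)
  ultimately show ?thesis unfolding bracket_dual_def using sp_mon[OF g(2)] f by simp
qed

text \<open>\<open>dual_arr\<close> is a retraction of \<open>j\<close>. So \<open>j\<close> is a
  split mono, and the image in \<open>T\<close> that defines the piece exists and is computed by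
  \<open>img_split\<close>.\<close>

lemma sq_part_eq:
  assumes x: "x \<in> Ob C" and Q: "Q \<in> sq C x"
  defines "j \<equiv> co (qz Q) (qz Q) x (iota x Q) (eps (qz Q))"
  shows "TC.mon (Ar (br (qz Q) (eps (qz Q))) (T_embed j) (B x))"
    "sq_part C \<delta> x Q = TC.cls (Ar (br (qz Q) (eps (qz Q))) (T_embed j) (B x))"
proof -
  let ?z = "qz Q" and ?y = "dm (qe Q)" and ?\<epsilon> = "eps (qz Q)"
  note r = sq_rep[OF x Q]
  have D: "sur (qe Q)" "mon (qi x Q)" "dm (qe Q) = dm (qi x Q)" "cd (qi x Q) = x" using r(1) unfolding diagram_def by auto
  note s = diagram_sp[OF r(1) HOL.refl] and ez = eps_props[of "qz Q"] and d = duD[OF x Q qz_is_eps[OF x Q]]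
  have zO: "?z \<in> Ob C" and yO: "?y \<in> Ob C" using D by auto
  note i0 = idem_props[OF zO ez(1,2)[OF zO]]
  let ?v = "br ?z ?\<epsilon>"
  have jH: "j \<in> H ?z x" using s ez x by (simp add: j_def)
  have je: "co ?z ?z x j ?\<epsilon> = j" unfolding j_def using co_assoc[of ?\<epsilon> ?z ?z ?\<epsilon> ?z "iota x Q" x] s ez zO x by simp
  have jT: "T_embed j \<in> Hom T ?v (B x)" using jH je zO x unfolding bracket_eq br_Hom by simp
  have dT: "T_embed (dual_arr x Q) \<in> Hom T (B x) ?v" using d zO x unfolding bracket_eq br_Hom by simp
  show mj: "TC.mon (Ar ?v (T_embed j) (B x))"
    by (rule TC.split_mon[OF B_Ob[OF x] i0(1) jT dT]) (use d(3) in \<open>simp add: bracket_eq br_Comp br_Idn j_def\<close>)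
  define n where "n = TC.rpr (B ?z) (TC.cls (X0 ?z))"
  obtain h where h: "TC.iso h" "dm h = sub_obj (TC.cls (X0 ?z))" "cd h = ?v" "TC.cmp (X0 ?z) h = n"
    using TC.sub_obj_cls_iso[OF i0(4)] unfolding n_def by auto
  have push: "co ?z ?y x (sp (ide ?y) (qi x Q)) (sp (qe Q) (ide ?y)) = iota x Q"
    using push_sp[OF D(2,4), of "qe Q" "ide ?y" ?z] D yO by simp
  have ba: "bracket_arr C ?y x (mr (qi x Q)) = (T_embed (sp (ide ?y) (qi x Q)) :: ('o, 'm, 'k) T_arr)"
    using bracket_arr_sp[of "qi x Q"] D by simp
  have bd: "bracket_dual C ?y ?z (mr (qe Q)) = (T_embed (sp (qe Q) (ide ?y)) :: ('o, 'm, 'k) T_arr)"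
    using bracket_dual_sp[of "qe Q"] D by simp
  let ?iota = "Ar (B ?z) (T_embed (iota x Q)) (B x)"
  have aio: "TC.arr ?iota" using B_Hom[OF zO x] s zO x by (simp add: TC.arr_triple B_Ob)
  have aX: "TC.arr (X0 ?z)" "TC.arr h" using i0 h by auto
  have "TC.cmp ?iota (X0 ?z) = Ar ?v (T_embed j) (B x)"
    unfolding TC.cmp_def by (simp add: bracket_eq br_Comp j_def)
  then have ion: "TC.cmp ?iota n = TC.cmp (Ar ?v (T_embed j) (B x)) h"
    unfolding h(4)[symmetric] using TC.cmp_assoc[of h "X0 ?z" ?iota] aio aX h by simp
  have "sq_part C \<delta> x Q = direct_image T (B ?z) (B x) (T_embed (iota x Q)) (TC.cls (X0 ?z))"
    unfolding sq_part_def r(3) enc_def prod.case part0_eq[OF zO]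
    using ba bd push by (simp add: bracket_eq br_Comp)
  also have "\<dots> = img T (sub_obj (TC.cls (X0 ?z))) (B x) (mr (TC.cmp ?iota n))"
    unfolding direct_image_def restrict_arr_def by (simp add: TC.mr_cmp n_def TC.rpr_def)
  also have "\<dots> = TC.cls (Ar ?v (T_embed j) (B x))"
  proof -
    obtain h' where h': "TC.arr h'" "dm h' = cd h" "cd h' = dm h" "TC.cmp h h' = TC.ide (cd h)" using h(1) by (rule TC.isoE)
    have "img T (dm h) (cd (Ar ?v (T_embed j) (B x))) (mr (TC.cmp (Ar ?v (T_embed j) (B x)) h)) = TC.cls (Ar ?v (T_embed j) (B x))"
      by (rule TC.img_split[OF mj aX(2) _ h'(1)]) (use h h' in auto)
    then show ?thesis unfolding ion using h by simp
  qed
  finally show "sq_part C \<delta> x Q = TC.cls (Ar ?v (T_embed j) (B x))" .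
qed

lemma img_idempotent:
  assumes x: "x \<in> Ob C" and a: "a \<in> H x x" "co x x x a a = a"
  shows "img T (B x) (B x) (T_embed a) = TC.cls (Ar (br x a) (T_embed a) (B x))"
proof -
  note i = idem_props[OF x a]
  let ?e = "Ar (B x) (T_embed a) (br x a)" and ?m = "Ar (br x a) (T_embed a) (B x)"
  have ae: "TC.arr ?e" using i B_Ob[OF x] by (simp add: TC.arr_triple)
  have "img T (dm ?e) (cd ?m) (mr (TC.cmp ?m ?e)) = TC.cls ?m"
    by (rule TC.img_split[OF i(4) ae _ TC.mon_arr[OF i(4)]]) (simp_all add: TC.cmp_def TC.ide_def i)
  then show ?thesis by (simp add: TC.mr_cmp i)
qed

text \<open>The common core of the three decompositions, with \<open>P\<close> the identity,
  \<open>p\<^sub>y\<close> or the projection onto the quotient pieces. Its image contains the pieces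
  in \<open>A\<close> by the last hypothesis and is exhausted by them by the third.\<close>

lemma internal_sum_part_proj:
  assumes x: "x \<in> Ob C" and A: "A \<subseteq> sq C x" and P: "P \<in> H x x" "co x x x P P = P"
    "co x x x (part_proj x A) P = P"
    "\<And>Q. Q \<in> A \<Longrightarrow> co (qz Q) x x P (co (qz Q) (qz Q) x (iota x Q) (eps (qz Q))) = co (qz Q) (qz Q) x (iota x Q) (eps (qz Q))"
  shows "internal_sum T (B x) (TC.cls (Ar (br x P) (T_embed P) (B x))) A (sq_part C \<delta> x)"
proof -
  note i = idem_props[OF x P(1,2)] and BO = B_Ob[OF x]
  define D where "D Q = br (qz Q) (eps (qz Q))" for Q
  define j where "j Q = co (qz Q) (qz Q) x (iota x Q) (eps (qz Q))" for Q
  \<comment> \<open>The duals restricted to the image of \<open>P\<close>. Since \<open>P\<close>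
    fixes every \<open>j Q\<close>, they remain dual to the \<open>j Q\<close>.\<close>
  define q where "q Q = co x x (qz Q) (dual_arr x Q) P" for Q
  have facts: "qz Q \<in> Ob C" "j Q \<in> H (qz Q) x" "q Q \<in> H x (qz Q)" "co (qz Q) x x P (j Q) = j Q" "co (qz Q) (qz Q) x (j Q) (eps (qz Q)) = j Q"
    "co x x (qz Q) (q Q) P = q Q" "co x (qz Q) (qz Q) (eps (qz Q)) (q Q) = q Q"
    "\<And>Q'. Q' \<in> A \<Longrightarrow> co (qz Q') x (qz Q) (q Q) (j Q') = (if Q' = Q then eps (qz Q) else 0)"
    "co x (qz Q) x (j Q) (q Q) = co x x x (co x (qz Q) x (iota x Q) (dual_arr x Q)) P"
    if QA: "Q \<in> A" for Q
  proof -
    have Q: "Q \<in> sq C x" using QA A by blast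
    note s = diagram_sp[OF sq_rep(1)[OF x Q] HOL.refl] and d = duD[OF x Q qz_is_eps[OF x Q]]
    have z: "qz Q \<in> Ob C" using s by simp
    note e = eps_props[OF z]
    show z: "qz Q \<in> Ob C" by fact
    show jH: "j Q \<in> H (qz Q) x" using s e x by (simp add: j_def)
    show qH: "q Q \<in> H x (qz Q)" using d P x z by (simp add: q_def)
    show "co (qz Q) x x P (j Q) = j Q" unfolding j_def by (rule P(4)[OF QA])
    show je: "co (qz Q) (qz Q) x (j Q) (eps (qz Q)) = j Q" unfolding j_def
      using co_assoc[of "eps (qz Q)" "qz Q" "qz Q" "eps (qz Q)" "qz Q" "iota x Q" x] s e x by simp
    show "co x x (qz Q) (q Q) P = q Q" unfolding q_def
      using co_assoc[of P x x P x "dual_arr x Q" "qz Q"] d P x z by simp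
    show "co x (qz Q) (qz Q) (eps (qz Q)) (q Q) = q Q" unfolding q_def
      using co_assoc[of P x x "dual_arr x Q" "qz Q" "eps (qz Q)" "qz Q"] d(1,2) P e x z by simp
    show "co x (qz Q) x (j Q) (q Q) = co x x x (co x (qz Q) x (iota x Q) (dual_arr x Q)) P"
    proof -
      have "co x (qz Q) x (j Q) (q Q) = co x x x (co x (qz Q) x (j Q) (dual_arr x Q)) P" unfolding q_def
        using co_assoc[of P x x "dual_arr x Q" "qz Q" "j Q" x] d(1) P jH x z by simp
      also have "co x (qz Q) x (j Q) (dual_arr x Q) = co x (qz Q) x (iota x Q) (dual_arr x Q)" unfolding j_def
        using co_assoc[of "dual_arr x Q" x "qz Q" "eps (qz Q)" "qz Q" "iota x Q" x] d(1,2) s e x by simp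
      finally show ?thesis .
    qed
    fix Q' assume Q'A: "Q' \<in> A"
    have Q': "Q' \<in> sq C x" using Q'A A by blast
    note s' = diagram_sp[OF sq_rep(1)[OF x Q'] HOL.refl]
    have z': "qz Q' \<in> Ob C" using s' by simp
    note e' = eps_props[OF z']
    have j': "j Q' \<in> H (qz Q') x" using s' e' x by (simp add: j_def)
    have "co (qz Q') x x P (j Q') = j Q'" unfolding j_def by (rule P(4)[OF Q'A])
    then have "co (qz Q') x (qz Q) (q Q) (j Q') = co (qz Q') x (qz Q) (dual_arr x Q) (j Q')" unfolding q_def
      using co_assoc[of "j Q'" "qz Q'" x P x "dual_arr x Q" "qz Q"] j' d(1) P(1) x z z' by simp
    then show "co (qz Q') x (qz Q) (q Q) (j Q') = (if Q' = Q then eps (qz Q) else 0)"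
      using d(3) d(4)[OF Q' _ qz_is_eps[OF x Q']] by (auto simp: j_def)
  qed
  have dT: "T_embed (j Q) \<in> Hom T (D Q) (br x P)" "T_embed (q Q) \<in> Hom T (br x P) (D Q)" "D Q \<in> Ob T" if "Q \<in> A" for Q
    using facts[OF that] eps_props(1,2)[OF facts(1)[OF that]] unfolding D_def br_Hom br_Ob by auto
  have bp: "biproduct T A D (\<lambda>Q. T_embed (j Q)) (br x P)"
    unfolding biproduct_def
  proof (intro conjI ballI exI[of _ "\<lambda>Q. T_embed (q Q)"])
    show "finite A" using finite_subset[OF A finite_sq[OF x]] .
    show "br x P \<in> Ob T" using i by simp
    show "Comp T (D Q) (br x P) (D Q') (T_embed (q Q')) (T_embed (j Q)) = (if Q = Q' then Idn T (D Q) else 0)"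
      if "Q \<in> A" "Q' \<in> A" for Q Q'
      using facts(8)[OF that(2,1)] by (simp add: D_def br_Comp br_Idn te_zero)
    have "(\<Sum>Q\<in>A. Comp T (br x P) (D Q) (br x P) (T_embed (j Q)) (T_embed (q Q))) = T_embed (\<Sum>Q\<in>A. co x (qz Q) x (j Q) (q Q))"
      by (simp add: D_def br_Comp te_sum)
    also have "(\<Sum>Q\<in>A. co x (qz Q) x (j Q) (q Q)) = (\<Sum>Q\<in>A. co x x x (co x (qz Q) x (iota x Q) (dual_arr x Q)) P)"
      by (rule sum.cong[OF HOL.refl]) (rule facts(9))
    also have "\<dots> = P" using P(3) by (simp add: part_proj_def co_sum_left)
    finally show "(\<Sum>Q\<in>A. Comp T (br x P) (D Q) (br x P) (T_embed (j Q)) (T_embed (q Q))) = Idn T (br x P)"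
      by (simp add: br_Idn)
  qed (use dT in auto)
  have c: "Comp T (D Q) (br x P) (B x) (T_embed P) (T_embed (j Q)) = T_embed (j Q)" if "Q \<in> A" for Q
    using facts(4)[OF that] by (simp add: D_def bracket_eq br_Comp)
  show ?thesis
  proof (rule TC.internal_sumI[OF BO i(4) bp])
    fix Q assume Q: "Q \<in> A"
    have Qs: "Q \<in> sq C x" using Q A by blast
    show "sq_part C \<delta> x Q = TC.cls (Ar (D Q) (Comp T (D Q) (br x P) (B x) (T_embed P) (T_embed (j Q))) (B x))"
      "TC.mon (Ar (D Q) (Comp T (D Q) (br x P) (B x) (T_embed P) (T_embed (j Q))) (B x))"
      unfolding c[OF Q] using sq_part_eq[OF x Qs] by (simp_all add: D_def j_def)
  qed
qed

lemma p_sub_eq: "x \<in> Ob C \<Longrightarrow> y \<in> subobjects C x \<Longrightarrow> p_sub C x y = (T_embed (pm (rpr x y)) :: ('o, 'm, 'k) T_arr)"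
  using pm_cls[of "rpr x y"] rpr[of y x] by (simp add: p_sub_def)

lemma p_star_eq: "x \<in> Ob C \<Longrightarrow> p_star C x (whole C x) = (T_embed (pstar x) :: ('o, 'm, 'k) T_arr)"
proof -
  assume x: "x \<in> Ob C"
  have S: "{y' \<in> subobjects C x. sub_le C x y' (whole C x)} = subobjects C x" using sub_le_whole[OF x] by blast
  have "(\<lambda>r. \<Sum>y'\<in>subobjects C x. of_int (mu_sub C x y' (whole C x)) * basis_vec (diag_sub C x y') r) = pstar x"
    unfolding pstar_def fun_eq_iff sum_apply smul_apply
    by (intro allI sum.cong HOL.refl) (use pm_cls rpr[OF _ x] in force)
  then show ?thesis unfolding p_star_def S by simp
qed

lemma filtration_decomposition:
  assumes x: "x \<in> Ob C" and y: "y \<in> subobjects C x"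
  shows "internal_sum T (B x) (img T (B x) (B x) (p_sub C x y)) {Q \<in> sq C x. sub_le C x (sq_sub C x Q) y} (sq_part C \<delta> x)"
proof -
  note r = rpr[OF y x]
  have m: "mon (rpr x y)" "cd (rpr x y) = x" using r by auto
  have A: "{Q \<in> sq C x. sub_le C x (sq_sub C x Q) y} = subs_below x (rpr x y)" using r by (simp add: subs_below_def)
  have "subs_below x (rpr x y) \<subseteq> sq C x" by (auto simp: subs_below_def)
  then show ?thesis
    unfolding A p_sub_eq[OF x y] img_idempotent[OF x pm_in_H[OF m] pm_idem[OF x m]]
  proof (rule internal_sum_part_proj[OF x _ pm_in_H[OF m] pm_idem[OF x m] part_proj_pm[OF x m]])
    fix Q assume Q: "Q \<in> subs_below x (rpr x y)"
    then have q: "Q \<in> sq C x" by (simp add: subs_below_def)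
    note s = diagram_sp[OF sq_rep(1)[OF x q] HOL.refl]
    have z: "qz Q \<in> Ob C" using s by simp
    show "co (qz Q) x x (pm (rpr x y)) (co (qz Q) (qz Q) x (iota x Q) (eps (qz Q))) = co (qz Q) (qz Q) x (iota x Q) (eps (qz Q))"
      using co_assoc[of "eps (qz Q)" "qz Q" "qz Q" "iota x Q" x "pm (rpr x y)" x] s eps_props(1)[OF z] pm_in_H[OF m] pm_iota[OF x m Q] x z by simp
  qed
qed

lemma whole_decomposition:
  assumes x: "x \<in> Ob C"
  shows "internal_sum T (B x) (whole T (B x)) (sq C x) (sq_part C \<delta> x)"
proof -
  have w: "whole T (B x) = TC.cls (Ar (br x (un x)) (T_embed (un x)) (B x))"
    by (simp add: TC.whole_cls TC.ide_def bracket_eq br_Idn)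
  have s: "part_proj x (sq C x) = un x" by (rule part_proj_all[OF x])
  show ?thesis unfolding w
  proof (rule internal_sum_part_proj[OF x])
    fix Q assume Q: "Q \<in> sq C x"
    note d = diagram_sp[OF sq_rep(1)[OF x Q] HOL.refl]
    have z: "qz Q \<in> Ob C" using d by simp
    show "co (qz Q) x x (un x) (co (qz Q) (qz Q) x (iota x Q) (eps (qz Q))) = co (qz Q) (qz Q) x (iota x Q) (eps (qz Q))"
      using d eps_props(1)[OF z] x z by simp
  qed (use s x in auto)
qed

text \<open>By \<open>pstar_quo\<close> the projection onto the quotient pieces and
  \<open>p\<^sub>x\<^sup>*\<close> are idempotents with the same kernel; each then maps the image of
  the other isomorphically onto its own.\<close>

lemma quotient_decomposition:
  assumes x: "x \<in> Ob C"
  shows "\<exists>S. internal_sum T (B x) S (quotients C x) (sq_part C \<delta> x) \<and>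
       induces_iso T (B x) (p_star C x (whole C x)) S (star_part C \<delta> x)"
proof -
  let ?E = "part_proj x (quo x)" and ?p = "pstar x"
  have qq: "quotients C x = quo x" by (simp add: quotients_def quo_def)
  have qs: "quo x \<subseteq> sq C x" by (auto simp: quo_def)
  have qe: "is_eps (qz Q) (eps (qz Q))" if "Q \<in> quo x" for Q using qz_is_eps[OF x] qs that by blast
  have EH: "?E \<in> H x x" using part_proj_in_H[OF x qs qe] .
  have EE: "co x x x ?E ?E = ?E" using part_proj_part_proj[OF x qs qe qs qe] by simp
  note pH = pstar_in_H[OF x] and pE = pstar_quo[OF x]
  have pp: "co x x x ?p ?p = ?p"
  proof -
    have "co x x x ?p ?p = co x x x (co x x x ?p ?E) ?p" using pE by simp
    also have "\<dots> = co x x x ?p (co x x x ?E ?p)" by (rule co_assoc) (use EH pH x in auto)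
    finally show ?thesis using pE by simp
  qed
  note iE = idem_props[OF x EH EE] and ip = idem_props[OF x pH pp]
  let ?S = "TC.cls (Ar (br x ?E) (T_embed ?E) (B x))"
  have st: "star_part C \<delta> x = TC.cls (Ar (br x ?p) (T_embed ?p) (B x))"
    unfolding star_part_def p_star_eq[OF x] by (rule img_idempotent[OF x pH pp])
  have 1: "internal_sum T (B x) ?S (quo x) (sq_part C \<delta> x)"
    by (rule internal_sum_part_proj[OF x qs EH EE EE]) (use part_proj_iota[OF x qs qe] qs qe in auto)
  have 2: "induces_iso T (B x) (T_embed ?p) ?S (star_part C \<delta> x)"
    unfolding induces_iso_def st
  proof (rule bexI[of _ "(br x ?E, T_embed ?E)"], unfold prod.case, rule bexI[of _ "(br x ?p, T_embed ?p)"], unfold prod.case,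
      rule bexI[of _ "T_embed ?p"], intro conjI)
    show "Comp T (B x) (br x ?p) (B x) (T_embed ?p) (T_embed ?p) = T_embed ?p" using ip by simp
    show "T_embed ?p \<in> Hom T (B x) (br x ?p)" using ip by simp
    show "iso_arr T (br x ?E) (br x ?p) (Comp T (br x ?E) (B x) (br x ?p) (T_embed ?p) (T_embed ?E))"
      unfolding iso_arr_def
    \<comment> \<open>The inverse is the projection \<open>?E\<close>, restricted to the image of
      \<open>?p\<close>.\<close>
    proof (intro conjI bexI[of _ "T_embed ?E"])
      show "Comp T (br x ?E) (B x) (br x ?p) (T_embed ?p) (T_embed ?E) \<in> Hom T (br x ?E) (br x ?p)"
        using pE pp EE pH by (simp add: bracket_eq br_Comp br_Hom)
      show "T_embed ?E \<in> Hom T (br x ?p) (br x ?E)" using pE EE EH by (simp add: br_Hom)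
      show "Comp T (br x ?E) (br x ?p) (br x ?E) (T_embed ?E) (Comp T (br x ?E) (B x) (br x ?p) (T_embed ?p) (T_embed ?E)) = Idn T (br x ?E)"
        using pE by (simp add: bracket_eq br_Comp br_Idn)
      show "Comp T (br x ?p) (br x ?E) (br x ?p) (Comp T (br x ?E) (B x) (br x ?p) (T_embed ?p) (T_embed ?E)) (T_embed ?E) = Idn T (br x ?p)"
        using pE by (simp add: bracket_eq br_Comp br_Idn)
    qed
    show "(br x ?p, T_embed ?p) \<in> TC.cls (Ar (br x ?p) (T_embed ?p) (B x))" using TC.mem_cls_self[OF ip(4)] by simp
    show "(br x ?E, T_embed ?E) \<in> ?S" using TC.mem_cls_self[OF iE(4)] by simp
  qed
  show ?thesis unfolding qq p_star_eq[OF x] using 1 2 by blast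
qed

end

theorem theorem4p3:
  fixes A :: "('o, 'm) cat"
    and \<delta> :: "'o \<Rightarrow> 'o \<Rightarrow> 'm \<Rightarrow> 'k :: {alg_closed_field, field_char_0}"
    and x :: 'o
  assumes "category A"
    and "finitely_complete A"
    and "regular_cat A"
    and "subobject_finite A"
    and "exact_cat A"
    and "malcev_cat A"
    and "terminal_no_proper_subobject A"
    and "degree_function A \<delta>"
    and "nondegenerate A \<delta>"
    and "x \<in> Ob A"
  shows
    "internal_sum (T_cat A \<delta>) (bracket A \<delta> x) (whole (T_cat A \<delta>) (bracket A \<delta> x))
       (sq A x) (sq_part A \<delta> x)
     \<and>
     (\<forall>y \<in> subobjects A x.
       internal_sum (T_cat A \<delta>) (bracket A \<delta> x)
         (img (T_cat A \<delta>) (bracket A \<delta> x) (bracket A \<delta> x) (p_sub A x y))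
         {Q \<in> sq A x. sub_le A x (sq_sub A x Q) y} (sq_part A \<delta> x))
     \<and>
     (\<exists>S. internal_sum (T_cat A \<delta>) (bracket A \<delta> x) S (quotients A x) (sq_part A \<delta> x) \<and>
       induces_iso (T_cat A \<delta>) (bracket A \<delta> x) (p_star A x (whole A x)) S (star_part A \<delta> x))"
proof -
  interpret malcev_category A \<delta>
    using assms
    by (auto intro!: malcev_category.intro relation_category.intro degree_category.intro regular_category.intro
        lex_category.intro lex_category_axioms.intro regular_category_axioms.intro degree_category_axioms.intro
        relation_category_axioms.intro malcev_category_axioms.intro)
  show ?thesis
    using whole_decomposition filtration_decomposition quotient_decomposition assms(10) by blast
qed

end
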